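(* Let $B$ be the standard Brownian bridge on $[0,1]$ and let $L_1^x(B)$, $x\in\mathbb{R}$, be its local time at $x$ up to time $1$. Then, as $\varepsilon\to0+$, $$ \mathsf{P}\left\{\int_{-\infty}^{\infty} (L_1^x(B))^3\, dx \leq\varepsilon\right\}\sim \frac{8\sqrt6}{\sqrt\pi}\, \varepsilon^{-1} \exp\left(-\frac92\varepsilon^{-1}\right). $$
   Context: $L_t^x(B)$ is the jointly continuous local time (occupation density) of $B$: $\int_0^tf(B(s))\,ds=\int_{-\infty}^\infty f(x)L_t^x(B)\,dx$ for all bounded Borel $f$ and $t\in[0,1]$. The notation $f(\varepsilon)\sim g(\varepsilon)$ means $f(\varepsilon)/g(\varepsilon)\to1$. *)

theory Defs
  imports "HOL-Probability.Probability" "HOL-Library.Landau_Symbols"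
begin

text \<open>Degenerate (almost surely constant) Gaussians are allowed; a Brownian bridge
  vanishes at both end points.\<close>

definition gaussian_rv :: "'a measure \<Rightarrow> ('a \<Rightarrow> real) \<Rightarrow> bool" where
  "gaussian_rv M X \<longleftrightarrow> X \<in> borel_measurable M \<and>
     (\<exists>\<mu> \<sigma>. (AE \<omega> in M. X \<omega> = \<mu>) \<or>
            \<sigma> > 0 \<and> distributed M lborel X (normal_density \<mu> \<sigma>))"

definition gaussian_process :: "'a measure \<Rightarrow> 'i set \<Rightarrow> ('i \<Rightarrow> 'a \<Rightarrow> real) \<Rightarrow> bool" where
  "gaussian_process M T X \<longleftrightarrow>
     (\<forall>J c. finite J \<and> J \<subseteq> T \<longrightarrow> gaussian_rv M (\<lambda>\<omega>. \<Sum>t\<in>J. c t * X t \<omega>))"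

text \<open>Since the process is centred, the covariance of \<open>B s\<close> and \<open>B t\<close> is the
  expectation of their product.\<close>

definition brownian_bridge :: "'a measure \<Rightarrow> (real \<Rightarrow> 'a \<Rightarrow> real) \<Rightarrow> bool" where
  "brownian_bridge M B \<longleftrightarrow>
     gaussian_process M {0..1} B \<and>
     (\<forall>t\<in>{0..1}. (LINT \<omega>|M. B t \<omega>) = 0) \<and>
     (\<forall>s\<in>{0..1}. \<forall>t\<in>{0..1}. (LINT \<omega>|M. B s \<omega> * B t \<omega>) = min s t - s * t) \<and>
     (AE \<omega> in M. continuous_on {0..1} (\<lambda>t. B t \<omega>))"

text \<open>\<open>L t x \<omega>\<close> is the local time at level \<open>x\<close> up to time \<open>t\<close>. The exceptional null set
  depends neither on \<open>t\<close> nor on \<open>f\<close>. Continuity in \<open>(t, x)\<close> is required for every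
  \<open>\<omega>\<close>, so that spatial integrals of \<open>L\<close> are random variables even if \<open>M\<close> is not
  complete.\<close>

definition local_time ::
  "'a measure \<Rightarrow> (real \<Rightarrow> 'a \<Rightarrow> real) \<Rightarrow> (real \<Rightarrow> real \<Rightarrow> 'a \<Rightarrow> real) \<Rightarrow> bool" where
  "local_time M B L \<longleftrightarrow>
     (\<forall>t\<in>{0..1}. \<forall>x. L t x \<in> borel_measurable M) \<and>
     (\<forall>\<omega>\<in>space M. continuous_on ({0..1} \<times> UNIV) (\<lambda>(t, x). L t x \<omega>)) \<and>
     (AE \<omega> in M. \<forall>t\<in>{0..1}. \<forall>f::real \<Rightarrow> real.
        f \<in> borel_measurable borel \<and> bounded (range f) \<longrightarrow>
        has_bochner_integral lborel (\<lambda>x. f x * L t x \<omega>) (LINT s:{0..t}|lborel. f (B s \<omega>)))"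

end

theory Submission
  imports Defs "HOL-Real_Asymp.Real_Asymp"
begin

text \<open>Let \<open>X\<close> be the integral of the cube of the local time. Mix bridges of length \<open>T\<close> with the weight
  \<open>exp (-(g^2 * T / 2)) / sqrt (2 * pi * T)\<close>. By Kac's moment formula the local times become a field \<open>Z\<close>
  whose moments are sums of products of Green functions \<open>exp (-g * \<bar>x - y\<bar>) / g\<close>, and these moments
  determine the conditional first and second moments of the spatial increments of \<open>Z\<close>: to the right
  of \<open>0\<close> it is a diffusion with generator \<open>2 * z * f'' - 2 * g * z * f'\<close> (Ray-Knight). If \<open>w\<close> decays and
  solves \<open>2 * w'' - 2 * g * w' = z^2 / 8 * w\<close> with \<open>w 0 = 1\<close>, then \<open>w (Z x)\<close>, discounted by the integral of
  \<open>Z^3 / 8\<close> over \<open>{0..x}\<close>, is a martingale. Together with the reflection \<open>x \<mapsto> -x\<close> this evaluates the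
  expectation of \<open>exp\<close> of minus the integral of \<open>Z^3 / 8\<close> over the line as the expectation of
  \<open>w (Z 0)^2\<close>. Substituting \<open>w z = exp (g * z / 2) * u (z / 2)\<close> gives \<open>u'' = (g^2 + y^2) * u\<close>, which is
  solved by an explicit Laplace integral. Undoing the mixture over \<open>T\<close> yields that the expectation of
  \<open>exp (-(t^2 / 8 * X))\<close> is \<open>(t / sinh t) powr (3/2)\<close>. Expanding this in powers of \<open>exp (-2 * t)\<close> and
  inverting term by term gives the distribution function of \<open>X\<close> as a series, whose first term carries
  the asymptotics at \<open>0\<close>.\<close>

text \<open>The weight of the mixture is \<open>heat T 0\<close> times
  \<open>exp (-(g^2 * T / 2))\<close>. The first factor normalises the bridge density, so that only
  heat kernels remain; the second turns their time convolutions into products of Green functions. As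
  the cubic integral scales like \<open>T^2\<close>, the single constant 1/8 covers all parameters
  \<open>T^2 / 8\<close> of the Laplace transform; its value makes the equation for \<open>u\<close>
  that of the harmonic oscillator, whose kernel is explicit. The diffusion is never constructed.
  Conditional statements are identities tested against products of bounded functions of earlier
  values; they are reached from moments by way of Laplace transforms with signed weights. The
  martingale is a limit of discrete sums whose one-step error is controlled by second and fourth
  moments of increments. Independence of the two half-lines given \<open>Z 0\<close> is replaced by
  eliminating them in turn, each time treating the rest as the past. The distribution function is
  known only through its Laplace transform, so it is compared with the series at nearby points. The
  leading term of the series mixes hitting times of levels just above 3, whence the exponent
  9/2.\<close>

abbreviation nn_lborel :: "(real \<Rightarrow> ennreal) \<Rightarrow> ennreal" (binder "NN " 10) where
  "NN x. f x \<equiv> \<integral>\<^sup>+x. f x \<partial>lborel"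

section \<open>Laplace transforms of the heat kernel and of hitting times\<close>

text \<open>\<open>F\<close> is required only to have limits at 0 from the right and at infinity,
  since the antiderivatives to come contain \<open>x / sqrt t\<close> and are singular at 0.\<close>

lemma nn_integral_FTC_Ioi:
  fixes f F :: "real \<Rightarrow> real"
  assumes F: "\<And>t. t > 0 \<Longrightarrow> DERIV F t :> f t"
    and f: "\<And>t. t > 0 \<Longrightarrow> isCont f t"
    and nonneg: "\<And>t. t > 0 \<Longrightarrow> 0 \<le> f t"
    and A: "(F \<longlongrightarrow> A) (at_right 0)" and B: "(F \<longlongrightarrow> B) at_top"
  shows "(NN t. ennreal (f t) * indicator {0<..} t) = ennreal (B - A)"
proof -
  have 1: "set_integrable lborel (einterval 0 \<infinity>) f" "(LBINT x=0..\<infinity>. f x) = B - A"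
  proof -
    have A': "((F \<circ> real_of_ereal) \<longlongrightarrow> A) (at_right 0)"
      using A unfolding zero_ereal_def by (simp add: ereal_tendsto_simps)
    have B': "((F \<circ> real_of_ereal) \<longlongrightarrow> B) (at_left \<infinity>)"
      using B by (simp add: ereal_tendsto_simps)
    show "set_integrable lborel (einterval 0 \<infinity>) f" "(LBINT x=0..\<infinity>. f x) = B - A"
      by (rule interval_integral_FTC_nonneg[OF _ _ _ _ A' B']; simp add: F f nonneg)+
  qed
  have e: "einterval 0 \<infinity> = {0::real<..}"
    by (auto simp: einterval_def)
  have i: "integrable lborel (\<lambda>x. indicator {0<..} x *\<^sub>R f x)"
    using 1(1) unfolding e set_integrable_def .
  have "(NN t. ennreal (f t) * indicator {0<..} t)
      = (NN t. ennreal (indicator {0<..} t *\<^sub>R f t))"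
    by (intro nn_integral_cong) (auto simp: indicator_def)
  also have "\<dots> = ennreal (LINT t|lborel. indicator {0<..} t *\<^sub>R f t)"
    by (rule nn_integral_eq_integral[OF i]) (auto simp: indicator_def nonneg)
  also have "(LINT t|lborel. indicator {0<..} t *\<^sub>R f t) = B - A"
    using 1(2) unfolding interval_lebesgue_integral_def e set_lebesgue_integral_def by simp
  finally show ?thesis .
qed

section \<open>The normal distribution function and antiderivatives built from it\<close>

definition std_normal_cdf :: "real \<Rightarrow> real" where
  "std_normal_cdf = cdf std_normal_distribution"

lemma std_normal_cdf_lim_top: "(std_normal_cdf \<longlongrightarrow> 1) at_top"
  and std_normal_cdf_lim_bot: "(std_normal_cdf \<longlongrightarrow> 0) at_bot"
proof -
  interpret real_distribution std_normal_distribution by (rule real_dist_normal_dist)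
  show "(std_normal_cdf \<longlongrightarrow> 1) at_top"
    using cdf_lim_at_top_prob unfolding std_normal_cdf_def .
  show "(std_normal_cdf \<longlongrightarrow> 0) at_bot"
    using cdf_lim_at_bot unfolding std_normal_cdf_def .
qed

lemma DERIV_std_normal_cdf: "DERIV std_normal_cdf x :> std_normal_density x"
proof -
  interpret real_distribution std_normal_distribution by (rule real_dist_normal_dist)
  have *: "std_normal_cdf u = std_normal_cdf (x - 1) + integral {x-1..u} std_normal_density"
    if "x - 1 \<le> u" for u
  proof (cases "x - 1 = u")
    case False
    with that have lt: "x - 1 < u" by simp
    have "std_normal_cdf u - std_normal_cdf (x-1) = measure std_normal_distribution {x-1<..u}"
      unfolding std_normal_cdf_def by (rule cdf_diff_eq[OF lt])
    also have "\<dots> = (LINT y|std_normal_distribution. indicator {x-1<..u} y)"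
      by simp
    also have "\<dots> = (LINT y|lborel. std_normal_density y *\<^sub>R indicator {x-1<..u} y)"
      by (subst integral_density) auto
    also have "\<dots> = (LINT y|lborel. indicator {x-1..u} y *\<^sub>R std_normal_density y)"
      by (rule integral_cong_AE, simp, simp, use AE_lborel_singleton[of "x-1"] in eventually_elim)
        (auto simp: indicator_def)
    also have "\<dots> = integral {x-1..u} std_normal_density"
    proof -
      have "set_integrable lborel {x-1..u} std_normal_density"
        by (rule borel_integrable_atLeastAtMost') (auto simp: std_normal_density_def intro!: continuous_intros)
      from set_borel_integral_eq_integral(2)[OF this] show ?thesis
        by (simp add: set_lebesgue_integral_def)
    qed
    finally show ?thesis by simp
  qed simp
  have "((\<lambda>u. integral {x-1..u} std_normal_density) has_real_derivative std_normal_density x) (at x within {x-1..x+1})"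
    by (rule integral_has_real_derivative) (auto simp: std_normal_density_def intro!: continuous_intros)
  then have "((\<lambda>u. integral {x-1..u} std_normal_density) has_real_derivative std_normal_density x) (at x)"
    by (simp add: at_within_Icc_at)
  then have "((\<lambda>u. std_normal_cdf (x-1) + integral {x-1..u} std_normal_density) has_real_derivative std_normal_density x) (at x)"
    by (auto intro!: derivative_eq_intros)
  then show ?thesis
    by (rule has_field_derivative_transform_within[where d=1])
      (auto simp: dist_real_def abs_if intro!: *[symmetric] split: if_splits)
qed

text \<open>The factor \<open>(g + x/t)/2\<close> is the point: adding the instances for
  \<open>x\<close> and \<open>-x\<close> leaves \<open>g\<close>, subtracting them leaves
  \<open>x/t\<close>. One computation thus yields both the Green function and the hitting time
  transform.\<close>

lemma green_antiderivative:
  fixes g x t :: real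
  assumes "t > 0"
  shows "((\<lambda>t. exp (-(g*x)) * std_normal_cdf ((g*t - x)/sqrt t)) has_real_derivative
     exp (-(g^2*t/2)) * exp (-(x^2/(2*t))) / sqrt (2*pi*t) * ((g + x/t)/2)) (at t)"
proof -
  have s: "sqrt t > 0" "sqrt t * sqrt t = t" using assms by auto
  have t: "t = (sqrt t)^2" using assms by simp
  have 1: "std_normal_density ((g*t - x)/sqrt t) = exp (g*x) * (exp (-(g^2*t/2)) * exp (-(x^2/(2*t))) / sqrt (2*pi))"
  proof -
    have "-(((g*t - x)/sqrt t)\<^sup>2) / 2 = g*x - g^2*t/2 - x^2/(2*t)"
      using assms by (simp add: power_divide power2_diff field_simps power2_eq_square)
    then have "exp (- ((g*t - x)/sqrt t)\<^sup>2 / 2) = exp (g*x) * (exp (-(g^2*t/2)) * exp (-(x^2/(2*t))))"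
      by (simp only: exp_add[symmetric]) simp
    then show ?thesis unfolding std_normal_density_def by simp
  qed
  have "((\<lambda>t. (g*t - x)/sqrt t) has_real_derivative (g * sqrt t - (g*t-x) * (inverse (sqrt t) / 2)) / (sqrt t * sqrt t)) (at t)"
    using assms by (auto intro!: derivative_eq_intros)
  also have "(g * sqrt t - (g*t-x) * (inverse (sqrt t) / 2)) / (sqrt t * sqrt t) =
       (g * (sqrt t * sqrt t) - (g*t-x) / 2) / (sqrt t * (sqrt t * sqrt t))"
    using s(1) by (simp add: field_simps)
  also have "\<dots> = (g + x/t)/2 / sqrt t"
    unfolding s(2) using s(1) assms by (simp add: field_simps)
  finally have d: "((\<lambda>t. (g*t - x)/sqrt t) has_real_derivative (g + x/t)/2 / sqrt t) (at t)" .
  have "exp (-(g*x)) * (std_normal_density ((g*t - x)/sqrt t) * ((g + x/t)/2 / sqrt t)) =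
    exp (-(g^2*t/2)) * exp (-(x^2/(2*t))) / sqrt (2*pi*t) * ((g + x/t)/2)"
  proof -
    have "exp (-(g*x)) * exp (g*x) = 1" by (simp add: exp_minus)
    then have e: "exp (-(g*x)) * (exp (g*x) * b) = b" for b by (metis mult.assoc mult_1)
    show ?thesis unfolding 1 mult.assoc e by (simp add: real_sqrt_mult)
  qed
  with DERIV_cmult[OF DERIV_chain2[OF DERIV_std_normal_cdf d], of "exp (-(g*x))"]
  show ?thesis by simp
qed

lemma std_normal_cdf_0: "std_normal_cdf 0 = 1/2"
proof -
  define H where "H x = std_normal_cdf x + std_normal_cdf (-x)" for x
  have "(H has_real_derivative 0) (at x)" for x
  proof -
    have "((\<lambda>x. std_normal_cdf (-x)) has_real_derivative std_normal_density (-x) * (-1)) (at x)"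
      by (rule DERIV_chain2[OF DERIV_std_normal_cdf]) (auto intro!: derivative_eq_intros)
    from DERIV_add[OF DERIV_std_normal_cdf this] show ?thesis
      unfolding H_def by (simp add: std_normal_density_def)
  qed
  then have c: "H x = H 0" for x using DERIV_isconst_all by blast
  have "((\<lambda>x. std_normal_cdf x + std_normal_cdf (-x)) \<longlongrightarrow> 1 + 0) at_top"
    by (intro tendsto_add std_normal_cdf_lim_top filterlim_compose[OF std_normal_cdf_lim_bot] filterlim_uminus_at_bot_at_top)
  then have "((\<lambda>_::real. H 0) \<longlongrightarrow> 1) at_top" using c by (simp add: H_def)
  then have "H 0 = 1" by (simp add: tendsto_const_iff)
  then show ?thesis by (simp add: H_def)
qed

text \<open>Resolvent kernel of Brownian motion killed at rate \<open>g^2 / 2\<close>. The sum of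
  the two antiderivatives, divided by \<open>g\<close>, is evaluated at both ends of the
  half-line.\<close>

lemma nn_integral_green:
  fixes g x :: real
  assumes g: "g > 0"
  shows "(NN t. ennreal (exp (-(g^2*t/2)) * exp (-(x^2/(2*t))) / sqrt (2*pi*t)) * indicator {0<..} t)
     = ennreal (exp (-g*\<bar>x\<bar>) / g)"
proof -
  define y where "y = \<bar>x\<bar>"
  have y: "y \<ge> 0" "x^2 = y^2" by (auto simp: y_def)
  define F where "F t = (exp (-(g*y)) * std_normal_cdf ((g*t - y)/sqrt t) + exp (g*y) * std_normal_cdf ((g*t + y)/sqrt t)) / g" for t
  have "(NN t. ennreal (exp (-(g^2*t/2)) * exp (-(x^2/(2*t))) / sqrt (2*pi*t)) * indicator {0<..} t)
     = ennreal ((exp (-(g*y)) + exp (g*y))/g - exp (g*y)/g)"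
  \<comment> \<open>At \<open>y = 0\<close> both arguments of \<open>std_normal_cdf\<close> tend to
    0 as \<open>t\<close> decreases to 0; otherwise they tend to minus and plus infinity.\<close>
  proof (cases "y = 0")
    case True
    have l0: "((\<lambda>t. (g*t)/sqrt t) \<longlongrightarrow> 0) (at_right 0)" using g by real_asymp
    have c: "(std_normal_cdf \<longlongrightarrow> 1/2) (at 0)"
      using DERIV_isCont[OF DERIV_std_normal_cdf, of 0] std_normal_cdf_0 by (simp add: isCont_def)
    have nz: "\<forall>\<^sub>F t in at_right 0. (g*t)/sqrt t \<noteq> 0"
      by (rule eventually_at_rightI[of 0 1]) (use g in auto)
    have A: "(F \<longlongrightarrow> (exp (-(g*y)) * (1/2) + exp (g*y) * (1/2))/g) (at_right 0)"
      unfolding F_def True using l0 nz c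
      by (intro tendsto_intros filterlim_compose[OF c]) (auto simp: filterlim_at)
    have B: "(F \<longlongrightarrow> (exp (-(g*y)) * 1 + exp (g*y) * 1) / g) at_top"
    proof -
      have "filterlim (\<lambda>t. (g*t - y)/sqrt t) at_top at_top" "filterlim (\<lambda>t. (g*t + y)/sqrt t) at_top at_top"
        using g by real_asymp+
      then show ?thesis unfolding F_def
        using g by (intro tendsto_intros filterlim_compose[OF std_normal_cdf_lim_top]) auto
    qed
    show ?thesis
      apply (subst nn_integral_FTC_Ioi[OF _ _ _ A B])
      subgoal for t
        unfolding F_def using DERIV_cdivide[OF DERIV_add[OF green_antiderivative[of t g y] green_antiderivative[of t g "-y"]], of g] g y
        by (simp add: field_simps)
      subgoal by (auto intro!: continuous_intros)
      subgoal by auto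
      subgoal using True by simp
      done
  next
    case False
    with y have y0: "y > 0" by simp
    have A: "(F \<longlongrightarrow> (exp (-(g*y)) * 0 + exp (g*y) * 1)/g) (at_right 0)"
    proof -
      have "filterlim (\<lambda>t. (g*t - y)/sqrt t) at_bot (at_right 0)" "filterlim (\<lambda>t. (g*t + y)/sqrt t) at_top (at_right 0)"
        using g y0 by real_asymp+
      then show ?thesis unfolding F_def
        using g by (intro tendsto_intros filterlim_compose[OF std_normal_cdf_lim_top] filterlim_compose[OF std_normal_cdf_lim_bot]) auto
    qed
    have B: "(F \<longlongrightarrow> (exp (-(g*y)) * 1 + exp (g*y) * 1) / g) at_top"
    proof -
      have "filterlim (\<lambda>t. (g*t - y)/sqrt t) at_top at_top" "filterlim (\<lambda>t. (g*t + y)/sqrt t) at_top at_top"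
        using g by real_asymp+
      then show ?thesis unfolding F_def
        using g by (intro tendsto_intros filterlim_compose[OF std_normal_cdf_lim_top]) auto
    qed
    show ?thesis
      apply (subst nn_integral_FTC_Ioi[OF _ _ _ A B])
      subgoal for t
        unfolding F_def using DERIV_cdivide[OF DERIV_add[OF green_antiderivative[of t g y] green_antiderivative[of t g "-y"]], of g] g y
        by (simp add: field_simps)
      subgoal by (auto intro!: continuous_intros)
      subgoal by auto
      subgoal by simp
      done
  qed
  then show ?thesis by (simp add: y_def add_divide_distrib)
qed

text \<open>Without \<open>exp (-(g^2*t/2))\<close> the integrand is the density of the first time
  at which Brownian motion reaches level \<open>x\<close>. Here the difference of the two
  antiderivatives is used.\<close>

lemma nn_integral_hitting:
  fixes g x :: real
  assumes g: "g > 0" and x: "x > 0"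
  shows "(NN t. ennreal (x * exp (-(g^2*t/2)) * exp (-(x^2/(2*t))) / (t * sqrt (2*pi*t))) * indicator {0<..} t)
     = ennreal (exp (-g*x))"
proof -
  define F where "F t = exp (-(g*x)) * std_normal_cdf ((g*t - x)/sqrt t) - exp (g*x) * std_normal_cdf ((g*t + x)/sqrt t)" for t
  have A: "(F \<longlongrightarrow> (exp (-(g*x)) * 0 - exp (g*x) * 1)) (at_right 0)"
  proof -
    have "filterlim (\<lambda>t. (g*t - x)/sqrt t) at_bot (at_right 0)" "filterlim (\<lambda>t. (g*t + x)/sqrt t) at_top (at_right 0)"
      using g x by real_asymp+
    then show ?thesis unfolding F_def
      using g by (intro tendsto_intros filterlim_compose[OF std_normal_cdf_lim_top] filterlim_compose[OF std_normal_cdf_lim_bot]) auto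
  qed
  have B: "(F \<longlongrightarrow> (exp (-(g*x)) * 1 - exp (g*x) * 1)) at_top"
  proof -
    have "filterlim (\<lambda>t. (g*t - x)/sqrt t) at_top at_top" "filterlim (\<lambda>t. (g*t + x)/sqrt t) at_top at_top"
      using g by real_asymp+
    then show ?thesis unfolding F_def
      using g by (intro tendsto_intros filterlim_compose[OF std_normal_cdf_lim_top]) auto
  qed
  show ?thesis
    apply (subst nn_integral_FTC_Ioi[OF _ _ _ A B])
    subgoal for t
      unfolding F_def using DERIV_diff[OF green_antiderivative[of t g x] green_antiderivative[of t g "-x"]] g
      by (simp add: field_simps)
    subgoal by (auto intro!: continuous_intros)
    subgoal using x by auto
    subgoal by simp
    done
qed

section \<open>Determinacy by moments and by Laplace transforms\<close>

lemma power_le_fact_exp: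
  fixes x :: real assumes "0 \<le> x" shows "x ^ n \<le> fact n * exp x"
proof -
  have "(\<Sum>i\<in>{n}. x ^ i /\<^sub>R fact i) \<le> (\<Sum>i. x ^ i /\<^sub>R fact i)"
    by (rule sum_le_suminf[OF summable_exp_generic]) (use assms in auto)
  then show ?thesis by (simp add: exp_def field_simps)
qed

text \<open>The power is paid for by the gap between \<open>b\<close> and \<open>c\<close>:
  \<open>S x ^ n\<close> is at most a constant times \<open>exp ((c - b) * S x)\<close>.\<close>

lemma integrable_power_exp:
  fixes S Y :: "'a \<Rightarrow> real"
  assumes c: "c > 0" and i: "integrable M (\<lambda>x. exp (c * S x) * Y x)"
    and [measurable]: "S \<in> borel_measurable M" "Y \<in> borel_measurable M"
    and S: "\<And>x. x \<in> space M \<Longrightarrow> 0 \<le> S x" and b: "b < c"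
  shows "integrable M (\<lambda>x. S x ^ n * exp (b * S x) * Y x)"
proof (rule Bochner_Integration.integrable_bound)
  define C where "C = fact n / (c - b)^n"
  show "integrable M (\<lambda>x. C * (exp (c * S x) * Y x))" using i by simp
  have "norm (S x ^ n * exp (b * S x) * Y x) \<le> norm (C * (exp (c * S x) * Y x))" if "x \<in> space M" for x
  proof -
    have "((c-b) * S x)^n \<le> fact n * exp ((c-b) * S x)"
      by (rule power_le_fact_exp) (use S[OF that] b in auto)
    then have "S x ^ n \<le> C * exp ((c-b) * S x)"
      using b unfolding C_def power_mult_distrib by (simp add: pos_le_divide_eq mult.commute)
    then have "S x ^ n * exp (b * S x) \<le> C * exp ((c-b) * S x) * exp (b * S x)"
      by (rule mult_right_mono) auto
    also have "\<dots> = C * exp (c * S x)" by (simp add: mult.assoc exp_add[symmetric] algebra_simps)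
    finally have "S x ^ n * exp (b * S x) * \<bar>Y x\<bar> \<le> C * exp (c * S x) * \<bar>Y x\<bar>"
      by (rule mult_right_mono) auto
    moreover have "C \<ge> 0" using b by (auto simp: C_def)
    ultimately show ?thesis using S[OF that] by (simp add: abs_mult mult.assoc)
  qed
  then show "AE x in M. norm (S x ^ n * exp (b * S x) * Y x) \<le> norm (C * (exp (c * S x) * Y x))"
    by (intro AE_I2)
qed measurable

text \<open>Expand \<open>exp ((r - r') * S x)\<close> and integrate termwise. Because
  \<open>exp (-(r * S x)) \<le> 1\<close>, the radius \<open>c\<close> is the same at every base
  point \<open>r \<ge> 0\<close>, which is what permits repeated continuation.\<close>

lemma exp_shift_series:
  fixes S Y :: "'a \<Rightarrow> real"
  assumes c: "c > 0" and i: "integrable M (\<lambda>x. exp (c * S x) * Y x)"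
    and [measurable]: "S \<in> borel_measurable M" "Y \<in> borel_measurable M"
    and S: "\<And>x. x \<in> space M \<Longrightarrow> 0 \<le> S x" and r: "r \<ge> 0" and r': "\<bar>r - r'\<bar> < c"
  shows "(\<lambda>m. (r - r')^m / fact m * (LINT x|M. S x ^ (n + m) * exp (-(r * S x)) * Y x))
    sums (LINT x|M. S x ^ n * exp (-(r' * S x)) * Y x)"
proof -
  have ii: "integrable M (\<lambda>x. S x ^ k * exp (b * S x) * Y x)" if "b < c" for b k
    by (rule integrable_power_exp[OF c i _ _ S that]) measurable
  define f where "f N x = (\<Sum>m<N. (r-r')^m / fact m * (S x ^ (n + m) * exp (-(r * S x)) * Y x))" for N x
  have conv: "(\<lambda>N. f N x) \<longlonglongrightarrow> S x ^ n * exp (-(r' * S x)) * Y x" for x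
  proof -
    have "(\<lambda>m. ((r-r')* S x)^m /\<^sub>R fact m) sums exp ((r-r')*S x)"
      by (rule exp_converges)
    from sums_mult2[OF this, of "S x ^ n * exp (-(r * S x)) * Y x"]
    have "(\<lambda>m. (r-r')^m / fact m * (S x ^ (n + m) * exp (-(r * S x)) * Y x)) sums
       (exp ((r-r')*S x) * (S x ^ n * exp (-(r * S x)) * Y x))"
      by (simp add: power_mult_distrib power_add divide_inverse ac_simps)
    moreover have "exp ((r-r')*S x) * (S x ^ n * exp (-(r * S x)) * Y x) = S x ^ n * (exp ((r-r')*S x) * exp (-(r * S x))) * Y x"
      by simp
    moreover have "exp ((r-r')*S x) * exp (-(r * S x)) = exp (-(r'*S x))"
      by (simp add: exp_add[symmetric] algebra_simps)
    ultimately show ?thesis unfolding sums_def f_def by simp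
  qed
  have "(\<lambda>N. LINT x|M. f N x) \<longlonglongrightarrow> (LINT x|M. S x ^ n * exp (-(r' * S x)) * Y x)"
  proof (rule integral_dominated_convergence[where w="\<lambda>x. \<bar>S x ^ n * exp (\<bar>r-r'\<bar> * S x) * Y x\<bar>"])
    show "integrable M (\<lambda>x. \<bar>S x ^ n * exp (\<bar>r-r'\<bar> * S x) * Y x\<bar>)"
      using ii[OF r', of n] by (rule integrable_abs)
    show "AE x in M. (\<lambda>N. f N x) \<longlonglongrightarrow> S x ^ n * exp (-(r' * S x)) * Y x"
      using conv by auto
    show "AE x in M. norm (f N x) \<le> \<bar>S x ^ n * exp (\<bar>r-r'\<bar> * S x) * Y x\<bar>" for N
    proof (rule AE_I2)
      fix x assume x: "x \<in> space M"
      have "norm (f N x) \<le> (\<Sum>m<N. (\<bar>r-r'\<bar> * S x)^m /\<^sub>R fact m * (S x ^ n * \<bar>Y x\<bar>))"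
        unfolding f_def
      proof (rule sum_norm_le)
        fix m
        have "exp (-(r * S x)) \<le> 1" using r S[OF x] by simp
        then have "exp (-(r * S x)) * (\<bar>r-r'\<bar>^m * S x ^ m / fact m * (S x ^ n * \<bar>Y x\<bar>)) \<le> \<bar>r-r'\<bar>^m * S x ^ m / fact m * (S x ^ n * \<bar>Y x\<bar>)"
          using S[OF x] by (intro mult_left_le_one_le) auto
        then show "norm ((r-r')^m / fact m * (S x ^ (n + m) * exp (-(r * S x)) * Y x)) \<le> (\<bar>r-r'\<bar> * S x)^m /\<^sub>R fact m * (S x ^ n * \<bar>Y x\<bar>)"
          using S[OF x] by (simp add: abs_mult power_abs power_add power_mult_distrib divide_inverse ac_simps)
      qed
      also have "\<dots> = (\<Sum>m<N. (\<bar>r-r'\<bar> * S x)^m /\<^sub>R fact m) * (S x ^ n * \<bar>Y x\<bar>)"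
        by (simp add: sum_distrib_right)
      also have "\<dots> \<le> exp (\<bar>r-r'\<bar> * S x) * (S x ^ n * \<bar>Y x\<bar>)"
      proof (rule mult_right_mono)
        show "(\<Sum>m<N. (\<bar>r-r'\<bar> * S x)^m /\<^sub>R fact m) \<le> exp (\<bar>r-r'\<bar> * S x)"
          unfolding exp_def by (rule sum_le_suminf[OF summable_exp_generic]) (use S[OF x] in auto)
      qed (use S[OF x] in auto)
      finally show "norm (f N x) \<le> \<bar>S x ^ n * exp (\<bar>r-r'\<bar> * S x) * Y x\<bar>"
        using S[OF x] by (simp add: abs_mult ac_simps)
    qed
  qed (auto simp: f_def)
  moreover have "(LINT x|M. f N x) = (\<Sum>m<N. (r - r')^m / fact m * (LINT x|M. S x ^ (n + m) * exp (-(r * S x)) * Y x))" for N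
    unfolding f_def by (subst Bochner_Integration.integral_sum) (use ii[of "-r"] r c in auto)
  ultimately show ?thesis by (simp add: sums_def)
qed

text \<open>Analytic continuation along the half-line: the power series at one base point determines
  all weighted moments at points within distance \<open>c\<close>, and these are the coefficients at
  the next base point. The weights \<open>Y1\<close> and \<open>Y2\<close> may change sign, as
  conditional identities require.\<close>

lemma moments_determine_laplace:
  fixes S1 Y1 :: "'a \<Rightarrow> real" and S2 Y2 :: "'b \<Rightarrow> real"
  assumes c: "c > 0"
    and i1: "integrable M1 (\<lambda>x. exp (c * S1 x) * Y1 x)"
    and m1[measurable]: "S1 \<in> borel_measurable M1" "Y1 \<in> borel_measurable M1"
    and S1: "\<And>x. x \<in> space M1 \<Longrightarrow> 0 \<le> S1 x"
    and i2: "integrable M2 (\<lambda>x. exp (c * S2 x) * Y2 x)"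
    and m2[measurable]: "S2 \<in> borel_measurable M2" "Y2 \<in> borel_measurable M2"
    and S2: "\<And>x. x \<in> space M2 \<Longrightarrow> 0 \<le> S2 x"
    and eq: "\<And>n. (LINT x|M1. S1 x ^ n * Y1 x) = (LINT x|M2. S2 x ^ n * Y2 x)"
    and r: "r \<ge> 0"
  shows "(LINT x|M1. exp (-(r * S1 x)) * Y1 x) = (LINT x|M2. exp (-(r * S2 x)) * Y2 x)"
proof -
  define P where "P r \<longleftrightarrow> (\<forall>n. (LINT x|M1. S1 x ^ n * exp (-(r * S1 x)) * Y1 x) = (LINT x|M2. S2 x ^ n * exp (-(r * S2 x)) * Y2 x))" for r
  have step: "P r'" if "P r" "r \<ge> 0" "\<bar>r - r'\<bar> < c" for r r'
    unfolding P_def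
  proof
    fix n
    show "(LINT x|M1. S1 x ^ n * exp (-(r' * S1 x)) * Y1 x) = (LINT x|M2. S2 x ^ n * exp (-(r' * S2 x)) * Y2 x)"
      using exp_shift_series[OF c i1 m1 S1 that(2,3), of n] exp_shift_series[OF c i2 m2 S2 that(2,3), of n] that(1)
      unfolding P_def by (auto dest: sums_unique2)
  qed
  have P0: "P 0" using eq by (simp add: P_def)
  have k: "P (real k * (c/2))" for k
  proof (induction k)
    case (Suc k)
    show ?case by (rule step[OF Suc]) (use c in \<open>auto simp: field_simps\<close>)
  qed (use P0 in simp)
  \<comment> \<open>\<open>k\<close> steps of length \<open>c/2\<close> stop at most
    \<open>c/2\<close> below \<open>r\<close>, within the radius of the last expansion.\<close>
  define k where "k = nat \<lfloor>r / (c/2)\<rfloor>"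
  have "real k \<le> r / (c/2)" "r / (c/2) < real k + 1"
    unfolding k_def using r c by (auto simp: of_nat_nat)
  then have "\<bar>real k * (c/2) - r\<bar> < c" using c by (auto simp: field_simps abs_if)
  from step[OF k _ this] c have "P r" by simp
  then show ?thesis unfolding P_def by (auto dest: spec[of _ 0])
qed

text \<open>Under \<open>u = exp (-s)\<close> the half-line is carried into the unit interval and
  \<open>exp (-(n * s))\<close> becomes \<open>u^n\<close>, so Weierstrass approximation applies.
  Vanishing of \<open>\<phi>\<close> beyond \<open>R\<close> makes the transformed function
  continuous at \<open>u = 0\<close>.\<close>

lemma laplace_determines_compact:
  fixes S1 Y1 :: "'a \<Rightarrow> real" and S2 Y2 :: "'b \<Rightarrow> real" and \<phi> :: "real \<Rightarrow> real"
  assumes i1: "integrable M1 Y1"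
    and m1[measurable]: "S1 \<in> borel_measurable M1"
    and S1: "\<And>x. x \<in> space M1 \<Longrightarrow> 0 \<le> S1 x"
    and i2: "integrable M2 Y2"
    and m2[measurable]: "S2 \<in> borel_measurable M2"
    and S2: "\<And>x. x \<in> space M2 \<Longrightarrow> 0 \<le> S2 x"
    and eq: "\<And>n::nat. (LINT x|M1. exp (-(real n * S1 x)) * Y1 x) = (LINT x|M2. exp (-(real n * S2 x)) * Y2 x)"
    and cont: "continuous_on UNIV \<phi>" and R: "\<And>x. x \<ge> R \<Longrightarrow> \<phi> x = 0"
  shows "(LINT x|M1. \<phi> (S1 x) * Y1 x) = (LINT x|M2. \<phi> (S2 x) * Y2 x)"
proof -
  define \<Phi> where "\<Phi> u = (if u \<le> 0 then 0 else \<phi> (- ln u))" for u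
  have m\<phi>[measurable]: "\<phi> \<in> borel_measurable borel" using cont by (rule borel_measurable_continuous_onI)
  have zero: "\<Phi> u = 0" if "u \<le> exp (-R)" for u
  proof (cases "u \<le> 0")
    case False
    then have "ln u \<le> -R" using that by (metis exp_gt_zero ln_exp ln_le_cancel_iff not_le)
    then show ?thesis using R False by (simp add: \<Phi>_def)
  qed (simp add: \<Phi>_def)
  have contA: "continuous_on {0..1} \<Phi>"
  proof -
    have "continuous_on ({0..exp (-R)} \<union> {exp (-R)/2..1}) \<Phi>"
    proof (rule continuous_on_closed_Un)
      show "continuous_on {0..exp (-R)} \<Phi>" using zero by (subst continuous_on_cong[where g="\<lambda>_. 0"]) auto
      have pos: "u > 0" if "exp (-R) \<le> u * 2" for u
        using that exp_gt_zero[of "-R"] by linarith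
      have "continuous_on {exp (-R)/2..1} (\<lambda>u. \<phi> (- ln u))"
        by (rule continuous_on_compose2[OF cont]) (auto intro!: continuous_intros simp: pos)
      then show "continuous_on {exp (-R)/2..1} \<Phi>"
        by (subst continuous_on_cong[where g="\<lambda>u. \<phi> (- ln u)"]) (auto simp: \<Phi>_def dest: pos)
    qed auto
    then show ?thesis by (rule continuous_on_subset) auto
  qed
  have \<phi>: "\<phi> s = \<Phi> (exp (-s))" for s by (simp add: \<Phi>_def)
  have bdd: "bounded (\<Phi> ` {0..1})"
    using compact_continuous_image[OF contA] compact_imp_bounded by auto
  then obtain B where B: "\<And>u. u \<in> {0..1} \<Longrightarrow> \<bar>\<Phi> u\<bar> \<le> B" unfolding bounded_iff by fastforce
  have "B \<ge> 0" using B[of 0] by auto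
  have B1: "\<bar>\<phi> (S1 x)\<bar> \<le> B" if "x \<in> space M1" for x unfolding \<phi> using S1[OF that] by (intro B) auto
  have B2: "\<bar>\<phi> (S2 x)\<bar> \<le> B" if "x \<in> space M2" for x unfolding \<phi> using S2[OF that] by (intro B) auto
  have [measurable]: "Y1 \<in> borel_measurable M1" "Y2 \<in> borel_measurable M2" using i1 i2 by auto
  have bi: "integrable M (\<lambda>x. h x * Y x)" if [measurable]: "integrable M Y" "h \<in> borel_measurable M" and "\<And>x. x \<in> space M \<Longrightarrow> \<bar>h x\<bar> \<le> C"
    for M :: "'c measure" and h Y :: "'c \<Rightarrow> real" and C
  proof (rule Bochner_Integration.integrable_bound[of M "\<lambda>x. C * Y x"])
    show "AE x in M. norm (h x * Y x) \<le> norm (C * Y x)"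
      by (rule AE_I2) (auto simp: abs_mult intro!: mult_right_mono order.trans[OF that(3) abs_ge_self])
  qed (use that in auto)
  have key: "\<bar>(LINT x|M1. \<phi> (S1 x) * Y1 x) - (LINT x|M2. \<phi> (S2 x) * Y2 x)\<bar> \<le> e * ((LINT x|M1. \<bar>Y1 x\<bar>) + (LINT x|M2. \<bar>Y2 x\<bar>))" if e: "e > 0" for e
  proof -
    obtain p where p: "real_polynomial_function p" "\<And>u. u \<in> {0..1} \<Longrightarrow> \<bar>\<Phi> u - p u\<bar> < e"
      using Stone_Weierstrass_real_polynomial_function[OF compact_Icc contA e] by auto
    then obtain a n where a: "p = (\<lambda>x. \<Sum>i\<le>n. a i * x ^ i)"
      using real_polynomial_function_iff_sum by auto
    have ae: "exp (- s) ^ i = exp (-(real i * s))" for s i by (simp add: exp_of_nat_mult[symmetric])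
    have eqp: "(LINT x|M1. p (exp (- S1 x)) * Y1 x) = (LINT x|M2. p (exp (- S2 x)) * Y2 x)"
    proof -
      have "(LINT x|M1. p (exp (- S1 x)) * Y1 x) = (\<Sum>i\<le>n. a i * (LINT x|M1. exp (-(real i * S1 x)) * Y1 x))"
        unfolding a sum_distrib_right ae mult.assoc
        by (subst Bochner_Integration.integral_sum) (auto intro!: bi[of _ _ _ 1] mult_nonneg_nonneg i1 S1)
      moreover have "(LINT x|M2. p (exp (- S2 x)) * Y2 x) = (\<Sum>i\<le>n. a i * (LINT x|M2. exp (-(real i * S2 x)) * Y2 x))"
        unfolding a sum_distrib_right ae mult.assoc
        by (subst Bochner_Integration.integral_sum) (auto intro!: bi[of _ _ _ 1] mult_nonneg_nonneg i2 S2)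
      ultimately show ?thesis using eq by simp
    qed
    have mp[measurable]: "p \<in> borel_measurable borel" unfolding a by measurable
    have d: "\<bar>(LINT x|M. \<phi> (S x) * Y x) - (LINT x|M. p (exp (- S x)) * Y x)\<bar> \<le> e * (LINT x|M. \<bar>Y x\<bar>)"
      if "integrable M Y" and [measurable]: "S \<in> borel_measurable M" and S: "\<And>x. x \<in> space M \<Longrightarrow> 0 \<le> S x"
      for M :: "'c measure" and S Y
    proof -
      have b1: "\<bar>\<phi> (S x)\<bar> \<le> B" if "x \<in> space M" for x unfolding \<phi> using S[OF that] by (intro B) auto
      have b2: "\<bar>\<phi> (S x) - p (exp (- S x))\<bar> \<le> e" if "x \<in> space M" for x
        unfolding \<phi> using S[OF that] p(2)[of "exp (- S x)"] by auto
      have b3: "\<bar>p (exp (- S x))\<bar> \<le> B + e" if "x \<in> space M" for x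
        using b1[OF that] b2[OF that] by linarith
      have I: "integrable M (\<lambda>x. \<phi> (S x) * Y x)" "integrable M (\<lambda>x. p (exp (- S x)) * Y x)"
        using b1 b3 by (auto intro!: bi[OF that(1)])
      have "(LINT x|M. \<phi> (S x) * Y x) - (LINT x|M. p (exp (- S x)) * Y x) = (LINT x|M. \<phi> (S x) * Y x - p (exp (- S x)) * Y x)"
        by (rule Bochner_Integration.integral_diff[OF I, symmetric])
      also have "\<bar>\<dots>\<bar> \<le> (LINT x|M. e * \<bar>Y x\<bar>)"
        unfolding real_norm_def[symmetric]
      proof (rule Bochner_Integration.integral_norm_bound[THEN order.trans], rule integral_mono)
        show "integrable M (\<lambda>x. norm (\<phi> (S x) * Y x - p (exp (- S x)) * Y x))"
          using I by auto
        fix x assume "x \<in> space M"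
        from b2[OF this] show "norm (\<phi> (S x) * Y x - p (exp (- S x)) * Y x) \<le> e * norm (Y x)"
          by (simp add: left_diff_distrib[symmetric] abs_mult mult_right_mono)
      qed (use that in auto)
      finally show ?thesis by simp
    qed
    from d[OF i1 m1 S1] d[OF i2 m2 S2] eqp show ?thesis by (simp add: distrib_left)
  qed
  define K where "K = (LINT x|M1. \<bar>Y1 x\<bar>) + (LINT x|M2. \<bar>Y2 x\<bar>)"
  have "K \<ge> 0" unfolding K_def by (intro add_nonneg_nonneg) auto
  have "\<bar>(LINT x|M1. \<phi> (S1 x) * Y1 x) - (LINT x|M2. \<phi> (S2 x) * Y2 x)\<bar> \<le> 0"
  proof (rule field_le_epsilon)
    fix e :: real assume e: "e > 0"
    have "e / (K+1) > 0" using e \<open>K \<ge> 0\<close> by simp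
    from key[OF this] have "\<bar>(LINT x|M1. \<phi> (S1 x) * Y1 x) - (LINT x|M2. \<phi> (S2 x) * Y2 x)\<bar> \<le> e / (K+1) * K"
      by (simp add: K_def)
    also have "\<dots> \<le> e" using e \<open>K \<ge> 0\<close> by (simp add: field_simps)
    finally show "\<bar>(LINT x|M1. \<phi> (S1 x) * Y1 x) - (LINT x|M2. \<phi> (S2 x) * Y2 x)\<bar> \<le> 0 + e" by simp
  qed
  then show ?thesis by simp
qed

lemma laplace_determines:
  fixes S1 Y1 :: "'a \<Rightarrow> real" and S2 Y2 :: "'b \<Rightarrow> real" and \<phi> :: "real \<Rightarrow> real"
  assumes i1: "integrable M1 Y1"
    and m1[measurable]: "S1 \<in> borel_measurable M1"
    and S1: "\<And>x. x \<in> space M1 \<Longrightarrow> 0 \<le> S1 x"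
    and i2: "integrable M2 Y2"
    and m2[measurable]: "S2 \<in> borel_measurable M2"
    and S2: "\<And>x. x \<in> space M2 \<Longrightarrow> 0 \<le> S2 x"
    and eq: "\<And>n::nat. (LINT x|M1. exp (-(real n * S1 x)) * Y1 x) = (LINT x|M2. exp (-(real n * S2 x)) * Y2 x)"
    and cont: "continuous_on UNIV \<phi>" and bdd: "\<And>x. \<bar>\<phi> x\<bar> \<le> B"
  shows "(LINT x|M1. \<phi> (S1 x) * Y1 x) = (LINT x|M2. \<phi> (S2 x) * Y2 x)"
proof -
  \<comment> \<open>The ramp is 1 up to \<open>k - 1\<close> and 0 from \<open>k\<close> on.\<close>
  define \<psi> where "\<psi> k x = \<phi> x * max 0 (min 1 (real k - x))" for k x
  have m\<phi>[measurable]: "\<phi> \<in> borel_measurable borel" using cont by (rule borel_measurable_continuous_onI)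
  have [measurable]: "Y1 \<in> borel_measurable M1" "Y2 \<in> borel_measurable M2" using i1 i2 by auto
  have c: "continuous_on UNIV (\<psi> k)" for k unfolding \<psi>_def
    by (intro continuous_intros cont)
  have [measurable]: "\<psi> k \<in> borel_measurable borel" for k using c by (rule borel_measurable_continuous_onI)
  have e: "(LINT x|M1. \<psi> k (S1 x) * Y1 x) = (LINT x|M2. \<psi> k (S2 x) * Y2 x)" for k
    by (rule laplace_determines_compact[OF i1 m1 S1 i2 m2 S2 eq c, of "real k"]) (auto simp: \<psi>_def)
  have l: "(\<lambda>k. LINT x|M. \<psi> k (S x) * Y x) \<longlonglongrightarrow> (LINT x|M. \<phi> (S x) * Y x)"
    if [measurable]: "integrable M Y" "S \<in> borel_measurable M" for M :: "'c measure" and S Y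
  proof (rule integral_dominated_convergence[where w="\<lambda>x. B * \<bar>Y x\<bar>"])
    show "AE x in M. (\<lambda>k. \<psi> k (S x) * Y x) \<longlonglongrightarrow> \<phi> (S x) * Y x"
    proof (rule AE_I2, rule tendsto_eventually)
      fix x
      have "\<forall>\<^sub>F k in sequentially. real k \<ge> S x + 1"
        using filterlim_real_sequentially unfolding filterlim_at_top by auto
      then show "\<forall>\<^sub>F k in sequentially. \<psi> k (S x) * Y x = \<phi> (S x) * Y x"
        by eventually_elim (simp add: \<psi>_def)
    qed
    show "AE x in M. norm (\<psi> k (S x) * Y x) \<le> B * \<bar>Y x\<bar>" for k
    proof (rule AE_I2)
      fix x
      have "\<bar>\<psi> k (S x)\<bar> \<le> \<bar>\<phi> (S x)\<bar> * 1" unfolding \<psi>_def abs_mult by (intro mult_left_mono) auto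
      also have "\<dots> \<le> B" using bdd by simp
      finally show "norm (\<psi> k (S x) * Y x) \<le> B * \<bar>Y x\<bar>" by (simp add: abs_mult mult_right_mono)
    qed
  qed (use that in auto)
  from l[OF i1 m1] l[OF i2 m2] show ?thesis unfolding e by (rule LIMSEQ_unique)
qed

section \<open>Inversion of the Laplace transform\<close>

text \<open>Density at time \<open>t\<close> of the first passage of Brownian motion through level
  \<open>c\<close>.\<close>

definition hit_density :: "real \<Rightarrow> real \<Rightarrow> real" where
  "hit_density c t = c * exp (-(c^2/(2*t))) / (t * sqrt (2*pi*t))"

lemma hit_density_measurable [measurable]:
  "(\<lambda>(c, t). hit_density c t) \<in> borel_measurable (borel \<Otimes>\<^sub>M borel)"
  unfolding hit_density_def by measurable

lemma hit_density_nonneg: "c \<ge> 0 \<Longrightarrow> t \<ge> 0 \<Longrightarrow> hit_density c t \<ge> 0"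
  unfolding hit_density_def by (intro divide_nonneg_nonneg mult_nonneg_nonneg) auto

lemma nn_integral_hit_density:
  assumes "s > 0" "c > 0"
  shows "(NN t. ennreal (exp (-(s*t)) * hit_density c t) * indicator {0<..} t)
     = ennreal (exp (- c * sqrt (2 * s)))"
proof -
  have "(NN t. ennreal (exp (-(s*t)) * hit_density c t) * indicator {0<..} t)
    = (NN t. ennreal (c * exp (-((sqrt (2 * s))^2*t/2)) * exp (-(c^2/(2*t))) / (t * sqrt (2*pi*t))) * indicator {0<..} t)"
    using assms by (intro nn_integral_cong) (simp add: hit_density_def ac_simps)
  also have "\<dots> = ennreal (exp (-sqrt (2 * s) * c))"
    by (rule nn_integral_hitting) (use assms in auto)
  finally show ?thesis by (simp add: mult.commute)
qed

text \<open>The Gamma integral at 1/2, read off from \<open>nn_integral_green\<close> at the point 0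
  with \<open>sqrt (2*t)\<close> in place of \<open>g\<close>.\<close>

lemma nn_integral_inv_sqrt_exp:
  assumes t: "t > 0"
  shows "(NN b. ennreal (exp (-(t*b)) / sqrt b) * indicator {0<..} b) = ennreal (sqrt (pi / t))"
proof -
  have "(NN b. ennreal (exp (-(t*b)) / sqrt b) * indicator {0<..} b)
    = (NN b. ennreal (sqrt (2*pi)) * (ennreal (exp (-((sqrt (2*t))^2*b/2)) * exp (-(0^2/(2*b))) / sqrt (2*pi*b)) * indicator {0<..} b))"
    using t by (intro nn_integral_cong) (auto simp: indicator_def ennreal_mult[symmetric] real_sqrt_mult[of "2*pi"] )
  also have "\<dots> = ennreal (sqrt (2*pi)) * ennreal (exp (- sqrt (2*t) * \<bar>0\<bar>) / sqrt (2*t))"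
    by (subst nn_integral_cmult, measurable, subst nn_integral_green) (use t in auto)
  also have "\<dots> = ennreal (sqrt (pi / t))"
    using t by (simp add: ennreal_mult[symmetric] real_sqrt_mult real_sqrt_divide)
  finally show ?thesis .
qed

lemma nn_integral_power_inv_sqrt_exp_finite:
  "(NN v. ennreal (v^j * exp (-(6 * v)) / sqrt v) * indicator {0<..} v) < \<infinity>"
proof -
  have "(NN v. ennreal (v^j * exp (-(6 * v)) / sqrt v) * indicator {0<..} v)
     \<le> (NN v. ennreal (fact j) * (ennreal (exp (-(5 * v)) / sqrt v) * indicator {0<..} v))"
  proof (rule nn_integral_mono)
    fix v :: real
    show "ennreal (v^j * exp (-(6 * v)) / sqrt v) * indicator {0<..} v \<le> ennreal (fact j) * (ennreal (exp (-(5 * v)) / sqrt v) * indicator {0<..} v)"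
    proof (cases "v > 0")
      case True
      have "v^j * exp (-(6 * v)) \<le> fact j * exp v * exp (-(6 * v))"
        by (intro mult_right_mono power_le_fact_exp) (use True in auto)
      also have "\<dots> = fact j * exp (-(5 * v))" by (simp add: mult.assoc exp_add[symmetric])
      finally show ?thesis using True by (simp add: ennreal_mult[symmetric] divide_right_mono)
    qed simp
  qed
  also have "\<dots> = ennreal (fact j) * ennreal (sqrt (pi / 5))"
    by (subst nn_integral_cmult, measurable, subst nn_integral_inv_sqrt_exp) auto
  also have "\<dots> < \<infinity>" by (simp add: ennreal_mult[symmetric])
  finally show ?thesis .
qed

text \<open>With \<open>t = sqrt (8 * s)\<close>, the Laplace transform \<open>(t / sinh t) powr (3/2) / s\<close> of the distribution
  function is expanded in powers of \<open>exp (-2 * t)\<close>, and \<open>sqrt (pi / t)\<close> is written as the integral of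
  \<open>exp (-t * b) / sqrt b\<close> over \<open>b > 0\<close>. This makes every term a mixture of transforms of hitting time
  densities, which are inverted explicitly.\<close>

definition binom32 :: "nat \<Rightarrow> real" where
  "binom32 k = pochhammer (3/2) k / fact k"

lemma binom32_nonneg: "binom32 k \<ge> 0"
  unfolding binom32_def by (auto intro!: divide_nonneg_nonneg pochhammer_nonneg)

lemma binom32_0 [simp]: "binom32 0 = 1" by (simp add: binom32_def)

lemma binom32_sums:
  assumes "0 \<le> v" "v < 1"
  shows "(\<lambda>k. binom32 k * v^k) sums ((1 - v) powr (-3/2))"
proof -
  have "(\<lambda>k. ((-3/2) gchoose k) * (-v)^k) sums ((1 + (-v)) powr (-3/2))"
    by (rule gen_binomial_real) (use assms in auto)
  moreover have "((-3/2) gchoose k) * (-v)^k = binom32 k * v^k" for k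
  proof -
    have "(-1) ^ k * (-v) ^ k = v ^ k" by (simp add: power_mult_distrib[symmetric])
    then have "(-1) ^ k * c * (-v) ^ k = c * v ^ k" for c by (metis mult.assoc mult.commute)
    from this[of "pochhammer (3/2) k / fact k"] show ?thesis unfolding gbinomial_pochhammer binom32_def by simp
  qed
  ultimately show ?thesis by simp
qed

lemma binom32_suminf_ennreal:
  assumes "0 \<le> v" "v < 1"
  shows "(\<Sum>k. ennreal (binom32 k * v^k)) = ennreal ((1 - v) powr (-3/2))"
  using binom32_sums[OF assms] assms by (intro suminf_ennreal_eq) (auto simp: binom32_nonneg)

text \<open>A level \<open>2 * a\<close> is used because at the rate \<open>s = t^2/8\<close> one
  has \<open>sqrt (2 * s) = t/2\<close>, so its hitting time has the transform
  \<open>exp (-a * t)\<close>. Integration against \<open>1 / sqrt b\<close> adds the factor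
  \<open>sqrt (pi/t)\<close>.\<close>

definition cdf_term :: "nat \<Rightarrow> real \<Rightarrow> ennreal" where
  "cdf_term k x = (NN b. ennreal (hit_density (2 * (3/2 + 2 * real k + b)) x / sqrt b) * indicator {0<..} b)"

text \<open>The constant collects \<open>(2 * t) powr (3/2) / (t^2/8) = 16 * sqrt 2 / sqrt t\<close>
  and \<open>1 / sqrt t = sqrt (pi/t) / sqrt pi\<close>. Values lie in \<open>ennreal\<close>, so
  that sums and integrals can be exchanged before finiteness is known.\<close>

definition cdf_series :: "real \<Rightarrow> ennreal" where
  "cdf_series x = ennreal (16 * sqrt 2 / sqrt pi) * (\<Sum>k. ennreal (binom32 k) * cdf_term k x)"

lemma cdf_term_measurable[measurable]: "cdf_term k \<in> borel_measurable borel"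
  unfolding cdf_term_def by measurable

lemma cdf_series_measurable[measurable]: "cdf_series \<in> borel_measurable borel"
  unfolding cdf_series_def by measurable

lemma cdf_term_laplace:
  assumes t: "t > 0"
  shows "(NN x. ennreal (exp (-(t^2/8*x))) * cdf_term k x * indicator {0<..} x)
     = ennreal (exp (-((3/2 + 2 * real k) * t)) * sqrt (pi/t))"
proof -
  let ?c = "\<lambda>b. 2 * (3/2 + 2 * real k + b)"
  have "(NN x. ennreal (exp (-(t^2/8*x))) * cdf_term k x * indicator {0<..} x)
    = (NN x. NN b. ennreal (exp (-(t^2/8*x))) * indicator {0<..} x * (ennreal (hit_density (?c b) x / sqrt b) * indicator {0<..} b))"
    unfolding cdf_term_def by (subst nn_integral_cmult[symmetric], measurable) (auto intro!: nn_integral_cong simp: indicator_def)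
  also have "\<dots> = (NN b. NN x. ennreal (exp (-(t^2/8*x))) * indicator {0<..} x * (ennreal (hit_density (?c b) x / sqrt b) * indicator {0<..} b))"
    by (rule lborel_pair.Fubini') measurable
  also have "\<dots> = (NN b. ennreal (exp (-((3/2 + 2 * real k) * t))) * (ennreal (exp (-(t*b)) / sqrt b) * indicator {0<..} b))"
  proof (rule nn_integral_cong)
    fix b :: real
    show "(NN x. ennreal (exp (-(t^2/8*x))) * indicator {0<..} x * (ennreal (hit_density (?c b) x / sqrt b) * indicator {0<..} b))
      = ennreal (exp (-((3/2 + 2 * real k) * t))) * (ennreal (exp (-(t*b)) / sqrt b) * indicator {0<..} b)"
    proof (cases "b > 0")
      case True
      have "(NN x. ennreal (exp (-(t^2/8*x))) * indicator {0<..} x * (ennreal (hit_density (?c b) x / sqrt b) * indicator {0<..} b))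
        = (NN x. ennreal (1 / sqrt b) * (ennreal (exp (-(t^2/8*x)) * hit_density (?c b) x) * indicator {0<..} x))"
        using True by (intro nn_integral_cong) (auto simp: indicator_def ennreal_mult[symmetric] hit_density_nonneg)
      also have "\<dots> = ennreal (1 / sqrt b) * ennreal (exp (-(?c b) * sqrt (2*(t^2/8))))"
        by (subst nn_integral_cmult, measurable, subst nn_integral_hit_density) (use t True in auto)
      also have "sqrt (2*(t^2/8)) = t/2" using t by (simp add: real_sqrt_divide)
      also have "exp (-(?c b) * (t/2)) = exp (-((3/2 + 2 * real k) * t)) * exp (-(t*b))"
        by (simp add: exp_add[symmetric] algebra_simps)
      finally show ?thesis using True by (simp add: ennreal_mult[symmetric])
    qed simp
  qed
  also have "\<dots> = ennreal (exp (-((3/2 + 2 * real k) * t))) * ennreal (sqrt (pi/t))"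
    by (subst nn_integral_cmult, measurable, subst nn_integral_inv_sqrt_exp) (use t in auto)
  finally show ?thesis by (simp add: ennreal_mult[symmetric] t less_imp_le)
qed

lemma cdf_series_laplace:
  assumes t: "t > 0"
  shows "(NN x. ennreal (exp (-(t^2/8*x))) * cdf_series x * indicator {0<..} x)
     = ennreal ((t / sinh t) powr (3/2) / (t^2/8))"
proof -
  have "(NN x. ennreal (exp (-(t^2/8*x))) * cdf_series x * indicator {0<..} x)
    = (NN x. ennreal (16 * sqrt 2 / sqrt pi) * (\<Sum>k. ennreal (binom32 k) * (ennreal (exp (-(t^2/8*x))) * cdf_term k x * indicator {0<..} x)))"
  proof (rule nn_integral_cong)
    fix x :: real
    have "(\<Sum>k. ennreal (binom32 k) * (ennreal (exp (-(t^2/8*x))) * cdf_term k x * indicator {0<..} x))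
      = (\<Sum>k. (ennreal (exp (-(t^2/8*x))) * indicator {0<..} x) * (ennreal (binom32 k) * cdf_term k x))"
      by (intro suminf_cong) (simp only: ac_simps)
    also have "\<dots> = (ennreal (exp (-(t^2/8*x))) * indicator {0<..} x) * (\<Sum>k. ennreal (binom32 k) * cdf_term k x)"
      by simp
    finally show "ennreal (exp (-(t^2/8*x))) * cdf_series x * indicator {0<..} x
      = ennreal (16 * sqrt 2 / sqrt pi) * (\<Sum>k. ennreal (binom32 k) * (ennreal (exp (-(t^2/8*x))) * cdf_term k x * indicator {0<..} x))"
      unfolding cdf_series_def by (simp only: ac_simps)
  qed
  also have "\<dots> = ennreal (16 * sqrt 2 / sqrt pi) * (\<Sum>k. ennreal (binom32 k) * ennreal (exp (-((3/2 + 2 * real k) * t)) * sqrt (pi/t)))"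
    by (subst nn_integral_cmult, measurable, subst nn_integral_suminf, measurable, subst nn_integral_cmult, measurable, subst cdf_term_laplace[OF t]) simp
  also have "(\<Sum>k. ennreal (binom32 k) * ennreal (exp (-((3/2 + 2 * real k) * t)) * sqrt (pi/t)))
     = (\<Sum>k. ennreal (exp (-(3/2*t)) * sqrt (pi/t)) * ennreal (binom32 k * exp (-2*t)^k))"
  proof (rule suminf_cong)
    fix k
    have "exp (-((3/2 + 2 * real k) * t)) = exp (-(3/2*t)) * exp (-2*t)^k"
      by (simp add: exp_of_nat_mult[symmetric] exp_add[symmetric] algebra_simps)
    then show "ennreal (binom32 k) * ennreal (exp (-((3/2 + 2 * real k) * t)) * sqrt (pi/t)) = ennreal (exp (-(3/2*t)) * sqrt (pi/t)) * ennreal (binom32 k * exp (-2*t)^k)"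
      using t by (simp add: ennreal_mult[symmetric] binom32_nonneg ac_simps)
  qed
  also have "\<dots> = ennreal (exp (-(3/2*t)) * sqrt (pi/t)) * ennreal ((1 - exp (-2*t)) powr (-3/2))"
    by (subst ennreal_suminf_cmult, subst binom32_suminf_ennreal) (use t in auto)
  also have "ennreal (16 * sqrt 2 / sqrt pi) * \<dots> = ennreal (16 * sqrt 2 / sqrt pi * (exp (-(3/2*t)) * sqrt (pi/t) * (1 - exp (-2*t)) powr (-3/2)))"
    using t by (simp add: ennreal_mult[symmetric])
  also have "16 * sqrt 2 / sqrt pi * (exp (-(3/2*t)) * sqrt (pi/t) * (1 - exp (-2*t)) powr (-3/2)) = (t / sinh t) powr (3/2) / (t^2/8)"
  proof -
    have s: "sinh t = exp t * (1 - exp (-2*t)) / 2"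
      by (simp add: sinh_field_def algebra_simps exp_add[symmetric])
    have p: "1 - exp (-2*t) > 0" using t by simp
    have "(t / sinh t) powr (3/2) = (t * 2) powr (3/2) / (exp t powr (3/2) * (1 - exp (-2*t)) powr (3/2))"
      unfolding s using t p by (simp add: powr_divide powr_mult)
    also have "exp t powr (3/2) = 1 / exp (-(3/2*t))" by (simp add: powr_def exp_minus field_simps)
    also have "(t * 2) powr (3/2) = 2 * t * sqrt 2 * sqrt t"
    proof -
      have "(t*2) powr (1 + 1/2) = (t*2) powr 1 * (t*2) powr (1/2)" by (rule powr_add)
      also have "\<dots> = t*2 * sqrt (t*2)" using t by (simp add: powr_half_sqrt)
      finally show ?thesis by (simp add: real_sqrt_mult)
    qed
    finally have e: "(t / sinh t) powr (3/2) = 2 * t * sqrt 2 * sqrt t * exp (-(3/2*t)) * (1 - exp (-2*t)) powr (-3/2)"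
      using powr_minus_divide[of "1 - exp (-2*t)" "3/2"] by simp
    have st: "sqrt t * sqrt t = t" using t by simp
    have t2: "t * sqrt t / t^2 = 1 / sqrt t" using st t by (simp add: field_simps power2_eq_square)
    have "(t / sinh t) powr (3/2) / (t^2/8) = 16 * sqrt 2 * (t * sqrt t / t^2) * exp (-(3/2*t)) * (1 - exp (-2*t)) powr (-3/2)"
      unfolding e by simp
    also have "\<dots> = 16 * sqrt 2 / sqrt pi * (exp (-(3/2*t)) * sqrt (pi/t) * (1 - exp (-2*t)) powr (-3/2))"
      unfolding t2 by (simp add: real_sqrt_divide)
    finally show ?thesis by simp
  qed
  finally show ?thesis .
qed

section \<open>Rescaling the series near zero\<close>

definition scaled_term :: "nat \<Rightarrow> real \<Rightarrow> ennreal" where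
  "scaled_term k x = (NN v. ennreal (exp (-(2/x*(6 * real k + 4*(real k)^2)) - (6 + 8 * real k) * v - 2 * x * v^2)
      * (2 * (3/2 + 2 * real k + x * v)) / sqrt (2*pi) / sqrt v) * indicator {0<..} v)"

text \<open>Substitute \<open>b = x * v\<close>. The exponent
  \<open>(3 + 4 * k + 2 * x * v)^2 / (2 * x)\<close> splits off \<open>9 / (2 * x)\<close>; what
  remains has a finite limit for \<open>k = 0\<close> and grows like \<open>1/x\<close> for
  \<open>k \<ge> 1\<close>.\<close>

lemma cdf_term_scaled:
  assumes x: "x > 0"
  shows "cdf_term k x = ennreal (exp (-(9/(2*x))) / x) * scaled_term k x"
proof -
  have "cdf_term k x = ennreal \<bar>x\<bar> * (NN v. ennreal (hit_density (2 * (3/2 + 2 * real k + (0 + x * v))) x / sqrt (0 + x * v)) * indicator {0<..} (0 + x * v))"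
    unfolding cdf_term_def by (rule nn_integral_real_affine) (use x in auto)
  also have "\<dots> = (NN v. ennreal \<bar>x\<bar> * (ennreal (hit_density (2 * (3/2 + 2 * real k + (0 + x * v))) x / sqrt (0 + x * v)) * indicator {0<..} (0 + x * v)))"
    by (rule nn_integral_cmult[symmetric]) measurable
  also have "\<dots> = (NN v. ennreal (exp (-(9/(2*x))) / x) * (ennreal (exp (-(2/x*(6 * real k + 4*(real k)^2)) - (6 + 8 * real k) * v - 2 * x * v^2)
      * (2 * (3/2 + 2 * real k + x * v)) / sqrt (2*pi) / sqrt v) * indicator {0<..} v))"
  proof (rule nn_integral_cong)
    fix v :: real
    let ?a = "3/2 + 2 * real k + x * v"
    show "ennreal \<bar>x\<bar> * (ennreal (hit_density (2 * (3/2 + 2 * real k + (0 + x * v))) x / sqrt (0 + x * v)) * indicator {0<..} (0 + x * v))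
      = ennreal (exp (-(9/(2*x))) / x) * (ennreal (exp (-(2/x*(6 * real k + 4*(real k)^2)) - (6 + 8 * real k) * v - 2 * x * v^2)
      * (2 * (3/2 + 2 * real k + x * v)) / sqrt (2*pi) / sqrt v) * indicator {0<..} v)"
    proof (cases "v > 0")
      case True
      have "x * v > 0" using x True by simp
      then have a: "?a > 0" by linarith
      have e: "-((2 * ?a)^2/(2*x)) = -(9/(2*x)) + (-(2/x*(6 * real k + 4*(real k)^2)) - (6 + 8 * real k) * v - 2 * x * v^2)"
        using x by (simp add: field_simps power2_eq_square)
      have "x * (hit_density (2 * ?a) x / sqrt (x * v)) = x * (2 * ?a * exp (-((2 * ?a)^2/(2*x))) / (x * sqrt (2*pi*x)) / sqrt (x * v))"
        by (simp add: hit_density_def)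
      also have "\<dots> = (2 * ?a * exp (-((2 * ?a)^2/(2*x))) / sqrt (2*pi) / sqrt v) / (sqrt x * sqrt x)"
        using x True by (simp add: real_sqrt_mult)
      also have "\<dots> = exp (-(9/(2*x))) / x * (exp (-(2/x*(6 * real k + 4*(real k)^2)) - (6 + 8 * real k) * v - 2 * x * v^2)
      * (2 * ?a) / sqrt (2*pi) / sqrt v)"
        unfolding e exp_add using x by (simp add: ac_simps)
      finally have "x * (hit_density (2 * ?a) x / sqrt (x * v)) = exp (-(9/(2*x))) / x * (exp (-(2/x*(6 * real k + 4*(real k)^2)) - (6 + 8 * real k) * v - 2 * x * v^2)
      * (2 * ?a) / sqrt (2*pi) / sqrt v)" .
      then show ?thesis using x True a by (simp add: ennreal_mult[symmetric] hit_density_nonneg)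
    next
      case False
      then show ?thesis using x by (auto simp: indicator_def zero_less_mult_iff)
    qed
  qed
  also have "\<dots> = ennreal (exp (-(9/(2*x))) / x) * scaled_term k x"
    unfolding scaled_term_def by (rule nn_integral_cmult) measurable
  finally show ?thesis .
qed

text \<open>The value is \<open>Gamma (j + 1/2) / 6 powr (j + 1/2)\<close>; the rate 6 is the
  coefficient \<open>6 + 8 * k\<close> of \<open>v\<close> in \<open>scaled_term\<close> at
  \<open>k = 0\<close>.\<close>

definition gamma_int :: "nat \<Rightarrow> real" where
  "gamma_int j = enn2real (NN v. ennreal (v^j * exp (-(6 * v)) / sqrt v) * indicator {0<..} v)"

lemma gamma_int_nonneg: "gamma_int j \<ge> 0"
  by (simp add: gamma_int_def)

lemma nn_integral_gamma_int:
  "(NN v. ennreal (v^j * exp (-(6 * v)) / sqrt v) * indicator {0<..} v) = ennreal (gamma_int j)"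
  using nn_integral_power_inv_sqrt_exp_finite[of j] unfolding gamma_int_def by (simp add: less_top)

lemma gamma_int_0: "gamma_int 0 = sqrt (pi/6)"
  using nn_integral_inv_sqrt_exp[of 6] unfolding gamma_int_def by simp

lemma nn_integral_linear_gamma_int:
  assumes "a \<ge> 0" "b \<ge> 0"
  shows "(NN v. ennreal ((a * v^i + b * v^j) * exp (-(6 * v)) / sqrt v) * indicator {0<..} v) = ennreal (a * gamma_int i + b * gamma_int j)"
proof -
  have "(NN v. ennreal ((a * v^i + b * v^j) * exp (-(6 * v)) / sqrt v) * indicator {0<..} v)
     = (NN v. ennreal a * (ennreal (v^i * exp (-(6 * v)) / sqrt v) * indicator {0<..} v) + ennreal b * (ennreal (v^j * exp (-(6 * v)) / sqrt v) * indicator {0<..} v))"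
    using assms by (intro nn_integral_cong)
      (auto simp: indicator_def ennreal_mult[symmetric] ennreal_plus[symmetric] field_simps simp del: ennreal_plus)
  also have "\<dots> = ennreal a * ennreal (gamma_int i) + ennreal b * ennreal (gamma_int j)"
    by (subst nn_integral_add, measurable, subst (1 2) nn_integral_cmult, measurable) (simp add: nn_integral_gamma_int)
  finally show ?thesis using assms gamma_int_nonneg by (simp add: ennreal_mult)
qed

text \<open>Rests on \<open>exp (-(2 * x * v^2)) \<le> 1\<close>.\<close>

lemma scaled_term_0_upper:
  assumes x: "x > 0"
  shows "scaled_term 0 x \<le> ennreal ((3 * gamma_int 0 + 2 * x * gamma_int 1) / sqrt (2*pi))"
proof -
  have "scaled_term 0 x \<le> (NN v. ennreal ((3 / sqrt (2*pi) * v^0 + 2 * x / sqrt (2*pi) * v^1) * exp (-(6 * v)) / sqrt v) * indicator {0<..} v)"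
    unfolding scaled_term_def
  proof (rule nn_integral_mono)
    fix v :: real
    show "ennreal (exp (-(2/x*(6 * real 0 + 4*(real 0)^2)) - (6 + 8 * real 0) * v - 2 * x * v^2)
      * (2 * (3/2 + 2 * real 0 + x * v)) / sqrt (2*pi) / sqrt v) * indicator {0<..} v
      \<le> ennreal ((3 / sqrt (2*pi) * v^0 + 2 * x / sqrt (2*pi) * v^1) * exp (-(6 * v)) / sqrt v) * indicator {0<..} v"
    proof (cases "v > 0")
      case True
      have "exp (-(6 * v) - 2 * x * v^2) * (3 + 2 * x * v) \<le> exp (-(6 * v)) * (3 + 2 * x * v)"
        using x True by (intro mult_right_mono) auto
      then have "exp (-(6 * v) - 2 * x * v^2) * (3 + 2 * x * v) / sqrt (2*pi) / sqrt v \<le> exp (-(6 * v)) * (3 + 2 * x * v) / sqrt (2*pi) / sqrt v"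
        using True by (intro divide_right_mono) auto
      then show ?thesis using True by (auto intro!: ennreal_leI simp: field_simps)
    qed simp
  qed
  also have "\<dots> = ennreal (3 / sqrt (2*pi) * gamma_int 0 + 2 * x / sqrt (2*pi) * gamma_int 1)"
    by (rule nn_integral_linear_gamma_int) (use x in auto)
  finally show ?thesis by (simp add: add_divide_distrib)
qed

text \<open>Rests on \<open>exp (-(2 * x * v^2)) \<ge> 1 - 2 * x * v^2\<close>, after dropping the
  positive summand \<open>2 * x * v\<close>.\<close>

lemma scaled_term_0_lower:
  assumes x: "x > 0"
  shows "ennreal ((3 * gamma_int 0 - 6 * x * gamma_int 2) / sqrt (2*pi)) \<le> scaled_term 0 x"
proof -
  \<comment> \<open>The error term is added on the right, because subtraction on
    \<open>ennreal\<close> truncates at 0.\<close>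
  have "ennreal (3 / sqrt (2*pi) * gamma_int 0 + 0 * gamma_int 0) = (NN v. ennreal ((3 / sqrt (2*pi) * v^0 + 0 * v^0) * exp (-(6 * v)) / sqrt v) * indicator {0<..} v)"
    by (rule nn_integral_linear_gamma_int[symmetric]) auto
  also have "\<dots> \<le> (NN v. ennreal (exp (-(2/x*(6 * real 0 + 4*(real 0)^2)) - (6 + 8 * real 0) * v - 2 * x * v^2)
      * (2 * (3/2 + 2 * real 0 + x * v)) / sqrt (2*pi) / sqrt v) * indicator {0<..} v +
      ennreal ((6 * x / sqrt (2*pi) * v^2 + 0 * v^2) * exp (-(6 * v)) / sqrt v) * indicator {0<..} v)"
  proof (rule nn_integral_mono)
    fix v :: real
    show "ennreal ((3 / sqrt (2*pi) * v^0 + 0 * v^0) * exp (-(6 * v)) / sqrt v) * indicator {0<..} v \<le>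
       ennreal (exp (-(2/x*(6 * real 0 + 4*(real 0)^2)) - (6 + 8 * real 0) * v - 2 * x * v^2)
      * (2 * (3/2 + 2 * real 0 + x * v)) / sqrt (2*pi) / sqrt v) * indicator {0<..} v +
      ennreal ((6 * x / sqrt (2*pi) * v^2 + 0 * v^2) * exp (-(6 * v)) / sqrt v) * indicator {0<..} v"
    proof (cases "v > 0")
      case True
      have "1 + (- (2 * x * v^2)) \<le> exp (- (2 * x * v^2))" by (rule exp_ge_add_one_self)
      then have "exp (-(6 * v)) * 3 \<le> exp (-(6 * v)) * (exp (-(2 * x * v^2)) * 3 + 6 * x * v^2)"
        by (intro mult_left_mono) auto
      also have "\<dots> = exp (-(6 * v) - 2 * x * v^2) * 3 + 6 * x * v^2 * exp (-(6 * v))"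
        by (simp add: algebra_simps exp_add[symmetric])
      also have "\<dots> \<le> exp (-(6 * v) - 2 * x * v^2) * (3 + 2 * x * v) + 6 * x * v^2 * exp (-(6 * v))"
        using x True by (intro add_right_mono mult_left_mono) auto
      finally have "exp (-(6 * v)) * 3 / sqrt (2*pi) / sqrt v \<le> (exp (-(6 * v) - 2 * x * v^2) * (3 + 2 * x * v) + 6 * x * v^2 * exp (-(6 * v))) / sqrt (2*pi) / sqrt v"
        using True by (intro divide_right_mono) auto
      then have "(3 / sqrt (2*pi) * v^0 + 0 * v^0) * exp (-(6 * v)) / sqrt v \<le>
        exp (-(2/x*(6 * real 0 + 4*(real 0)^2)) - (6 + 8 * real 0) * v - 2 * x * v^2) * (2 * (3/2 + 2 * real 0 + x * v)) / sqrt (2*pi) / sqrt v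
          + (6 * x / sqrt (2*pi) * v^2 + 0 * v^2) * exp (-(6 * v)) / sqrt v"
        by (simp add: add_divide_distrib distrib_left mult_ac)
      then have "ennreal ((3 / sqrt (2*pi) * v^0 + 0 * v^0) * exp (-(6 * v)) / sqrt v) \<le>
        ennreal (exp (-(2/x*(6 * real 0 + 4*(real 0)^2)) - (6 + 8 * real 0) * v - 2 * x * v^2) * (2 * (3/2 + 2 * real 0 + x * v)) / sqrt (2*pi) / sqrt v
          + (6 * x / sqrt (2*pi) * v^2 + 0 * v^2) * exp (-(6 * v)) / sqrt v)"
        by (rule ennreal_leI)
      also have "\<dots> = ennreal (exp (-(2/x*(6 * real 0 + 4*(real 0)^2)) - (6 + 8 * real 0) * v - 2 * x * v^2) * (2 * (3/2 + 2 * real 0 + x * v)) / sqrt (2*pi) / sqrt v)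
          + ennreal ((6 * x / sqrt (2*pi) * v^2 + 0 * v^2) * exp (-(6 * v)) / sqrt v)"
        using True x by (intro ennreal_plus) auto
      finally show ?thesis using True by simp
    qed simp
  qed
  also have "\<dots> = scaled_term 0 x + ennreal (6 * x / sqrt (2*pi) * gamma_int 2 + 0 * gamma_int 2)"
    unfolding scaled_term_def
    by (subst nn_integral_add, measurable, subst nn_integral_linear_gamma_int) (use x in auto)
  finally have "ennreal (3 / sqrt (2*pi) * gamma_int 0) \<le> scaled_term 0 x + ennreal (6 * x / sqrt (2*pi) * gamma_int 2)" by simp
  then have "ennreal (3 / sqrt (2*pi) * gamma_int 0) - ennreal (6 * x / sqrt (2*pi) * gamma_int 2) \<le> scaled_term 0 x"
    by (simp add: ennreal_minus_le_iff add.commute)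
  then show ?thesis using x gamma_int_nonneg
    by (simp add: ennreal_minus[symmetric] diff_divide_distrib)
qed

text \<open>The exponent contains \<open>12 * k / x\<close>, which is at least
  \<open>12 * (1/x - 1) + 12 * k\<close> for \<open>k \<ge> 1\<close> and \<open>x \<le> 1\<close>.
  The factor linear in \<open>k\<close> is absorbed by \<open>exp (2 * k)\<close>, leaving
  \<open>exp (-10)^k\<close>, which is summable against the binomial coefficients.\<close>

lemma scaled_term_tail:
  assumes x: "0 < x" "x \<le> 1" and k: "k \<ge> 1"
  shows "scaled_term k x \<le> ennreal (exp (-(12*(1/x - 1))) * exp (-10)^k * ((3 * gamma_int 0 + 2 * gamma_int 1) / sqrt (2*pi)))"
proof -
  define E where "E = exp (-(12*(1/x - 1))) * exp (-10)^k / sqrt (2*pi)"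
  have E0: "E \<ge> 0" by (simp add: E_def)
  have "scaled_term k x \<le> (NN v. ennreal ((3 * E * v^0 + 2 * E * v^1) * exp (-(6 * v)) / sqrt v) * indicator {0<..} v)"
    unfolding scaled_term_def
  proof (rule nn_integral_mono)
    fix v :: real
    show "ennreal (exp (-(2/x*(6 * real k + 4*(real k)^2)) - (6 + 8 * real k) * v - 2 * x * v^2)
      * (2 * (3/2 + 2 * real k + x * v)) / sqrt (2*pi) / sqrt v) * indicator {0<..} v
      \<le> ennreal ((3 * E * v^0 + 2 * E * v^1) * exp (-(6 * v)) / sqrt v) * indicator {0<..} v"
    proof (cases "v > 0")
      case True
      have ix: "1/x - 1 \<ge> 0" using x by (simp add: field_simps)
      have "12 * (1/x - 1) * 1 \<le> 12 * (1/x - 1) * real k" using k ix by (intro mult_left_mono) auto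
      then have 1: "12*(1/x - 1) + 12 * real k \<le> 12 * real k / x" by (simp add: algebra_simps)
      have "-(2/x*(6 * real k + 4*(real k)^2)) - (6 + 8 * real k) * v - 2 * x * v^2
        \<le> -(12 * real k / x) - 6 * v"
      proof -
        have "2/x*(6 * real k + 4*(real k)^2) = 12 * real k / x + 8*(real k)^2/x" using x by (simp add: field_simps)
        moreover have "8*(real k)^2/x \<ge> 0" "8 * real k * v \<ge> 0" "2 * x * v^2 \<ge> 0" using x True by auto
        ultimately show ?thesis by (simp add: algebra_simps)
      qed
      also have "\<dots> \<le> -(12*(1/x - 1)) - 12 * real k - 6 * v" using 1 by linarith
      finally have e: "exp (-(2/x*(6 * real k + 4*(real k)^2)) - (6 + 8 * real k) * v - 2 * x * v^2)
        \<le> exp (-(12*(1/x - 1)) - 12 * real k - 6 * v)" by simp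
      have "1 + 2 * real k \<le> exp (2 * real k)" by (rule exp_ge_add_one_self)
      moreover have "2 * (3/2 + 2 * real k + x * v) \<le> (1 + 2 * real k) * (3 + 2 * v)"
      proof -
        have "x * v \<le> 1 * v" using x True by (intro mult_right_mono) auto
        moreover have "2 * real k * v \<ge> 0" using True by simp
        ultimately show ?thesis by (simp add: algebra_simps)
      qed
      ultimately have "2 * (3/2 + 2 * real k + x * v) \<le> exp (2 * real k) * (3 + 2 * v)"
        using True by (meson add_nonneg_nonneg less_imp_le mult_nonneg_nonneg mult_right_mono order_trans zero_le_numeral)
      with e have le: "exp (-(2/x*(6 * real k + 4*(real k)^2)) - (6 + 8 * real k) * v - 2 * x * v^2) * (2 * (3/2 + 2 * real k + x * v))
        \<le> exp (-(12*(1/x - 1)) - 12 * real k - 6 * v) * (exp (2 * real k) * (3 + 2 * v))"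
        using x True by (intro mult_mono[OF e]) auto
      have "exp (-(12*(1/x - 1)) - 12 * real k - 6 * v) * exp (2 * real k) = exp (-(12*(1/x - 1))) * exp (-10)^k * exp (-(6 * v))"
        by (simp add: exp_of_nat_mult[symmetric] exp_add[symmetric])
      then have "exp (-(12*(1/x - 1)) - 12 * real k - 6 * v) * (exp (2 * real k) * (3 + 2 * v)) = exp (-(12*(1/x - 1))) * exp (-10)^k * exp (-(6 * v)) * (3 + 2 * v)"
        by (simp only: mult.assoc[symmetric])
      note le' = le[unfolded this]
      have "exp (-(2/x*(6 * real k + 4*(real k)^2)) - (6 + 8 * real k) * v - 2 * x * v^2) * (2 * (3/2 + 2 * real k + x * v)) / sqrt (2*pi) / sqrt v
        \<le> exp (-(12*(1/x - 1))) * exp (-10)^k * exp (-(6 * v)) * (3 + 2 * v) / sqrt (2*pi) / sqrt v"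
        using True by (intro divide_right_mono le') auto
      also have "\<dots> = (3 * E * v^0 + 2 * E * v^1) * exp (-(6 * v)) / sqrt v"
      proof -
        have "3 * E * v^0 + 2 * E * v^1 = E * (3 + 2 * v)" by (simp add: algebra_simps)
        then show ?thesis by (simp only: E_def mult_ac times_divide_eq_right times_divide_eq_left divide_divide_eq_left)
      qed
      finally show ?thesis using True by (simp add: ennreal_leI)
    qed simp
  qed
  also have "\<dots> = ennreal (3 * E * gamma_int 0 + 2 * E * gamma_int 1)"
    by (rule nn_integral_linear_gamma_int) (use E0 in auto)
  also have "3 * E * gamma_int 0 + 2 * E * gamma_int 1 = exp (-(12*(1/x - 1))) * exp (-10)^k * ((3 * gamma_int 0 + 2 * gamma_int 1) / sqrt (2*pi))"
    unfolding E_def by (simp add: distrib_left add_divide_distrib mult_ac)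
  finally show ?thesis .
qed

lemma scaled_sum_bounds:
  assumes x: "0 < x" "x \<le> 1"
  defines "G \<equiv> \<lambda>a b. (3 * gamma_int 0 + b * gamma_int a) / sqrt (2*pi)"
  shows "(\<Sum>k. ennreal (binom32 k) * scaled_term k x)
      \<le> ennreal (G 1 (2 * x)) + ennreal (exp (-(12*(1/x - 1))) * G 1 2 * (1 - exp (-10)) powr (-3/2))"
    and "ennreal (G 2 (- (6 * x))) \<le> (\<Sum>k. ennreal (binom32 k) * scaled_term k x)"
proof -
  have G: "G 1 2 \<ge> 0" unfolding G_def using gamma_int_nonneg by auto
  have "(\<Sum>k. ennreal (binom32 k) * scaled_term k x)
    \<le> (\<Sum>k. (if k = 0 then ennreal (G 1 (2 * x)) else 0) + ennreal (exp (-(12*(1/x - 1))) * G 1 2) * ennreal (binom32 k * exp (-10)^k))"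
  proof (rule suminf_le)
    fix k
    show "ennreal (binom32 k) * scaled_term k x
      \<le> (if k = 0 then ennreal (G 1 (2 * x)) else 0) + ennreal (exp (-(12*(1/x - 1))) * G 1 2) * ennreal (binom32 k * exp (-10)^k)"
    proof (cases "k = 0")
      case True
      have "scaled_term 0 x \<le> ennreal (G 1 (2 * x)) + ennreal (exp (-(12*(1/x - 1))) * G 1 2) * ennreal (binom32 k * exp (-10)^k)"
        by (rule order.trans[OF scaled_term_0_upper[OF x(1)]]) (simp add: G_def add_increasing2)
      then show ?thesis using True by simp
    next
      case False
      then have "scaled_term k x \<le> ennreal (exp (-(12*(1/x - 1))) * exp (-10)^k * G 1 2)"
        unfolding G_def by (intro scaled_term_tail x) simp
      then have "ennreal (binom32 k) * scaled_term k x \<le> ennreal (binom32 k) * ennreal (exp (-(12*(1/x - 1))) * exp (-10)^k * G 1 2)"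
        by (rule mult_left_mono) simp
      also have "\<dots> = ennreal (exp (-(12*(1/x - 1))) * G 1 2) * ennreal (binom32 k * exp (-10)^k)"
        using G by (simp add: ennreal_mult[symmetric] binom32_nonneg mult_ac)
      finally show ?thesis using False by simp
    qed
  qed auto
  also have "\<dots> = (\<Sum>k. (if k = 0 then ennreal (G 1 (2 * x)) else 0)) + ennreal (exp (-(12*(1/x - 1))) * G 1 2) * (\<Sum>k. ennreal (binom32 k * exp (-10)^k))"
    by (subst suminf_add[symmetric]) auto
  also have "(\<Sum>k::nat. (if k = 0 then ennreal (G 1 (2 * x)) else 0)) = ennreal (G 1 (2 * x))"
    using sums_single[of 0 "\<lambda>_. ennreal (G 1 (2 * x))"] by (simp add: sums_iff)
  also have "(\<Sum>k. ennreal (binom32 k * exp (-10)^k)) = ennreal ((1 - exp (-10)) powr (-3/2))"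
    by (rule binom32_suminf_ennreal) auto
  finally show "(\<Sum>k. ennreal (binom32 k) * scaled_term k x)
      \<le> ennreal (G 1 (2 * x)) + ennreal (exp (-(12*(1/x - 1))) * G 1 2 * (1 - exp (-10)) powr (-3/2))"
    using G by (simp add: ennreal_mult)
  have "ennreal (G 2 (- (6 * x))) \<le> ennreal (binom32 0) * scaled_term 0 x"
    using scaled_term_0_lower[OF x(1)] by (simp add: G_def)
  also have "\<dots> \<le> (\<Sum>k. ennreal (binom32 k) * scaled_term k x)"
    using sum_le_suminf[of "\<lambda>k. ennreal (binom32 k) * scaled_term k x" "{0}"] by simp
  finally show "ennreal (G 2 (- (6 * x))) \<le> (\<Sum>k. ennreal (binom32 k) * scaled_term k x)" .
qed

lemma scaled_sum_tendsto:
  "((\<lambda>x. \<Sum>k. ennreal (binom32 k) * scaled_term k x) \<longlongrightarrow> ennreal (3 * sqrt (pi/6) / sqrt (2*pi))) (at_right 0)"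
proof -
  define G where "G a b = (3 * gamma_int 0 + b * gamma_int a) / sqrt (2*pi)" for a b
  have l: "((\<lambda>x. ennreal (G 2 (- (6 * x)))) \<longlongrightarrow> ennreal (3 * sqrt (pi/6) / sqrt (2*pi))) (at_right 0)"
  proof (rule tendsto_ennrealI)
    have "((\<lambda>x. G 2 (- (6 * x))) \<longlongrightarrow> (3 * gamma_int 0 + (- (6 * 0)) * gamma_int 2) / sqrt (2*pi)) (at_right 0)"
      unfolding G_def by (intro tendsto_intros) auto
    then show "((\<lambda>x. G 2 (- (6 * x))) \<longlongrightarrow> 3 * sqrt (pi/6) / sqrt (2*pi)) (at_right 0)"
      by (simp add: gamma_int_0)
  qed
  have u: "((\<lambda>x. ennreal (G 1 (2 * x)) + ennreal (exp (-(12*(1/x - 1))) * G 1 2 * (1 - exp (-10)) powr (-3/2)))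
     \<longlongrightarrow> ennreal (3 * sqrt (pi/6) / sqrt (2*pi)) + ennreal 0) (at_right 0)"
  proof (intro tendsto_add tendsto_ennrealI)
    have "((\<lambda>x. G 1 (2 * x)) \<longlongrightarrow> (3 * gamma_int 0 + (2 * 0) * gamma_int 1) / sqrt (2*pi)) (at_right 0)"
      unfolding G_def by (intro tendsto_intros) auto
    then show "((\<lambda>x. G 1 (2 * x)) \<longlongrightarrow> 3 * sqrt (pi/6) / sqrt (2*pi)) (at_right 0)"
      by (simp add: gamma_int_0)
    have "((\<lambda>x::real. exp (-(12*(1/x - 1)))) \<longlongrightarrow> 0) (at_right 0)" by real_asymp
    then have "((\<lambda>x. exp (-(12*(1/x - 1))) * G 1 2 * (1 - exp (-10)) powr (-3/2)) \<longlongrightarrow> 0 * G 1 2 * (1 - exp (-10)) powr (-3/2)) (at_right 0)"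
      by (intro tendsto_mult tendsto_const)
    then show "((\<lambda>x. exp (-(12*(1/x - 1))) * G 1 2 * (1 - exp (-10)) powr (-3/2)) \<longlongrightarrow> 0) (at_right 0)" by simp
  qed
  have ev: "eventually (\<lambda>x::real. 0 < x \<and> x \<le> 1) (at_right 0)"
    by (rule eventually_at_rightI[of 0 1]) auto
  show ?thesis
  proof (rule tendsto_sandwich[OF _ _ l u[unfolded ennreal_0 add_0_right]])
    show "\<forall>\<^sub>F x in at_right 0. ennreal (G 2 (- (6 * x))) \<le> (\<Sum>k. ennreal (binom32 k) * scaled_term k x)"
      using ev by eventually_elim (use scaled_sum_bounds(2) in \<open>auto simp: G_def\<close>)
    show "\<forall>\<^sub>F x in at_right 0. (\<Sum>k. ennreal (binom32 k) * scaled_term k x) \<le> ennreal (G 1 (2 * x)) + ennreal (exp (-(12*(1/x - 1))) * G 1 2 * (1 - exp (-10)) powr (-3/2))"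
      using ev by eventually_elim (use scaled_sum_bounds(1) in \<open>auto simp: G_def\<close>)
  qed
qed

lemma cdf_series_scaled:
  assumes x: "x > 0"
  shows "cdf_series x = ennreal (exp (-(9/(2*x))) / x) * (ennreal (16 * sqrt 2 / sqrt pi) * (\<Sum>k. ennreal (binom32 k) * scaled_term k x))"
proof -
  have "(\<Sum>k. ennreal (binom32 k) * cdf_term k x) = (\<Sum>k. ennreal (exp (-(9/(2*x))) / x) * (ennreal (binom32 k) * scaled_term k x))"
    unfolding cdf_term_scaled[OF x] by (intro suminf_cong) (simp only: mult_ac)
  also have "\<dots> = ennreal (exp (-(9/(2*x))) / x) * (\<Sum>k. ennreal (binom32 k) * scaled_term k x)" by simp
  finally show ?thesis unfolding cdf_series_def by (simp only: mult_ac)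
qed

lemma cdf_series_asymptotics:
  obtains R where "(R \<longlongrightarrow> 8 * sqrt 6 / sqrt pi) (at_right 0)"
    "\<forall>\<^sub>F x in at_right 0. cdf_series x = ennreal (exp (-(9/(2*x))) / x * R x) \<and> R x \<ge> 0"
proof -
  define R' where "R' x = ennreal (16 * sqrt 2 / sqrt pi) * (\<Sum>k. ennreal (binom32 k) * scaled_term k x)" for x
  \<comment> \<open>Prefactor of the series times the limit of its term at
    \<open>k = 0\<close>.\<close>
  have "16 * sqrt 2 / sqrt pi * (3 * sqrt (pi/6) / sqrt (2*pi)) = 8 * sqrt 6 / sqrt pi"
  proof -
    have "sqrt 6 * sqrt 6 = 6" by simp
    then have "48 / sqrt 6 = 8 * sqrt 6" by (simp add: field_simps)
    then show ?thesis by (simp add: real_sqrt_mult real_sqrt_divide field_simps)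
  qed
  then have "(R' \<longlongrightarrow> ennreal (8 * sqrt 6 / sqrt pi)) (at_right 0)"
    unfolding R'_def using ennreal_tendsto_cmult[OF _ scaled_sum_tendsto, of "ennreal (16 * sqrt 2 / sqrt pi)"]
    by (simp add: ennreal_mult[symmetric])
  then have R': "(R' \<longlongrightarrow> ennreal (8 * sqrt 6 / sqrt pi)) (at_right 0)" .
  have fin: "\<forall>\<^sub>F x in at_right 0. R' x < \<infinity>"
    by (rule order_tendstoD(2)[OF R']) simp
  show ?thesis
  proof (rule that[of "\<lambda>x. enn2real (R' x)"])
    show "((\<lambda>x. enn2real (R' x)) \<longlongrightarrow> 8 * sqrt 6 / sqrt pi) (at_right 0)"
      using tendsto_enn2real[OF R'] by simp
    have "eventually (\<lambda>x::real. 0 < x) (at_right 0)" by (rule eventually_at_right_less)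
    with fin show "\<forall>\<^sub>F x in at_right 0. cdf_series x = ennreal (exp (-(9/(2*x))) / x * enn2real (R' x)) \<and> enn2real (R' x) \<ge> 0"
    proof eventually_elim
      case (elim x)
      have "ennreal (exp (-(9/(2*x))) / x * enn2real (R' x)) = ennreal (exp (-(9/(2*x))) / x) * ennreal (enn2real (R' x))"
        by (rule ennreal_mult) (use elim in auto)
      then show ?case using elim by (simp add: cdf_series_scaled R'_def[symmetric])
    qed
  qed
qed

section \<open>Recovering a distribution function from its Laplace transform\<close>

lemma (in prob_space) laplace_cdf:
  assumes [measurable]: "X \<in> borel_measurable M" and X: "\<And>w. w \<in> space M \<Longrightarrow> 0 \<le> X w" and s: "s > 0"
  shows "(NN x. ennreal (exp (-(s * x)) * prob {w\<in>space M. X w \<le> x}) * indicator {0<..} x)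
    = ennreal (expectation (\<lambda>w. exp (-(s * X w))) / s)"
proof -
  have 1: "(NN x. ennreal (exp (-(s * x))) * indicator {0<..} x * indicator {X w..} x) = ennreal (exp (-(s * X w)) / s)"
    if "w \<in> space M" for w
  proof -
    have "(NN x. ennreal (exp (-(s * x))) * indicator {0<..} x * indicator {X w..} x)
      = (NN x. ennreal (exp (-(s * x))) * indicator {X w..} x)"
      by (rule nn_integral_cong_AE, use AE_lborel_singleton[of 0] in eventually_elim) (use X[OF that] in \<open>auto simp: indicator_def\<close>)
    also have "\<dots> = ennreal (0 - (- exp (-(s * X w)) / s))"
    proof (rule nn_integral_FTC_atLeast)
      show "DERIV (\<lambda>x. - exp (-(s * x)) / s) x :> exp (-(s * x))" for x
        using s by (auto intro!: derivative_eq_intros simp: field_simps)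
      show "((\<lambda>x. - exp (-(s * x)) / s) \<longlongrightarrow> 0) at_top" using s by real_asymp
    qed auto
    finally show ?thesis by simp
  qed
  have ind: "indicator {X w..} x = (if X w \<le> x then 1 else 0 :: ennreal)" for x w
    by (simp add: indicator_def)
  interpret P: pair_sigma_finite lborel M by unfold_locales
  have "(NN x. ennreal (exp (-(s * x)) * prob {w\<in>space M. X w \<le> x}) * indicator {0<..} x)
    = (NN x. \<integral>\<^sup>+w. ennreal (exp (-(s * x))) * indicator {0<..} x * indicator {X w..} x \<partial>M)"
  proof (rule nn_integral_cong)
    fix x :: real
    have "(\<integral>\<^sup>+w. indicator {X w..} x \<partial>M) = (\<integral>\<^sup>+w. indicator {w\<in>space M. X w \<le> x} w \<partial>M)"
      by (intro nn_integral_cong) (auto simp: indicator_def)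
    also have "\<dots> = ennreal (prob {w\<in>space M. X w \<le> x})"
      by (subst nn_integral_indicator) (auto simp: emeasure_eq_measure)
    finally have "ennreal (prob {w\<in>space M. X w \<le> x}) = (\<integral>\<^sup>+w. indicator {X w..} x \<partial>M)" by simp
    moreover have "(\<lambda>w. indicator {X w..} x :: ennreal) \<in> borel_measurable M"
      unfolding ind by measurable
    then have "(\<integral>\<^sup>+w. ennreal (exp (-(s * x))) * indicator {0<..} x * indicator {X w..} x \<partial>M)
      = ennreal (exp (-(s * x))) * indicator {0<..} x * (\<integral>\<^sup>+w. indicator {X w..} x \<partial>M)"
      by (rule nn_integral_cmult)
    ultimately show "ennreal (exp (-(s * x)) * prob {w\<in>space M. X w \<le> x}) * indicator {0<..} x
      = (\<integral>\<^sup>+w. ennreal (exp (-(s * x))) * indicator {0<..} x * indicator {X w..} x \<partial>M)"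
      by (simp only: ennreal_mult exp_ge_zero measure_nonneg mult_ac)
  qed
  also have "\<dots> = (\<integral>\<^sup>+w. (NN x. ennreal (exp (-(s * x))) * indicator {0<..} x * indicator {X w..} x) \<partial>M)"
  proof (rule P.Fubini'[symmetric])
    have "(\<lambda>(x, w). indicator {X w..} x :: ennreal) \<in> borel_measurable (lborel \<Otimes>\<^sub>M M)"
      unfolding ind by (simp add: split_beta')
    then show "(\<lambda>(x, w). ennreal (exp (-(s * x))) * indicator {0<..} x * indicator {X w..} x) \<in> borel_measurable (lborel \<Otimes>\<^sub>M M)"
      by (simp add: split_beta')
  qed
  also have "\<dots> = (\<integral>\<^sup>+w. ennreal (exp (-(s * X w)) / s) \<partial>M)"
    by (intro nn_integral_cong 1)
  also have "\<dots> = ennreal (expectation (\<lambda>w. exp (-(s * X w)) / s))"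
  proof (rule nn_integral_eq_integral)
    show "integrable M (\<lambda>w. exp (-(s * X w)) / s)"
      by (rule integrable_const_bound[where B="1/s"]) (use X s in \<open>auto simp: divide_right_mono\<close>)
  qed (use s in auto)
  finally show ?thesis by simp
qed

text \<open>Only monotonicity of \<open>F\<close> is used, so no continuity of \<open>H\<close> has to be established.\<close>

lemma mono_eq_in_laplace_sandwich:
  fixes F H :: "real \<Rightarrow> real"
  assumes [measurable]: "F \<in> borel_measurable borel" "H \<in> borel_measurable borel"
    and mono: "mono F"
    and i: "integrable lborel (\<lambda>x. indicator {0<..} x * exp (-x) * F x)" "integrable lborel (\<lambda>x. indicator {0<..} x * exp (-x) * H x)"
    and eq: "\<And>\<phi> B. continuous_on UNIV \<phi> \<Longrightarrow> (\<And>x. \<bar>\<phi> x\<bar> \<le> B) \<Longrightarrow>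
       (LINT x|lborel. \<phi> x * (indicator {0<..} x * exp (-x) * F x)) = (LINT x|lborel. \<phi> x * (indicator {0<..} x * exp (-x) * H x))"
    and ab: "0 < a" "a < b"
  shows "\<exists>y\<in>{a<..<b}. H y \<le> F b" "\<exists>y\<in>{a<..<b}. F a \<le> H y"
proof -
  define \<phi> where "\<phi> y = max 0 (min (y - a) (b - y))" for y
  have c: "continuous_on UNIV \<phi>" unfolding \<phi>_def by (intro continuous_intros)
  have B: "\<bar>\<phi> y\<bar> \<le> b - a" for y using ab unfolding \<phi>_def by (auto simp: abs_if min_def max_def)
  have [measurable]: "\<phi> \<in> borel_measurable borel" using c by (rule borel_measurable_continuous_onI)
  have ii: "integrable lborel (\<lambda>x. \<phi> x * (indicator {0<..} x * exp (-x) * f x))" if "integrable lborel (\<lambda>x. indicator {0<..} x * exp (-x) * f x)"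
    and [measurable]: "f \<in> borel_measurable borel" for f :: "real \<Rightarrow> real"
  proof (rule Bochner_Integration.integrable_bound)
    show "integrable lborel (\<lambda>x. (b-a) * (indicator {0<..} x * exp (-x) * f x))" using that by simp
    show "AE x in lborel. norm (\<phi> x * (indicator {0<..} x * exp (-x) * f x)) \<le> norm ((b-a) * (indicator {0<..} x * exp (-x) * f x))"
      unfolding norm_mult by (intro AE_I2 mult_right_mono) (use B ab in auto)
  qed simp
  have pos: "\<phi> y > 0 \<longleftrightarrow> y \<in> {a<..<b}" for y unfolding \<phi>_def by auto
  have nn: "\<phi> y \<ge> 0" for y unfolding \<phi>_def by auto
  have zero: "(LINT x|lborel. \<phi> x * (indicator {0<..} x * exp (-x) * F x) - \<phi> x * (indicator {0<..} x * exp (-x) * H x)) = 0"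
    by (subst Bochner_Integration.integral_diff) (use ii i eq[OF c B] in auto)
  \<comment> \<open>A function positive throughout \<open>{a<..<b}\<close> cannot have integral zero
    against the tent \<open>\<phi>\<close>. This is applied to \<open>H - F\<close> and
    \<open>F - H\<close>, where monotonicity of \<open>F\<close> replaces its value at an endpoint
    by its value at \<open>y\<close>.\<close>
  have contra: False if D: "\<And>y. y \<in> {a<..<b} \<Longrightarrow> 0 < D y"
    and I: "integrable lborel (\<lambda>x. \<phi> x * (indicator {0<..} x * exp (-x) * D x))" and Z: "(LINT x|lborel. \<phi> x * (indicator {0<..} x * exp (-x) * D x)) = 0"
  for D :: "real \<Rightarrow> real"
  proof -
    have p: "0 < \<phi> x * (indicator {0<..} x * exp (-x) * D x)" if "x \<in> {a<..<b}" for x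
      using D[OF that] pos[of x] that ab by (auto simp: indicator_def)
    have nn': "0 \<le> \<phi> x * (indicator {0<..} x * exp (-x) * D x)" for x
      using p[of x] pos[of x] nn[of x] by (cases "x \<in> {a<..<b}") force+
    have "AE x in lborel. \<phi> x * (indicator {0<..} x * exp (-x) * D x) = 0"
      using integral_nonneg_eq_0_iff_AE[OF I] Z nn' by auto
    then have "AE x in lborel. x \<notin> {a<..<b}"
      by eventually_elim (use p in force)
    then have "emeasure lborel {a<..<b} = 0"
      by (subst (asm) AE_iff_measurable[of "{a<..<b}"]) auto
    then show False using ab by simp
  qed
  show "\<exists>y\<in>{a<..<b}. H y \<le> F b"
  proof (rule ccontr)
    assume n: "\<not> ?thesis"
    have "0 < H y - F y" if "y \<in> {a<..<b}" for y
      using n that monoD[OF mono, of y b] by force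
    moreover have "integrable lborel (\<lambda>x. \<phi> x * (indicator {0<..} x * exp (-x) * (H x - F x)))"
      "(LINT x|lborel. \<phi> x * (indicator {0<..} x * exp (-x) * (H x - F x))) = 0"
      using Bochner_Integration.integrable_diff[OF ii[OF i(2)] ii[OF i(1)]] eq[OF c B]
        Bochner_Integration.integral_diff[OF ii[OF i(2)] ii[OF i(1)]] by (auto simp: right_diff_distrib)
    ultimately show False by (rule contra)
  qed
  show "\<exists>y\<in>{a<..<b}. F a \<le> H y"
  proof (rule ccontr)
    assume n: "\<not> ?thesis"
    have "0 < F y - H y" if "y \<in> {a<..<b}" for y
      using n that monoD[OF mono, of a y] by force
    moreover have "integrable lborel (\<lambda>x. \<phi> x * (indicator {0<..} x * exp (-x) * (F x - H x)))"
      "(LINT x|lborel. \<phi> x * (indicator {0<..} x * exp (-x) * (F x - H x))) = 0"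
      using Bochner_Integration.integrable_diff[OF ii[OF i(1)] ii[OF i(2)]] eq[OF c B]
        Bochner_Integration.integral_diff[OF ii[OF i(1)] ii[OF i(2)]] by (auto simp: right_diff_distrib)
    ultimately show False by (rule contra)
  qed
qed

lemma nn_integral_to_lebesgue:
  fixes f :: "'a \<Rightarrow> real"
  assumes "f \<in> borel_measurable M" "\<And>x. x \<in> space M \<Longrightarrow> 0 \<le> f x" "(\<integral>\<^sup>+x. ennreal (f x) \<partial>M) = ennreal c" "c \<ge> 0"
  shows "integrable M f" "(LINT x|M. f x) = c"
proof -
  have "has_bochner_integral M f c"
    by (rule has_bochner_integral_nn_integral) (use assms in auto)
  then show "integrable M f" "(LINT x|M. f x) = c" by (auto simp: has_bochner_integral_iff)
qed

text \<open>A distribution function is not integrable, so everything is damped by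
  \<open>exp (-x)\<close> and the transforms are compared at the rates \<open>n + 1\<close>. Series
  and distribution function then agree when tested against bounded continuous functions, and
  monotonicity converts this into inequalities at suitable points.\<close>

lemma (in prob_space) cdf_sandwich:
  assumes X[measurable]: "X \<in> borel_measurable M" and X0: "\<And>w. w \<in> space M \<Longrightarrow> 0 \<le> X w"
    and L: "\<And>t. t > 0 \<Longrightarrow> expectation (\<lambda>w. exp (-(t^2/8 * X w))) = (t / sinh t) powr (3/2)"
    and ab: "0 < a" "a < b"
  defines "F \<equiv> \<lambda>x. prob {w\<in>space M. X w \<le> x}"
  shows "\<exists>y\<in>{a<..<b}. enn2real (cdf_series y) \<le> F b" "\<exists>y\<in>{a<..<b}. F a \<le> enn2real (cdf_series y)"
proof -
  let ?H = "\<lambda>x. enn2real (cdf_series x)"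
  have mono: "mono F" unfolding F_def by (intro monoI finite_measure_mono) auto
  have [measurable]: "F \<in> borel_measurable borel" using mono by (rule borel_measurable_mono)
  have F0: "F x \<ge> 0" for x by (simp add: F_def)
  define \<Phi> where "\<Phi> s = expectation (\<lambda>w. exp (-(s * X w))) / s" for s
  have \<Phi>0: "\<Phi> s \<ge> 0" if "s > 0" for s
    unfolding \<Phi>_def using that by (intro divide_nonneg_nonneg integral_nonneg) auto
  have LF: "(NN x. ennreal (indicator {0<..} x * exp (-(s * x)) * F x)) = ennreal (\<Phi> s)" if s: "s > 0" for s
  proof -
    have "(NN x. ennreal (indicator {0<..} x * exp (-(s * x)) * F x)) = (NN x. ennreal (exp (-(s * x)) * F x) * indicator {0<..} x)"
      by (intro nn_integral_cong) (auto simp: indicator_def)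
    then show ?thesis using laplace_cdf[OF X X0 s] by (simp add: F_def \<Phi>_def)
  qed
  have LH': "(NN x. ennreal (exp (-(s * x))) * cdf_series x * indicator {0<..} x) = ennreal (\<Phi> s)" if s: "s > 0" for s
  proof -
    define t where "t = sqrt (8 * s)"
    have t: "t > 0" "t^2/8 = s" using s by (auto simp: t_def)
    show ?thesis using cdf_series_laplace[OF t(1)] L[OF t(1)] unfolding t(2) \<Phi>_def by simp
  qed
  \<comment> \<open>The transform is finite, so \<open>cdf_series\<close> is finite almost
    everywhere on the positive half-line and \<open>enn2real\<close> loses nothing under the
    integral.\<close>
  have fin: "AE x in lborel. x > 0 \<longrightarrow> cdf_series x < \<infinity>"
  proof -
    have "(NN x. ennreal (exp (-(1 * x))) * cdf_series x * indicator {0<..} x) \<noteq> \<infinity>"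
      by (subst LH') auto
    then have "AE x in lborel. ennreal (exp (-(1 * x))) * cdf_series x * indicator {0<..} x \<noteq> \<infinity>"
      by (intro nn_integral_noteq_infinite) auto
    then show ?thesis by eventually_elim (auto simp: indicator_def ennreal_mult_eq_top_iff top.not_eq_extremum split: if_splits)
  qed
  have LH: "(NN x. ennreal (indicator {0<..} x * exp (-(s * x)) * ?H x)) = ennreal (\<Phi> s)" if s: "s > 0" for s
  proof -
    have "(NN x. ennreal (indicator {0<..} x * exp (-(s * x)) * ?H x)) = (NN x. ennreal (exp (-(s * x))) * cdf_series x * indicator {0<..} x)"
      by (rule nn_integral_cong_AE, use fin in eventually_elim) (auto simp: indicator_def ennreal_mult)
    then show ?thesis using LH'[OF s] by simp
  qed
  have fe: "exp (-(real n * max 0 x)) * (indicator {0<..} x * exp (-x) * v) = indicator {0<..} x * exp (-((real n + 1) * x)) * v" for n and x v :: real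
    by (cases "x > 0") (auto simp: exp_add[symmetric] mult.assoc[symmetric] algebra_simps)
  have iF: "integrable lborel (\<lambda>x. indicator {0<..} x * exp (-x) * F x)"
    using nn_integral_to_lebesgue(1)[OF _ _ LF[of 1] \<Phi>0] F0 by simp
  have iH: "integrable lborel (\<lambda>x. indicator {0<..} x * exp (-x) * ?H x)"
    using nn_integral_to_lebesgue(1)[OF _ _ LH[of 1] \<Phi>0] by simp
  have eq: "(LINT x|lborel. \<phi> x * (indicator {0<..} x * exp (-x) * F x)) = (LINT x|lborel. \<phi> x * (indicator {0<..} x * exp (-x) * ?H x))"
    if c: "continuous_on UNIV \<phi>" and B: "\<And>x. \<bar>\<phi> x\<bar> \<le> B" for \<phi> :: "real \<Rightarrow> real" and B
  proof -
    have "(LINT x|lborel. \<phi> (max 0 x) * (indicator {0<..} x * exp (-x) * F x)) = (LINT x|lborel. \<phi> (max 0 x) * (indicator {0<..} x * exp (-x) * ?H x))"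
    proof (rule laplace_determines[OF iF _ _ iH _ _ _ c B])
      fix n :: nat
      have "(LINT x|lborel. indicator {0<..} x * exp (-((real n + 1) * x)) * F x) = \<Phi> (real n + 1)"
        by (rule nn_integral_to_lebesgue(2)[OF _ _ LF \<Phi>0]) (auto simp: F0)
      moreover have "(LINT x|lborel. indicator {0<..} x * exp (-((real n + 1) * x)) * ?H x) = \<Phi> (real n + 1)"
        by (rule nn_integral_to_lebesgue(2)[OF _ _ LH \<Phi>0]) auto
      ultimately show "(LINT x|lborel. exp (-(real n * max 0 x)) * (indicator {0<..} x * exp (-x) * F x))
        = (LINT x|lborel. exp (-(real n * max 0 x)) * (indicator {0<..} x * exp (-x) * ?H x))"
        unfolding fe by simp
    qed auto
    moreover have *: "\<phi> (max 0 x) * (indicator {0<..} x * exp (-x) * v) = \<phi> x * (indicator {0<..} x * exp (-x) * v)" for x v :: real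
      by (cases "x > 0") auto
    ultimately show ?thesis unfolding * by simp
  qed
  show "\<exists>y\<in>{a<..<b}. enn2real (cdf_series y) \<le> F b"
    by (rule mono_eq_in_laplace_sandwich(1)[OF _ _ mono iF iH eq ab]) auto
  show "\<exists>y\<in>{a<..<b}. F a \<le> enn2real (cdf_series y)"
    by (rule mono_eq_in_laplace_sandwich(2)[OF _ _ mono iF iH eq ab]) auto
qed

lemma (in prob_space) small_deviation_from_laplace:
  assumes X[measurable]: "X \<in> borel_measurable M" and X0: "\<And>w. w \<in> space M \<Longrightarrow> 0 \<le> X w"
    and L: "\<And>t. t > 0 \<Longrightarrow> expectation (\<lambda>w. exp (-(t^2/8 * X w))) = (t / sinh t) powr (3/2)"
  shows "(\<lambda>\<epsilon>::real. prob {w\<in>space M. X w \<le> \<epsilon>}) \<sim>[at_right 0]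
         (\<lambda>\<epsilon>. 8 * sqrt 6 / sqrt pi * inverse \<epsilon> * exp (- (9 / 2) * inverse \<epsilon>))"
proof -
  define F where "F x = prob {w\<in>space M. X w \<le> x}" for x
  define K where "K = 8 * sqrt 6 / sqrt pi"
  have K: "K > 0" by (simp add: K_def)
  obtain R where R: "(R \<longlongrightarrow> K) (at_right 0)"
    "\<forall>\<^sub>F x in at_right 0. cdf_series x = ennreal (exp (-(9/(2*x))) / x * R x) \<and> R x \<ge> 0"
    by (rule cdf_series_asymptotics[folded K_def])
  from R(2) obtain d where d: "d > 0" and Rd: "\<And>x. 0 < x \<Longrightarrow> x < d \<Longrightarrow> cdf_series x = ennreal (exp (-(9/(2*x))) / x * R x) \<and> R x \<ge> 0"
    unfolding eventually_at_right_field by auto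
  have H: "enn2real (cdf_series x) = exp (-(9/(2*x))) / x * R x" "R x \<ge> 0" if "0 < x" "x < d" for x
    using Rd[OF that] that by auto
  \<comment> \<open>A window of width \<open>x^3\<close> moves the exponent \<open>9/(2*x)\<close>
    by a term of order \<open>x\<close>, which vanishes in the limit; a width of order
    \<open>x^2\<close> would leave a constant factor.\<close>
  have "\<exists>y. x \<in> {0<..<1} \<longrightarrow> y \<in> {x<..<x+x^3} \<and> F x \<le> enn2real (cdf_series y)" for x
  proof (cases "x \<in> {0<..<1}")
    case True
    then show ?thesis using cdf_sandwich(2)[OF X X0 L, of x "x+x^3"] unfolding F_def by auto
  qed auto
  then obtain u where u: "\<And>x. x \<in> {0<..<1} \<Longrightarrow> u x \<in> {x<..<x+x^3} \<and> F x \<le> enn2real (cdf_series (u x))" by metis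
  have "\<exists>y. x \<in> {0<..<1} \<longrightarrow> y \<in> {x-x^3<..<x} \<and> enn2real (cdf_series y) \<le> F x" for x
  proof (cases "x \<in> {0<..<1}")
    case True
    then have "x^3 < x^1" by (subst power_strict_decreasing_iff) auto
    then show ?thesis using cdf_sandwich(1)[OF X X0 L, of "x-x^3" x] True by (auto simp: F_def)
  qed auto
  then obtain l where l: "\<And>x. x \<in> {0<..<1} \<Longrightarrow> l x \<in> {x-x^3<..<x} \<and> enn2real (cdf_series (l x)) \<le> F x" by metis
  have ev1: "eventually (\<lambda>x::real. 0 < x \<and> x < 1) (at_right 0)" by (rule eventually_at_rightI[of 0 1]) auto
  have ev2: "eventually (\<lambda>x::real. x + x^3 < d) (at_right 0)"
  proof -
    have "((\<lambda>x::real. x + x^3) \<longlongrightarrow> 0 + 0^3) (at_right 0)" by (intro tendsto_intros)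
    then show ?thesis by (rule order_tendstoD) (use d in simp)
  qed
  have lu: "filterlim u (at_right 0) (at_right 0)"
  proof (rule tendsto_imp_filterlim_at_right)
    have "((\<lambda>x::real. x + x^3) \<longlongrightarrow> 0 + 0^3) (at_right 0)" by (intro tendsto_intros)
    then have t: "((\<lambda>x::real. x + x^3) \<longlongrightarrow> 0) (at_right 0)" by simp
    show "(u \<longlongrightarrow> 0) (at_right 0)"
      by (rule tendsto_sandwich[OF _ _ tendsto_const t]; use ev1 in eventually_elim) (use u in force)+
    show "\<forall>\<^sub>F x in at_right 0. 0 < u x" using ev1 by eventually_elim (use u in force)
  qed
  have cube: "x^3 < x" if "0 < x" "x < 1" for x :: real
    using power_strict_decreasing[of 1 3 x] that by simp
  have ll: "filterlim l (at_right 0) (at_right 0)"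
  proof (rule tendsto_imp_filterlim_at_right)
    have t: "((\<lambda>x::real. x) \<longlongrightarrow> 0) (at_right 0)" by (rule tendsto_ident_at)
    have p: "0 < l x" if "0 < x" "x < 1" for x using l[of x] cube[OF that] that by auto
    show "(l \<longlongrightarrow> 0) (at_right 0)"
      by (rule tendsto_sandwich[OF _ _ tendsto_const t]; use ev1 in eventually_elim) (use l p in force)+
    show "\<forall>\<^sub>F x in at_right 0. 0 < l x" using ev1 by eventually_elim (use p in force)
  qed
  have ex: "exp (-b) / x * r * (x * exp a) = exp (a - b) * r" if "x \<noteq> 0" for a b r x :: real
    using that by (simp add: exp_diff exp_minus field_simps)
  define G where "G x = F x / (inverse x * exp (- (9 / 2) * inverse x))" for x
  have up: "\<forall>\<^sub>F x in at_right 0. G x \<le> exp (9/(2*x) - 9/(2*(x+x^3))) * R (u x)"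
    using ev1 ev2
  proof eventually_elim
    case (elim x)
    then have ux: "x < u x" "u x < x + x^3" "F x \<le> enn2real (cdf_series (u x))" using u[of x] by auto
    have "F x \<le> exp (-(9/(2*u x))) / u x * R (u x)"
      using ux elim H(1)[of "u x"] by simp
    also have "\<dots> \<le> exp (-(9/(2*(x+x^3)))) / x * R (u x)"
      using ux elim H(2)[of "u x"] by (intro mult_right_mono frac_le) (auto simp: field_simps)
    finally have "F x * (x * exp (9/(2*x))) \<le> exp (-(9/(2*(x+x^3)))) / x * R (u x) * (x * exp (9/(2*x)))"
      using elim by (intro mult_right_mono) auto
    also have "\<dots> = exp (9/(2*x) - 9/(2*(x+x^3))) * R (u x)"
      using elim by (intro ex) auto
    also have "F x * (x * exp (9/(2*x))) = G x"
      using elim by (simp add: G_def exp_minus field_simps)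
    finally show ?case .
  qed
  have lo: "\<forall>\<^sub>F x in at_right 0. exp (9/(2*x) - 9/(2*(x-x^3))) * R (l x) \<le> G x"
    using ev1 ev2
  proof eventually_elim
    case (elim x)
    have c: "x^3 < x" using cube elim by auto
    then have lx: "x - x^3 < l x" "l x < x" "0 < l x" "enn2real (cdf_series (l x)) \<le> F x" using l[of x] elim by auto
    have "x < d" using elim by (smt (verit) zero_less_power)
    then have lxd: "l x < d" using lx by simp
    have "exp (-(9/(2*(x-x^3)))) / x * R (l x) \<le> exp (-(9/(2*l x))) / l x * R (l x)"
      using lx elim c H(2)[of "l x"] lxd by (intro mult_right_mono frac_le) (auto simp: field_simps)
    also have "\<dots> \<le> F x" using lx lxd H(1)[of "l x"] by simp
    finally have "exp (-(9/(2*(x-x^3)))) / x * R (l x) * (x * exp (9/(2*x))) \<le> F x * (x * exp (9/(2*x)))"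
      using elim by (intro mult_right_mono) auto
    also have "exp (-(9/(2*(x-x^3)))) / x * R (l x) * (x * exp (9/(2*x))) = exp (9/(2*x) - 9/(2*(x-x^3))) * R (l x)"
      using elim by (intro ex) auto
    also have "F x * (x * exp (9/(2*x))) = G x"
      using elim by (simp add: G_def exp_minus field_simps)
    finally show ?case .
  qed
  have G: "(G \<longlongrightarrow> K) (at_right 0)"
  proof (rule tendsto_sandwich[OF lo up])
    have "((\<lambda>x::real. exp (9/(2*x) - 9/(2*(x-x^3)))) \<longlongrightarrow> 1) (at_right 0)" by real_asymp
    from tendsto_mult[OF this filterlim_compose[OF R(1) ll]] show "((\<lambda>x. exp (9/(2*x) - 9/(2*(x-x^3))) * R (l x)) \<longlongrightarrow> K) (at_right 0)" by simp
    have "((\<lambda>x::real. exp (9/(2*x) - 9/(2*(x+x^3)))) \<longlongrightarrow> 1) (at_right 0)" by real_asymp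
    from tendsto_mult[OF this filterlim_compose[OF R(1) lu]] show "((\<lambda>x. exp (9/(2*x) - 9/(2*(x+x^3))) * R (u x)) \<longlongrightarrow> K) (at_right 0)" by simp
  qed
  have "((\<lambda>x. F x / (8 * sqrt 6 / sqrt pi * inverse x * exp (- (9 / 2) * inverse x))) \<longlongrightarrow> 1) (at_right 0)"
  proof -
    have "((\<lambda>x. G x / K) \<longlongrightarrow> K / K) (at_right 0)" using K by (intro tendsto_intros G) auto
    moreover have "G x / K = F x / (K * inverse x * exp (- (9 / 2) * inverse x))" for x
      unfolding G_def by (simp only: divide_divide_eq_left mult_ac)
    ultimately show ?thesis using K unfolding K_def[symmetric] by simp
  qed
  then show ?thesis unfolding F_def by (rule asymp_equivI')
qed

section \<open>The differential equation for the space diffusion\<close>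

lemma DERIV_under_integral:
  fixes f f' :: "real \<Rightarrow> 'a \<Rightarrow> real"
  assumes y: "a < y" "y < b"
    and f: "\<And>x. a < x \<Longrightarrow> x < b \<Longrightarrow> integrable M (f x)"
    and D: "\<And>x t. a < x \<Longrightarrow> x < b \<Longrightarrow> t \<in> space M \<Longrightarrow> DERIV (\<lambda>x. f x t) x :> f' x t"
    and G: "\<And>x t. a < x \<Longrightarrow> x < b \<Longrightarrow> t \<in> space M \<Longrightarrow> \<bar>f' x t\<bar> \<le> G t"
    and iG: "integrable M G" and [measurable]: "f' y \<in> borel_measurable M"
  shows "DERIV (\<lambda>x. LINT t|M. f x t) y :> (LINT t|M. f' y t)"
  unfolding DERIV_def tendsto_at_iff_sequentially comp_def
proof (intro allI impI)
  fix h :: "nat \<Rightarrow> real" assume h0: "\<forall>i. h i \<in> UNIV - {0}" and h: "h \<longlonglongrightarrow> 0"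
  have "(\<lambda>i. y + h i) \<longlonglongrightarrow> y + 0" by (intro tendsto_intros h)
  then have l: "(\<lambda>i. y + h i) \<longlonglongrightarrow> y" by simp
  have "\<forall>\<^sub>F i in sequentially. a < y + h i \<and> y + h i < b"
    using order_tendstoD(1)[OF l y(1)] order_tendstoD(2)[OF l y(2)] by eventually_elim auto
  then obtain N where N: "\<And>i. i \<ge> N \<Longrightarrow> a < y + h i \<and> y + h i < b" by (auto simp: eventually_sequentially)
  have "(\<lambda>i. LINT t|M. (f (y + h (i + N)) t - f y t) / h (i + N)) \<longlonglongrightarrow> (LINT t|M. f' y t)"
  proof (rule integral_dominated_convergence[OF _ _ iG])
    show "(\<lambda>t. (f (y + h (i + N)) t - f y t) / h (i + N)) \<in> borel_measurable M" for i
      using f[of "y + h (i+N)"] f[OF y] N[of "i+N"] by auto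
    show "AE t in M. (\<lambda>i. (f (y + h (i + N)) t - f y t) / h (i + N)) \<longlonglongrightarrow> f' y t"
    proof (rule AE_I2)
      fix t assume t: "t \<in> space M"
      have "(\<lambda>i. (f (y + h i) t - f y t) / h i) \<longlonglongrightarrow> f' y t"
        using D[OF y t] h0 h unfolding DERIV_def tendsto_at_iff_sequentially comp_def by auto
      then show "(\<lambda>i. (f (y + h (i + N)) t - f y t) / h (i + N)) \<longlonglongrightarrow> f' y t"
        by (rule LIMSEQ_ignore_initial_segment)
    qed
    show "AE t in M. norm ((f (y + h (i + N)) t - f y t) / h (i + N)) \<le> G t" for i
    proof (rule AE_I2)
      fix t assume t: "t \<in> space M"
      let ?x = "y + h (i + N)"
      have x: "a < ?x" "?x < b" "?x \<noteq> y" using N[of "i+N"] h0 by auto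
      have "norm (f ?x t - f y t) \<le> G t * norm (?x - y)"
      proof (rule field_differentiable_bound[where S="{a<..<b}" and f'="\<lambda>x. f' x t"])
        show "((\<lambda>x. f x t) has_field_derivative f' z t) (at z within {a<..<b})" if "z \<in> {a<..<b}" for z
          using D[of z t] that t by (auto intro: has_field_derivative_at_within)
      qed (use x y G t in auto)
      then show "norm ((f ?x t - f y t) / h (i + N)) \<le> G t"
        using h0 by (simp add: field_simps)
    qed
  qed measurable
  moreover have "(LINT t|M. (f (y + h (i + N)) t - f y t) / h (i + N)) = ((LINT t|M. f (y + h (i + N)) t) - (LINT t|M. f y t)) / h (i + N)" for i
    using f[of "y + h (i+N)"] f[OF y] N[of "i+N"] by simp
  ultimately have "(\<lambda>i. ((LINT t|M. f (y + h (i + N)) t) - (LINT t|M. f y t)) / h (i + N)) \<longlonglongrightarrow> (LINT t|M. f' y t)"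
    by (simp only:)
  then show "(\<lambda>i. ((LINT t|M. f (y + h i) t) - (LINT t|M. f y t)) / h i) \<longlonglongrightarrow> (LINT t|M. f' y t)"
    by (rule LIMSEQ_offset)
qed

section \<open>Elementary bounds for hyperbolic functions\<close>

lemma sinh_ge_self: "t \<le> sinh t" if "0 \<le> t" for t :: real
proof -
  have "sinh 0 - 0 \<le> sinh t - t"
  proof (rule DERIV_nonneg_imp_nondecreasing[OF that])
    fix x :: real
    show "\<exists>y. ((\<lambda>x. sinh x - x) has_real_derivative y) (at x) \<and> 0 \<le> y"
      by (intro exI[of _ "cosh x - 1"]) (auto intro!: derivative_eq_intros simp: cosh_real_ge_1)
  qed
  then show ?thesis by simp
qed

lemma sinh_le_mult_cosh: "sinh t \<le> t * cosh t" if "0 \<le> t" for t :: real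
proof -
  have "0 * cosh 0 - sinh 0 \<le> t * cosh t - sinh t"
  proof (rule DERIV_nonneg_imp_nondecreasing[OF that])
    fix x :: real assume "0 \<le> x"
    then show "\<exists>y. ((\<lambda>x. x * cosh x - sinh x) has_real_derivative y) (at x) \<and> 0 \<le> y"
      by (intro exI[of _ "x * sinh x"]) (auto intro!: derivative_eq_intros)
  qed
  then show ?thesis by simp
qed

definition coth :: "real \<Rightarrow> real" where "coth t = cosh t / sinh t"

lemma coth_measurable[measurable]: "coth \<in> borel_measurable borel"
  unfolding coth_def[abs_def] sinh_field_def cosh_field_def by measurable

lemma coth_ge_inverse: "1 / t \<le> coth t" if "0 < t"
  using sinh_le_mult_cosh[of t] that by (simp add: coth_def field_simps)

lemma coth_ge_1: "1 \<le> coth t" if "0 < t"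
  using that by (simp add: coth_def field_simps sinh_field_def cosh_field_def)

lemma coth_le: "coth t \<le> 1 + 1 / t" if "0 < t"
proof -
  have "1 + (-2 * t) \<le> exp (-2 * t)" by (rule exp_ge_add_one_self)
  then have "(1 - exp (-2 * t)) * exp t \<le> 2 * t * exp t" by (intro mult_right_mono) auto
  moreover have "exp (-2*t) * exp t = exp (-t)" by (simp add: exp_add[symmetric])
  ultimately have "exp t - exp (-t) \<le> 2 * t * exp t" by (simp add: algebra_simps)
  moreover have e: "exp (-t) \<le> exp t" using that by simp
  moreover have "1 + 2 * t \<le> exp (2 * t)" by (rule exp_ge_add_one_self)
  then have "(1 + 2 * t) * exp (-t) \<le> exp (2 * t) * exp (-t)" by (intro mult_right_mono) auto
  then have "exp (-t) + 2 * t * exp (-t) \<le> exp t" by (simp add: exp_add[symmetric] algebra_simps)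
  ultimately have "t * cosh t \<le> t * sinh t + sinh t"
    by (simp add: sinh_field_def cosh_field_def field_simps)
  then show ?thesis using that by (simp add: coth_def field_simps)
qed

lemma sinh_le_mult_exp: "sinh t \<le> t * exp t" if "0 < t" for t :: real
proof -
  have "1 + (-2 * t) \<le> exp (-2 * t)" by (rule exp_ge_add_one_self)
  then have "(1 - exp (-2 * t)) * exp t \<le> 2 * t * exp t" by (intro mult_right_mono) auto
  moreover have "exp (-2*t) * exp t = exp (-t)" by (simp add: exp_add[symmetric])
  ultimately show ?thesis by (simp add: sinh_field_def algebra_simps)
qed

lemma powr_neg_three_half: "x powr (-3/2) = 1 / (x * sqrt x)" if "x > 0"
proof -
  have "x powr (-3/2) = inverse (x powr (1 + 1/2))" by (simp add: powr_minus[symmetric])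
  also have "x powr (1 + 1/2) = x * sqrt x" unfolding powr_add using that by (simp add: powr_half_sqrt)
  finally show ?thesis by (simp add: field_simps)
qed

text \<open>The rate of exponential killing is \<open>g^2 / 2\<close>, so that \<open>g\<close>
  itself is the decay rate of the Green function.\<close>

locale killing_rate =
  fixes g :: real
  assumes g: "0 < g"
begin

text \<open>\<open>y * exp (g^2 * t / 2) * kern y t\<close> solves the heat equation \<open>2 * v_t = v_yy - y^2 * v\<close>, so its Laplace
  transform in \<open>t\<close>, the function \<open>u\<close> below, solves \<open>u'' = (g^2 + y^2) * u\<close>.\<close>

definition kern :: "real \<Rightarrow> real \<Rightarrow> real" where
  "kern y t = exp (-(g^2 * t / 2)) * sinh t powr (-3/2) * exp (-(y^2 * coth t / 2))"

text \<open>A family closed under differentiation: each derivative in \<open>y\<close> brings down a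
  factor \<open>- y * coth t\<close> and so raises \<open>k\<close> by one.\<close>

definition I :: "nat \<Rightarrow> real \<Rightarrow> real" where
  "I k y = (LINT t|lborel. indicator {0<..} t * (kern y t * coth t ^ k))"

lemma kern_measurable[measurable]: "(\<lambda>(y, t). kern y t) \<in> borel_measurable (borel \<Otimes>\<^sub>M borel)"
  unfolding kern_def sinh_field_def by measurable

lemma kern_nonneg: "0 \<le> kern y t" by (simp add: kern_def)

lemma kern_mono: "kern y t \<le> kern x t" if "0 \<le> x" "x \<le> y" "0 < t"
proof -
  have "x^2 * coth t \<le> y^2 * coth t"
    using that coth_ge_1[OF that(3)] by (intro mult_right_mono power_mono) auto
  then show ?thesis unfolding kern_def by (intro mult_left_mono) auto
qed

text \<open>From \<open>sinh t \<ge> t\<close> and \<open>coth t \<ge> 1/t\<close>. The bound is a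
  multiple of a hitting time density, so its integral is explicit, and the integrability of the
  kernel rests on it.\<close>

lemma kern_le_hit:
  assumes t: "0 < t"
  shows "kern y t \<le> exp (-(g^2 * t / 2)) * exp (-(y^2/(2*t))) / (t * sqrt t)"
proof -
  have "sinh t powr (-3/2) = 1 / (sinh t * sqrt (sinh t))" using t by (intro powr_neg_three_half) simp
  also have "\<dots> \<le> 1 / (t * sqrt t)"
    using sinh_ge_self[of t] t by (intro divide_left_mono mult_mono mult_pos_pos) auto
  finally have 1: "sinh t powr (-3/2) \<le> 1 / (t * sqrt t)" .
  have "y^2 * (1/t) \<le> y^2 * coth t" using coth_ge_inverse[OF t] by (intro mult_left_mono) auto
  then have 2: "exp (-(y^2 * coth t / 2)) \<le> exp (-(y^2/(2*t)))" by simp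
  have "kern y t \<le> exp (-(g^2 * t / 2)) * (1 / (t * sqrt t)) * exp (-(y^2/(2*t)))"
    unfolding kern_def using 1 2 t by (intro mult_mono) auto
  then show ?thesis by simp
qed

text \<open>Half of the Gaussian exponent absorbs the powers of \<open>coth t\<close>, which are
  unbounded near \<open>t = 0\<close>; the other half remains as the kernel at
  \<open>y / sqrt 2\<close>.\<close>

lemma kern_coth_le:
  assumes t: "0 < t" and y: "0 < y"
  shows "kern y t * coth t ^ k \<le> fact k * (4 / y^2)^k * kern (y / sqrt 2) t"
proof -
  have c: "coth t \<ge> 1" using coth_ge_1[OF t] .
  have "(y^2/4 * coth t)^k \<le> fact k * exp (y^2/4 * coth t)"
    by (rule power_le_fact_exp) (use c in auto)
  then have "coth t ^ k \<le> fact k * (4 / y^2)^k * exp (y^2/4 * coth t)"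
    using y by (simp add: power_mult_distrib power_divide field_simps)
  then have "kern y t * coth t ^ k \<le> kern y t * (fact k * (4 / y^2)^k * exp (y^2/4 * coth t))"
    by (intro mult_left_mono kern_nonneg)
  also have "\<dots> = fact k * (4 / y^2)^k * (exp (-(g^2 * t / 2)) * sinh t powr (-3/2) * (exp (-(y^2 * coth t / 2)) * exp (y^2/4 * coth t)))"
    by (simp add: kern_def)
  also have "exp (-(y^2 * coth t / 2)) * exp (y^2/4 * coth t) = exp (-((y / sqrt 2)^2 * coth t / 2))"
    by (simp add: exp_add[symmetric] power_divide)
  finally show ?thesis by (simp add: kern_def)
qed

lemma integrable_hit:
  assumes y: "0 < y"
  shows "integrable lborel (\<lambda>t. indicator {0<..} t * (exp (-(g^2 * t / 2)) * exp (-(y^2/(2*t))) / (t * sqrt t)))"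
    "(LINT t|lborel. indicator {0<..} t * (exp (-(g^2 * t / 2)) * exp (-(y^2/(2*t))) / (t * sqrt t))) = sqrt (2*pi) / y * exp (-g*y)"
proof -
  have "(NN t. ennreal (indicator {0<..} t * (exp (-(g^2 * t / 2)) * exp (-(y^2/(2*t))) / (t * sqrt t))))
    = (NN t. ennreal (sqrt (2*pi) / y) * (ennreal (y * exp (-(g^2*t/2)) * exp (-(y^2/(2*t))) / (t * sqrt (2*pi*t))) * indicator {0<..} t))"
    using y by (intro nn_integral_cong) (auto simp: indicator_def ennreal_mult[symmetric] real_sqrt_mult)
  also have "\<dots> = ennreal (sqrt (2*pi) / y) * ennreal (exp (-g*y))"
    by (subst nn_integral_cmult, measurable, subst nn_integral_hitting[OF g y]) simp
  also have "\<dots> = ennreal (sqrt (2*pi) / y * exp (-g*y))"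
    using y by (simp add: ennreal_mult[symmetric])
  finally have *: "(NN t. ennreal (indicator {0<..} t * (exp (-(g^2 * t / 2)) * exp (-(y^2/(2*t))) / (t * sqrt t))))
    = ennreal (sqrt (2*pi) / y * exp (-g*y))" .
  note L = nn_integral_to_lebesgue[OF _ _ this]
  show "integrable lborel (\<lambda>t. indicator {0<..} t * (exp (-(g^2 * t / 2)) * exp (-(y^2/(2*t))) / (t * sqrt t)))"
    by (rule L(1)) (use y in \<open>auto simp: indicator_def\<close>)
  show "(LINT t|lborel. indicator {0<..} t * (exp (-(g^2 * t / 2)) * exp (-(y^2/(2*t))) / (t * sqrt t))) = sqrt (2*pi) / y * exp (-g*y)"
    by (rule L(2)) (use y in \<open>auto simp: indicator_def\<close>)
qed

lemma integrable_kern: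
  assumes y: "0 < y"
  shows "integrable lborel (\<lambda>t. indicator {0<..} t * (kern y t * coth t ^ k))"
proof -
  have y2: "0 < y / sqrt 2" using y by simp
  show ?thesis
  proof (rule Bochner_Integration.integrable_bound)
    show "integrable lborel (\<lambda>t. fact k * (4 / y^2)^k * (indicator {0<..} t * (exp (-(g^2 * t / 2)) * exp (-((y / sqrt 2)^2/(2*t))) / (t * sqrt t))))"
      by (intro integrable_mult_right integrable_hit y2)
    show "AE t in lborel. norm (indicator {0<..} t * (kern y t * coth t ^ k)) \<le> norm (fact k * (4 / y^2)^k * (indicator {0<..} t * (exp (-(g^2 * t / 2)) * exp (-((y / sqrt 2)^2/(2*t))) / (t * sqrt t))))"
    proof (rule AE_I2)
      fix t :: real
      show "norm (indicator {0<..} t * (kern y t * coth t ^ k)) \<le> norm (fact k * (4 / y^2)^k * (indicator {0<..} t * (exp (-(g^2 * t / 2)) * exp (-((y / sqrt 2)^2/(2*t))) / (t * sqrt t))))"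
      proof (cases "t > 0")
        case True
        have "kern y t * coth t ^ k \<le> fact k * (4 / y^2)^k * kern (y / sqrt 2) t"
          by (rule kern_coth_le[OF True y])
        also have "\<dots> \<le> fact k * (4 / y^2)^k * (exp (-(g^2 * t / 2)) * exp (-((y / sqrt 2)^2/(2*t))) / (t * sqrt t))"
          by (intro mult_left_mono kern_le_hit True) auto
        finally have "kern y t * coth t ^ k \<le> fact k * (4 / y^2)^k * (exp (-(g^2 * t / 2)) * exp (-((y / sqrt 2)^2/(2*t))) / (t * sqrt t))" .
        moreover have "0 \<le> kern y t * coth t ^ k" using coth_ge_1[OF True] by (intro mult_nonneg_nonneg kern_nonneg) auto
        ultimately show ?thesis using True by simp
      qed simp
    qed
  qed measurable
qed

lemma DERIV_I:
  assumes y: "0 < y"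
  shows "DERIV (I k) y :> - y * I (Suc k) y"
proof -
  have "DERIV (\<lambda>x. LINT t|lborel. indicator {0<..} t * (kern x t * coth t ^ k)) y :> (LINT t|lborel. - y * (indicator {0<..} t * (kern y t * coth t ^ Suc k)))"
  \<comment> \<open>The kernel decreases in \<open>y\<close>, so its value at \<open>y/2\<close>
    dominates on the whole interval from \<open>y/2\<close> to \<open>2*y\<close>.\<close>
  proof (rule DERIV_under_integral[where a="y/2" and b="2*y" and G="\<lambda>t. 2 * y * (indicator {0<..} t * (kern (y/2) t * coth t ^ Suc k))"])
    show "integrable lborel (\<lambda>t. 2 * y * (indicator {0<..} t * (kern (y/2) t * coth t ^ Suc k)))"
      by (intro integrable_mult_right integrable_kern) (use y in auto)
    show "integrable lborel (\<lambda>t. indicator {0<..} t * (kern x t * coth t ^ k))" if "y/2 < x" for x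
      by (rule integrable_kern) (use that y in auto)
    show "DERIV (\<lambda>x. indicator {0<..} t * (kern x t * coth t ^ k)) x :> - x * (indicator {0<..} t * (kern x t * coth t ^ Suc k))" for x t
      unfolding kern_def by (auto intro!: derivative_eq_intros)
    show "\<bar>- x * (indicator {0<..} t * (kern x t * coth t ^ Suc k))\<bar> \<le> 2 * y * (indicator {0<..} t * (kern (y/2) t * coth t ^ Suc k))"
      if "y/2 < x" "x < 2*y" for x t
    proof (cases "t > 0")
      case True
      have "x * (kern x t * coth t ^ Suc k) \<le> 2 * y * (kern (y/2) t * coth t ^ Suc k)"
        using that y coth_ge_1[OF True] by (intro mult_mono kern_mono True mult_nonneg_nonneg kern_nonneg) auto
      moreover have "0 \<le> x * (kern x t * coth t ^ Suc k)"
        using that y coth_ge_1[OF True] by (intro mult_nonneg_nonneg kern_nonneg) auto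
      ultimately show ?thesis using True by simp
    qed simp
  qed (use y in auto)
  then show ?thesis unfolding I_def[abs_def] by simp
qed

end

context killing_rate
begin

lemma I_nonneg: "0 \<le> I k y"
  unfolding I_def by (rule Bochner_Integration.integral_nonneg) (auto simp: indicator_def intro!: mult_nonneg_nonneg kern_nonneg dest: coth_ge_1)

lemma DERIV_coth: "0 < t \<Longrightarrow> DERIV coth t :> 1 - coth t ^ 2"
  unfolding coth_def[abs_def]
  by (auto intro!: derivative_eq_intros simp: field_simps power2_eq_square)

lemma DERIV_kern:
  assumes t: "0 < t"
  shows "DERIV (kern y) t :> - (g^2/2 * kern y t) - 3/2 * (kern y t * coth t) - y^2/2 * (kern y t - kern y t * coth t^2)"
proof -
  have "DERIV (\<lambda>t. sinh t powr (-3/2)) t :> (-3/2) * sinh t powr (-3/2 - 1) * cosh t"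
    using t by (auto intro!: derivative_eq_intros)
  moreover have "sinh t powr (-3/2 - 1) = sinh t powr (-3/2) / sinh t powr 1" by (rule powr_diff)
  then have "(-3/2) * sinh t powr (-3/2 - 1) * cosh t = -3/2 * (sinh t powr (-3/2) * coth t)"
    using t unfolding coth_def by (simp only: powr_one sinh_real_pos_iff times_divide_eq_right times_divide_eq_left mult.assoc less_imp_le)
  ultimately have p: "DERIV (\<lambda>t. sinh t powr (-3/2)) t :> -3/2 * (sinh t powr (-3/2) * coth t)" by (simp only:)
  have e: "DERIV (\<lambda>t. exp (-(y^2 * coth t / 2))) t :> exp (-(y^2 * coth t / 2)) * (-(y^2 * (1 - coth t ^ 2) / 2))"
    using DERIV_coth[OF t] by (auto intro!: derivative_eq_intros)
  have a: "DERIV (\<lambda>t. exp (-(g^2 * t / 2))) t :> exp (-(g^2 * t / 2)) * (-(g^2/2))"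
    by (auto intro!: derivative_eq_intros)
  show ?thesis unfolding kern_def
    using DERIV_mult[OF DERIV_mult[OF a p] e] by (simp add: field_simps)
qed

text \<open>The time derivative of \<open>kern y\<close> integrates to zero over the half-line,
  since \<open>kern y\<close> vanishes at both ends. Written in powers of \<open>coth t\<close>,
  this derivative becomes a relation between the \<open>I k y\<close>.\<close>

lemma I_ode:
  assumes y: "0 < y"
  shows "y^2 * I 2 y - 3 * I 1 y = (g^2 + y^2) * I 0 y"
proof -
  define f where "f t = - (g^2/2 * kern y t) - 3/2 * (kern y t * coth t) - y^2/2 * (kern y t - kern y t * coth t^2)" for t
  have e: "einterval 0 \<infinity> = {0::real<..}" by (auto simp: einterval_def)
  have i: "integrable lborel (\<lambda>t. indicator {0<..} t * (kern y t * coth t ^ k))" for k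
    by (rule integrable_kern[OF y])
  have fe: "indicator {0<..} t *\<^sub>R f t = - (g^2/2) * (indicator {0<..} t * (kern y t * coth t ^ 0)) - 3/2 * (indicator {0<..} t * (kern y t * coth t ^ 1))
     - y^2/2 * (indicator {0<..} t * (kern y t * coth t ^ 0)) + y^2/2 * (indicator {0<..} t * (kern y t * coth t ^ 2))" for t
    by (simp add: f_def algebra_simps)
  have i': "integrable lborel (\<lambda>t. indicator {0<..} t *\<^sub>R f t)"
    unfolding fe by (intro Bochner_Integration.integrable_add Bochner_Integration.integrable_diff integrable_mult_right i)
  have val: "(LINT t|lborel. indicator {0<..} t *\<^sub>R f t) = - (g^2/2) * I 0 y - 3/2 * I 1 y - y^2/2 * I 0 y + y^2/2 * I 2 y"
    unfolding fe I_def
    by (subst Bochner_Integration.integral_add Bochner_Integration.integral_diff,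
       (intro Bochner_Integration.integrable_add Bochner_Integration.integrable_diff integrable_mult_right i)+)+ simp
  have "(LBINT t=0..\<infinity>. f t) = 0 - 0"
  proof (rule interval_integral_FTC_integrable)
    show "(kern y has_vector_derivative f t) (at t)" if "0 < ereal t" for t
      using DERIV_kern[of t y] that unfolding f_def by (simp add: has_real_derivative_iff_has_vector_derivative)
    show "isCont f t" if "0 < ereal t" for t
    proof -
      have t: "0 < t" using that by simp
      show ?thesis unfolding f_def
        by (intro continuous_intros DERIV_isCont[OF DERIV_kern[OF t]] DERIV_isCont[OF DERIV_coth[OF t]])
    qed
    show "set_integrable lborel (einterval 0 \<infinity>) f" unfolding set_integrable_def e by (rule i')
    have "(kern y \<longlongrightarrow> 0) (at_right 0)"
    proof (rule tendsto_sandwich[OF _ _ tendsto_const])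
      show "\<forall>\<^sub>F t in at_right 0. 0 \<le> kern y t" by (simp add: kern_nonneg)
      show "\<forall>\<^sub>F t in at_right 0. kern y t \<le> exp (-(g^2 * t / 2)) * exp (-(y^2/(2*t))) / (t * sqrt t)"
        by (rule eventually_at_rightI[of 0 1]) (auto intro: kern_le_hit)
      show "((\<lambda>t. exp (-(g^2 * t / 2)) * exp (-(y^2/(2*t))) / (t * sqrt t)) \<longlongrightarrow> 0) (at_right 0)"
        using y g by real_asymp
    qed
    then show "((kern y \<circ> real_of_ereal) \<longlongrightarrow> 0) (at_right 0)"
      unfolding zero_ereal_def by (simp add: ereal_tendsto_simps)
    have "(kern y \<longlongrightarrow> 0) at_top"
    proof (rule tendsto_sandwich[OF _ _ tendsto_const])
      show "\<forall>\<^sub>F t in at_top. 0 \<le> kern y t" by (simp add: kern_nonneg)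
      show "\<forall>\<^sub>F t in at_top. kern y t \<le> exp (-(g^2 * t / 2)) * exp (-(y^2/(2*t))) / (t * sqrt t)"
        by (rule eventually_mono[OF eventually_gt_at_top[of 0]]) (auto intro: kern_le_hit)
      show "((\<lambda>t. exp (-(g^2 * t / 2)) * exp (-(y^2/(2*t))) / (t * sqrt t)) \<longlongrightarrow> 0) at_top"
        using y g by real_asymp
    qed
    then show "((kern y \<circ> real_of_ereal) \<longlongrightarrow> 0) (at_left \<infinity>)"
      by (simp add: ereal_tendsto_simps)
  qed simp
  then have "(LINT t|lborel. indicator {0<..} t *\<^sub>R f t) = 0"
    unfolding interval_lebesgue_integral_def e set_lebesgue_integral_def by simp
  then show ?thesis unfolding val by (simp add: field_simps)
qed

text \<open>The factor \<open>y / sqrt (2*pi)\<close> makes the limit at 0 equal to 1: with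
  \<open>t\<close> and \<open>1/t\<close> in place of \<open>sinh t\<close> and
  \<open>coth t\<close>, the result would be the hitting time transform
  \<open>exp (-g*y)\<close>.\<close>

definition u :: "real \<Rightarrow> real" where "u y = y / sqrt (2*pi) * I 0 y"
definition u1 :: "real \<Rightarrow> real" where "u1 y = (I 0 y - y^2 * I 1 y) / sqrt (2*pi)"

lemma DERIV_u: "0 < y \<Longrightarrow> DERIV u y :> u1 y"
  unfolding u_def[abs_def] u1_def
  by (rule derivative_eq_intros DERIV_I refl | simp)+ (simp add: field_simps power2_eq_square)

lemma DERIV_u1:
  assumes y: "0 < y" shows "DERIV u1 y :> (g^2 + y^2) * u y"
proof -
  have "DERIV u1 y :> (- y * I 1 y - (2 * y * I 1 y + y^2 * (- y * I 2 y))) / sqrt (2*pi)"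
  proof -
    have "DERIV (\<lambda>y. I 0 y - y^2 * I 1 y) y :> - y * I 1 y - (2 * y * I 1 y + y^2 * (- y * I 2 y))"
      using DERIV_I[OF y, of 0] DERIV_I[OF y, of 1]
      by (auto intro!: derivative_eq_intros simp: numeral_2_eq_2)
    from DERIV_cdivide[OF this] show ?thesis unfolding u1_def[abs_def] .
  qed
  also have "(- y * I 1 y - (2 * y * I 1 y + y^2 * (- y * I 2 y))) / sqrt (2*pi) = y / sqrt (2*pi) * (y^2 * I 2 y - 3 * I 1 y)"
  proof -
    have "- y * I 1 y - (2 * y * I 1 y + y^2 * (- y * I 2 y)) = y * (y^2 * I 2 y - 3 * I 1 y)"
      by (simp add: algebra_simps power2_eq_square)
    then show ?thesis by (simp only: times_divide_eq_left)
  qed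
  also have "\<dots> = (g^2 + y^2) * u y" unfolding I_ode[OF y] u_def by simp
  finally show ?thesis .
qed

lemma u_nonneg: "0 \<le> y \<Longrightarrow> 0 \<le> u y"
  unfolding u_def by (intro mult_nonneg_nonneg I_nonneg) auto

lemma u_le:
  assumes y: "0 < y" shows "u y \<le> exp (-g*y)"
proof -
  have "I 0 y \<le> (LINT t|lborel. indicator {0<..} t * (exp (-(g^2 * t / 2)) * exp (-(y^2/(2*t))) / (t * sqrt t)))"
    unfolding I_def
    by (rule integral_mono[OF integrable_kern[OF y] integrable_hit(1)[OF y]]) (auto simp: indicator_def kern_le_hit)
  also have "\<dots> = sqrt (2*pi) / y * exp (-g*y)" by (rule integrable_hit(2)[OF y])
  finally have "y / sqrt (2*pi) * I 0 y \<le> y / sqrt (2*pi) * (sqrt (2*pi) / y * exp (-g*y))"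
    using y by (intro mult_left_mono) auto
  then show ?thesis using y by (simp add: u_def)
qed

end

text \<open>The comparison opposite to \<open>kern_le_hit\<close>, from
  \<open>sinh t \<le> t * exp t\<close> and \<open>coth t \<le> 1 + 1/t\<close>. The resulting
  factor \<open>exp (-(3/2*t))\<close> raises the killing rate from \<open>g^2/2\<close> to
  \<open>(g^2 + 3)/2\<close>, hence the square root; the summand 1 in the bound on
  \<open>coth\<close> costs \<open>exp (-(y^2/2))\<close>.\<close>

lemma (in killing_rate) u_ge:
  assumes y: "0 < y" shows "exp (-(y^2/2)) * exp (- sqrt (g^2 + 3) * y) \<le> u y"
proof -
  define g' where "g' = sqrt (g^2 + 3)"
  have g': "g' > 0" "g'^2 = g^2 + 3" by (auto simp: g'_def add_nonneg_pos)
  interpret K: killing_rate g' by unfold_locales (rule g')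
  have le: "exp (-(y^2/2)) * (exp (-(g'^2 * t / 2)) * exp (-(y^2/(2*t))) / (t * sqrt t)) \<le> kern y t" if t: "t > 0" for t
  proof -
    have st: "sinh t > 0" using t by simp
    have "sinh t * sqrt (sinh t) \<le> (t * exp t) * sqrt (t * exp t)"
      using sinh_le_mult_exp[OF t] t by (intro mult_mono) auto
    also have "\<dots> = t * sqrt t * exp (3/2 * t)"
    proof -
      have "sqrt (exp t) = exp (t/2)" by (rule real_sqrt_unique) (simp_all add: exp_double[symmetric])
      moreover have "exp t * exp (t/2) = exp (3/2 * t)" by (simp add: exp_add[symmetric])
      ultimately have "(t * exp t) * sqrt (t * exp t) = t * sqrt t * (exp t * exp (t/2))" by (simp add: real_sqrt_mult)
      then show ?thesis using \<open>exp t * exp (t/2) = _\<close> by simp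
    qed
    finally have "1 / (t * sqrt t * exp (3/2 * t)) \<le> sinh t powr (-3/2)"
      unfolding powr_neg_three_half[OF st] using t st by (intro divide_left_mono mult_pos_pos) auto
    then have 1: "exp (-(3/2*t)) / (t * sqrt t) \<le> sinh t powr (-3/2)" by (simp add: exp_minus field_simps)
    have "y^2 * coth t \<le> y^2 * (1 + 1/t)" using coth_le[OF t] by (intro mult_left_mono) auto
    then have 2: "exp (-(y^2/2) - y^2/(2*t)) \<le> exp (-(y^2 * coth t / 2))"
      by (simp add: algebra_simps)
    have "exp (-(y^2/2)) * (exp (-(g'^2 * t / 2)) * exp (-(y^2/(2*t))) / (t * sqrt t))
       = exp (-(g^2*t/2)) * (exp (-(3/2*t)) / (t * sqrt t)) * exp (-(y^2/2) - y^2/(2*t))"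
    proof -
      have "-(g'^2 * t / 2) = -(g^2*t/2) + -(3/2*t)" unfolding g'(2) by (simp add: distrib_right add_divide_distrib)
      then have 1: "exp (-(g'^2 * t / 2)) = exp (-(g^2*t/2)) * exp (-(3/2*t))" by (simp only: exp_add)
      have 2: "exp (-(y^2/2) - y^2/(2*t)) = exp (-(y^2/2)) * exp (-(y^2/(2*t)))" by (simp add: exp_add[symmetric])
      show ?thesis unfolding 1 2 by (simp only: mult_ac times_divide_eq_right times_divide_eq_left)
    qed
    also have "\<dots> \<le> kern y t" unfolding kern_def using 1 2 t by (intro mult_mono) auto
    finally show ?thesis .
  qed
  have "exp (-(y^2/2)) * (sqrt (2*pi) / y * exp (-g'*y)) =
    (LINT t|lborel. exp (-(y^2/2)) * (indicator {0<..} t * (exp (-(g'^2 * t / 2)) * exp (-(y^2/(2*t))) / (t * sqrt t))))"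
    by (simp only: integral_mult_right_zero K.integrable_hit(2)[OF y])
  also have "\<dots> \<le> I 0 y" unfolding I_def
    by (rule integral_mono[OF integrable_mult_right[OF K.integrable_hit(1)[OF y]] integrable_kern[OF y]])
       (use le in \<open>auto simp: indicator_def\<close>)
  finally have "y / sqrt (2*pi) * (exp (-(y^2/2)) * (sqrt (2*pi) / y * exp (-g'*y))) \<le> y / sqrt (2*pi) * I 0 y"
    using y by (intro mult_left_mono) auto
  then show ?thesis using y unfolding u_def g'_def[symmetric] by simp
qed

context killing_rate
begin

lemma u_tendsto: "(u \<longlongrightarrow> 1) (at_right 0)"
proof (rule tendsto_sandwich)
  show "\<forall>\<^sub>F y in at_right 0. exp (-(y^2/2)) * exp (- sqrt (g^2 + 3) * y) \<le> u y"
    by (rule eventually_at_rightI[of 0 1], rule u_ge) auto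
  show "\<forall>\<^sub>F y in at_right 0. u y \<le> exp (-g*y)"
    by (rule eventually_at_rightI[of 0 1], rule u_le) auto
  have "((\<lambda>y::real. exp (-(y^2/2)) * exp (- sqrt (g^2 + 3) * y)) \<longlongrightarrow> exp (-(0^2/2)) * exp (- sqrt (g^2 + 3) * 0)) (at_right 0)"
    by (intro tendsto_intros) auto
  then show "((\<lambda>y::real. exp (-(y^2/2)) * exp (- sqrt (g^2 + 3) * y)) \<longlongrightarrow> 1) (at_right 0)" by simp
  have "((\<lambda>y. exp (-g*y)) \<longlongrightarrow> exp (-g*0)) (at_right 0)" by (intro tendsto_intros)
  then show "((\<lambda>y. exp (-g*y)) \<longlongrightarrow> 1) (at_right 0)" by simp
qed

text \<open>\<open>coth t \<ge> 1\<close> gives Gaussian decay in \<open>y\<close>, strong enough to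
  beat the factor \<open>exp (g*y)\<close> that enters through \<open>w0\<close>.\<close>

lemma I_decay:
  assumes y: "1 \<le> y"
  shows "I k y \<le> exp (-((y^2 - 1)/2)) * I k 1"
proof -
  have le: "kern y t * coth t ^ k \<le> exp (-((y^2 - 1)/2)) * (kern 1 t * coth t ^ k)" if t: "t > 0" for t
  proof -
    have "(y^2 - 1) * 1 \<le> (y^2 - 1) * coth t" using coth_ge_1[OF t] y by (intro mult_left_mono) auto
    then have "exp (-(y^2 * coth t / 2)) \<le> exp (-((y^2 - 1)/2)) * exp (-(1^2 * coth t / 2))"
      unfolding exp_add[symmetric] exp_le_cancel_iff by (simp add: algebra_simps diff_divide_distrib)
    then have "kern y t \<le> exp (-(g^2 * t / 2)) * sinh t powr (-3/2) * (exp (-((y^2 - 1)/2)) * exp (-(1^2 * coth t / 2)))"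
      unfolding kern_def by (intro mult_left_mono) auto
    then have "kern y t \<le> exp (-((y^2 - 1)/2)) * kern 1 t" by (simp add: kern_def mult_ac)
    then have "kern y t * coth t ^ k \<le> exp (-((y^2 - 1)/2)) * kern 1 t * coth t ^ k"
      using coth_ge_1[OF t] by (intro mult_right_mono) auto
    then show ?thesis by (simp add: mult_ac)
  qed
  have "I k y \<le> (LINT t|lborel. exp (-((y^2 - 1)/2)) * (indicator {0<..} t * (kern 1 t * coth t ^ k)))"
    unfolding I_def using le
    by (intro integral_mono integrable_mult_right integrable_kern) (use y in \<open>auto simp: indicator_def\<close>)
  then show ?thesis by (simp add: I_def)
qed

lemma poly_exp_bound:
  fixes y :: real
  assumes y: "0 \<le> y"
  shows "(1 + y)^n * exp (g*y) * exp (-((y^2 - 1)/2)) \<le> fact n * exp (3/2 + (1+g)^2/2)"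
proof -
  have "(1 + y)^n \<le> fact n * exp (1 + y)" by (rule power_le_fact_exp) (use y in auto)
  then have "(1 + y)^n * exp (g*y) * exp (-((y^2 - 1)/2)) \<le> fact n * exp (1 + y) * exp (g*y) * exp (-((y^2 - 1)/2))"
    by (intro mult_right_mono) auto
  also have "\<dots> = fact n * exp (1 + y + g*y - (y^2 - 1)/2)"
    by (simp add: mult.assoc exp_add[symmetric] algebra_simps)
  also have "\<dots> \<le> fact n * exp (3/2 + (1+g)^2/2)"
  proof -
    have "0 \<le> (y - (1 + g))^2" by simp
    then have "1 + y + g*y - (y^2 - 1)/2 \<le> 3/2 + (1+g)^2/2" by (simp add: power2_eq_square field_simps)
    then show ?thesis by simp
  qed
  finally show ?thesis .
qed

text \<open>The powers 3 and 2 dominate the polynomials that multiply \<open>u\<close> and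
  \<open>u1\<close> in the derivatives of \<open>w0\<close> up to the third. Gaussian decay settles
  \<open>y \<ge> 1\<close>; below 1 the bound \<open>u_le\<close> and the differential equation are
  used.\<close>

lemma u_decay:
  obtains C where "C \<ge> 0" "\<And>y. 0 < y \<Longrightarrow> exp (g*y) * (1 + y)^3 * u y \<le> C" "\<And>y. 0 < y \<Longrightarrow> exp (g*y) * (1 + y)^2 * \<bar>u1 y\<bar> \<le> C"
proof -
  define C1 where "C1 = fact 4 * exp (3/2 + (1+g)^2/2) * (I 0 1 + I 1 1)"
  have C1: "C1 \<ge> 0" unfolding C1_def by (intro mult_nonneg_nonneg add_nonneg_nonneg I_nonneg) auto
  have big: "exp (g*y) * (1+y)^3 * u y \<le> C1" "exp (g*y) * (1+y)^2 * \<bar>u1 y\<bar> \<le> C1" if y: "1 \<le> y" for y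
  proof -
    have s: "1 \<le> sqrt (2*pi)" using pi_ge_two by (simp add: real_le_rsqrt)
    have p: "(1 + y)^4 * exp (g*y) * exp (-((y^2 - 1)/2)) * (I 0 1 + I 1 1) \<le> C1"
      unfolding C1_def using poly_exp_bound[of y 4] y by (intro mult_right_mono add_nonneg_nonneg I_nonneg) auto
    have "u y \<le> y * I 0 y" unfolding u_def using s y I_nonneg[of 0 y]
      by (intro mult_right_mono) (auto simp: divide_le_eq mult_le_cancel_left1)
    also have "\<dots> \<le> (1 + y) * (exp (-((y^2 - 1)/2)) * (I 0 1 + I 1 1))"
    proof (intro mult_mono)
      show "I 0 y \<le> exp (- ((y\<^sup>2 - 1) / 2)) * (I 0 1 + I 1 1)"
        using I_decay[OF y, of 0] I_nonneg[of 1 1] by (simp add: distrib_left add_increasing2)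
    qed (use y I_nonneg in auto)
    finally have "exp (g*y) * (1+y)^3 * u y \<le> exp (g*y) * (1+y)^3 * ((1 + y) * (exp (-((y^2 - 1)/2)) * (I 0 1 + I 1 1)))"
      using y by (intro mult_left_mono) auto
    also have "\<dots> = (1 + y)^4 * exp (g*y) * exp (-((y^2 - 1)/2)) * (I 0 1 + I 1 1)"
      by (simp add: eval_nat_numeral)
    also note p
    finally show "exp (g*y) * (1+y)^3 * u y \<le> C1" .
    have "\<bar>u1 y\<bar> = \<bar>I 0 y - y^2 * I 1 y\<bar> / sqrt (2*pi)" by (simp add: u1_def)
    also have "\<dots> \<le> \<bar>I 0 y - y^2 * I 1 y\<bar>" using s by (simp add: divide_le_eq mult_le_cancel_left1)
    also have "\<dots> \<le> 1 * I 0 y + y^2 * I 1 y" using I_nonneg[of 0 y] I_nonneg[of 1 y] by (auto simp: abs_le_iff)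
    also have "\<dots> \<le> (1+y)^2 * (exp (-((y^2 - 1)/2)) * I 0 1) + (1+y)^2 * (exp (-((y^2 - 1)/2)) * I 1 1)"
      using y I_nonneg by (intro add_mono mult_mono I_decay) auto
    also have "\<dots> = (1 + y)^2 * (exp (-((y^2 - 1)/2)) * (I 0 1 + I 1 1))" by (simp add: algebra_simps)
    finally have "exp (g*y) * (1+y)^2 * \<bar>u1 y\<bar> \<le> exp (g*y) * (1+y)^2 * ((1 + y)^2 * (exp (-((y^2 - 1)/2)) * (I 0 1 + I 1 1)))"
      using y by (intro mult_left_mono) auto
    also have "\<dots> = (1 + y)^4 * exp (g*y) * exp (-((y^2 - 1)/2)) * (I 0 1 + I 1 1)"
      by (simp add: eval_nat_numeral)
    also note p
    finally show "exp (g*y) * (1+y)^2 * \<bar>u1 y\<bar> \<le> C1" .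
  qed
  define D where "D = \<bar>u1 1\<bar> + (g^2 + 1)"
  \<comment> \<open>Near 0 the two terms that define \<open>u1\<close> both blow up, so
    \<open>u1\<close> is bounded by following its bounded derivative
    \<open>(g^2 + y^2) * u y\<close> back from the point 1.\<close>
  have u1_small: "\<bar>u1 y\<bar> \<le> D" if y: "0 < y" "y \<le> 1" for y
  proof -
    have "norm (u1 y - u1 1) \<le> (g^2 + 1) * norm (y - 1)"
    proof (rule field_differentiable_bound[where S="{y..1}" and f'="\<lambda>y. (g^2 + y^2) * u y"])
      show "(u1 has_field_derivative (g^2 + z^2) * u z) (at z within {y..1})" if "z \<in> {y..1}" for z
        using DERIV_u1[of z] that y by (auto intro: has_field_derivative_at_within)
      show "norm ((g^2 + z^2) * u z) \<le> g^2 + 1" if "z \<in> {y..1}" for z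
      proof -
        have z: "0 < z" "z \<le> 1" using that y by auto
        have "u z \<le> 1" using u_le[OF z(1)] g z by (smt (verit) exp_le_one_iff mult_nonneg_nonneg mult_minus_left)
        moreover have "z^2 \<le> 1" using z by (simp add: power_le_one)
        ultimately have "(g^2 + z^2) * u z \<le> (g^2 + 1) * 1" using u_nonneg[of z] z by (intro mult_mono) auto
        then show ?thesis using u_nonneg[of z] z by (simp add: abs_mult)
      qed
    qed (use y in auto)
    moreover have "(g^2 + 1) * norm (y - 1) \<le> (g^2+1) * 1" using y by (intro mult_left_mono) auto
    ultimately show ?thesis unfolding D_def by auto
  qed
  have D: "D \<ge> 0" by (auto simp: D_def)
  show ?thesis
  proof (rule that[of "C1 + 8 * exp g * (1 + D)"])
    fix y :: real assume y: "0 < y"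
    show "exp (g*y) * (1 + y)^3 * u y \<le> C1 + 8 * exp g * (1 + D)"
    proof (cases "1 \<le> y")
      case True
      then show ?thesis using big(1)[OF True] D by (simp add: add_increasing2)
    next
      case False
      have "exp (g*y) * (1+y)^3 * u y \<le> exp g * 2^3 * exp (-g*y)"
        using False y u_le[OF y] u_nonneg[of y] g by (intro mult_mono power_mono) auto
      also have "\<dots> \<le> exp g * 2^3 * 1" using g y by (intro mult_left_mono) auto
      also have "\<dots> \<le> 8 * exp g * (1 + D)" using D by simp
      finally show ?thesis using C1 by simp
    qed
    show "exp (g*y) * (1 + y)^2 * \<bar>u1 y\<bar> \<le> C1 + 8 * exp g * (1 + D)"
    proof (cases "1 \<le> y")
      case True
      then show ?thesis using big(2)[OF True] D by (simp add: add_increasing2)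
    next
      case False
      have "exp (g*y) * (1+y)^2 * \<bar>u1 y\<bar> \<le> exp g * 2^2 * D"
        using False y u1_small[of y] g by (intro mult_mono power_mono) auto
      also have "\<dots> \<le> 8 * exp g * (1 + D)" using D by simp
      finally show ?thesis using C1 by simp
    qed
  qed (use C1 D in auto)
qed

end

section \<open>The decaying solution and its derivatives\<close>

context killing_rate
begin

text \<open>\<open>w1\<close>, \<open>w2\<close>, \<open>w3\<close> are the successive derivatives
  of \<open>w0\<close>, with every second derivative of \<open>u\<close> already eliminated through
  the differential equation.\<close>

definition w0 :: "real \<Rightarrow> real" where "w0 z = exp (g * (z/2)) * u (z/2)"
definition w1 :: "real \<Rightarrow> real" where "w1 z = exp (g * (z/2)) * (g * u (z/2) + u1 (z/2)) / 2"
definition w2 :: "real \<Rightarrow> real" where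
  "w2 z = exp (g * (z/2)) * ((2 * g^2 + (z/2)^2) * u (z/2) + 2 * g * u1 (z/2)) / 4"
definition w3 :: "real \<Rightarrow> real" where
  "w3 z = exp (g * (z/2)) * ((4 * g^3 + 3 * g * (z/2)^2 + 2 * (z/2)) * u (z/2) + (4 * g^2 + (z/2)^2) * u1 (z/2)) / 8"

lemma DERIV_u_half: "0 < z \<Longrightarrow> DERIV (\<lambda>z. u (z/2)) z :> u1 (z/2) / 2"
  by (rule DERIV_chain2[where f=u and g="\<lambda>z. z/2" and Db="1/2", THEN DERIV_cong, OF DERIV_u]) (auto intro!: derivative_eq_intros)

lemma DERIV_u1_half: "0 < z \<Longrightarrow> DERIV (\<lambda>z. u1 (z/2)) z :> (g^2 + (z/2)^2) * u (z/2) / 2"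
  by (rule DERIV_chain2[where f=u1 and g="\<lambda>z. z/2" and Db="1/2", THEN DERIV_cong, OF DERIV_u1]) (auto intro!: derivative_eq_intros)

lemma DERIV_exp_half: "DERIV (\<lambda>z. exp (g * (z/2))) z :> exp (g * (z/2)) * (g/2)"
  by (auto intro!: derivative_eq_intros)

lemma DERIV_w: "DERIV w0 z :> w1 z" if "0 < z"
  unfolding w0_def[abs_def] w1_def
  by (rule DERIV_cong[OF DERIV_mult[OF DERIV_exp_half DERIV_u_half[OF that]]]) (simp add: field_simps)

lemma DERIV_w1: "DERIV w1 z :> w2 z" if "0 < z"
  unfolding w1_def[abs_def] w2_def
  by (rule DERIV_cong[OF DERIV_cdivide[OF DERIV_mult[OF DERIV_exp_half DERIV_add[OF DERIV_cmult[OF DERIV_u_half[OF that], of g] DERIV_u1_half[OF that]]], of 2]])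
    (simp add: field_simps power2_eq_square)

lemma DERIV_w2: "DERIV w2 z :> w3 z" if "0 < z"
proof -
  have q: "DERIV (\<lambda>z. 2 * g^2 + (z/2)^2) z :> z / 2" by (auto intro!: derivative_eq_intros)
  show ?thesis
    unfolding w2_def[abs_def] w3_def
    by (rule DERIV_cong[OF DERIV_cdivide[OF DERIV_mult[OF DERIV_exp_half DERIV_add[OF DERIV_mult[OF q DERIV_u_half[OF that]] DERIV_cmult[OF DERIV_u1_half[OF that], of "2*g"]]], of 4]])
      (simp add: field_simps power2_eq_square power3_eq_cube)
qed

lemma w_nonneg: "0 \<le> z \<Longrightarrow> 0 \<le> w0 z"
  unfolding w0_def by (intro mult_nonneg_nonneg u_nonneg) auto

lemma w_le_1: "w0 z \<le> 1" if "0 < z"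
proof -
  have "exp (g * (z/2)) * u (z/2) \<le> exp (g * (z/2)) * exp (-g*(z/2))"
    using that by (intro mult_left_mono u_le) auto
  then show ?thesis by (simp add: w0_def exp_add[symmetric])
qed

text \<open>Purely algebraic, because the second derivative of \<open>u\<close> was eliminated in
  \<open>w2\<close>. Multiplied by \<open>z\<close>, the left side is the generator applied to
  \<open>w0\<close> and the right side is the potential \<open>z^3/8\<close> times
  \<open>w0\<close>.\<close>

lemma w_ode: "2 * w2 z - 2 * g * w1 z = z^2 / 8 * w0 z"
  unfolding w0_def w1_def w2_def by (simp add: field_simps power2_eq_square)

lemma w_tendsto: "(w0 \<longlongrightarrow> 1) (at_right 0)"
proof -
  have "filterlim (\<lambda>z::real. z/2) (at_right 0) (at_right 0)" by real_asymp
  then have "((\<lambda>z. u (z/2)) \<longlongrightarrow> 1) (at_right 0)" by (rule filterlim_compose[OF u_tendsto])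
  moreover have "((\<lambda>z::real. exp (g * (z/2))) \<longlongrightarrow> exp (g * (0/2))) (at_right 0)" by (intro tendsto_intros) auto
  ultimately show ?thesis unfolding w0_def[abs_def] using tendsto_mult by fastforce
qed

text \<open>The bounds on \<open>w1\<close> and \<open>w2\<close> make these derivatives admissible
  as test functions of the past; the bound on \<open>w3\<close> controls the Taylor remainder
  uniformly.\<close>

lemma w_deriv_bounded:
  obtains C where "C \<ge> 0" "\<And>z. 0 < z \<Longrightarrow> \<bar>w1 z\<bar> \<le> C" "\<And>z. 0 < z \<Longrightarrow> \<bar>w2 z\<bar> \<le> C" "\<And>z. 0 < z \<Longrightarrow> \<bar>w3 z\<bar> \<le> C"
proof -
  obtain C where C: "C \<ge> 0" "\<And>y. 0 < y \<Longrightarrow> exp (g*y) * (1 + y)^3 * u y \<le> C" "\<And>y. 0 < y \<Longrightarrow> exp (g*y) * (1 + y)^2 * \<bar>u1 y\<bar> \<le> C"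
    using u_decay by blast
  have comb: "\<bar>exp (g * y) * (a * u y + b * u1 y)\<bar> \<le> (A + B) * C" if y: "0 < y" and "0 \<le> a" "0 \<le> b" "a \<le> A * (1+y)^3" "b \<le> B * (1+y)^2"  "0 \<le> A" "0 \<le> B" for y a b A B
  proof -
    have "\<bar>exp (g * y) * (a * u y + b * u1 y)\<bar> = exp (g*y) * \<bar>a * u y + b * u1 y\<bar>" by (simp add: abs_mult)
    also have "\<dots> \<le> exp (g*y) * (a * u y + b * \<bar>u1 y\<bar>)"
      using u_nonneg[of y] that by (intro mult_left_mono order.trans[OF abs_triangle_ineq]) (auto simp: abs_mult)
    also have "\<dots> \<le> exp (g*y) * (A * (1+y)^3 * u y + B * (1+y)^2 * \<bar>u1 y\<bar>)"
      using u_nonneg[of y] that by (intro mult_left_mono add_mono mult_right_mono) auto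
    also have "\<dots> = A * (exp (g*y) * (1+y)^3 * u y) + B * (exp (g*y) * (1+y)^2 * \<bar>u1 y\<bar>)" by (simp add: algebra_simps)
    also have "\<dots> \<le> A * C + B * C" using C y that by (intro add_mono mult_left_mono) auto
    finally show ?thesis by (simp add: algebra_simps)
  qed
  have p: "1 \<le> (1+y)^k" "y \<le> (1+y)^Suc k" "y^2 \<le> (1+y)^Suc (Suc k)" if "0 < y" for y :: real and k
  proof -
    show 1: "1 \<le> (1+y)^k" for k using that by (intro one_le_power) auto
    have "y * 1 \<le> (1+y) * (1+y)^k" using that 1 by (intro mult_mono) auto
    then show "y \<le> (1+y)^Suc k" by simp
    have "y^2 * 1 \<le> (1+y)^2 * (1+y)^k" using that 1 by (intro mult_mono power_mono) auto
    then show "y^2 \<le> (1+y)^Suc (Suc k)" by (simp add: power2_eq_square mult.assoc)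
  qed
  have g0: "0 \<le> g" using g by simp
  define K where "K = (4 * g^3 + 3 * g + 2 + 2 * g^2 + 1 + g) + (1 + 2 * g + (4 * g^2 + 1))"
  show ?thesis
  proof (rule that[of "K * C"])
    show "0 \<le> K * C" unfolding K_def using g0 C(1) by simp
  next
    fix z :: real assume z: "0 < z"
    define y where "y = z/2"
    have y: "0 < y" using z by (simp add: y_def)
    have "\<bar>exp (g * y) * (g * u y + 1 * u1 y)\<bar> \<le> (g + 1) * C"
      using p(1)[OF y] g0 by (intro comb y) (auto simp: mult_le_cancel_left1)
    then have "\<bar>w1 z\<bar> \<le> (g + 1) * C" using C(1) g0 unfolding w1_def y_def[symmetric] by (simp add: abs_divide)
    also have "\<dots> \<le> K * C" unfolding K_def using g0 C(1) by (intro mult_right_mono) auto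
    finally show "\<bar>w1 z\<bar> \<le> K * C" .
    have "\<bar>exp (g * y) * ((2 * g^2 + y^2) * u y + (2 * g) * u1 y)\<bar> \<le> ((2 * g^2 + 1) + 2 * g) * C"
    proof (intro comb y)
      have "2 * g^2 * 1 + y^2 \<le> 2 * g^2 * (1+y)^3 + (1+y)^3"
        using p(1)[OF y, of 3] p(3)[OF y, of 1] by (intro add_mono mult_left_mono) (auto simp: numeral_3_eq_3)
      then show "2 * g^2 + y^2 \<le> (2 * g^2 + 1) * (1+y)^3" by (simp add: algebra_simps)
      show "2 * g \<le> 2 * g * (1+y)^2" using p(1)[OF y, of 2] g0 by (simp add: mult_le_cancel_left1)
    qed (use g0 in auto)
    then have "\<bar>w2 z\<bar> \<le> ((2 * g^2 + 1) + 2 * g) * C" using C(1) g0 unfolding w2_def y_def[symmetric] by (simp add: abs_divide)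
    also have "\<dots> \<le> K * C" unfolding K_def using g0 C(1) by (intro mult_right_mono) auto
    finally show "\<bar>w2 z\<bar> \<le> K * C" .
    have "\<bar>exp (g * y) * ((4 * g^3 + 3 * g * y^2 + 2 * y) * u y + (4 * g^2 + y^2) * u1 y)\<bar> \<le> ((4 * g^3 + 3 * g + 2) + (4 * g^2 + 1)) * C"
    proof (intro comb y)
      have "4 * g^3 * 1 + 3 * g * y^2 + 2 * y \<le> 4 * g^3 * (1+y)^3 + 3 * g * (1+y)^3 + 2 * (1+y)^3"
        using p(1)[OF y, of 3] p(3)[OF y, of 1] p(2)[OF y, of 2] g0 by (intro add_mono mult_left_mono) (auto simp: numeral_3_eq_3 numeral_2_eq_2)
      then show "4 * g^3 + 3 * g * y^2 + 2 * y \<le> (4 * g^3 + 3 * g + 2) * (1+y)^3" by (simp add: algebra_simps)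
      have "4 * g^2 * 1 + y^2 \<le> 4 * g^2 * (1+y)^2 + (1+y)^2"
        using p(1)[OF y, of 2] p(3)[OF y, of 0] by (intro add_mono mult_left_mono) (auto simp: numeral_2_eq_2)
      then show "4 * g^2 + y^2 \<le> (4 * g^2 + 1) * (1+y)^2" by (simp add: algebra_simps)
    qed (use g0 y in auto)
    then have "\<bar>w3 z\<bar> \<le> ((4 * g^3 + 3 * g + 2) + (4 * g^2 + 1)) * C" using C(1) g0 unfolding w3_def y_def[symmetric] by (simp add: abs_divide)
    also have "\<dots> \<le> K * C" unfolding K_def using g0 C(1) by (intro mult_right_mono) auto
    finally show "\<bar>w3 z\<bar> \<le> K * C" .
  qed
qed

lemma w_taylor:
  assumes C: "\<And>z. 0 < z \<Longrightarrow> \<bar>w3 z\<bar> \<le> C" and a: "0 < a" and b: "0 < b"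
  shows "\<bar>w0 b - w0 a - w1 a * (b - a) - w2 a / 2 * (b - a)^2\<bar> \<le> C * \<bar>b - a\<bar>^3"
proof (cases "a = b")
  case True
  then show ?thesis by simp
next
  case False
  define diff where "diff m = (if m = 0 then w0 else if m = 1 then w1 else if m = 2 then w2 else w3)" for m :: nat
  have "\<exists>t. (if b < a then b < t \<and> t < a else a < t \<and> t < b) \<and>
     w0 b = (\<Sum>m<3. diff m a / fact m * (b - a)^m) + diff 3 t / fact 3 * (b - a)^3"
  proof (rule Taylor)
    show "\<forall>m t. m < 3 \<and> min a b \<le> t \<and> t \<le> max a b \<longrightarrow> DERIV (diff m) t :> diff (Suc m) t"
      using DERIV_w DERIV_w1 DERIV_w2 a b by (auto simp: diff_def less_Suc_eq numeral_3_eq_3 min_def split: if_splits)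
  qed (use False in \<open>auto simp: diff_def\<close>)
  then obtain t where t: "0 < t" "w0 b = (\<Sum>m<3. diff m a / fact m * (b - a)^m) + diff 3 t / fact 3 * (b - a)^3"
    using a b by (smt (verit))
  have e: "w0 b - w0 a - w1 a * (b - a) - w2 a / 2 * (b - a)^2 = w3 t / 6 * (b - a)^3"
    using t(2) by (simp add: diff_def eval_nat_numeral)
  have "\<bar>w3 t / 6\<bar> \<le> C" using C[OF t(1)] by (simp add: abs_divide)
  then show ?thesis unfolding e abs_mult power_abs by (intro mult_right_mono) auto
qed

section \<open>The integral of the squared solution\<close>

lemma nn_integral_square_gauss:
  assumes a: "0 < a"
  shows "(NN y. ennreal (y^2 * exp (-(a * y^2 / 2))) * indicator {0<..} y) = ennreal (sqrt (pi/2) / (a * sqrt a))"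
proof -
  define s where "s = sqrt (2 / a)"
  have s: "s > 0" "s^2 = 2/a" using a by (auto simp: s_def)
  have "(NN y. ennreal (y^2 * exp (-(a * y^2 / 2))) * indicator {0<..} y)
    = ennreal \<bar>s\<bar> * (NN y. ennreal ((0 + s * y)^2 * exp (-(a * (0 + s * y)^2 / 2))) * indicator {0<..} (0 + s * y))"
    by (rule nn_integral_real_affine) (use s in auto)
  also have "(NN y. ennreal ((0 + s * y)^2 * exp (-(a * (0 + s * y)^2 / 2))) * indicator {0<..} (0 + s * y))
     = (NN y. ennreal (s^2) * ennreal (indicator {0..} y *\<^sub>R (exp (-y\<^sup>2) * y^(2*1))))"
  proof (rule nn_integral_cong_AE, use AE_lborel_singleton[of 0] in eventually_elim)
    fix y :: real assume "y \<noteq> 0"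
    have "a * (s * y)^2 / 2 = y^2" using a by (simp add: power_mult_distrib s(2))
    then show "ennreal ((0 + s * y)^2 * exp (-(a * (0 + s * y)^2 / 2))) * indicator {0<..} (0 + s * y) = ennreal (s^2) * ennreal (indicator {0..} y *\<^sub>R (exp (-y\<^sup>2) * y^(2*1)))"
      using \<open>y \<noteq> 0\<close> s(1) by (auto simp: indicator_def ennreal_mult[symmetric] power_mult_distrib zero_less_mult_iff mult_ac)
  qed
  also have "\<dots> = ennreal (s^2) * ennreal ((sqrt pi / 2) * (fact (2 * 1) / (2 ^ (2 * 1) * fact 1)))"
  proof -
    note G = gaussian_moment_even_pos[of 1, unfolded has_bochner_integral_iff]
    show ?thesis
      by (subst nn_integral_cmult, measurable, subst nn_integral_eq_integral[OF conjunct1[OF G]], simp, simp only: conjunct2[OF G])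
  qed
  also have "ennreal \<bar>s\<bar> * \<dots> = ennreal (sqrt (pi/2) / (a * sqrt a))"
  proof -
    have "s * (s^2 * (sqrt pi / 2 * (fact (2 * 1) / (2 ^ (2 * 1) * fact 1)))) = sqrt (pi/2) / (a * sqrt a)"
      unfolding s(2) unfolding s_def using a real_sqrt_mult_self[of 2]
      by (simp add: real_sqrt_divide field_simps fact_2)
    then show ?thesis using s(1) by (simp add: ennreal_mult[symmetric])
  qed
  finally show ?thesis .
qed

end

text \<open>The factor \<open>r\<close> is the length of the set of \<open>t\<close> that split
  \<open>r = t + s\<close> into two positive times.\<close>

lemma nn_integral_sum_positive:
  fixes h :: "real \<Rightarrow> ennreal"
  assumes [measurable]: "h \<in> borel_measurable borel"
  shows "(NN t. (NN s. h (t + s) * indicator {0<..} s) * indicator {0<..} t)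
     = (NN r. ennreal r * h r * indicator {0<..} r)"
proof -
  have "(NN t. (NN s. h (t + s) * indicator {0<..} s) * indicator {0<..} t)
    = (NN t. NN r. h r * indicator {0<..} r * indicator {0<..<r} t)"
  proof (rule nn_integral_cong)
    fix t :: real
    have "(NN s. h (t + s) * indicator {0<..} s) * indicator {0<..} t
       = (NN s. h (t + s) * indicator {0<..} s * indicator {0<..} t)"
      by (rule nn_integral_multc[symmetric]) measurable
    also have "\<dots> = (NN s. h (t + 1 * s) * indicator {0<..} (t + 1 * s) * indicator {0<..<t + 1 * s} t)"
      by (intro nn_integral_cong) (auto simp: indicator_def)
    also have "\<dots> = ennreal \<bar>1\<bar> * (NN s. h (t + 1 * s) * indicator {0<..} (t + 1 * s) * indicator {0<..<t + 1 * s} t)"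
      by simp
    also have "\<dots> = (NN r. h r * indicator {0<..} r * indicator {0<..<r} t)"
      by (rule nn_integral_real_affine[symmetric]) (auto simp: indicator_def)
    finally show "(NN s. h (t + s) * indicator {0<..} s) * indicator {0<..} t
      = (NN r. h r * indicator {0<..} r * indicator {0<..<r} t)" .
  qed
  also have "\<dots> = (NN r. NN t. h r * indicator {0<..} r * indicator {0<..<r} t)"
    by (rule lborel_pair.Fubini') (auto simp: indicator_def)
  also have "\<dots> = (NN r. ennreal r * h r * indicator {0<..} r)"
  proof (rule nn_integral_cong)
    fix r :: real
    have "(NN t. h r * indicator {0<..} r * indicator {0<..<r} t) = h r * indicator {0<..} r * (NN t. indicator {0<..<r} t)"
      by (rule nn_integral_cmult) measurable
    then show "(NN t. h r * indicator {0<..} r * indicator {0<..<r} t) = ennreal r * h r * indicator {0<..} r"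
      by (cases "0 < r") (auto simp: mult.commute)
  qed
  finally show ?thesis .
qed

lemma sinh_add_coth: "coth t + coth s = sinh (t + s) / (sinh t * sinh s)" if "0 < t" "0 < s"
  using that by (simp add: coth_def sinh_add field_simps)

context killing_rate
begin

lemma u_nn_integral:
  assumes y: "0 < y"
  shows "ennreal (u y) = (NN t. ennreal (y / sqrt (2*pi) * kern y t) * indicator {0<..} t)"
proof -
  have "(NN t. ennreal (y / sqrt (2*pi) * kern y t) * indicator {0<..} t)
    = (NN t. ennreal (y / sqrt (2*pi) * (indicator {0<..} t * (kern y t * coth t ^ 0))))"
    by (intro nn_integral_cong) (auto simp: indicator_def)
  also have "\<dots> = ennreal (LINT t|lborel. y / sqrt (2*pi) * (indicator {0<..} t * (kern y t * coth t ^ 0)))"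
    by (rule nn_integral_eq_integral[OF integrable_mult_right[OF integrable_kern[OF y]]])
      (use y in \<open>auto simp: indicator_def kern_nonneg\<close>)
  also have "(LINT t|lborel. y / sqrt (2*pi) * (indicator {0<..} t * (kern y t * coth t ^ 0))) = u y"
    unfolding u_def I_def by simp
  finally show ?thesis by simp
qed

text \<open>Composition of two oscillator kernels: the Gaussian integral has the parameter
  \<open>coth t + coth s\<close>, and
  \<open>sinh t * sinh s * (coth t + coth s) = sinh (t + s)\<close>.\<close>

lemma kern_product_integral:
  assumes t: "0 < t" and s: "0 < s"
  shows "(NN y. ennreal (y / sqrt (2*pi) * kern y t * (y / sqrt (2*pi) * kern y s)) * indicator {0<..} y)
     = ennreal (exp (-(g^2 * (t + s) / 2)) * sinh (t + s) powr (-3/2) / (2 * sqrt (2 * pi)))"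
proof -
  define a where "a = coth t + coth s"
  have a: "a > 0" using coth_ge_1[OF t] coth_ge_1[OF s] by (simp add: a_def)
  define c where "c = exp (-(g^2 * (t + s) / 2)) * (sinh t * sinh s) powr (-3/2) / (2*pi)"
  have c: "c \<ge> 0" by (simp add: c_def)
  have "y / sqrt (2*pi) * kern y t * (y / sqrt (2*pi) * kern y s) = c * (y^2 * exp (-(a * y^2 / 2)))" for y
  proof -
    have "kern y t * kern y s = (exp (-(g^2 * t / 2)) * exp (-(g^2 * s / 2))) * (sinh t powr (-3/2) * sinh s powr (-3/2)) * (exp (-(y^2 * coth t / 2)) * exp (-(y^2 * coth s / 2)))"
      by (simp add: kern_def mult_ac)
    also have "exp (-(g^2 * t / 2)) * exp (-(g^2 * s / 2)) = exp (-(g^2 * (t + s) / 2))"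
      by (simp add: exp_add[symmetric] distrib_left add_divide_distrib)
    also have "exp (-(y^2 * coth t / 2)) * exp (-(y^2 * coth s / 2)) = exp (-(a * y^2 / 2))"
      by (simp add: exp_add[symmetric] a_def algebra_simps add_divide_distrib)
    also have "sinh t powr (-3/2) * sinh s powr (-3/2) = (sinh t * sinh s) powr (-3/2)"
      using t s by (simp add: powr_mult)
    finally have k: "kern y t * kern y s = exp (-(g^2 * (t + s) / 2)) * (sinh t * sinh s) powr (-3/2) * exp (-(a * y^2 / 2))" .
    have "y / sqrt (2*pi) * kern y t * (y / sqrt (2*pi) * kern y s) = y^2 / (sqrt (2*pi) * sqrt (2*pi)) * (kern y t * kern y s)"
      by (simp add: power2_eq_square del: real_sqrt_mult_self)
    then show ?thesis unfolding k c_def by simp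
  qed
  then have "(NN y. ennreal (y / sqrt (2*pi) * kern y t * (y / sqrt (2*pi) * kern y s)) * indicator {0<..} y)
    = (NN y. ennreal c * (ennreal (y^2 * exp (-(a * y^2 / 2))) * indicator {0<..} y))"
    using c by (intro nn_integral_cong) (auto simp: indicator_def ennreal_mult)
  also have "\<dots> = ennreal c * ennreal (sqrt (pi/2) / (a * sqrt a))"
    by (subst nn_integral_cmult, measurable, subst nn_integral_square_gauss[OF a]) simp
  also have "\<dots> = ennreal (c * (sqrt (pi/2) / (a * sqrt a)))"
    using c a by (intro ennreal_mult[symmetric]) auto
  also have "c * (sqrt (pi/2) / (a * sqrt a)) = exp (-(g^2 * (t + s) / 2)) * sinh (t + s) powr (-3/2) / (2 * sqrt (2 * pi))"
  proof -
    have ss: "sinh t * sinh s > 0" using t s by simp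
    have "1 / (a * sqrt a) = a powr (-3/2)" using a by (simp only: powr_neg_three_half)
    then have "(sinh t * sinh s) powr (-3/2) * (1 / (a * sqrt a)) = (sinh t * sinh s * a) powr (-3/2)"
      using ss a by (simp add: powr_mult)
    also have "sinh t * sinh s * a = sinh (t + s)"
      unfolding a_def sinh_add_coth[OF t s] using t s by simp
    finally have e: "(sinh t * sinh s) powr (-3/2) * (1 / (a * sqrt a)) = sinh (t + s) powr (-3/2)" .
    have p: "sqrt (pi/2) / (2*pi) = 1 / (2 * sqrt (2*pi))"
      by (simp add: real_sqrt_divide real_sqrt_mult field_simps)
    have "c * (sqrt (pi/2) / (a * sqrt a)) = exp (-(g^2 * (t + s) / 2)) * ((sinh t * sinh s) powr (-3/2) * (1 / (a * sqrt a))) * (sqrt (pi/2) / (2*pi))"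
      by (simp add: c_def)
    then show ?thesis unfolding e p by simp
  qed
  finally show ?thesis .
qed

lemma u_measurable: "(\<lambda>y. u y) \<in> borel_measurable borel"
  unfolding u_def I_def by measurable

text \<open>The left side will be the expectation of \<open>w (Z 0)^2\<close>, as \<open>Z 0\<close>
  has density \<open>exp (-(g * z))\<close>; this density cancels the exponential in
  \<open>w0\<close> and leaves \<open>u (z/2)^2\<close>. Writing both factors \<open>u\<close> as
  time integrals and collecting \<open>t + s\<close> produces the mixture on the right.\<close>

lemma w_square_integral:
  "(NN z. ennreal (exp (-(g * z)) * (w0 z)^2) * indicator {0<..} z)
     = (NN t. ennreal (exp (-(g^2 * t / 2)) / sqrt (2 * pi * t) * (t / sinh t) powr (3/2)) * indicator {0<..} t)"
proof -
  note u_measurable[measurable]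
  let ?k = "\<lambda>y t. ennreal (y / sqrt (2*pi) * kern y t) * indicator {0<..} t"
  have wu: "exp (-(g * z)) * (w0 z)^2 = (u (z/2))^2" for z
    by (simp add: w0_def power_mult_distrib exp_double[symmetric] mult.assoc[symmetric] exp_add[symmetric] )
  have "(NN z. ennreal (exp (-(g * z)) * (w0 z)^2) * indicator {0<..} z)
    = ennreal \<bar>2\<bar> * (NN y. ennreal ((u ((0 + 2 * y)/2))^2) * indicator {0<..} (0 + 2 * y))"
    unfolding wu by (rule nn_integral_real_affine) auto
  also have "(NN y. ennreal ((u ((0 + 2 * y)/2))^2) * indicator {0<..} (0 + 2 * y))
    = (NN y. (NN t. NN s. ?k y t * ?k y s * indicator {0<..} y))"
  proof (rule nn_integral_cong)
    fix y :: real
    show "ennreal ((u ((0 + 2 * y)/2))^2) * indicator {0<..} (0 + 2 * y) = (NN t. NN s. ?k y t * ?k y s * indicator {0<..} y)"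
    proof (cases "0 < y")
      case True
      have "(NN t. NN s. ?k y t * ?k y s * indicator {0<..} y) = (NN t. ?k y t * ennreal (u y))"
        using True by (intro nn_integral_cong) (simp add: nn_integral_cmult u_nn_integral[OF True])
      also have "\<dots> = ennreal (u y) * ennreal (u y)"
        by (subst nn_integral_multc, measurable, subst u_nn_integral[OF True, symmetric]) simp
      finally show ?thesis using True u_nonneg[of y] by (simp add: ennreal_mult power2_eq_square)
    qed simp
  qed
  also have "\<dots> = (NN t. (NN y. NN s. ?k y t * ?k y s * indicator {0<..} y))"
    by (rule lborel_pair.Fubini'[symmetric]) measurable
  also have "\<dots> = (NN t. (NN s. NN y. ?k y t * ?k y s * indicator {0<..} y))"
    by (intro nn_integral_cong lborel_pair.Fubini'[symmetric]) measurable
  also have "\<dots> = (NN t. (NN s. ennreal (exp (-(g^2 * (t + s) / 2)) * sinh (t + s) powr (-3/2) / (2 * sqrt (2 * pi))) * indicator {0<..} s) * indicator {0<..} t)"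
  proof (rule nn_integral_cong)
    fix t :: real
    have "(NN s. NN y. ?k y t * ?k y s * indicator {0<..} y) = (NN s. ennreal (exp (-(g^2 * (t + s) / 2)) * sinh (t + s) powr (-3/2) / (2 * sqrt (2 * pi))) * indicator {0<..} s * indicator {0<..} t)"
    proof (rule nn_integral_cong)
      fix s :: real
      show "(NN y. ?k y t * ?k y s * indicator {0<..} y) = ennreal (exp (-(g^2 * (t + s) / 2)) * sinh (t + s) powr (-3/2) / (2 * sqrt (2 * pi))) * indicator {0<..} s * indicator {0<..} t"
      proof (cases "0 < t \<and> 0 < s")
        case True
        then have "(NN y. ?k y t * ?k y s * indicator {0<..} y) = (NN y. ennreal (y / sqrt (2*pi) * kern y t * (y / sqrt (2*pi) * kern y s)) * indicator {0<..} y)"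
          by (intro nn_integral_cong) (auto simp: indicator_def ennreal_mult[symmetric] kern_nonneg)
        with True kern_product_integral[of t s] show ?thesis by simp
      qed auto
    qed
    also have "\<dots> = (NN s. ennreal (exp (-(g^2 * (t + s) / 2)) * sinh (t + s) powr (-3/2) / (2 * sqrt (2 * pi))) * indicator {0<..} s) * indicator {0<..} t"
      unfolding sinh_field_def by (rule nn_integral_multc) measurable
    finally show "(NN s. NN y. ?k y t * ?k y s * indicator {0<..} y)
      = (NN s. ennreal (exp (-(g^2 * (t + s) / 2)) * sinh (t + s) powr (-3/2) / (2 * sqrt (2 * pi))) * indicator {0<..} s) * indicator {0<..} t" .
  qed
  also have "\<dots> = (NN r. ennreal r * ennreal (exp (-(g^2 * r / 2)) * sinh r powr (-3/2) / (2 * sqrt (2 * pi))) * indicator {0<..} r)"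
    unfolding sinh_field_def by (rule nn_integral_sum_positive) measurable
  also have "ennreal \<bar>2\<bar> * \<dots> = (NN t. ennreal (exp (-(g^2 * t / 2)) / sqrt (2 * pi * t) * (t / sinh t) powr (3/2)) * indicator {0<..} t)"
    unfolding sinh_field_def
  proof (subst nn_integral_cmult[symmetric], measurable, unfold sinh_field_def[symmetric], rule nn_integral_cong)
    fix t :: real
    show "ennreal \<bar>2\<bar> * (ennreal t * ennreal (exp (-(g^2 * t / 2)) * sinh t powr (-3/2) / (2 * sqrt (2 * pi))) * indicator {0<..} t)
      = ennreal (exp (-(g^2 * t / 2)) / sqrt (2 * pi * t) * (t / sinh t) powr (3/2)) * indicator {0<..} t"
    proof (cases "0 < t")
      case True
      have "(t / sinh t) powr (3/2) = t powr (1 + 1/2) * sinh t powr (-3/2)"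
        using True powr_minus_divide[of "sinh t" "3/2"] by (simp add: powr_divide)
      also have "t powr (1 + 1/2) = t * sqrt t" unfolding powr_add using True by (simp add: powr_half_sqrt)
      finally have "exp (-(g^2 * t / 2)) / sqrt (2 * pi * t) * (t / sinh t) powr (3/2) = 2 * (t * (exp (-(g^2 * t / 2)) * sinh t powr (-3/2) / (2 * sqrt (2 * pi))))"
        using True by (simp add: real_sqrt_mult)
      then show ?thesis using True by (simp add: ennreal_mult[symmetric] del: ennreal_numeral flip: ennreal_numeral)
    qed simp
  qed
  finally show ?thesis .
qed

end

section \<open>Fields with the moments of Kac\<close>

definition green :: "real \<Rightarrow> real \<Rightarrow> real" where
  "green g z = exp (-g * \<bar>z\<bar>) / g"

text \<open>Sum over chains from \<open>z\<close> through \<open>n\<close> of the points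
  \<open>x i\<close> and finally to 0: each link carries a Green function, each visit to
  \<open>x i\<close> the weight \<open>a i\<close>. The base case is the return to 0, where the
  bridge ends.\<close>

fun kac :: "real \<Rightarrow> nat \<Rightarrow> (nat \<Rightarrow> real) \<Rightarrow> (nat \<Rightarrow> real) \<Rightarrow> nat \<Rightarrow> real \<Rightarrow> real" where
  "kac g m a x 0 z = green g z"
| "kac g m a x (Suc n) z = (\<Sum>i<m. a i * green g (z - x i) * kac g m a x n (x i))"

text \<open>The part of the Kac sum for \<open>\<Sum>i<m. a i * Z (x i) + b * Z y\<close> that has degree \<open>k\<close> in \<open>b\<close>
  and \<open>n\<close> in \<open>a\<close>.\<close>

fun kac2 :: "real \<Rightarrow> nat \<Rightarrow> (nat \<Rightarrow> real) \<Rightarrow> (nat \<Rightarrow> real) \<Rightarrow> real \<Rightarrow> nat \<Rightarrow> nat \<Rightarrow> real \<Rightarrow> real" where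
  "kac2 g m a x y 0 0 z = green g z"
| "kac2 g m a x y (Suc n) 0 z = (\<Sum>i<m. a i * green g (z - x i) * kac2 g m a x y n 0 (x i))"
| "kac2 g m a x y 0 (Suc k) z = green g (z - y) * kac2 g m a x y 0 k y"
| "kac2 g m a x y (Suc n) (Suc k) z =
     (\<Sum>i<m. a i * green g (z - x i) * kac2 g m a x y n (Suc k) (x i)) + green g (z - y) * kac2 g m a x y (Suc n) k y"

text \<open>Induction on the first link of the chain, which leads either to one of the first
  \<open>m\<close> points or to \<open>y\<close>.\<close>

lemma kac_kac2:
  fixes a x :: "nat \<Rightarrow> real"
  assumes a: "a m = b" "x m = y"
  shows "kac g (Suc m) a x N z = (\<Sum>k\<le>N. b^k * kac2 g m a x y (N - k) k z)"
proof (induction N arbitrary: z)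
  case (Suc N)
  let ?J = "kac2 g m a x y"
  define A where "A n k z = (\<Sum>i<m. a i * green g (z - x i) * ?J n k (x i))" for n k z
  have J: "?J (Suc n) k z = A n k z + (if k = 0 then 0 else green g (z - y) * ?J (Suc n) (k - 1) y)" for n k z
    by (cases k) (auto simp: A_def)
  have J0: "?J 0 (Suc k) z = green g (z - y) * ?J 0 k y" for k z by simp
  have "kac g (Suc m) a x (Suc N) z = (\<Sum>i<m. a i * green g (z - x i) * (\<Sum>k\<le>N. b^k * ?J (N - k) k (x i)))
      + b * green g (z - y) * (\<Sum>k\<le>N. b^k * ?J (N - k) k y)"
    by (simp add: Suc a)
  also have "(\<Sum>i<m. a i * green g (z - x i) * (\<Sum>k\<le>N. b^k * ?J (N - k) k (x i))) = (\<Sum>k\<le>N. b^k * A (N - k) k z)"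
    unfolding A_def sum_distrib_left by (subst sum.swap) (simp add: mult_ac)
  also have "b * green g (z - y) * (\<Sum>k\<le>N. b^k * ?J (N - k) k y) = (\<Sum>k\<le>N. b^Suc k * (green g (z - y) * ?J (N - k) k y))"
    by (simp add: sum_distrib_left mult_ac)
  also have "\<dots> = (\<Sum>k\<in>{1..Suc N}. b^k * (green g (z - y) * ?J (Suc N - k) (k - 1) y))"
    by (rule sum.reindex_bij_witness[of _ "\<lambda>k. k - 1" Suc]) auto
  also have "\<dots> = (\<Sum>k\<in>{1..N}. b^k * (green g (z - y) * ?J (Suc N - k) (k - 1) y)) + b^Suc N * ?J 0 (Suc N) z"
    by (subst sum.nat_ivl_Suc') (auto)
  also have "(\<Sum>k\<in>{1..N}. b^k * (green g (z - y) * ?J (Suc N - k) (k - 1) y)) = (\<Sum>k\<le>N. b^k * (if k = 0 then 0 else green g (z - y) * ?J (Suc N - k) (k - 1) y))"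
    by (rule sum.mono_neutral_cong_left) auto
  also have "(\<Sum>k\<le>N. b^k * A (N - k) k z) + ((\<Sum>k\<le>N. b^k * (if k = 0 then 0 else green g (z - y) * ?J (Suc N - k) (k - 1) y)) + b^Suc N * ?J 0 (Suc N) z)
    = (\<Sum>k\<le>N. b^k * ?J (Suc N - k) k z) + b^Suc N * ?J 0 (Suc N) z"
  proof -
    have "b^k * A (N - k) k z + b^k * (if k = 0 then 0 else green g (z - y) * ?J (Suc N - k) (k - 1) y) = b^k * ?J (Suc N - k) k z" if "k \<le> N" for k
      using that by (simp add: J Suc_diff_le distrib_left[symmetric])
    then show ?thesis by (simp add: sum.distrib[symmetric] add.assoc[symmetric])
  qed
  finally show ?case by simp
qed simp

lemma kac2_cong: "(\<And>i. i < m \<Longrightarrow> a i = a' i \<and> x i = x' i) \<Longrightarrow> kac2 g m a x y n k z = kac2 g m a' x' y n k z"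
  by (induction g m a x y n k z rule: kac2.induct) auto

lemma green_nonneg: "0 < g \<Longrightarrow> 0 \<le> green g z" by (simp add: green_def)

lemma green_le: "0 < g \<Longrightarrow> green g z \<le> 1 / g" by (simp add: green_def divide_right_mono)

lemma kac_nonneg:
  assumes "0 < g" "\<And>i. i < m \<Longrightarrow> 0 \<le> a i"
  shows "0 \<le> kac g m a x n z"
  by (induction n arbitrary: z) (auto intro!: sum_nonneg mult_nonneg_nonneg assms green_nonneg)

text \<open>Every link costs at most \<open>1/g\<close>, so the moments grow no faster than
  \<open>fact n\<close> times a geometric sequence. This yields exponential moments and hence
  determinacy.\<close>

lemma kac_le:
  assumes g: "0 < g" and a: "\<And>i. i < m \<Longrightarrow> 0 \<le> a i"
  shows "kac g m a x n z \<le> ((\<Sum>i<m. a i) / g)^n / g"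
proof (induction n arbitrary: z)
  case (Suc n)
  have "kac g m a x (Suc n) z \<le> (\<Sum>i<m. a i * (1/g) * (((\<Sum>i<m. a i) / g)^n / g))"
    unfolding kac.simps using g a
    by (intro sum_mono mult_mono Suc green_le mult_nonneg_nonneg green_nonneg kac_nonneg) auto
  then show ?case by (simp add: sum_distrib_right[symmetric] sum_divide_distrib[symmetric])
qed (simp add: green_le g)

lemma kac_reflect: "kac g m a (\<lambda>i. - x i) n (- z) = kac g m a x n z"
proof (induction n arbitrary: z)
  case (Suc n)
  have "green g (x i - z) = green g (z - x i)" for i by (simp add: green_def abs_minus_commute)
  then show ?case using Suc by simp
qed (simp add: green_def)

text \<open>All \<open>x i\<close>, the starting point and the end point 0 lie at or below
  \<open>y\<close>, so a link between such a point and \<open>y + h\<close> is \<open>e\<close>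
  times the link with \<open>y\<close>. One visit uses two such links. Two separate visits use four,
  but two consecutive visits only two, with an inner link worth \<open>green g 0 = 1/g\<close>; the
  last term corrects \<open>e^4\<close> to \<open>e^2\<close> for these.\<close>

lemma kac2_one_shift:
  fixes x :: "nat \<Rightarrow> real"
  assumes g: "0 < g" and y: "0 \<le> y" and h: "0 \<le> h" and x: "\<And>i. i < m \<Longrightarrow> x i \<le> y"
  defines "e \<equiv> exp (- g * h)"
  shows "z \<le> y \<Longrightarrow> green g (z - (y + h)) = e * green g (z - y)"
    "kac2 g m a x (y + h) n 0 z = kac2 g m a x y n 0 z"
    "kac2 g m a x y n 0 (y + h) = e * kac2 g m a x y n 0 y"
    "z \<le> y \<Longrightarrow> kac2 g m a x (y + h) n 1 z = e^2 * kac2 g m a x y n 1 z"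
    "z \<le> y \<Longrightarrow> kac2 g m a x (y + h) n 2 z = e^4 * kac2 g m a x y n 2 z + (e^2 - e^4) / g * kac2 g m a x y n 1 z"
proof -
  have G: "green g (z - (y + h)) = e * green g (z - y)" if "z \<le> y" for z
    using that h by (simp add: green_def e_def exp_add[symmetric] algebra_simps abs_if)
  then show "z \<le> y \<Longrightarrow> green g (z - (y + h)) = e * green g (z - y)" .
  have G': "green g (y + h - z) = e * green g (y - z)" if "z \<le> y" for z
    using that h by (simp add: green_def e_def exp_add[symmetric] algebra_simps abs_if)
  have 0: "kac2 g m a x (y + h) n 0 z = kac2 g m a x y n 0 z" for n z
    by (induction n arbitrary: z) auto
  then show "kac2 g m a x (y + h) n 0 z = kac2 g m a x y n 0 z" .
  have 00: "kac2 g m a x y n 0 (y + h) = e * kac2 g m a x y n 0 y" for n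
  proof (cases n)
    case 0
    then show ?thesis using G'[of 0] y by simp
  next
    case (Suc k)
    then show ?thesis by (simp add: G' x sum_distrib_left mult_ac)
  qed
  then show "kac2 g m a x y n 0 (y + h) = e * kac2 g m a x y n 0 y" .
  have 1: "kac2 g m a x (y + h) n 1 z = e^2 * kac2 g m a x y n 1 z" if "z \<le> y" for n z
    using that
  proof (induction n arbitrary: z)
    case 0
    then show ?case using 00[of 0] by (simp add: G power2_eq_square)
  next
    case (Suc n)
    have "kac2 g m a x (y + h) (Suc n) 1 z = (\<Sum>i<m. a i * green g (z - x i) * kac2 g m a x (y + h) n 1 (x i)) + green g (z - (y + h)) * kac2 g m a x (y + h) (Suc n) 0 (y + h)"
      by simp
    also have "\<dots> = (\<Sum>i<m. a i * green g (z - x i) * (e^2 * kac2 g m a x y n 1 (x i))) + e * green g (z - y) * (e * kac2 g m a x y (Suc n) 0 y)"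
      using Suc x unfolding 0 00 by (simp add: G)
    also have "\<dots> = e^2 * kac2 g m a x y (Suc n) 1 z"
      by (simp add: distrib_left sum_distrib_left power2_eq_square mult_ac)
    finally show ?case .
  qed
  then show "z \<le> y \<Longrightarrow> kac2 g m a x (y + h) n 1 z = e^2 * kac2 g m a x y n 1 z" .
  have g0: "green g 0 = 1 / g" by (simp add: green_def)
  \<comment> \<open>Starting at \<open>y + h\<close> there is one crossing link less: three if the
    visit comes later, one if it is immediate.\<close>
  have 10: "kac2 g m a x (y + h) n 1 (y + h) = e^3 * kac2 g m a x y n 1 y + (e - e^3) / g * kac2 g m a x y n 0 y" for n
  proof (cases n)
    case 0
    then show ?thesis using 00[of 0] g by (simp add: g0 field_simps)
  next
    case (Suc k)
    have "kac2 g m a x (y + h) n 1 (y + h) = (\<Sum>i<m. a i * green g (y + h - x i) * kac2 g m a x (y + h) k 1 (x i)) + 1 / g * kac2 g m a x (y + h) n 0 (y + h)"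
      using Suc by (simp add: g0)
    also have "\<dots> = (\<Sum>i<m. a i * (e * green g (y - x i)) * (e^2 * kac2 g m a x y k 1 (x i))) + 1 / g * (e * kac2 g m a x y n 0 y)"
      unfolding 0 00 using x 1 by (simp add: G')
    also have "(\<Sum>i<m. a i * (e * green g (y - x i)) * (e^2 * kac2 g m a x y k 1 (x i))) = e^3 * (\<Sum>i<m. a i * green g (y - x i) * kac2 g m a x y k 1 (x i))"
      by (simp add: sum_distrib_left power2_eq_square power3_eq_cube mult_ac)
    also have "(\<Sum>i<m. a i * green g (y - x i) * kac2 g m a x y k 1 (x i)) = kac2 g m a x y n 1 y - 1 / g * kac2 g m a x y n 0 y"
      using Suc by (simp add: g0)
    finally show ?thesis by (simp add: algebra_simps diff_divide_distrib)
  qed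
  show "z \<le> y \<Longrightarrow> kac2 g m a x (y + h) n 2 z = e^4 * kac2 g m a x y n 2 z + (e^2 - e^4) / g * kac2 g m a x y n 1 z"
  proof (induction n arbitrary: z)
    case 0
    have "kac2 g m a x (y + h) 0 2 z = green g (z - (y + h)) * kac2 g m a x (y + h) 0 1 (y + h)"
      by (simp add: numeral_2_eq_2)
    also have "\<dots> = e * green g (z - y) * (e^3 * kac2 g m a x y 0 1 y + (e - e^3) / g * kac2 g m a x y 0 0 y)"
      unfolding 10 using G[OF 0] by simp
    also have "\<dots> = e^4 * kac2 g m a x y 0 2 z + (e^2 - e^4) / g * kac2 g m a x y 0 1 z"
      using g by (simp add: numeral_2_eq_2 field_simps power2_eq_square power3_eq_cube eval_nat_numeral)
    finally show ?case .
  next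
    case (Suc n)
    have "kac2 g m a x (y + h) (Suc n) 2 z = (\<Sum>i<m. a i * green g (z - x i) * kac2 g m a x (y + h) n 2 (x i)) + green g (z - (y + h)) * kac2 g m a x (y + h) (Suc n) 1 (y + h)"
      by (simp add: numeral_2_eq_2)
    also have "\<dots> = (\<Sum>i<m. a i * green g (z - x i) * (e^4 * kac2 g m a x y n 2 (x i) + (e^2 - e^4) / g * kac2 g m a x y n 1 (x i)))
       + e * green g (z - y) * (e^3 * kac2 g m a x y (Suc n) 1 y + (e - e^3) / g * kac2 g m a x y (Suc n) 0 y)"
      unfolding 10 using G[OF Suc(2)] Suc x by simp
    also have "\<dots> = e^4 * ((\<Sum>i<m. a i * green g (z - x i) * kac2 g m a x y n 2 (x i)) + green g (z - y) * kac2 g m a x y (Suc n) 1 y)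
       + (e^2 - e^4) / g * ((\<Sum>i<m. a i * green g (z - x i) * kac2 g m a x y n 1 (x i)) + green g (z - y) * kac2 g m a x y (Suc n) 0 y)"
    proof -
      have 1: "(\<Sum>i<m. a i * green g (z - x i) * (A * p i + B * q i)) = A * (\<Sum>i<m. a i * green g (z - x i) * p i) + B * (\<Sum>i<m. a i * green g (z - x i) * q i)" for A B p q
        by (simp add: sum_distrib_left distrib_left sum.distrib mult_ac)
      have 2: "e * G * (e^3 * P + (e - e^3) / g * Q) = e^4 * (G * P) + (e^2 - e^4) / g * (G * Q)" for G P Q
        using g by (simp add: field_simps power2_eq_square power3_eq_cube eval_nat_numeral)
      show ?thesis unfolding 1 2 by (simp add: distrib_left)
    qed
    also have "\<dots> = e^4 * kac2 g m a x y (Suc n) 2 z + (e^2 - e^4) / g * kac2 g m a x y (Suc n) 1 z"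
      by (simp add: numeral_2_eq_2)
    finally show ?case .
  qed
qed

text \<open>The signed sum is the fourth moment of an increment divided by 24, as
  \<open>4 choose k\<close> cancels against \<open>fact (4 - k) * fact k\<close>. The factor
  \<open>(1 - e^2)^2\<close> is of order \<open>h^2\<close>.\<close>

lemma kac2_fourth:
  fixes y :: real
  assumes g: "0 < g" and y: "0 \<le> y" and h: "0 \<le> h"
  defines "e \<equiv> exp (- g * h)"
  shows "(\<Sum>k\<le>4. (-1)^k * kac2 g 1 (\<lambda>_. 1) (\<lambda>_. y) (y + h) (4 - k) k 0) = (1 - e^2)^2 * (exp (-g * y))^2 / g^5"
proof -
  have r: "green g 0 = 1 / g" "green g (y - (y + h)) = e / g" "green g (y + h - y) = e / g" "green g (0 - y) = exp (-g * y) / g"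
     "green g (0 - (y + h)) = e * exp (-g * y) / g" "green g y = exp (-g * y) / g" "green g (y + h) = e * exp (-g * y) / g"
     "green g (-y) = exp (-g * y) / g" "green g (-h) = e / g" "green g h = e / g"  "green g (-y-h) = e * exp (-g * y) / g"
    using y h by (auto simp: green_def e_def exp_add[symmetric] algebra_simps)
  show ?thesis
    using g by (simp add: eval_nat_numeral r) (simp add: field_simps)
qed

section \<open>The field, its moments and its past\<close>

lemma sum_append:
  fixes f h :: "nat \<Rightarrow> 'b :: comm_monoid_add"
  shows "(\<Sum>i<m+p. if i < m then f i else h (i - m)) = (\<Sum>i<m. f i) + (\<Sum>i<p. h i)"
  by (induction p) (auto simp: add.assoc)

text \<open>Coefficients are nonnegative so that the moments can be stated as \<open>ennreal\<close>
  integrals, whose finiteness supplies integrability. The case \<open>n = 0\<close> says that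
  \<open>N\<close> has total mass \<open>1/g\<close>. Continuity and bounded support hold for every
  \<open>w\<close>, so spatial integrals are finite.\<close>

locale kac_field = killing_rate g + finite_measure N for g and N :: "'a measure" +
  fixes Z :: "real \<Rightarrow> 'a \<Rightarrow> real"
  assumes Z_measurable[measurable]: "\<And>x. Z x \<in> borel_measurable N"
    and Z_nonneg: "\<And>w x. w \<in> space N \<Longrightarrow> 0 \<le> Z x w"
    and Z_cont: "\<And>w. w \<in> space N \<Longrightarrow> continuous_on UNIV (\<lambda>x. Z x w)"
    and Z_support: "\<And>w. w \<in> space N \<Longrightarrow> \<exists>R. \<forall>x. R \<le> \<bar>x\<bar> \<longrightarrow> Z x w = 0"
    and kac_moments: "\<And>m a x n. (\<And>i. i < m \<Longrightarrow> 0 \<le> a i) \<Longrightarrow>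
      (\<integral>\<^sup>+w. ennreal ((\<Sum>i<m. a i * Z (x i) w) ^ n) \<partial>N) = ennreal (fact n * kac g m a x n 0)"
begin

definition lin :: "nat \<Rightarrow> (nat \<Rightarrow> real) \<Rightarrow> (nat \<Rightarrow> real) \<Rightarrow> 'a \<Rightarrow> real" where
  "lin m a x w = (\<Sum>i<m. a i * Z (x i) w)"

lemma lin_measurable[measurable]: "lin m a x \<in> borel_measurable N"
  unfolding lin_def by measurable

lemma lin_nonneg: "(\<And>i. i < m \<Longrightarrow> 0 \<le> a i) \<Longrightarrow> w \<in> space N \<Longrightarrow> 0 \<le> lin m a x w"
  unfolding lin_def by (intro sum_nonneg mult_nonneg_nonneg Z_nonneg) auto

lemma lin_moments:
  assumes "\<And>i. i < m \<Longrightarrow> 0 \<le> a i"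
  shows "integrable N (\<lambda>w. lin m a x w ^ n)" "(LINT w|N. lin m a x w ^ n) = fact n * kac g m a x n 0"
proof -
  have "(\<integral>\<^sup>+w. ennreal (lin m a x w ^ n) \<partial>N) = ennreal (fact n * kac g m a x n 0)"
    unfolding lin_def by (rule kac_moments[OF assms])
  moreover have "0 \<le> fact n * kac g m a x n 0" using kac_nonneg[OF g assms] by (intro mult_nonneg_nonneg) auto
  ultimately show "integrable N (\<lambda>w. lin m a x w ^ n)" "(LINT w|N. lin m a x w ^ n) = fact n * kac g m a x n 0"
    using nn_integral_to_lebesgue[of "\<lambda>w. lin m a x w ^ n" N "fact n * kac g m a x n 0"] lin_nonneg[OF assms]
    by (auto intro: zero_le_power)
qed

text \<open>\<open>c\<close> is chosen with \<open>c * A < 1\<close>, so that the exponential series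
  of the moments is dominated by a geometric one.\<close>

lemma exp_lin_integrable:
  assumes a: "\<And>i. i < m \<Longrightarrow> 0 \<le> a i"
  shows "\<exists>c>0. integrable N (\<lambda>w. exp (c * lin m a x w))"
proof -
  define A where "A = (\<Sum>i<m. a i) / g"
  have A: "0 \<le> A" unfolding A_def using g a by (intro divide_nonneg_pos sum_nonneg) auto
  define c where "c = 1 / (2 * (A + 1))"
  have c: "0 < c" "c * A < 1" using A by (auto simp: c_def field_simps)
  have "(\<integral>\<^sup>+w. ennreal (exp (c * lin m a x w)) \<partial>N) = (\<integral>\<^sup>+w. (\<Sum>n. ennreal (c^n / fact n) * ennreal (lin m a x w ^ n)) \<partial>N)"
  proof (rule nn_integral_cong)
    fix w assume w: "w \<in> space N"
    have "(\<lambda>n. (c * lin m a x w)^n /\<^sub>R fact n) sums exp (c * lin m a x w)" by (rule exp_converges)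
    then have "(\<lambda>n. c^n / fact n * lin m a x w ^ n) sums exp (c * lin m a x w)"
      by (simp add: power_mult_distrib divide_inverse mult_ac)
    then have "(\<Sum>n. ennreal (c^n / fact n * lin m a x w ^ n)) = ennreal (exp (c * lin m a x w))"
      using c lin_nonneg[OF a w] by (intro suminf_ennreal_eq) auto
    then show "ennreal (exp (c * lin m a x w)) = (\<Sum>n. ennreal (c^n / fact n) * ennreal (lin m a x w ^ n))"
      using c lin_nonneg[OF a w] by (simp add: ennreal_mult[symmetric])
  qed
  also have "\<dots> = (\<Sum>n. ennreal (c^n / fact n) * ennreal (fact n * kac g m a x n 0))"
    by (subst nn_integral_suminf, measurable, subst nn_integral_cmult, measurable) (simp add: lin_def kac_moments[OF a])
  also have "\<dots> \<le> (\<Sum>n. ennreal ((c * A)^n / g))"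
  proof (rule suminf_le)
    fix n
    have "c^n / fact n * (fact n * kac g m a x n 0) \<le> c^n * (A^n / g)"
      using kac_le[of g m a x n 0] g a c unfolding A_def[symmetric] by (simp del: times_divide_eq_right)
    then show "ennreal (c^n / fact n) * ennreal (fact n * kac g m a x n 0) \<le> ennreal ((c * A)^n / g)"
      using c kac_nonneg[of g m a x n 0] g a by (simp add: ennreal_mult[symmetric] power_mult_distrib ennreal_leI)
  qed auto
  also have "\<dots> < \<infinity>"
  proof -
    have "summable (\<lambda>n. (c * A)^n / g)" using c A by (intro summable_divide summable_geometric) auto
    then have "(\<Sum>n. ennreal ((c * A)^n / g)) = ennreal (\<Sum>n. (c * A)^n / g)"
      using c A g by (intro suminf_ennreal_eq summable_sums) auto
    then show ?thesis by simp
  qed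
  finally have "integrable N (\<lambda>w. exp (c * lin m a x w))"
    by (intro integrableI_nonneg) auto
  then show ?thesis using c by blast
qed

lemma single_moment:
  shows "integrable N (\<lambda>w. Z y w ^ n)" and "(LINT w|N. Z y w ^ n) = fact n * kac g 1 (\<lambda>_. 1) (\<lambda>_. y) n 0"
  using lin_moments[of 1 "\<lambda>_. 1" "\<lambda>_. y" n] by (auto simp: lin_def)

text \<open>The Kac formula for \<open>lin m a x w + b * Z y w\<close> equates two polynomials in
  \<open>b\<close>. Agreement for all \<open>b \<ge> 0\<close> forces equal coefficients, and these
  contain the mixed moments.\<close>

lemma mixed_moment:
  assumes a: "\<And>i. i < m \<Longrightarrow> 0 \<le> a i"
  shows "integrable N (\<lambda>w. lin m a x w ^ n * Z y w ^ k)"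
    "(LINT w|N. lin m a x w ^ n * Z y w ^ k) = fact n * fact k * kac2 g m a x y n k 0"
proof -
  define L where "L b w = lin (Suc m) (a(m := b)) (x(m := y)) w" for b w
  have L: "L b w = lin m a x w + b * Z y w" for b w by (simp add: L_def lin_def)
  have nn: "i < Suc m \<Longrightarrow> 0 \<le> (a(m := b)) i" if "0 \<le> b" for b i using that a by auto
  have iL: "integrable N (\<lambda>w. L b w ^ q)" if "0 \<le> b" for b q
    unfolding L_def by (rule lin_moments(1)[OF nn[OF that]])
  have int: "integrable N (\<lambda>w. lin m a x w ^ n * Z y w ^ k)" for n k
  proof (rule Bochner_Integration.integrable_bound[OF iL[of 1 "n + k"]])
    show "AE w in N. norm (lin m a x w ^ n * Z y w ^ k) \<le> norm (L 1 w ^ (n + k))"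
    proof (rule AE_I2)
      fix w assume w: "w \<in> space N"
      have "lin m a x w ^ n * Z y w ^ k \<le> L 1 w ^ n * L 1 w ^ k"
        unfolding L using lin_nonneg[OF a w] Z_nonneg[OF w] by (intro mult_mono power_mono) auto
      then show "norm (lin m a x w ^ n * Z y w ^ k) \<le> norm (L 1 w ^ (n + k))"
        unfolding power_add using lin_nonneg[OF a w] Z_nonneg[OF w] by (simp add: L)
    qed
  qed auto
  then show "integrable N (\<lambda>w. lin m a x w ^ n * Z y w ^ k)" .
  define d where "d M k = real (M choose k) * (LINT w|N. lin m a x w ^ (M - k) * Z y w ^ k) - fact M * kac2 g m a x y (M - k) k 0" for M k
  have z: "(\<Sum>k\<le>M. d M k * b^k) = 0" if b: "0 \<le> b" for b M
  proof -
    have "L b w ^ M = (\<Sum>k\<le>M. b^k * (real (M choose k) * (lin m a x w ^ (M - k) * Z y w ^ k)))" for w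
      unfolding L by (subst add.commute, subst binomial_ring) (simp add: power_mult_distrib mult_ac)
    then have "(LINT w|N. L b w ^ M) = (\<Sum>k\<le>M. b^k * (real (M choose k) * (LINT w|N. lin m a x w ^ (M - k) * Z y w ^ k)))"
      using int by (simp add: Bochner_Integration.integral_sum)
    moreover have "(LINT w|N. L b w ^ M) = fact M * (\<Sum>k\<le>M. b^k * kac2 g m a x y (M - k) k 0)"
    proof -
      have "kac g (Suc m) (a(m := b)) (x(m := y)) M 0 = (\<Sum>k\<le>M. b^k * kac2 g m (a(m := b)) (x(m := y)) y (M - k) k 0)"
        by (rule kac_kac2) auto
      also have "\<dots> = (\<Sum>k\<le>M. b^k * kac2 g m a x y (M - k) k 0)"
        by (intro sum.cong refl arg_cong2[of _ _ _ _ "(*)"] kac2_cong) auto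
      finally have "kac g (Suc m) (a(m := b)) (x(m := y)) M 0 = (\<Sum>k\<le>M. b^k * kac2 g m a x y (M - k) k 0)" .
      with lin_moments(2)[OF nn[OF b], where x="x(m := y)" and n=M] show ?thesis by (simp only: L_def)
    qed
    ultimately have "(\<Sum>k\<le>M. b^k * (real (M choose k) * (LINT w|N. lin m a x w ^ (M - k) * Z y w ^ k))) - (\<Sum>k\<le>M. fact M * (b^k * kac2 g m a x y (M - k) k 0)) = 0"
      by (simp add: sum_distrib_left)
    then show ?thesis
      unfolding sum_subtractf[symmetric] d_def by (simp add: algebra_simps)
  qed
  have d0: "d M k = 0" if "k \<le> M" for M k
  proof (rule ccontr)
    assume "d M k \<noteq> 0"
    then have "finite {b. (\<Sum>i\<le>M. d M i * b^i) = 0}" using that polyfun_rootbound by blast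
    moreover have "{0..} \<subseteq> {b. (\<Sum>i\<le>M. d M i * b^i) = 0}" using z by auto
    ultimately show False using finite_subset infinite_Ici by blast
  qed
  have "real ((n + k) choose k) * (LINT w|N. lin m a x w ^ n * Z y w ^ k) = fact (n + k) * kac2 g m a x y n k 0"
    using d0[of k "n + k"] by (simp add: d_def)
  moreover have "fact (n + k) = real ((n + k) choose k) * (fact n * fact k)"
    using binomial_fact_lemma[of k "n + k"] by (metis add_diff_cancel_right' le_add2 mult.commute of_nat_fact of_nat_mult)
  ultimately show "(LINT w|N. lin m a x w ^ n * Z y w ^ k) = fact n * fact k * kac2 g m a x y n k 0"
    by simp
qed

text \<open>An exponential rate is halved: one half serves the exponential of
  \<open>lin m a x w\<close>, the other absorbs the polynomial growth of \<open>V\<close>. Appending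
  the two index lists lets a single exponential moment cover both.\<close>

lemma exp_integrable_family:
  assumes a: "\<And>i. i < m \<Longrightarrow> 0 \<le> a i" and V[measurable]: "V \<in> borel_measurable N"
    and bound: "\<And>w. w \<in> space N \<Longrightarrow> \<bar>V w\<bar> \<le> K * (1 + lin p b y w)^q" and b: "\<And>i. i < p \<Longrightarrow> 0 \<le> b i"
  shows "\<exists>c>0. integrable N (\<lambda>w. exp (c * lin m a x w) * V w)"
proof -
  define a' where "a' i = (if i < m then a i else b (i - m))" for i
  define x' where "x' i = (if i < m then x i else y (i - m))" for i
  have "lin (m + p) a' x' w = lin m a x w + lin p b y w" for w
  proof -
    have "a' i * Z (x' i) w = (if i < m then a i * Z (x i) w else b (i - m) * Z (y (i - m)) w)" for i
      by (simp add: a'_def x'_def)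
    then show ?thesis unfolding lin_def
      using sum_append[of m "\<lambda>i. a i * Z (x i) w" "\<lambda>i. b i * Z (y i) w" p] by simp
  qed
  note L = this
  have a'0: "\<And>i. i < m + p \<Longrightarrow> 0 \<le> a' i" using a b by (auto simp: a'_def)
  obtain c where c: "0 < c" "integrable N (\<lambda>w. exp (c * lin (m + p) a' x' w))"
    using exp_lin_integrable[of "m + p" a' x'] a'0 by metis
  define C where "C = \<bar>K\<bar> * (fact q * exp (c/2) / (c/2)^q)"
  have "integrable N (\<lambda>w. exp ((c/2) * lin m a x w) * V w)"
  proof (rule Bochner_Integration.integrable_bound)
    show "integrable N (\<lambda>w. C * exp (c * lin (m + p) a' x' w))" using c by simp
    show "AE w in N. norm (exp ((c/2) * lin m a x w) * V w) \<le> norm (C * exp (c * lin (m + p) a' x' w))"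
    proof (rule AE_I2)
      fix w assume w: "w \<in> space N"
      let ?A = "lin m a x w" and ?B = "lin p b y w"
      have AB: "0 \<le> ?A" "0 \<le> ?B" using lin_nonneg[OF a w] lin_nonneg[OF b w] by auto
      have "((c/2) * (1 + ?B))^q \<le> fact q * exp ((c/2) * (1 + ?B))"
        by (rule power_le_fact_exp) (use c AB in auto)
      then have "(1 + ?B)^q * (c/2)^q \<le> fact q * exp (c/2) * exp ((c/2) * ?B)"
      proof -
        have "exp ((c/2) * (1 + ?B)) = exp (c/2) * exp ((c/2) * ?B)" by (simp add: distrib_left exp_add)
        with \<open>((c/2) * (1 + ?B))^q \<le> _\<close> show ?thesis by (simp only: power_mult_distrib mult_ac)
      qed
      then have 1: "(1 + ?B)^q \<le> fact q * exp (c/2) / (c/2)^q * exp ((c/2) * ?B)"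
        using c by (simp add: pos_le_divide_eq)
      have "\<bar>V w\<bar> \<le> K * (1 + ?B)^q" by (rule bound[OF w])
      also have "\<dots> \<le> \<bar>K\<bar> * (1 + ?B)^q" using AB by (intro mult_right_mono) auto
      also have "\<dots> \<le> \<bar>K\<bar> * (fact q * exp (c/2) / (c/2)^q * exp ((c/2) * ?B))"
        by (intro mult_left_mono 1) auto
      also have "\<dots> = C * exp ((c/2) * ?B)" by (simp add: C_def)
      finally have "exp ((c/2) * ?A) * \<bar>V w\<bar> \<le> exp ((c/2) * ?A) * (C * exp ((c/2) * ?B))"
        by (intro mult_left_mono) auto
      also have "\<dots> = C * exp ((c/2) * (?A + ?B))" by (simp only: distrib_left exp_add mult_ac)
      also have "\<dots> \<le> C * exp (c * (?A + ?B))"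
      proof (rule mult_left_mono)
        have "(c/2) * (?A + ?B) \<le> c * (?A + ?B)" using AB c by (intro mult_right_mono) auto
        then show "exp ((c/2) * (?A + ?B)) \<le> exp (c * (?A + ?B))" by simp
        show "0 \<le> C" using c unfolding C_def by simp
      qed
      finally have "exp ((c/2) * ?A) * \<bar>V w\<bar> \<le> C * exp (c * (?A + ?B))" .
      moreover have "0 \<le> C" using c unfolding C_def by simp
      ultimately show "norm (exp ((c/2) * lin m a x w) * V w) \<le> norm (C * exp (c * lin (m + p) a' x' w))"
        by (simp add: L abs_mult)
    qed
  qed measurable
  then show ?thesis using c by (intro exI[of _ "c/2"]) auto
qed

text \<open>Stands in for the sigma-algebra of the values \<open>Z x\<close> with
  \<open>x \<le> y\<close>: zero integral against all of \<open>past y\<close> expresses a vanishing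
  conditional expectation. Negative \<open>x\<close> are included, so \<open>past 0\<close> sees the
  whole left half-line.\<close>

inductive_set past :: "real \<Rightarrow> ('a \<Rightarrow> real) set" for y :: real where
  past_one: "(\<lambda>_. 1) \<in> past y"
| past_mult: "H \<in> past y \<Longrightarrow> x \<le> y \<Longrightarrow> continuous_on UNIV \<phi> \<Longrightarrow> (\<And>z. \<bar>\<phi> z\<bar> \<le> B) \<Longrightarrow> (\<lambda>w. H w * \<phi> (Z x w)) \<in> past y"

lemma past_measurable: "H \<in> past y \<Longrightarrow> H \<in> borel_measurable N"
proof (induction rule: past.induct)
  case (past_mult H x \<phi> B)
  note past_mult.IH[measurable]
  have [measurable]: "\<phi> \<in> borel_measurable borel" using past_mult(3) by (rule borel_measurable_continuous_onI)
  show ?case by measurable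
qed auto

lemma past_bounded: "H \<in> past y \<Longrightarrow> \<exists>B\<ge>0. \<forall>w. \<bar>H w\<bar> \<le> B"
proof (induction rule: past.induct)
  case past_one
  show ?case by (rule exI[of _ 1]) auto
next
  case (past_mult H x \<phi> B)
  then obtain B' where "B' \<ge> 0" "\<And>w. \<bar>H w\<bar> \<le> B'" by auto
  have "\<bar>\<phi> z\<bar> \<le> \<bar>B\<bar>" for z by (rule order.trans[OF past_mult(4) abs_ge_self])
  then have "\<bar>H w * \<phi> (Z x w)\<bar> \<le> B' * \<bar>B\<bar>" for w
    unfolding abs_mult using \<open>\<And>w. \<bar>H w\<bar> \<le> B'\<close> \<open>B' \<ge> 0\<close> by (intro mult_mono) auto
  then show ?case using \<open>B' \<ge> 0\<close> by (intro exI[of _ "B' * \<bar>B\<bar>"]) auto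
qed

lemma past_mono: "H \<in> past y \<Longrightarrow> y \<le> y' \<Longrightarrow> H \<in> past y'"
proof (induction rule: past.induct)
  case (past_mult H x \<phi> B)
  show ?case by (rule past.past_mult[OF past_mult.IH _ past_mult(3,4)]) (use past_mult in auto)
qed (rule past.past_one)

lemma bounded_mult_integrable:
  fixes H V :: "'a \<Rightarrow> real"
  assumes "integrable N V" "H \<in> borel_measurable N" "\<And>w. \<bar>H w\<bar> \<le> B"
  shows "integrable N (\<lambda>w. H w * V w)"
proof (rule Bochner_Integration.integrable_bound[of N "\<lambda>w. B * V w"])
  show "AE w in N. norm (H w * V w) \<le> norm (B * V w)"
    by (rule AE_I2) (auto simp: abs_mult intro!: mult_right_mono order.trans[OF assms(3) abs_ge_self])
qed (use assms in auto)

lemma past_mult_integrable: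
  fixes V :: "'a \<Rightarrow> real"
  shows "H \<in> past y \<Longrightarrow> integrable N V \<Longrightarrow> integrable N (\<lambda>w. H w * V w)"
  using past_bounded[of H y] past_measurable[of H y] bounded_mult_integrable[of V H] by blast

text \<open>The factors of \<open>H\<close> are traded one at a time for exponentials, by
  determinacy of Laplace transforms with the remaining integrand as signed weight. The induction
  therefore carries an extra factor \<open>exp (- lin m a x w)\<close>.\<close>

lemma past_orthogonal:
  assumes iV: "integrable N V"
    and V: "\<And>m a x. (\<And>i. i < m \<Longrightarrow> 0 \<le> a i \<and> x i \<le> y) \<Longrightarrow> (LINT w|N. exp (- lin m a x w) * V w) = 0"
    and H: "H \<in> past y"
  shows "(LINT w|N. H w * V w) = 0"
proof -
  have [measurable]: "V \<in> borel_measurable N" using iV by simp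
  have "(LINT w|N. H w * (exp (- lin m a x w) * V w)) = 0" if "\<And>i. i < m \<Longrightarrow> 0 \<le> a i \<and> x i \<le> y" for m a x
    using H that
  proof (induction arbitrary: m a x rule: past.induct)
    case past_one
    then show ?case using V[of m a x] by simp
  next
    case (past_mult H x' \<phi> B)
    note mH[measurable] = past_measurable[OF past_mult(1)]
    have ex: "\<bar>exp (- lin m a x w)\<bar> \<le> 1" if "w \<in> space N" for w
      using lin_nonneg[of m a w x] past_mult.prems that by auto
    have "integrable N (\<lambda>w. exp (- lin m a x w) * V w)"
    proof (rule Bochner_Integration.integrable_bound[OF iV])
      show "AE w in N. norm (exp (- lin m a x w) * V w) \<le> norm (V w)"
        unfolding norm_mult using ex by (intro AE_I2 mult_left_le_one_le) auto
    qed measurable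
    then have i: "integrable N (\<lambda>w. H w * (exp (- lin m a x w) * V w))"
      by (rule past_mult_integrable[OF past_mult(1)])
    have "(LINT w|N. \<phi> (Z x' w) * (H w * (exp (- lin m a x w) * V w))) = (LINT w|N. \<phi> (Z x' w) * 0)"
    proof (rule laplace_determines[OF i _ _ _ _ _ _ past_mult(3,4)])
      fix n :: nat
      define a' where "a' = a(m := real n)"
      define x'' where "x'' = x(m := x')"
      have "lin (Suc m) a' x'' w = lin m a x w + real n * Z x' w" for w
        by (simp add: lin_def a'_def x''_def)
      then have "exp (- lin (Suc m) a' x'' w) = exp (- (real n * Z x' w)) * exp (- lin m a x w)" for w
        by (simp add: exp_add[symmetric])
      moreover have "(LINT w|N. H w * (exp (- lin (Suc m) a' x'' w) * V w)) = 0"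
        using past_mult.prems past_mult(2) by (intro past_mult.IH) (auto simp: a'_def x''_def less_Suc_eq)
      ultimately show "(LINT w|N. exp (- (real n * Z x' w)) * (H w * (exp (- lin m a x w) * V w))) = (LINT w|N. exp (- (real n * Z x' w)) * 0)"
        by (simp add: mult_ac)
    qed (auto intro: Z_nonneg)
    then show ?case by (simp add: mult_ac)
  qed
  from this[of 0] show ?thesis by (simp add: lin_def)
qed

end

section \<open>Conditional moments of increments\<close>

lemma diff_power4:
  fixes a b :: real
  shows "(b - a)^4 = (\<Sum>k\<le>4. (-1)^k * real (4 choose k) * (a ^ (4 - k) * b ^ k))"
proof -
  have "{..4} = {0, 1, 2, 3, 4::nat}" by auto
  then have "(\<Sum>k\<le>4. (-1)^k * real (4 choose k) * (a ^ (4 - k) * b ^ k)) = a^4 - 4 * (a^3 * b) + 6 * (a^2 * b^2) - 4 * (a * b^3) + b^4"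
    by (simp add: eval_nat_numeral)
  also have "\<dots> = (b - a)^4" by algebra
  finally show ?thesis ..
qed

context kac_field
begin

text \<open>Two determinacy steps: vanishing moments of \<open>lin\<close> weighted by
  \<open>V\<close> give vanishing Laplace transforms, and these give orthogonality to
  \<open>past y\<close>. The growth bound on \<open>V\<close> supplies the exponential moments for
  the first step.\<close>

lemma cond_zero:
  assumes V[measurable]: "V \<in> borel_measurable N"
    and bound: "\<And>w. w \<in> space N \<Longrightarrow> \<bar>V w\<bar> \<le> K * (1 + lin p b r w)^q" and b: "\<And>i. i < p \<Longrightarrow> 0 \<le> b i"
    and mom: "\<And>m a x n. (\<And>i. i < m \<Longrightarrow> 0 \<le> a i \<and> x i \<le> y) \<Longrightarrow> (LINT w|N. lin m a x w ^ n * V w) = 0"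
    and H: "H \<in> past y"
  shows "(LINT w|N. H w * V w) = 0"
proof (rule past_orthogonal[OF _ _ H])
  obtain c where "integrable N (\<lambda>w. exp (c * lin 0 (\<lambda>_. 0) (\<lambda>_. 0) w) * V w)"
    using exp_integrable_family[of 0 "\<lambda>_. 0" V K p b r q "\<lambda>_. 0", OF _ V bound b] by blast
  then show "integrable N V" by (simp add: lin_def)
  fix m and a x :: "nat \<Rightarrow> real"
  assume ax: "\<And>i. i < m \<Longrightarrow> 0 \<le> a i \<and> x i \<le> y"
  obtain c where c: "0 < c" "integrable N (\<lambda>w. exp (c * lin m a x w) * V w)"
    using exp_integrable_family[of m a V K p b r q x, OF _ V bound b] ax by blast
  have "(LINT w|N. exp (-(1 * lin m a x w)) * V w) = (LINT w|N. exp (-(1 * lin m a x w)) * 0)"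
    by (rule moments_determine_laplace[OF c(1,2)]) (use ax mom[of m a x] in \<open>auto intro!: lin_nonneg\<close>)
  then show "(LINT w|N. exp (- lin m a x w) * V w) = 0" by simp
qed

lemma lin_pair: "lin 2 (\<lambda>_. 1) (\<lambda>i. if i = 0 then y else y') w = Z y w + Z y' w"
  by (simp add: lin_def numeral_2_eq_2)

lemma Z_power_integrable: "integrable N (\<lambda>w. Z y w ^ n)"
  by (rule single_moment(1))

lemma Z_pair_integrable: "integrable N (\<lambda>w. Z y w ^ n * Z y' w ^ k)"
  using mixed_moment(1)[of 1 "\<lambda>_. 1" "\<lambda>_. y" n y' k] by (simp add: lin_def)

text \<open>The factor \<open>exp (- g * h)^2\<close> comes from the two crossing links of a chain
  with a single visit.\<close>

lemma cond_first:
  assumes y: "0 \<le> y" and h: "0 \<le> h" and H: "H \<in> past y"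
  shows "(LINT w|N. H w * Z (y + h) w) = exp (- g * h)^2 * (LINT w|N. H w * Z y w)"
proof -
  define e where "e = exp (- g * h)"
  have e: "0 \<le> e" "e \<le> 1" using g h by (auto simp: e_def)
  have e2: "0 \<le> e^2" "e^2 \<le> 1" using e by (auto simp: power_le_one)
  have "(LINT w|N. H w * (Z (y + h) w - e^2 * Z y w)) = 0"
  proof (rule cond_zero[OF _ _ _ _ H])
    fix w assume w: "w \<in> space N"
    have "\<bar>Z (y + h) w - e^2 * Z y w\<bar> \<le> \<bar>Z (y + h) w\<bar> + e^2 * \<bar>Z y w\<bar>"
      by (rule order.trans[OF abs_triangle_ineq4]) (simp add: abs_mult)
    also have "\<dots> \<le> Z (y + h) w + 1 * Z y w" using e2 Z_nonneg[OF w] by (intro add_mono mult_mono) auto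
    finally show "\<bar>Z (y + h) w - e^2 * Z y w\<bar> \<le> 1 * (1 + lin 2 (\<lambda>_. 1) (\<lambda>i. if i = 0 then y else (y + h)) w)^1"
      unfolding lin_pair by simp
  next
    fix m n and a x :: "nat \<Rightarrow> real"
    assume ax: "\<And>i. i < m \<Longrightarrow> 0 \<le> a i \<and> x i \<le> y"
    then have a: "\<And>i. i < m \<Longrightarrow> 0 \<le> a i" by blast
    have mm: "integrable N (\<lambda>w. lin m a x w ^ n * Z r w ^ k)" "(LINT w|N. lin m a x w ^ n * Z r w ^ k) = fact n * fact k * kac2 g m a x r n k 0" for r k
      using mixed_moment[of m a x n r k] a by auto
    have "(LINT w|N. lin m a x w ^ n * (Z (y + h) w - e^2 * Z y w)) = (LINT w|N. lin m a x w ^ n * Z (y + h) w ^ 1 - e^2 * (lin m a x w ^ n * Z y w ^ 1))"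
      by (simp add: algebra_simps)
    also have "\<dots> = fact n * fact 1 * kac2 g m a x (y + h) n 1 0 - e^2 * (fact n * fact 1 * kac2 g m a x y n 1 0)"
      by (subst Bochner_Integration.integral_diff, rule mm, rule integrable_mult_right, rule mm, subst integral_mult_right_zero, subst (1 2) mm, rule refl)
    also have "\<dots> = 0"
      using kac2_one_shift(4)[OF g y h, of m x 0 a n] ax y by (simp add: e_def)
    finally show "(LINT w|N. lin m a x w ^ n * (Z (y + h) w - e^2 * Z y w)) = 0" .
  qed auto
  moreover have "integrable N (\<lambda>w. H w * Z (y + h) w)" "integrable N (\<lambda>w. H w * Z y w)"
    using past_mult_integrable[OF H] Z_power_integrable[of _ 1] by auto
  moreover have "H w * (Z (y + h) w - e^2 * Z y w) = H w * Z (y + h) w - e^2 * (H w * Z y w)" for w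
    by (simp add: algebra_simps)
  ultimately show ?thesis by (simp add: e_def)
qed

text \<open>The summand with \<open>Z y\<close> comes from consecutive double visits; its factor 2
  is \<open>fact 2 / fact 1\<close>, the ratio of the factorials in the mixed moments.\<close>

lemma cond_second:
  assumes y: "0 \<le> y" and h: "0 \<le> h" and H: "H \<in> past y"
  defines "e \<equiv> exp (- g * h)"
  shows "(LINT w|N. H w * Z (y + h) w^2) = e^4 * (LINT w|N. H w * Z y w^2) + 2 * (e^2 - e^4) / g * (LINT w|N. H w * Z y w)"
proof -
  have e: "0 \<le> e" "e \<le> 1" using g h by (auto simp: e_def)
  define c where "c = 2 * (e^2 - e^4) / g"
  have e2: "0 \<le> e^4" "e^4 \<le> 1" "e^4 \<le> e^2" using e by (auto simp: power_le_one intro!: power_decreasing)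
  have c: "0 \<le> c" using e2 g by (simp add: c_def)
  have "(LINT w|N. H w * (Z (y + h) w^2 - e^4 * Z y w^2 - c * Z y w)) = 0"
  proof (rule cond_zero[OF _ _ _ _ H])
    fix w assume w: "w \<in> space N"
    let ?A = "Z y w" and ?B = "Z (y + h) w"
    have AB: "0 \<le> ?A" "0 \<le> ?B" using Z_nonneg[OF w] by auto
    have "\<bar>?B^2 - e^4 * ?A^2 - c * ?A\<bar> \<le> \<bar>?B^2 - e^4 * ?A^2\<bar> + \<bar>c * ?A\<bar>" by (rule abs_triangle_ineq4)
    also have "\<dots> \<le> (\<bar>?B^2\<bar> + \<bar>e^4 * ?A^2\<bar>) + \<bar>c * ?A\<bar>" by (intro add_right_mono abs_triangle_ineq4)
    also have "\<dots> = (?B^2 + e^4 * ?A^2) + c * ?A" using AB c e by (simp add: abs_mult)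
    also have "\<dots> \<le> (?B^2 + 1 * ?A^2) + c * ?A" using e2 AB by (intro add_mono mult_right_mono) auto
    also have "\<dots> \<le> (1 + c) * (1 + (?A + ?B))^2"
    proof -
      have "?B^2 + ?A^2 \<le> (1 + (?A + ?B))^2" "?A \<le> (1 + (?A + ?B))^2"
        using AB by (auto simp: power2_eq_square algebra_simps)
      then have "?B^2 + ?A^2 + c * ?A \<le> (1 + (?A + ?B))^2 + c * (1 + (?A + ?B))^2"
        using c by (intro add_mono mult_left_mono) auto
      then show ?thesis by (simp add: algebra_simps)
    qed
    finally show "\<bar>Z (y + h) w^2 - e^4 * Z y w^2 - c * Z y w\<bar> \<le> (1 + c) * (1 + lin 2 (\<lambda>_. 1) (\<lambda>i. if i = 0 then y else (y + h)) w)^2"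
      unfolding lin_pair .
  next
    fix m n and a x :: "nat \<Rightarrow> real"
    assume ax: "\<And>i. i < m \<Longrightarrow> 0 \<le> a i \<and> x i \<le> y"
    then have a: "\<And>i. i < m \<Longrightarrow> 0 \<le> a i" by blast
    have mm: "integrable N (\<lambda>w. lin m a x w ^ n * Z r w ^ k)" "(LINT w|N. lin m a x w ^ n * Z r w ^ k) = fact n * fact k * kac2 g m a x r n k 0" for r k
      using mixed_moment[of m a x n r k] a by auto
    have "(LINT w|N. lin m a x w ^ n * (Z (y + h) w^2 - e^4 * Z y w^2 - c * Z y w))
       = (LINT w|N. lin m a x w ^ n * Z (y + h) w ^ 2 - e^4 * (lin m a x w ^ n * Z y w ^ 2) - c * (lin m a x w ^ n * Z y w ^ 1))"
      by (simp add: algebra_simps)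
    also have "\<dots> = fact n * fact 2 * kac2 g m a x (y + h) n 2 0 - e^4 * (fact n * fact 2 * kac2 g m a x y n 2 0) - c * (fact n * fact 1 * kac2 g m a x y n 1 0)"
      by (subst Bochner_Integration.integral_diff, intro Bochner_Integration.integrable_diff integrable_mult_right mm, intro integrable_mult_right mm,
        subst Bochner_Integration.integral_diff, rule mm, intro integrable_mult_right mm, subst (1 2) integral_mult_right_zero, subst (1 2 3) mm, rule refl)
    also have "\<dots> = 0"
      using kac2_one_shift(5)[OF g y h, of m x 0 a n] ax y unfolding e_def[symmetric]
      by (simp add: c_def algebra_simps)
    finally show "(LINT w|N. lin m a x w ^ n * (Z (y + h) w^2 - e^4 * Z y w^2 - c * Z y w)) = 0" .
  qed auto
  moreover have "integrable N (\<lambda>w. H w * Z (y + h) w^2)" "integrable N (\<lambda>w. H w * Z y w^2)" "integrable N (\<lambda>w. H w * Z y w)"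
    using past_mult_integrable[OF H] Z_power_integrable[of _ 1] Z_power_integrable[of _ 2] by auto
  moreover have "H w * (Z (y + h) w^2 - e^4 * Z y w^2 - c * Z y w) = H w * Z (y + h) w^2 - e^4 * (H w * Z y w^2) - c * (H w * Z y w)" for w
    by (simp add: algebra_simps)
  ultimately have "(LINT w|N. H w * Z (y + h) w^2) - e^4 * (LINT w|N. H w * Z y w^2) - c * (LINT w|N. H w * Z y w) = 0"
    by simp
  then show ?thesis by (simp add: c_def)
qed

text \<open>\<open>Z y\<close> is unbounded, so its product with \<open>H\<close> is not itself a
  test function of the past. It is truncated, \<open>cond_first\<close> is applied, and the
  truncation is removed by dominated convergence.\<close>

lemma cond_product:
  assumes y: "0 \<le> y" and h: "0 \<le> h" and H: "H \<in> past y"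
  shows "(LINT w|N. H w * (Z y w * Z (y + h) w)) = exp (- g * h)^2 * (LINT w|N. H w * Z y w^2)"
proof -
  define \<phi> where "\<phi> k z = max 0 (min z (real k))" for k and z :: real
  have c: "continuous_on UNIV (\<phi> k)" for k unfolding \<phi>_def by (intro continuous_intros)
  have B: "\<bar>\<phi> k z\<bar> \<le> real k" for k z by (simp add: \<phi>_def)
  have [measurable]: "\<phi> k \<in> borel_measurable borel" for k using c by (rule borel_measurable_continuous_onI)
  note mH[measurable] = past_measurable[OF H]
  have lim: "(\<lambda>k. LINT w|N. H w * \<phi> k (Z y w) * Z y' w) \<longlonglongrightarrow> (LINT w|N. H w * (Z y w * Z y' w))" for y'
  proof (rule integral_dominated_convergence[where w="\<lambda>w. \<bar>H w * (Z y w * Z y' w)\<bar>"])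
    show "integrable N (\<lambda>w. \<bar>H w * (Z y w * Z y' w)\<bar>)"
      using past_mult_integrable[OF H] Z_pair_integrable[of y 1 y' 1] by (intro integrable_abs) auto
    show "AE w in N. (\<lambda>k. H w * \<phi> k (Z y w) * Z y' w) \<longlonglongrightarrow> H w * (Z y w * Z y' w)"
    proof (rule AE_I2, rule tendsto_eventually)
      fix w assume w: "w \<in> space N"
      have "\<forall>\<^sub>F k in sequentially. Z y w \<le> real k"
        using filterlim_real_sequentially unfolding filterlim_at_top by auto
      then show "\<forall>\<^sub>F k in sequentially. H w * \<phi> k (Z y w) * Z y' w = H w * (Z y w * Z y' w)"
        by eventually_elim (use Z_nonneg[OF w] in \<open>simp add: \<phi>_def\<close>)
    qed
    show "AE w in N. norm (H w * \<phi> k (Z y w) * Z y' w) \<le> \<bar>H w * (Z y w * Z y' w)\<bar>" for k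
    proof (rule AE_I2)
      fix w assume w: "w \<in> space N"
      have "\<bar>\<phi> k (Z y w)\<bar> \<le> \<bar>Z y w\<bar>" using Z_nonneg[OF w] by (auto simp: \<phi>_def)
      then have "\<bar>H w\<bar> * (\<bar>\<phi> k (Z y w)\<bar> * \<bar>Z y' w\<bar>) \<le> \<bar>H w\<bar> * (\<bar>Z y w\<bar> * \<bar>Z y' w\<bar>)"
        by (intro mult_left_mono mult_right_mono) auto
      then show "norm (H w * \<phi> k (Z y w) * Z y' w) \<le> \<bar>H w * (Z y w * Z y' w)\<bar>" by (simp add: abs_mult mult.assoc)
    qed
  qed measurable
  have "(\<lambda>w. H w * \<phi> k (Z y w)) \<in> past y" for k
    by (rule past_mult[OF H _ c B]) simp
  from cond_first[OF y h this]
  have "(\<lambda>k. LINT w|N. H w * \<phi> k (Z y w) * Z (y + h) w) = (\<lambda>k. exp (- g * h)^2 * (LINT w|N. H w * \<phi> k (Z y w) * Z y w))"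
    by auto
  with lim[of "y + h"] have "(\<lambda>k. exp (- g * h)^2 * (LINT w|N. H w * \<phi> k (Z y w) * Z y w)) \<longlonglongrightarrow> (LINT w|N. H w * (Z y w * Z (y + h) w))" by simp
  moreover have "(\<lambda>k. exp (- g * h)^2 * (LINT w|N. H w * \<phi> k (Z y w) * Z y w)) \<longlonglongrightarrow> exp (- g * h)^2 * (LINT w|N. H w * (Z y w * Z y w))"
    by (intro tendsto_mult_left lim)
  ultimately show ?thesis unfolding power2_eq_square[of "Z y _"] by (rule LIMSEQ_unique)
qed

text \<open>To first order in \<open>h\<close> the factor is \<open>-2 * g * h\<close>, the drift of
  the diffusion.\<close>

lemma increment_first:
  assumes y: "0 \<le> y" and h: "0 \<le> h" and H: "H \<in> past y"
  shows "(LINT w|N. H w * (Z (y + h) w - Z y w)) = (exp (- g * h)^2 - 1) * (LINT w|N. H w * Z y w)"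
proof -
  have "integrable N (\<lambda>w. H w * Z (y + h) w)" "integrable N (\<lambda>w. H w * Z y w)"
    using past_mult_integrable[OF H] Z_power_integrable[of _ 1] by auto
  then show ?thesis by (simp add: right_diff_distrib cond_first[OF y h H] left_diff_distrib)
qed

text \<open>To first order in \<open>h\<close> the right side is \<open>4 * h\<close> times the
  integral of \<open>H w * Z y w\<close>, which is the second-order part \<open>2 * z * f''\<close>
  of the generator.\<close>

lemma increment_second:
  assumes y: "0 \<le> y" and h: "0 \<le> h" and H: "H \<in> past y"
  defines "e \<equiv> exp (- g * h)"
  shows "(LINT w|N. H w * (Z (y + h) w - Z y w)^2) = (1 - e^2)^2 * (LINT w|N. H w * Z y w^2) + 2 * (e^2 - e^4) / g * (LINT w|N. H w * Z y w)"
proof -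
  have i: "integrable N (\<lambda>w. H w * Z (y + h) w^2)" "integrable N (\<lambda>w. H w * Z y w^2)" "integrable N (\<lambda>w. H w * (Z y w * Z (y + h) w))"
    using past_mult_integrable[OF H] Z_pair_integrable[of y 1 "y+h" 1] Z_power_integrable[of _ 2] by auto
  have "(LINT w|N. H w * (Z (y + h) w - Z y w)^2) = (LINT w|N. H w * Z (y + h) w^2 - 2 * (H w * (Z y w * Z (y + h) w)) + H w * Z y w^2)"
    by (simp add: power2_eq_square algebra_simps)
  also have "\<dots> = (LINT w|N. H w * Z (y + h) w^2) - 2 * (LINT w|N. H w * (Z y w * Z (y + h) w)) + (LINT w|N. H w * Z y w^2)"
    using i by simp
  finally show ?thesis unfolding cond_second[OF y h H] cond_product[OF y h H] e_def[symmetric]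
    by (simp add: algebra_simps power2_eq_square eval_nat_numeral)
qed

text \<open>Of order \<open>h^2\<close>. It is stated without a test function because it enters only
  the Taylor remainder, where test functions are bounded by their supremum.\<close>

lemma increment_fourth:
  assumes y: "0 \<le> y" and h: "0 \<le> h"
  defines "e \<equiv> exp (- g * h)"
  shows "integrable N (\<lambda>w. (Z (y + h) w - Z y w)^4)"
    "(LINT w|N. (Z (y + h) w - Z y w)^4) = 24 * ((1 - e^2)^2 * (exp (-g * y))^2 / g^5)"
proof -
  have eq: "(Z (y + h) w - Z y w)^4 = (\<Sum>k\<le>4. (-1)^k * real (4 choose k) * (Z y w ^ (4 - k) * Z (y + h) w ^ k))" for w
    by (rule diff_power4)
  have i: "integrable N (\<lambda>w. Z y w ^ (4 - k) * Z (y + h) w ^ k)" for k by (rule Z_pair_integrable)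
  show "integrable N (\<lambda>w. (Z (y + h) w - Z y w)^4)" unfolding eq
    by (intro Bochner_Integration.integrable_sum integrable_mult_right i)
  have "(LINT w|N. (Z (y + h) w - Z y w)^4) = (\<Sum>k\<le>4. (-1)^k * real (4 choose k) * (LINT w|N. Z y w ^ (4 - k) * Z (y + h) w ^ k))"
    unfolding eq by (subst Bochner_Integration.integral_sum) (auto intro!: i)
  also have "\<dots> = (\<Sum>k\<le>4. 24 * ((-1)^k * kac2 g 1 (\<lambda>_. 1) (\<lambda>_. y) (y + h) (4 - k) k 0))"
  proof (rule sum.cong)
    fix k :: nat assume "k \<in> {..4}"
    then have k: "k \<le> 4" by simp
    have "(LINT w|N. Z y w ^ (4 - k) * Z (y + h) w ^ k) = fact (4 - k) * fact k * kac2 g 1 (\<lambda>_. 1) (\<lambda>_. y) (y + h) (4 - k) k 0"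
      using mixed_moment(2)[of 1 "\<lambda>_. 1" "\<lambda>_. y" "4 - k" "y + h" k] by (simp add: lin_def)
    moreover have "real (4 choose k) * (fact (4 - k) * fact k) = 24"
    proof -
      have "k = 0 \<or> k = 1 \<or> k = 2 \<or> k = 3 \<or> k = 4" using k by linarith
      then show ?thesis by (auto simp: fact_numeral eval_nat_numeral)
    qed
    ultimately show "(-1)^k * real (4 choose k) * (LINT w|N. Z y w ^ (4 - k) * Z (y + h) w ^ k) = 24 * ((-1)^k * kac2 g 1 (\<lambda>_. 1) (\<lambda>_. y) (y + h) (4 - k) k 0)"
      by (simp add: mult_ac)
  qed simp
  also have "\<dots> = 24 * ((1 - e^2)^2 * (exp (-g * y))^2 / g^5)"
    unfolding sum_distrib_left[symmetric] kac2_fourth[OF g y h] e_def ..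
  finally show "(LINT w|N. (Z (y + h) w - Z y w)^4) = 24 * ((1 - e^2)^2 * (exp (-g * y))^2 / g^5)" .
qed

end

section \<open>The one-step estimate for the martingale\<close>

lemma exp_taylor_bounds:
  fixes x :: real
  assumes "0 \<le> x"
  shows "\<bar>exp (-x) - 1 + x\<bar> \<le> x^2 / 2" "\<bar>exp (-x) - 1 + x * exp (-x)\<bar> \<le> x^2" "1 - exp (-x) \<le> x"
proof -
  show 3: "1 - exp (-x) \<le> x" using exp_ge_add_one_self[of "-x"] by simp
  have "1 + x + x^2/2 \<le> exp x" using exp_lower_Taylor_quadratic[OF assms] .
  have "0 - 0 + 0 - 0^2/2 \<le> 1 - exp (-x) - x + x^2/2 + 0"
  proof -
    have "1 - exp (-0) - 0 + 0^2/2 \<le> 1 - exp (-x) - x + x^2/2"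
    proof (rule DERIV_nonneg_imp_nondecreasing[OF assms])
      fix t :: real assume "0 \<le> t"
      show "\<exists>y. ((\<lambda>x. 1 - exp (-x) - x + x^2/2) has_real_derivative y) (at t) \<and> 0 \<le> y"
        using exp_ge_add_one_self[of "-t"] by (intro exI[of _ "exp (-t) - 1 + t"]) (auto intro!: derivative_eq_intros)
    qed
    then show ?thesis by simp
  qed
  then have "exp (-x) - 1 + x \<le> x^2/2" by simp
  then show 1: "\<bar>exp (-x) - 1 + x\<bar> \<le> x^2 / 2" using 3 by simp
  have "(exp (-x) - 1) * (1 + x) \<le> 0" using assms by (intro mult_nonpos_nonneg) auto
  then have u: "exp (-x) - 1 + x * exp (-x) \<le> x" by (simp add: algebra_simps)
  have "(1 + x) * exp (-x) \<le> exp x * exp (-x)" using exp_ge_add_one_self[of x] by (intro mult_right_mono) auto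
  then have "exp (-x) - 1 + x * exp (-x) \<le> 0" by (simp add: exp_add[symmetric] algebra_simps)
  moreover have "- (x^2) \<le> exp (-x) - 1 + x * exp (-x)"
  proof -
    have "(1 - x) * (1 + x) \<le> exp (-x) * (1 + x)" using exp_ge_add_one_self[of "-x"] assms by (intro mult_right_mono) auto
    then show ?thesis by (simp add: algebra_simps power2_eq_square)
  qed
  ultimately show "\<bar>exp (-x) - 1 + x * exp (-x)\<bar> \<le> x^2" by simp
qed

text \<open>Replaces a third absolute moment by even ones. With \<open>s = sqrt h\<close>, second
  moments of order \<open>h\<close> and fourth moments of order \<open>h^2\<close> both contribute
  \<open>h * sqrt h\<close>.\<close>

lemma abs_cube_le:
  fixes d :: real assumes s: "0 < s"
  shows "\<bar>d\<bar>^3 \<le> (s * d^2 + d^4 / s) / 2"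
proof -
  define a where "a = \<bar>d\<bar>"
  have "0 \<le> (s - a)^2 * a^2 / s" using s by auto
  also have "(s - a)^2 * a^2 / s = s * a^2 - 2 * a^3 + a^4 / s"
    using s by (simp add: field_simps eval_nat_numeral)
  finally have "a^3 \<le> (s * a^2 + a^4 / s) / 2" by simp
  then show ?thesis by (simp add: a_def power_even_abs)
qed

context kac_field
begin

lemma moment_le: "(LINT w|N. Z y w ^ n) \<le> fact n / g ^ (Suc n)"
proof -
  have "(LINT w|N. Z y w ^ n) = fact n * kac g 1 (\<lambda>_. 1) (\<lambda>_. y) n 0" by (rule single_moment(2))
  also have "\<dots> \<le> fact n * ((1 / g)^n / g)"
    using kac_le[OF g, of 1 "\<lambda>_. 1" "\<lambda>_. y" n 0] by (intro mult_left_mono) auto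
  finally show ?thesis by (simp add: power_divide mult.commute)
qed

lemma bounded_abs_integral_le:
  fixes H V :: "'a \<Rightarrow> real"
  assumes "integrable N V" "H \<in> borel_measurable N" "\<And>w. w \<in> space N \<Longrightarrow> \<bar>H w\<bar> \<le> B" "\<And>w. w \<in> space N \<Longrightarrow> 0 \<le> V w" "0 \<le> B"
  shows "\<bar>LINT w|N. H w * V w\<bar> \<le> B * (LINT w|N. V w)" "integrable N (\<lambda>w. H w * V w)"
proof -
  have le: "\<bar>H w * V w\<bar> \<le> B * V w" if "w \<in> space N" for w
    using assms(3,4)[OF that] by (simp add: abs_mult mult_right_mono)
  show i: "integrable N (\<lambda>w. H w * V w)"
  proof (rule Bochner_Integration.integrable_bound[of N "\<lambda>w. B * V w"])
    show "AE w in N. norm (H w * V w) \<le> norm (B * V w)"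
      using le by (intro AE_I2) (metis abs_ge_self order.trans real_norm_def)
  qed (use assms in auto)
  have "\<bar>LINT w|N. H w * V w\<bar> \<le> (LINT w|N. \<bar>H w * V w\<bar>)" by (rule integral_abs_bound)
  also have "\<dots> \<le> (LINT w|N. B * V w)" using i assms le by (intro integral_mono) auto
  finally show "\<bar>LINT w|N. H w * V w\<bar> \<le> B * (LINT w|N. V w)" by simp
qed

text \<open>The argument of \<open>w0\<close> is shifted by \<open>\<eta> > 0\<close> because \<open>w0\<close> is differentiable only on the open half line;
  the potential is adapted so that the shifted function still satisfies its equation exactly.\<close>

definition potential :: "real \<Rightarrow> real \<Rightarrow> real" where
  "potential \<eta> z = max 0 z * (max 0 z + \<eta>)^2 / 8"

definition wshift :: "real \<Rightarrow> real \<Rightarrow> real" where "wshift \<eta> z = w0 (max 0 z + \<eta>)"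

lemma potential_nonneg: "0 \<le> potential \<eta> z" by (simp add: potential_def)

lemma potential_cont: "continuous_on UNIV (potential \<eta>)"
  unfolding potential_def by (intro continuous_intros) auto

lemma shifted_cont:
  fixes f f' :: "real \<Rightarrow> real"
  assumes \<eta>: "0 < \<eta>" and f: "\<And>z. 0 < z \<Longrightarrow> DERIV f z :> f' z"
  shows "continuous_on UNIV (\<lambda>z. f (max 0 z + \<eta>))"
proof -
  have "continuous_on {0<..} f" using f by (intro DERIV_continuous_on) (auto intro: has_field_derivative_at_within)
  moreover have "continuous_on UNIV (\<lambda>z::real. max 0 z + \<eta>)" by (intro continuous_intros)
  ultimately show ?thesis
    by (rule continuous_on_compose2) (use \<eta> in \<open>auto simp: max_def\<close>)
qed

lemma wshift_cont: "0 < \<eta> \<Longrightarrow> continuous_on UNIV (wshift \<eta>)"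
  unfolding wshift_def by (rule shifted_cont[OF _ DERIV_w])

lemma wshift_bound: "0 < \<eta> \<Longrightarrow> \<bar>wshift \<eta> z\<bar> \<le> 1"
  unfolding wshift_def using w_nonneg[of "max 0 z + \<eta>"] w_le_1[of "max 0 z + \<eta>"] by auto

text \<open>In the second-order Taylor expansion of \<open>wshift\<close> the conditional first and
  second moments of the increment produce the generator, which the differential equation cancels
  against the killing. What is left is of order \<open>h * sqrt h\<close> with a constant that
  depends on neither \<open>y\<close> nor \<open>H\<close>.\<close>

lemma one_step:
  assumes \<eta>: "0 < \<eta>" "\<eta> \<le> 1"
  obtains C where "\<And>y h H. 0 \<le> y \<Longrightarrow> 0 < h \<Longrightarrow> h \<le> 1 \<Longrightarrow> H \<in> past y \<Longrightarrow> (\<And>w. \<bar>H w\<bar> \<le> 1) \<Longrightarrow>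
    \<bar>LINT w|N. H w * (exp (- (h * potential \<eta> (Z y w))) * wshift \<eta> (Z (y + h) w) - wshift \<eta> (Z y w))\<bar> \<le> C * (h * sqrt h)"
proof -
  obtain C1 where C1: "0 \<le> C1" "\<And>z. 0 < z \<Longrightarrow> \<bar>w1 z\<bar> \<le> C1" "\<And>z. 0 < z \<Longrightarrow> \<bar>w2 z\<bar> \<le> C1" "\<And>z. 0 < z \<Longrightarrow> \<bar>w3 z\<bar> \<le> C1"
    using w_deriv_bounded by blast
  define F1 where "F1 z = w1 (max 0 z + \<eta>)" for z
  define F2 where "F2 z = w2 (max 0 z + \<eta>)" for z
  let ?F = "wshift \<eta>" and ?V = "potential \<eta>"
  have cF: "continuous_on UNIV ?F" "continuous_on UNIV F1" "continuous_on UNIV F2"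
    unfolding F1_def F2_def using \<eta> by (auto intro: wshift_cont shifted_cont[OF _ DERIV_w1] shifted_cont[OF _ DERIV_w2])
  have bF: "\<bar>?F z\<bar> \<le> 1" "\<bar>F1 z\<bar> \<le> C1" "\<bar>F2 z\<bar> \<le> C1" for z
    unfolding F1_def F2_def using \<eta> by (auto intro!: wshift_bound C1)
  have [measurable]: "?F \<in> borel_measurable borel" "F1 \<in> borel_measurable borel" "F2 \<in> borel_measurable borel" "?V \<in> borel_measurable borel"
    using cF potential_cont by (auto intro: borel_measurable_continuous_onI)
  \<comment> \<open>\<open>m1\<close> and \<open>m2\<close> bound the first two moments of
    \<open>Z y\<close>. \<open>m6\<close> bounds the second moment of the potential, a cubic, by way
    of \<open>(1 + z)^6 \<le> 64 * (1 + z^6)\<close> and \<open>fact 6 = 720\<close>.\<close>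
  define m1 where "m1 = 1 / g^2"
  define m2 where "m2 = 2 / g^3"
  define m6 where "m6 = 64 * (1 / g + 720 / g^7)"
  have m: "0 \<le> m1" "0 \<le> m2" "0 \<le> m6" using g by (auto simp: m1_def m2_def m6_def)
  define C where "C = 2 * g^2 * (C1 * m1) + 2 * g^2 * (C1 * m2) + 6 * g * (C1 * m1) + C1 * ((4 * g^2 * m2 + 4 * m1) + 96 / g^3) / 2 + m6"
  show ?thesis
  proof (rule that[of C])
    fix y h :: real and H :: "'a \<Rightarrow> real"
    assume y: "0 \<le> y" and h: "0 < h" "h \<le> 1" and H: "H \<in> past y" and H1: "\<And>w. \<bar>H w\<bar> \<le> 1"
    note mH[measurable] = past_measurable[OF H]
    define Y where "Y = Z y"
    define Y' where "Y' = Z (y + h)"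
    define D where "D w = Y' w - Y w" for w
    define E where "E z = exp (- (h * ?V z))" for z
    have [measurable]: "Y \<in> borel_measurable N" "Y' \<in> borel_measurable N" "D \<in> borel_measurable N" "E \<in> borel_measurable borel"
      unfolding Y_def Y'_def D_def E_def by measurable
    have Y0: "0 \<le> Y w" "0 \<le> Y' w" if "w \<in> space N" for w using Z_nonneg[OF that] by (auto simp: Y_def Y'_def)
    have E: "0 \<le> E z" "E z \<le> 1" "\<bar>E z\<bar> \<le> 1" for z unfolding E_def using h potential_nonneg[of \<eta> z] by auto
    have cE: "continuous_on UNIV E" unfolding E_def
      by (intro continuous_intros) (use potential_cont in auto)
    \<comment> \<open>Here \<open>e\<close> is the square of the \<open>e\<close> in the lemmas on
      increments, so \<open>e - e^2\<close> stands for their \<open>e^2 - e^4\<close>.\<close>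
    define e where "e = exp (- g * h)^2"
    have e: "e = exp (- (2 * g * h))" by (simp add: e_def exp_double[symmetric])
    have e01: "0 \<le> e" "e \<le> 1" unfolding e using g h by auto
    have gh: "0 \<le> 2 * g * h" using g h by simp
    have e1: "1 - e \<le> 2 * g * h" "\<bar>e - 1 + 2 * g * h\<bar> \<le> 2 * g^2 * h^2"
      using exp_taylor_bounds(1,3)[OF gh] unfolding e by (auto simp: power_mult_distrib)
    have e2: "(1 - e)^2 \<le> 4 * g^2 * h^2"
      using power_mono[OF e1(1), of 2] e01 by (simp add: power_mult_distrib)
    have e3: "\<bar>(e - e^2) / g - 2 * h\<bar> \<le> 6 * g * h^2"
    proof -
      have "\<bar>(e - e^2) - 2 * g * h\<bar> = \<bar>(1 - e - 2 * g * h) - (1 - e)^2\<bar>" by (simp add: power2_eq_square algebra_simps)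
      also have "\<dots> \<le> 2 * g^2 * h^2 + 4 * g^2 * h^2"      proof (rule order.trans[OF abs_triangle_ineq4], rule add_mono)
        show "\<bar>1 - e - 2 * g * h\<bar> \<le> 2 * g^2 * h^2" using e1(2) by linarith
        show "\<bar>(1 - e)^2\<bar> \<le> 4 * g^2 * h^2" using e2 by simp
      qed
      finally have "\<bar>(e - e^2) - 2 * g * h\<bar> / g \<le> 6 * g^2 * h^2 / g" using g by (intro divide_right_mono) auto
      moreover have "\<bar>(e - e^2) - 2 * g * h\<bar> / g = \<bar>(e - e^2) / g - 2 * h\<bar>"
      proof -
        have "(e - e^2) / g - 2 * h = ((e - e^2) - 2 * g * h) / g" using g by (simp add: field_simps)
        then show ?thesis using g by (simp add: abs_divide)
      qed
      ultimately show ?thesis using g by (simp add: power2_eq_square)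
    qed
    have iY: "integrable N (\<lambda>w. Y w ^ n)" for n unfolding Y_def by (rule Z_power_integrable)
    have iY1: "integrable N Y" "integrable N (\<lambda>w. Y w ^ 2)" using iY[of 1] iY[of 2] by auto
    have EY: "(LINT w|N. Y w) \<le> m1" "(LINT w|N. Y w ^ 2) \<le> m2"
      using moment_le[of y 1] moment_le[of y 2] by (auto simp: Y_def m1_def m2_def eval_nat_numeral)
    have EY0: "0 \<le> (LINT w|N. Y w)" using Y0 by (intro Bochner_Integration.integral_nonneg) auto
    have iD4: "integrable N (\<lambda>w. D w ^ 4)" unfolding D_def Y_def Y'_def using increment_fourth(1)[OF y, of h] h by simp
    have ED4: "(LINT w|N. D w ^ 4) \<le> 96 / g^3 * h^2"
    proof -
      have "(LINT w|N. D w ^ 4) = 24 * ((1 - e)^2 * (exp (-g * y))^2 / g^5)"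
        unfolding D_def Y_def Y'_def e_def using increment_fourth(2)[OF y, of h] h by simp
      also have "\<dots> \<le> 24 * ((4 * g^2 * h^2) * 1 / g^5)"
        using g y e2 by (intro mult_left_mono divide_right_mono mult_mono) (auto simp: power_le_one)
      also have "\<dots> = 96 / g^3 * h^2" using g by (simp add: field_simps eval_nat_numeral)
      finally show ?thesis .
    qed
    have iD2: "integrable N (\<lambda>w. D w ^ 2)"
    proof -
      have "(\<lambda>w. D w ^ 2) = (\<lambda>w. Y' w ^ 2 - 2 * (Y w ^ 1 * Y' w ^ 1) + Y w ^ 2)" by (auto simp: D_def power2_eq_square algebra_simps)
      then show ?thesis unfolding Y_def Y'_def
        by (simp only:) (intro Bochner_Integration.integrable_add Bochner_Integration.integrable_diff integrable_mult_right Z_pair_integrable Z_power_integrable)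
    qed
    have iD1: "integrable N D" unfolding D_def[abs_def] Y_def Y'_def using Z_power_integrable[of _ 1] by auto
    have ED2: "(LINT w|N. D w ^ 2) \<le> (4 * g^2 * m2 + 4 * m1) * h"
    proof -
      have "(LINT w|N. D w ^ 2) = (1 - e)^2 * (LINT w|N. Y w ^ 2) + 2 * (e - e^2) / g * (LINT w|N. Y w)"
        using increment_second[OF y _ past_one, of h] h unfolding D_def Y_def Y'_def e_def by (simp flip: power_mult)
      also have "\<dots> \<le> (4 * g^2 * h^2) * m2 + (4 * h) * m1"
      proof (intro add_mono mult_mono EY e2)
        have "e - e^2 \<le> 1 - e" using zero_le_power2[of "1 - e"] by (simp add: power2_eq_square algebra_simps)
        then have "2 * (e - e^2) / g \<le> 2 * (2 * g * h) / g" using e1 g by (intro divide_right_mono) auto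
        then show "2 * (e - e^2) / g \<le> 4 * h" using g by simp
      qed (use EY0 h in auto)
      also have "\<dots> \<le> (4 * g^2 * h) * m2 + (4 * h) * m1"
        using h m by (intro add_right_mono mult_right_mono mult_left_mono) (auto simp: power2_eq_square mult_left_le)
      finally show ?thesis by (simp add: algebra_simps)
    qed
    have EV: "integrable N (\<lambda>w. ?V (Y w)^2)" "(LINT w|N. ?V (Y w)^2) \<le> m6"
    proof -
      have le: "?V (Y w)^2 \<le> 64 * (1 + Y w ^ 6)" if "w \<in> space N" for w
      proof -
        define z where "z = Y w"
        have z: "0 \<le> z" using Y0[OF that] by (simp add: z_def)
        have "?V z \<le> (1 + z) * (1 + z)^2 / 1"
          unfolding potential_def using z \<eta> by (intro frac_le mult_mono power_mono) auto
        then have "?V z^2 \<le> ((1 + z)^3)^2" using potential_nonneg[of \<eta> z] by (intro power_mono) (auto simp: power3_eq_cube power2_eq_square)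
        also have "((1 + z)^3)^2 = (1 + z)^6" by (simp flip: power_mult)
        also have "\<dots> \<le> 64 * (1 + z^6)"
        proof (cases "z \<le> 1")
          case True
          then have "(1 + z)^6 \<le> 2^6" using z by (intro power_mono) auto
          also have "\<dots> \<le> 64 * (1 + z^6)" using z by simp
          finally show ?thesis .
        next
          case False
          then have "(1 + z)^6 \<le> (2 * z)^6" by (intro power_mono) auto
          then show ?thesis by (simp add: power_mult_distrib)
        qed
        finally show ?thesis by (simp add: z_def)
      qed
      have ib: "integrable N (\<lambda>w. 64 * (1 + Y w ^ 6))" using iY[of 0] iY[of 6] by auto
      show i: "integrable N (\<lambda>w. ?V (Y w)^2)"
        by (rule Bochner_Integration.integrable_bound[OF ib]) (use le in \<open>auto intro!: AE_I2 order.trans[OF le abs_ge_self]\<close>)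
      have "(LINT w|N. ?V (Y w)^2) \<le> (LINT w|N. 64 * (1 + Y w ^ 6))" by (rule integral_mono[OF i ib le])
      also have "\<dots> = 64 * ((LINT w|N. Y w ^ 0) + (LINT w|N. Y w ^ 6))" using iY[of 0] iY[of 6] by simp
      also have "\<dots> \<le> 64 * (1 / g + 720 / g^7)"
        using moment_le[of y 0] moment_le[of y 6] by (intro mult_left_mono add_mono) (auto simp: Y_def fact_numeral)
      finally show "(LINT w|N. ?V (Y w)^2) \<le> m6" by (simp add: m6_def)
    qed
    define R where "R w = ?F (Y' w) - ?F (Y w) - F1 (Y w) * D w - F2 (Y w) / 2 * D w^2" for w
    have [measurable]: "R \<in> borel_measurable N" unfolding R_def by measurable
    have Rle: "\<bar>R w\<bar> \<le> C1 * ((sqrt h * D w^2 + D w^4 / sqrt h) / 2)" if w: "w \<in> space N" for w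
    proof -
      have "\<bar>R w\<bar> \<le> C1 * \<bar>D w\<bar>^3"
        using w_taylor[OF C1(4), of "Y w + \<eta>" "Y' w + \<eta>"] Y0[OF w] \<eta>
        by (simp add: R_def D_def wshift_def F1_def F2_def)
      also have "\<dots> \<le> C1 * ((sqrt h * D w^2 + D w^4 / sqrt h) / 2)"
        using C1(1) h by (intro mult_left_mono abs_cube_le) auto
      finally show ?thesis .
    qed
    have iR: "integrable N (\<lambda>w. C1 * ((sqrt h * D w^2 + D w^4 / sqrt h) / 2))" using iD2 iD4 by auto
    have iR': "integrable N R"
      by (rule Bochner_Integration.integrable_bound[OF iR], measurable, rule AE_I2, unfold real_norm_def, rule order.trans[OF Rle abs_ge_self])
    \<comment> \<open>The killing factor of the step is a function of \<open>Z y\<close> and so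
      joins \<open>H\<close> as part of the past.\<close>
    define K where "K w = H w * E (Y w)" for w
    have K1: "\<bar>K w\<bar> \<le> 1" for w unfolding K_def abs_mult using H1[of w] E[of "Y w"] by (intro mult_le_one) auto
    have [measurable]: "K \<in> borel_measurable N" unfolding K_def by measurable
    have KF1: "(\<lambda>w. K w * F1 (Y w)) \<in> past y"
      unfolding K_def Y_def by (rule past_mult[OF past_mult[OF H order.refl cE E(3)] order.refl cF(2) bF(2)])
    have KF2: "(\<lambda>w. K w * F2 (Y w)) \<in> past y"
      unfolding K_def Y_def by (rule past_mult[OF past_mult[OF H order.refl cE E(3)] order.refl cF(3) bF(3)])
    have "\<bar>K w\<bar> * \<bar>F1 (Y w)\<bar> \<le> 1 * C1" "\<bar>K w\<bar> * \<bar>F2 (Y w)\<bar> \<le> 1 * C1" for w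
      by (intro mult_mono K1 bF; simp)+
    then have KFb: "\<bar>K w * F1 (Y w)\<bar> \<le> C1" "\<bar>K w * F2 (Y w)\<bar> \<le> C1" for w
      by (simp_all add: abs_mult)
    define Q1 where "Q1 = (LINT w|N. (K w * F1 (Y w)) * Y w)"
    define Q2 where "Q2 = (LINT w|N. (K w * F2 (Y w)) * Y w)"
    define Q3 where "Q3 = (LINT w|N. (K w * F2 (Y w)) * Y w^2)"
    have Q: "\<bar>Q1\<bar> \<le> C1 * m1" "\<bar>Q2\<bar> \<le> C1 * m1" "\<bar>Q3\<bar> \<le> C1 * m2"
      unfolding Q1_def Q2_def Q3_def
      by (rule order.trans[OF bounded_abs_integral_le(1)[OF _ _ KFb(1) _ C1(1)]], use iY1 Y0 EY C1(1) in \<open>auto intro!: mult_left_mono\<close>)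
         (rule order.trans[OF bounded_abs_integral_le(1)[OF _ _ KFb(2) _ C1(1)]], use iY1 Y0 EY C1(1) in \<open>auto intro!: mult_left_mono\<close>)+
    have iQ: "integrable N (\<lambda>w. (K w * F1 (Y w)) * Y w)" "integrable N (\<lambda>w. (K w * F2 (Y w)) * Y w)"
      by (rule past_mult_integrable[OF KF1 iY1(1)], rule past_mult_integrable[OF KF2 iY1(1)])
    have A1: "(LINT w|N. (K w * F1 (Y w)) * D w) = (e - 1) * Q1"
      using increment_first[OF y _ KF1, of h] h by (simp add: D_def Y_def Y'_def e_def Q1_def)
    have A2: "(LINT w|N. (K w * F2 (Y w)) * D w^2) = (1 - e)^2 * Q3 + 2 * (e - e^2) / g * Q2"
      using increment_second[OF y _ KF2, of h] h by (simp add: D_def Y_def Y'_def e_def Q2_def Q3_def flip: power_mult)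
    define T where "T w = ?F (Y w) * (E (Y w) - 1 + h * ?V (Y w) * E (Y w))" for w
    have [measurable]: "T \<in> borel_measurable N" unfolding T_def by measurable
    have Tle: "\<bar>T w\<bar> \<le> h^2 * ?V (Y w)^2" for w
    proof -
      have "\<bar>E (Y w) - 1 + h * ?V (Y w) * E (Y w)\<bar> \<le> (h * ?V (Y w))^2"
        unfolding E_def by (rule exp_taylor_bounds(2)) (use h potential_nonneg in auto)
      then have "\<bar>T w\<bar> \<le> 1 * (h * ?V (Y w))^2" unfolding T_def abs_mult using bF(1)[of "Y w"] by (intro mult_mono) auto
      then show ?thesis by (simp add: power_mult_distrib)
    qed
    have iT: "integrable N T"
      by (rule Bochner_Integration.integrable_bound[of N "\<lambda>w. h^2 * ?V (Y w)^2"]) (use EV Tle in \<open>auto intro!: AE_I2 order.trans[OF Tle abs_ge_self]\<close>)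
    \<comment> \<open>This is \<open>w_ode\<close> at \<open>Y w + \<eta>\<close>, multiplied by
      \<open>Y w\<close>, and explains the form \<open>z * (z + \<eta>)^2 / 8\<close> of the
      potential.\<close>
    have ode: "2 * F2 (Y w) * Y w - 2 * g * F1 (Y w) * Y w = ?V (Y w) * ?F (Y w)" if w: "w \<in> space N" for w
      using w_ode[of "Y w + \<eta>"] Y0[OF w] unfolding potential_def wshift_def F1_def F2_def
      by (simp add: algebra_simps flip: left_diff_distrib)
    \<comment> \<open>By \<open>ode\<close> the last two terms together are
      \<open>- H w * (h * ?V (Y w) * E (Y w) * ?F (Y w))\<close>. They cancel the first-order parts
      of the conditional moments, while \<open>T\<close> keeps the second-order error of the killing
      factor.\<close>
    have split: "H w * (E (Y w) * ?F (Y' w) - ?F (Y w)) =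
        (K w * F1 (Y w)) * D w + 1/2 * ((K w * F2 (Y w)) * D w^2) + K w * R w
        + H w * T w + (2 * g * h) * ((K w * F1 (Y w)) * Y w) - (2 * h) * ((K w * F2 (Y w)) * Y w)" if w: "w \<in> space N" for w
    proof -
      have "(2 * h) * ((K w * F2 (Y w)) * Y w) - (2 * g * h) * ((K w * F1 (Y w)) * Y w) = h * K w * (2 * F2 (Y w) * Y w - 2 * g * F1 (Y w) * Y w)"
        by (simp add: algebra_simps)
      also have "\<dots> = H w * (h * ?V (Y w) * E (Y w) * ?F (Y w))" unfolding ode[OF w] K_def by simp
      finally have o: "(2 * g * h) * ((K w * F1 (Y w)) * Y w) - (2 * h) * ((K w * F2 (Y w)) * Y w) = - (H w * (h * ?V (Y w) * E (Y w) * ?F (Y w)))" by simp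
      show ?thesis unfolding add_diff_eq[symmetric] o unfolding T_def R_def K_def by (simp add: algebra_simps)
    qed
    have i1: "integrable N (\<lambda>w. (K w * F1 (Y w)) * D w)" by (rule past_mult_integrable[OF KF1 iD1])
    have i2: "integrable N (\<lambda>w. (K w * F2 (Y w)) * D w^2)" by (rule past_mult_integrable[OF KF2 iD2])
    have i3: "integrable N (\<lambda>w. K w * R w)" by (rule bounded_mult_integrable[OF iR' _ K1]) measurable
    have i4: "integrable N (\<lambda>w. H w * T w)" by (rule past_mult_integrable[OF H iT])
    have "(LINT w|N. H w * (E (Y w) * ?F (Y' w) - ?F (Y w))) =
       (LINT w|N. (K w * F1 (Y w)) * D w + 1/2 * ((K w * F2 (Y w)) * D w^2) + K w * R w
        + H w * T w + (2 * g * h) * ((K w * F1 (Y w)) * Y w) - (2 * h) * ((K w * F2 (Y w)) * Y w))"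
      by (intro Bochner_Integration.integral_cong split refl)
    also have "\<dots> = (e - 1) * Q1 + 1/2 * ((1 - e)^2 * Q3 + 2 * (e - e^2) / g * Q2) + (LINT w|N. K w * R w)
        + (LINT w|N. H w * T w) + (2 * g * h) * Q1 - (2 * h) * Q2"
    proof -
      have s: "(LINT w|N. a w + c * b w + k w + t w + c' * p w - c'' * q w) = (LINT w|N. a w) + c * (LINT w|N. b w) + (LINT w|N. k w) + (LINT w|N. t w) + c' * (LINT w|N. p w) - c'' * (LINT w|N. q w)"
        if "integrable N a" "integrable N b" "integrable N k" "integrable N t" "integrable N p" "integrable N q" for a b k t p q :: "'a \<Rightarrow> real" and c c' c''
        using that by simp
      show ?thesis unfolding s[OF i1 i2 i3 i4 iQ] A1 A2 Q1_def[symmetric] Q2_def[symmetric] ..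
    qed
    also have "\<dots> = (e - 1 + 2 * g * h) * Q1 + (1 - e)^2 / 2 * Q3 + ((e - e^2) / g - 2 * h) * Q2 + (LINT w|N. K w * R w) + (LINT w|N. H w * T w)"
      by (simp add: algebra_simps add_divide_distrib)
    finally have total: "(LINT w|N. H w * (E (Y w) * ?F (Y' w) - ?F (Y w))) = (e - 1 + 2 * g * h) * Q1 + (1 - e)^2 / 2 * Q3 + ((e - e^2) / g - 2 * h) * Q2 + (LINT w|N. K w * R w) + (LINT w|N. H w * T w)" .
    have "\<bar>LINT w|N. H w * (E (Y w) * ?F (Y' w) - ?F (Y w))\<bar> \<le> (2 * g^2 * h^2) * (C1 * m1) + (4 * g^2 * h^2) / 2 * (C1 * m2) + (6 * g * h^2) * (C1 * m1) + C1 * (((4 * g^2 * m2 + 4 * m1) + 96 / g^3) / 2) * (h * sqrt h) + h^2 * m6"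
      unfolding total
    proof (intro order.trans[OF abs_triangle_ineq] add_mono)
      show "\<bar>(e - 1 + 2 * g * h) * Q1\<bar> \<le> (2 * g^2 * h^2) * (C1 * m1)" unfolding abs_mult by (intro mult_mono e1 Q) auto
      show "\<bar>(1 - e)^2 / 2 * Q3\<bar> \<le> (4 * g^2 * h^2) / 2 * (C1 * m2)" unfolding abs_mult using e2 by (intro mult_mono Q) auto
      show "\<bar>((e - e^2) / g - 2 * h) * Q2\<bar> \<le> (6 * g * h^2) * (C1 * m1)" unfolding abs_mult using g by (intro mult_mono e3 Q) auto
      have "\<bar>LINT w|N. K w * R w\<bar> \<le> (LINT w|N. \<bar>K w * R w\<bar>)" by (rule integral_abs_bound)
      also have "\<dots> \<le> (LINT w|N. C1 * ((sqrt h * D w^2 + D w^4 / sqrt h) / 2))"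
      proof (rule integral_mono)
        fix w assume w: "w \<in> space N"
        have "\<bar>K w * R w\<bar> \<le> 1 * \<bar>R w\<bar>" unfolding abs_mult by (intro mult_right_mono K1) auto
        then show "\<bar>K w * R w\<bar> \<le> C1 * ((sqrt h * D w^2 + D w^4 / sqrt h) / 2)" using Rle[OF w] by simp
      qed (use i3 iR in auto)
      also have "\<dots> = C1 * ((sqrt h * (LINT w|N. D w^2) + (LINT w|N. D w^4) / sqrt h) / 2)" using iD2 iD4 by simp
      also have "\<dots> \<le> C1 * ((sqrt h * ((4 * g^2 * m2 + 4 * m1) * h) + (96 / g^3 * h^2) / sqrt h) / 2)"
        using C1(1) h ED2 ED4 by (intro mult_left_mono divide_right_mono add_mono) auto
      also have "(96 / g^3 * h^2) / sqrt h = 96 / g^3 * (h * sqrt h)"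
      proof -
        have "h / sqrt h = sqrt h" by (rule real_div_sqrt) (use h in auto)
        moreover have "(96 / g^3 * h^2) / sqrt h = 96 / g^3 * (h * (h / sqrt h))" by (simp add: power2_eq_square)
        ultimately show ?thesis by simp
      qed
      also have "C1 * ((sqrt h * ((4 * g^2 * m2 + 4 * m1) * h) + 96 / g^3 * (h * sqrt h)) / 2) = C1 * (((4 * g^2 * m2 + 4 * m1) + 96 / g^3) / 2) * (h * sqrt h)"
        by (simp add: algebra_simps add_divide_distrib)
      finally show "\<bar>LINT w|N. K w * R w\<bar> \<le> C1 * (((4 * g^2 * m2 + 4 * m1) + 96 / g^3) / 2) * (h * sqrt h)" .
      have "\<bar>LINT w|N. H w * T w\<bar> \<le> (LINT w|N. \<bar>H w * T w\<bar>)" by (rule integral_abs_bound)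
      also have "\<dots> \<le> (LINT w|N. h^2 * ?V (Y w)^2)"
      proof (rule integral_mono)
        fix w
        have "\<bar>H w * T w\<bar> \<le> 1 * \<bar>T w\<bar>" unfolding abs_mult by (intro mult_right_mono H1) auto
        then show "\<bar>H w * T w\<bar> \<le> h^2 * ?V (Y w)^2" using Tle[of w] by simp
      qed (use i4 EV in auto)
      also have "\<dots> \<le> h^2 * m6" using EV by (simp add: mult_left_mono)
      finally show "\<bar>LINT w|N. H w * T w\<bar> \<le> h^2 * m6" .
    qed
    also have "\<dots> \<le> C * (h * sqrt h)"
    proof -
      have "h^2 \<le> h * sqrt h"
      proof -
        have "h \<le> sqrt h" using h by (simp add: real_le_rsqrt power2_eq_square mult_left_le)
        then show ?thesis using h by (simp add: power2_eq_square)
      qed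
      then have "h^2 * (2 * g^2 * (C1 * m1) + 2 * g^2 * (C1 * m2) + 6 * g * (C1 * m1) + m6) \<le> (h * sqrt h) * (2 * g^2 * (C1 * m1) + 2 * g^2 * (C1 * m2) + 6 * g * (C1 * m1) + m6)"
        using g C1(1) m by (intro mult_right_mono add_nonneg_nonneg mult_nonneg_nonneg) auto
      then show ?thesis unfolding C_def by (simp add: algebra_simps add_divide_distrib)
    qed
    finally show "\<bar>LINT w|N. H w * (exp (- (h * potential \<eta> (Z y w))) * wshift \<eta> (Z (y + h) w) - wshift \<eta> (Z y w))\<bar> \<le> C * (h * sqrt h)"
      by (simp add: E_def Y_def Y'_def)
  qed
qed

end

section \<open>The exponential functional of the field\<close>

text \<open>Left endpoints are taken because the weight of a step must be determined by the past of
  its starting point. By uniform continuity the error after \<open>k\<close> steps is at most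
  \<open>e * (k * h)\<close>.\<close>

lemma riemann_sum_tendsto:
  fixes f :: "real \<Rightarrow> real"
  assumes T: "0 \<le> T" and f: "continuous_on {0..T} f"
  shows "(\<lambda>n. T / real (Suc n) * (\<Sum>i<Suc n. f (real i * (T / real (Suc n))))) \<longlonglongrightarrow> integral {0..T} f"
proof (rule LIMSEQ_I)
  fix r :: real assume r: "0 < r"
  define e where "e = r / (2 * (T + 1))"
  have e: "0 < e" using r T by (simp add: e_def)
  have "uniformly_continuous_on {0..T} f" using f by (intro compact_uniformly_continuous) auto
  then obtain d where d: "0 < d" "\<And>x y. x \<in> {0..T} \<Longrightarrow> y \<in> {0..T} \<Longrightarrow> dist y x < d \<Longrightarrow> dist (f y) (f x) < e"
    using e unfolding uniformly_continuous_on_def by metis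
  obtain n0 where n0: "T / d < real n0" using reals_Archimedean2 by blast
  have "norm (T / real (Suc n) * (\<Sum>i<Suc n. f (real i * (T / real (Suc n)))) - integral {0..T} f) < r" if n: "n \<ge> n0" for n
  proof -
    define h where "h = T / real (Suc n)"
    have h0: "0 \<le> h" using T by (simp add: h_def)
    have hd: "h < d"
    proof -
      have "T / d < real (Suc n)" using n0 n by linarith
      then show ?thesis using d(1) by (simp add: h_def field_simps)
    qed
    have hT: "real (Suc n) * h = T" by (simp add: h_def)
    have le: "real k * h \<le> T" if "k \<le> Suc n" for k
      using that h0 hT by (metis mult_right_mono of_nat_le_iff)
    have ig: "f integrable_on {a..b}" if "0 \<le> a" "b \<le> T" for a b
      by (rule integrable_continuous_real, rule continuous_on_subset[OF f]) (use that in auto)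
    have "\<bar>h * (\<Sum>i<k. f (real i * h)) - integral {0..real k * h} f\<bar> \<le> e * (real k * h)" if "k \<le> Suc n" for k
      using that
    proof (induction k)
      case (Suc k)
      have k: "real k * h \<le> T" "real (Suc k) * h \<le> T" "0 \<le> real k * h" using le[of k] le[of "Suc k"] Suc h0 by auto
      have kk: "real (Suc k) * h = real k * h + h" by (simp add: algebra_simps)
      have "integral {0..real (Suc k) * h} f = integral {0..real k * h} f + integral {real k * h..real (Suc k) * h} f"
        by (rule Henstock_Kurzweil_Integration.integral_combine[symmetric]) (use k kk h0 in \<open>auto intro!: ig\<close>)
      moreover have "\<bar>h * f (real k * h) - integral {real k * h..real (Suc k) * h} f\<bar> \<le> e * h"
      proof -
        have "integral {real k * h..real (Suc k) * h} (\<lambda>s. f (real k * h) - f s) = h * f (real k * h) - integral {real k * h..real (Suc k) * h} f"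
          using k kk h0 by (subst Henstock_Kurzweil_Integration.integral_diff) (auto intro!: ig)
        moreover have "norm (integral {real k * h..real (Suc k) * h} (\<lambda>s. f (real k * h) - f s)) \<le> e * (real (Suc k) * h - real k * h)"
        proof (rule integral_bound)
          show "continuous_on {real k * h..real (Suc k) * h} (\<lambda>s. f (real k * h) - f s)"
            by (intro continuous_intros continuous_on_subset[OF f]) (use k in auto)
          fix s assume s: "s \<in> {real k * h..real (Suc k) * h}"
          then have "dist (real k * h) s < d" using hd kk by (auto simp: dist_real_def abs_if)
          then have "dist (f (real k * h)) (f s) < e" using s k by (intro d) auto
          then show "norm (f (real k * h) - f s) \<le> e" by (simp add: dist_norm)
        qed (use kk h0 in auto)
        ultimately show ?thesis using kk by simp
      qed
      ultimately have "\<bar>h * (\<Sum>i<Suc k. f (real i * h)) - integral {0..real (Suc k) * h} f\<bar> \<le> e * (real k * h) + e * h"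
        using Suc by (simp add: distrib_left)
      then show ?case by (simp add: algebra_simps)
    qed simp
    from this[of "Suc n"] have "\<bar>h * (\<Sum>i<Suc n. f (real i * h)) - integral {0..T} f\<bar> \<le> e * T" using hT by simp
    also have "\<dots> < r" using r T by (simp add: e_def field_simps add_nonneg_pos)
    finally show ?thesis by (simp add: h_def)
  qed
  then show "\<exists>no. \<forall>n\<ge>no. norm (T / real (Suc n) * (\<Sum>i<Suc n. f (real i * (T / real (Suc n)))) - integral {0..T} f) < r" by blast
qed

section \<open>From discrete sums to the one-sided functional\<close>

context kac_field
begin

text \<open>Discretised killing: each factor uses the value at the left end of its step, so that the
  weight after \<open>k\<close> steps lies in \<open>past (real k * h)\<close>.\<close>

fun path_weight :: "real \<Rightarrow> real \<Rightarrow> ('a \<Rightarrow> real) \<Rightarrow> nat \<Rightarrow> 'a \<Rightarrow> real" where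
  "path_weight \<eta> h H 0 w = H w"
| "path_weight \<eta> h H (Suc k) w = path_weight \<eta> h H k w * exp (- (h * potential \<eta> (Z (real k * h) w)))"

lemma path_weight_eq: "path_weight \<eta> h H k w = H w * exp (- (h * (\<Sum>i<k. potential \<eta> (Z (real i * h) w))))"
  by (induction k) (auto simp: distrib_left exp_add[symmetric])

lemma path_weight_past:
  assumes "0 \<le> h" "H \<in> past 0"
  shows "path_weight \<eta> h H k \<in> past (real k * h)"
proof (induction k)
  case (Suc k)
  have c: "continuous_on UNIV (\<lambda>z. exp (- (h * potential \<eta> z)))"
    using potential_cont by (intro continuous_intros) auto
  have b: "\<bar>exp (- (h * potential \<eta> z))\<bar> \<le> 1" for z using assms potential_nonneg by simp
  have "(\<lambda>w. path_weight \<eta> h H k w * exp (- (h * potential \<eta> (Z (real k * h) w)))) \<in> past (real k * h)"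
    by (rule past_mult[OF Suc order.refl c b])
  moreover have "path_weight \<eta> h H (Suc k) = (\<lambda>w. path_weight \<eta> h H k w * exp (- (h * potential \<eta> (Z (real k * h) w))))"
    by (rule ext) simp
  ultimately have "path_weight \<eta> h H (Suc k) \<in> past (real k * h)" by simp
  then show ?case by (rule past_mono) (use assms in \<open>auto intro!: mult_right_mono\<close>)
next
  case 0
  have "path_weight \<eta> h H 0 = H" by (rule ext) simp
  then show ?case using assms by simp
qed

lemma path_weight_bound:
  assumes "0 \<le> h" "\<And>w. \<bar>H w\<bar> \<le> 1"
  shows "\<bar>path_weight \<eta> h H k w\<bar> \<le> 1"
proof -
  have "exp (- (h * (\<Sum>i<k. potential \<eta> (Z (real i * h) w)))) \<le> 1"
    using assms potential_nonneg by (auto intro!: mult_nonneg_nonneg sum_nonneg)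
  then show ?thesis unfolding path_weight_eq abs_mult using assms(2)[of w] by (intro mult_le_one) auto
qed

lemma wshift_measurable: "0 < \<eta> \<Longrightarrow> wshift \<eta> \<in> borel_measurable borel"
  by (rule borel_measurable_continuous_onI[OF wshift_cont])

lemma potential_measurable[measurable]: "potential \<eta> \<in> borel_measurable borel"
  by (rule borel_measurable_continuous_onI[OF potential_cont])

lemma Z_integrable_on:
  fixes f :: "real \<Rightarrow> real"
  assumes "w \<in> space N" "continuous_on UNIV f"
  shows "continuous_on {a..b} (\<lambda>x. f (Z x w))"
proof -
  have "continuous_on {a..b} (\<lambda>x. Z x w)" by (rule continuous_on_subset[OF Z_cont[OF assms(1)]]) simp
  then show ?thesis by (rule continuous_on_compose2[OF assms(2)]) simp
qed

text \<open>A step of length \<open>h\<close> costs \<open>O(h powr (3/2))\<close>, so \<open>n\<close> steps of length \<open>X / n\<close> cost \<open>O(n powr (-1/2))\<close>.\<close>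

lemma discrete_martingale:
  assumes \<eta>: "0 < \<eta>" "\<eta> \<le> 1" and X: "0 \<le> X" and H: "H \<in> past 0" and H1: "\<And>w. \<bar>H w\<bar> \<le> 1"
  shows "(LINT w|N. H w * exp (- integral {0..X} (\<lambda>x. potential \<eta> (Z x w))) * wshift \<eta> (Z X w)) = (LINT w|N. H w * wshift \<eta> (Z 0 w))"
proof -
  note wshift_measurable[OF \<eta>(1), measurable]
  note mH[measurable] = past_measurable[OF H]
  obtain C where C: "\<And>y h H. 0 \<le> y \<Longrightarrow> 0 < h \<Longrightarrow> h \<le> 1 \<Longrightarrow> H \<in> past y \<Longrightarrow> (\<And>w. \<bar>H w\<bar> \<le> 1) \<Longrightarrow>
    \<bar>LINT w|N. H w * (exp (- (h * potential \<eta> (Z y w))) * wshift \<eta> (Z (y + h) w) - wshift \<eta> (Z y w))\<bar> \<le> C * (h * sqrt h)"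
    using one_step[OF \<eta>] by blast
  define A where "A h k = (LINT w|N. path_weight \<eta> h H k w * wshift \<eta> (Z (real k * h) w))" for h k
  have mP: "path_weight \<eta> h H k \<in> borel_measurable N" if "0 \<le> h" for h k
    using past_measurable[OF path_weight_past[OF that H]] .
  have iP: "integrable N (\<lambda>w. path_weight \<eta> h H k w * wshift \<eta> (Z y w))" if "0 \<le> h" for h k y
  proof (rule integrable_const_bound[where B=1])
    show "AE w in N. norm (path_weight \<eta> h H k w * wshift \<eta> (Z y w)) \<le> 1"
      using path_weight_bound[OF that H1] wshift_bound[OF \<eta>(1)] by (auto simp: abs_mult intro!: mult_le_one)
    show "(\<lambda>w. path_weight \<eta> h H k w * wshift \<eta> (Z y w)) \<in> borel_measurable N"
      using mP[OF that] by measurable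
  qed
  have step: "\<bar>A h (Suc k) - A h k\<bar> \<le> C * (h * sqrt h)" if h: "0 < h" "h \<le> 1" for h k
  proof -
    have "A h (Suc k) - A h k = (LINT w|N. path_weight \<eta> h H k w * (exp (- (h * potential \<eta> (Z (real k * h) w))) * wshift \<eta> (Z (real k * h + h) w) - wshift \<eta> (Z (real k * h) w)))"
    proof -
      have "real (Suc k) * h = real k * h + h" by (simp add: algebra_simps)
      then show ?thesis unfolding A_def
        using iP[of h "Suc k" "real k * h + h"] iP[of h k "real k * h"] h
        by (subst Bochner_Integration.integral_diff[symmetric]) (auto simp: right_diff_distrib mult.assoc)
    qed
    also have "\<bar>\<dots>\<bar> \<le> C * (h * sqrt h)"
      using h by (intro C path_weight_past H path_weight_bound H1) auto
    finally show ?thesis .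
  qed
  have tele: "\<bar>A h k - A h 0\<bar> \<le> real k * (C * (h * sqrt h))" if h: "0 < h" "h \<le> 1" for h k
  proof (induction k)
    case (Suc k)
    have "\<bar>A h (Suc k) - A h 0\<bar> \<le> \<bar>A h (Suc k) - A h k\<bar> + \<bar>A h k - A h 0\<bar>" by linarith
    also have "\<dots> \<le> C * (h * sqrt h) + real k * (C * (h * sqrt h))" by (intro add_mono step h Suc)
    finally show ?case by (simp add: algebra_simps)
  qed simp
  show ?thesis
  proof (cases "X = 0")
    case True
    then show ?thesis by simp
  next
    case False
    with X have X0: "0 < X" by simp
    define hn where "hn n = X / real (Suc n)" for n
    have hn0: "0 < hn n" for n using X0 by (simp add: hn_def)
    have hX: "real (Suc n) * hn n = X" for n by (simp add: hn_def)
    have lim1: "(\<lambda>n. A (hn n) (Suc n)) \<longlonglongrightarrow> (LINT w|N. H w * exp (- integral {0..X} (\<lambda>x. potential \<eta> (Z x w))) * wshift \<eta> (Z X w))"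
      unfolding A_def hX path_weight_eq
    proof (rule integral_dominated_convergence[where w="\<lambda>_. 1"])
      have conv: "(\<lambda>n. H w * exp (- (hn n * (\<Sum>i<Suc n. potential \<eta> (Z (real i * hn n) w)))) * wshift \<eta> (Z X w))
         \<longlonglongrightarrow> H w * exp (- integral {0..X} (\<lambda>x. potential \<eta> (Z x w))) * wshift \<eta> (Z X w)" if w: "w \<in> space N" for w
        unfolding hn_def by (intro tendsto_intros riemann_sum_tendsto X Z_integrable_on w potential_cont)
      then show "AE w in N. (\<lambda>n. H w * exp (- (hn n * (\<Sum>i<Suc n. potential \<eta> (Z (real i * hn n) w)))) * wshift \<eta> (Z X w))
         \<longlonglongrightarrow> H w * exp (- integral {0..X} (\<lambda>x. potential \<eta> (Z x w))) * wshift \<eta> (Z X w)" by simp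
      show "(\<lambda>w. H w * exp (- integral {0..X} (\<lambda>x. potential \<eta> (Z x w))) * wshift \<eta> (Z X w)) \<in> borel_measurable N"
        by (rule borel_measurable_LIMSEQ_real[OF conv]) measurable
      show "AE w in N. norm (H w * exp (- (hn n * (\<Sum>i<Suc n. potential \<eta> (Z (real i * hn n) w)))) * wshift \<eta> (Z X w)) \<le> 1" for n
      proof (rule AE_I2)
        fix w
        have "\<bar>path_weight \<eta> (hn n) H (Suc n) w\<bar> \<le> 1" by (rule path_weight_bound[OF less_imp_le[OF hn0] H1])
        then show "norm (H w * exp (- (hn n * (\<Sum>i<Suc n. potential \<eta> (Z (real i * hn n) w)))) * wshift \<eta> (Z X w)) \<le> 1"
          unfolding path_weight_eq real_norm_def abs_mult[of "H w * _"] using wshift_bound[OF \<eta>(1)] by (intro mult_le_one) auto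
      qed
    qed (auto simp: integrable_const)
    have A0: "A h 0 = (LINT w|N. H w * wshift \<eta> (Z 0 w))" for h by (simp add: A_def)
    have "(\<lambda>n. A (hn n) (Suc n) - A (hn n) 0) \<longlonglongrightarrow> 0"
    proof (rule Lim_null_comparison)
      have "\<forall>\<^sub>F n in sequentially. X \<le> real n" using filterlim_real_sequentially unfolding filterlim_at_top by auto
      then show "\<forall>\<^sub>F n in sequentially. norm (A (hn n) (Suc n) - A (hn n) 0) \<le> X * C * sqrt (hn n)"
      proof eventually_elim
        case (elim n)
        then have h1: "hn n \<le> 1" by (simp add: hn_def)
        have "\<bar>A (hn n) (Suc n) - A (hn n) 0\<bar> \<le> real (Suc n) * (C * (hn n * sqrt (hn n)))" by (rule tele[OF hn0 h1])
        also have "\<dots> = (real (Suc n) * hn n) * C * sqrt (hn n)" by (simp only: mult_ac)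
        finally show ?case unfolding hX by simp
      qed
      have "(\<lambda>n. X * C * sqrt (X / real (Suc n))) \<longlonglongrightarrow> 0"
        using X0 by real_asymp
      then show "(\<lambda>n. X * C * sqrt (hn n)) \<longlonglongrightarrow> 0" by (simp add: hn_def)
    qed
    then have "(\<lambda>n. A (hn n) (Suc n)) \<longlonglongrightarrow> (LINT w|N. H w * wshift \<eta> (Z 0 w))"
      unfolding A0 by (simp add: LIM_zero_iff)
    from LIMSEQ_unique[OF lim1 this] show ?thesis .
  qed
qed

definition half_integral :: "real \<Rightarrow> 'a \<Rightarrow> real" where
  "half_integral \<eta> w = (LINT x|lborel. indicator {0..} x * potential \<eta> (Z x w))"

lemma half_integral_eq:
  assumes w: "w \<in> space N"
  obtains R where "0 \<le> R" "\<And>x. R \<le> \<bar>x\<bar> \<Longrightarrow> Z x w = 0" "\<And>\<eta> X. R \<le> X \<Longrightarrow> half_integral \<eta> w = integral {0..X} (\<lambda>x. potential \<eta> (Z x w))"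
proof -
  obtain R where R: "\<And>x. R \<le> \<bar>x\<bar> \<Longrightarrow> Z x w = 0" using Z_support[OF w] by blast
  show ?thesis
  proof (rule that[of "\<bar>R\<bar>"])
    fix \<eta> X :: real assume X: "\<bar>R\<bar> \<le> X"
    have "half_integral \<eta> w = (LINT x|lborel. indicator {0..X} x *\<^sub>R potential \<eta> (Z x w))"
      unfolding half_integral_def
      by (intro Bochner_Integration.integral_cong refl) (use X R in \<open>auto simp: indicator_def potential_def\<close>)
    also have "\<dots> = integral {0..X} (\<lambda>x. potential \<eta> (Z x w))"
      using set_borel_integral_eq_integral(2)[OF borel_integrable_atLeastAtMost'[OF Z_integrable_on[OF w potential_cont, of 0 X]]]
      by (simp add: set_lebesgue_integral_def)
    finally show "half_integral \<eta> w = integral {0..X} (\<lambda>x. potential \<eta> (Z x w))" .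
  qed (use R in auto)
qed

lemma half_integral_nonneg: "0 \<le> half_integral \<eta> w"
  unfolding half_integral_def by (rule Bochner_Integration.integral_nonneg) (simp add: potential_nonneg indicator_def)

text \<open>Continuous extension of \<open>w0\<close> by its limit at 0. The value
  \<open>w0 0\<close> itself is 0, owing to the factor \<open>y\<close> in \<open>u\<close>.\<close>

definition wbar :: "real \<Rightarrow> real" where "wbar z = (if z \<le> 0 then 1 else w0 z)"

lemma wbar_cont: "continuous_on UNIV wbar"
proof -
  have "isCont wbar z" for z
  proof -
    consider "z < 0" | "z = 0" | "0 < z" by linarith
    then show ?thesis
    proof cases
      case 1
      have "isCont (\<lambda>_::real. 1::real) z" by simp
      moreover have "\<forall>\<^sub>F x in nhds z. wbar x = 1"
        using eventually_nhds_in_open[of "{..<0}" z] 1 by (auto elim!: eventually_mono simp: wbar_def)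
      ultimately show ?thesis by (subst isCont_cong)
    next
      case 2
      have "(wbar \<longlongrightarrow> 1) (at_right 0)"
        by (rule Lim_transform_eventually[OF w_tendsto]) (auto simp: wbar_def eventually_at_filter)
      moreover have "(wbar \<longlongrightarrow> 1) (at_left 0)"
        by (rule tendsto_eventually) (auto simp: wbar_def eventually_at_filter)
      ultimately show ?thesis using 2 by (simp add: isCont_def filterlim_split_at wbar_def)
    next
      case 3
      have "isCont w0 z" by (rule DERIV_isCont[OF DERIV_w[OF 3]])
      moreover have "\<forall>\<^sub>F x in nhds z. wbar x = w0 x"
        using eventually_nhds_in_open[of "{0<..}" z] 3 by (auto elim!: eventually_mono simp: wbar_def)
      ultimately show ?thesis by (subst isCont_cong)
    qed
  qed
  then show ?thesis by (simp add: continuous_on_eq_continuous_at)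
qed

lemma wbar_bound: "0 \<le> wbar z" "wbar z \<le> 1" "\<bar>wbar z\<bar> \<le> 1"
  using w_nonneg[of z] w_le_1[of z] by (auto simp: wbar_def)

lemma wbar_measurable[measurable]: "wbar \<in> borel_measurable borel"
  by (rule borel_measurable_continuous_onI[OF wbar_cont])

text \<open>The martingale identity is applied on \<open>{0..n}\<close> with \<open>n\<close>
  growing. Each path of \<open>Z\<close> vanishes far out, so the terminal value of
  \<open>wshift\<close> is eventually the constant \<open>w0 \<eta>\<close>.\<close>

lemma future_eliminate_shift:
  assumes \<eta>: "0 < \<eta>" "\<eta> \<le> 1" and H: "H \<in> past 0" and H1: "\<And>w. \<bar>H w\<bar> \<le> 1"
  shows "(LINT w|N. H w * exp (- half_integral \<eta> w) * w0 \<eta>) = (LINT w|N. H w * wshift \<eta> (Z 0 w))"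
    "half_integral \<eta> \<in> borel_measurable N"
proof -
  note wshift_measurable[OF \<eta>(1), measurable]
  note mH[measurable] = past_measurable[OF H]
  have mI[measurable]: "(\<lambda>w. integral {0..X} (\<lambda>x. potential \<eta> (Z x w))) \<in> borel_measurable N" if "0 \<le> X" for X
  proof (rule borel_measurable_LIMSEQ_real)
    show "(\<lambda>n. X / real (Suc n) * (\<Sum>i<Suc n. potential \<eta> (Z (real i * (X / real (Suc n))) w))) \<longlonglongrightarrow> integral {0..X} (\<lambda>x. potential \<eta> (Z x w))"
      if "w \<in> space N" for w
      by (intro riemann_sum_tendsto \<open>0 \<le> X\<close> Z_integrable_on that potential_cont)
  qed measurable
  have ev: "\<forall>\<^sub>F n in sequentially. integral {0..real n} (\<lambda>x. potential \<eta> (Z x w)) = half_integral \<eta> w \<and> Z (real n) w = 0"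
    if w: "w \<in> space N" for w
  proof -
    obtain R where R: "0 \<le> R" "\<And>x. R \<le> \<bar>x\<bar> \<Longrightarrow> Z x w = 0" "\<And>\<eta> X. R \<le> X \<Longrightarrow> half_integral \<eta> w = integral {0..X} (\<lambda>x. potential \<eta> (Z x w))"
      using half_integral_eq[OF w] by blast
    have "\<forall>\<^sub>F n in sequentially. R \<le> real n" using filterlim_real_sequentially unfolding filterlim_at_top by auto
    then show ?thesis by eventually_elim (use R in auto)
  qed
  show mh[measurable]: "half_integral \<eta> \<in> borel_measurable N"
  proof (rule borel_measurable_LIMSEQ_real)
    show "(\<lambda>n. integral {0..real n} (\<lambda>x. potential \<eta> (Z x w))) \<longlonglongrightarrow> half_integral \<eta> w" if "w \<in> space N" for w
      using ev[OF that] by (intro tendsto_eventually) (auto elim: eventually_mono)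
  qed (use mI in auto)
  have "(\<lambda>n. LINT w|N. H w * exp (- integral {0..real n} (\<lambda>x. potential \<eta> (Z x w))) * wshift \<eta> (Z (real n) w))
    \<longlonglongrightarrow> (LINT w|N. H w * exp (- half_integral \<eta> w) * w0 \<eta>)"
  proof (rule integral_dominated_convergence[where w="\<lambda>_. 1"])
    show "AE w in N. (\<lambda>n. H w * exp (- integral {0..real n} (\<lambda>x. potential \<eta> (Z x w))) * wshift \<eta> (Z (real n) w)) \<longlonglongrightarrow> H w * exp (- half_integral \<eta> w) * w0 \<eta>"
    proof (rule AE_I2, rule tendsto_eventually)
      fix w assume "w \<in> space N"
      from ev[OF this] show "\<forall>\<^sub>F n in sequentially. H w * exp (- integral {0..real n} (\<lambda>x. potential \<eta> (Z x w))) * wshift \<eta> (Z (real n) w) = H w * exp (- half_integral \<eta> w) * w0 \<eta>"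
        by eventually_elim (simp add: wshift_def)
    qed
    show "AE w in N. norm (H w * exp (- integral {0..real n} (\<lambda>x. potential \<eta> (Z x w))) * wshift \<eta> (Z (real n) w)) \<le> 1" for n
    proof (rule AE_I2)
      fix w assume w: "w \<in> space N"
      have "0 \<le> integral {0..real n} (\<lambda>x. potential \<eta> (Z x w))"
        by (rule Henstock_Kurzweil_Integration.integral_nonneg) (auto intro!: integrable_continuous_real Z_integrable_on w potential_cont potential_nonneg)
      then have "exp (- integral {0..real n} (\<lambda>x. potential \<eta> (Z x w))) \<le> 1" by simp
      then show "norm (H w * exp (- integral {0..real n} (\<lambda>x. potential \<eta> (Z x w))) * wshift \<eta> (Z (real n) w)) \<le> 1"
        unfolding norm_mult using H1[of w] wshift_bound[OF \<eta>(1)] by (intro mult_le_one) auto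
    qed
  qed (use mI in \<open>auto simp: integrable_const\<close>)
  moreover have "(LINT w|N. H w * exp (- integral {0..real n} (\<lambda>x. potential \<eta> (Z x w))) * wshift \<eta> (Z (real n) w)) = (LINT w|N. H w * wshift \<eta> (Z 0 w))" for n
    by (rule discrete_martingale[OF \<eta> _ H H1]) auto
  ultimately show "(LINT w|N. H w * exp (- half_integral \<eta> w) * w0 \<eta>) = (LINT w|N. H w * wshift \<eta> (Z 0 w))"
    by (simp add: LIMSEQ_const_iff)
qed

text \<open>For fixed \<open>w\<close> the functional \<open>half_integral \<eta> w\<close> is a
  quadratic polynomial in \<open>\<eta>\<close>, so it converges to the purely cubic one as
  \<open>\<eta>\<close> tends to 0; at the same time \<open>w0 \<eta>\<close> tends to 1 and
  \<open>wshift \<eta>\<close> to \<open>wbar\<close>.\<close>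

lemma future_eliminate:
  assumes H: "H \<in> past 0" and H1: "\<And>w. \<bar>H w\<bar> \<le> 1"
  shows "(LINT w|N. H w * exp (- half_integral 0 w)) = (LINT w|N. H w * wbar (Z 0 w))"
    "half_integral 0 \<in> borel_measurable N"
proof -
  note mH[measurable] = past_measurable[OF H]
  define \<eta> where "\<eta> n = 1 / real (Suc n)" for n
  have \<eta>: "0 < \<eta> n" "\<eta> n \<le> 1" for n by (auto simp: \<eta>_def)
  have \<eta>l: "\<eta> \<longlonglongrightarrow> 0" unfolding \<eta>_def by real_asymp
  have \<eta>r: "filterlim \<eta> (at_right 0) sequentially"
    by (rule tendsto_imp_filterlim_at_right[OF \<eta>l]) (simp add: \<eta>)
  have mh[measurable]: "half_integral (\<eta> n) \<in> borel_measurable N" for n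
    by (rule future_eliminate_shift(2)[OF \<eta> H H1])
  note wshift_measurable[OF \<eta>(1), measurable]
  have hl: "(\<lambda>n. half_integral (\<eta> n) w) \<longlonglongrightarrow> half_integral 0 w" if w: "w \<in> space N" for w
  proof -
    obtain R where R: "0 \<le> R" "\<And>x. R \<le> \<bar>x\<bar> \<Longrightarrow> Z x w = 0" "\<And>\<eta> X. R \<le> X \<Longrightarrow> half_integral \<eta> w = integral {0..X} (\<lambda>x. potential \<eta> (Z x w))"
      using half_integral_eq[OF w] by blast
    let ?z = "\<lambda>x. max 0 (Z x w)"
    have c: "continuous_on {0..R} (\<lambda>x. ?z x ^ k)" for k
      using Z_cont[OF w] by (intro continuous_intros) (auto intro: continuous_on_subset)
    have e: "half_integral \<eta> w = (integral {0..R} (\<lambda>x. ?z x ^ 3) + 2 * \<eta> * integral {0..R} (\<lambda>x. ?z x ^ 2) + \<eta>^2 * integral {0..R} (\<lambda>x. ?z x ^ 1)) / 8" for \<eta>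
    proof -
      have p: "potential \<eta> (Z x w) = (?z x ^ 3 + (2 * \<eta>) * ?z x ^ 2 + \<eta>^2 * ?z x ^ 1) / 8" for x
        by (simp add: potential_def power2_eq_square power3_eq_cube algebra_simps)
      have "((\<lambda>x. (?z x ^ 3 + (2 * \<eta>) * ?z x ^ 2 + \<eta>^2 * ?z x ^ 1) / 8) has_integral
        (integral {0..R} (\<lambda>x. ?z x ^ 3) + (2 * \<eta>) * integral {0..R} (\<lambda>x. ?z x ^ 2) + \<eta>^2 * integral {0..R} (\<lambda>x. ?z x ^ 1)) / 8) {0..R}"
        by (intro has_integral_divide has_integral_add has_integral_mult_right integrable_integral integrable_continuous_real c)
      from integral_unique[OF this] show ?thesis unfolding R(3)[OF order.refl] p .
    qed
    have "(\<lambda>n. half_integral (\<eta> n) w) \<longlonglongrightarrow> (integral {0..R} (\<lambda>x. ?z x ^ 3) + 2 * 0 * integral {0..R} (\<lambda>x. ?z x ^ 2) + 0^2 * integral {0..R} (\<lambda>x. ?z x ^ 1)) / 8"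
      unfolding e by (intro tendsto_intros \<eta>l) auto
    then show ?thesis unfolding e[of 0] .
  qed
  show mh0[measurable]: "half_integral 0 \<in> borel_measurable N"
    by (rule borel_measurable_LIMSEQ_real[OF hl]) measurable
  have l1: "(\<lambda>n. LINT w|N. H w * exp (- half_integral (\<eta> n) w) * w0 (\<eta> n)) \<longlonglongrightarrow> (LINT w|N. H w * exp (- half_integral 0 w) * 1)"
  proof (rule integral_dominated_convergence[where w="\<lambda>_. 1"])
    show "AE w in N. (\<lambda>n. H w * exp (- half_integral (\<eta> n) w) * w0 (\<eta> n)) \<longlonglongrightarrow> H w * exp (- half_integral 0 w) * 1"
      by (intro AE_I2 tendsto_intros hl filterlim_compose[OF w_tendsto \<eta>r])
    show "AE w in N. norm (H w * exp (- half_integral (\<eta> n) w) * w0 (\<eta> n)) \<le> 1" for n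
      unfolding norm_mult using H1 half_integral_nonneg w_nonneg[of "\<eta> n"] w_le_1[of "\<eta> n"] \<eta>[of n]
      by (intro AE_I2 mult_le_one) auto
  qed (auto simp: integrable_const)
  have l2: "(\<lambda>n. LINT w|N. H w * wshift (\<eta> n) (Z 0 w)) \<longlonglongrightarrow> (LINT w|N. H w * wbar (Z 0 w))"
  proof (rule integral_dominated_convergence[where w="\<lambda>_. 1"])
    show "AE w in N. (\<lambda>n. H w * wshift (\<eta> n) (Z 0 w)) \<longlonglongrightarrow> H w * wbar (Z 0 w)"
    proof (rule AE_I2)
      fix w assume w: "w \<in> space N"
      have "wshift (\<eta> n) (Z 0 w) = wbar (Z 0 w + \<eta> n)" for n
        using Z_nonneg[OF w, of 0] \<eta>[of n] by (auto simp: wshift_def wbar_def)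
      moreover have "(\<lambda>n. wbar (Z 0 w + \<eta> n)) \<longlonglongrightarrow> wbar (Z 0 w + 0)"
        by (rule continuous_on_tendsto_compose[OF wbar_cont tendsto_add[OF tendsto_const \<eta>l]]) auto
      ultimately show "(\<lambda>n. H w * wshift (\<eta> n) (Z 0 w)) \<longlonglongrightarrow> H w * wbar (Z 0 w)"
        by (intro tendsto_mult tendsto_const) simp
    qed
    show "AE w in N. norm (H w * wshift (\<eta> n) (Z 0 w)) \<le> 1" for n
      unfolding norm_mult using H1 wshift_bound[OF \<eta>(1)] by (intro AE_I2 mult_le_one) auto
  qed (auto simp: integrable_const)
  have "(LINT w|N. H w * exp (- half_integral (\<eta> n) w) * w0 (\<eta> n)) = (LINT w|N. H w * wshift (\<eta> n) (Z 0 w))" for n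
    by (rule future_eliminate_shift(1)[OF \<eta> H H1])
  with l1 l2 show "(LINT w|N. H w * exp (- half_integral 0 w)) = (LINT w|N. H w * wbar (Z 0 w))"
    by (auto dest: LIMSEQ_unique)
qed

end

section \<open>The law at the origin and the two-sided functional\<close>

lemma nn_integral_power_exp:
  assumes g: "0 < (g :: real)"
  shows "(NN z. ennreal (z^n * exp (-(g * z))) * indicator {0<..} z) = ennreal (fact n / g^Suc n)"
proof -
  have "(NN z. ennreal (z^n * exp (-(g * z))) * indicator {0<..} z)
    = ennreal \<bar>1/g\<bar> * (NN z. ennreal ((0 + 1/g * z)^n * exp (-(g * (0 + 1/g * z)))) * indicator {0<..} (0 + 1/g * z))"
    by (rule nn_integral_real_affine) (use g in auto)
  also have "(NN z. ennreal ((0 + 1/g * z)^n * exp (-(g * (0 + 1/g * z)))) * indicator {0<..} (0 + 1/g * z))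
    = (NN z. ennreal (1 / g^n) * (ennreal (z^n * exp (-z)) * indicator {0..} z))"
    by (rule nn_integral_cong_AE, use AE_lborel_singleton[of 0] in eventually_elim)
      (use g in \<open>auto simp: indicator_def ennreal_mult[symmetric] power_divide zero_less_divide_iff\<close>)
  also have "\<dots> = ennreal (1 / g^n) * ennreal (fact n)"
    by (subst nn_integral_cmult, measurable, subst nn_intergal_power_times_exp_Ici) auto
  finally show ?thesis using g by (simp add: ennreal_mult[symmetric])
qed

text \<open>The Kac sums are invariant under reflection because \<open>green g\<close> is even and
  the end point 0 is fixed.\<close>

lemma (in kac_field) reflected: "kac_field g N (\<lambda>x. Z (- x))"
proof (intro kac_field.intro kac_field_axioms.intro)
  show "killing_rate g" "finite_measure N" by unfold_locales
  show "continuous_on UNIV (\<lambda>x. Z (- x) w)" if "w \<in> space N" for w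
    by (rule continuous_on_compose2[OF Z_cont[OF that]]) (auto intro!: continuous_intros)
  show "\<exists>R. \<forall>x. R \<le> \<bar>x\<bar> \<longrightarrow> Z (- x) w = 0" if "w \<in> space N" for w
    using Z_support[OF that] by (metis abs_minus_cancel)
  show "(\<integral>\<^sup>+w. ennreal ((\<Sum>i<m. a i * Z (- x i) w) ^ n) \<partial>N) = ennreal (fact n * kac g m a x n 0)"
    if "\<And>i. i < m \<Longrightarrow> 0 \<le> a i" for m a x n
    using kac_moments[OF that, of m "\<lambda>i. i" "\<lambda>i. - x i" n] kac_reflect[of g m a x n 0] by simp
qed (use Z_nonneg in auto)

context kac_field
begin

text \<open>All links at the point 0 equal \<open>1/g\<close>, so the moments are
  \<open>fact n / g^Suc n\<close>, those of the density \<open>exp (-(g * z))\<close> on the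
  positive half-line. Determinacy does the rest.\<close>

lemma Z0_law:
  assumes c: "continuous_on UNIV \<phi>" and B: "\<And>z. \<bar>\<phi> z\<bar> \<le> B"
  shows "(LINT w|N. \<phi> (Z 0 w)) = (LINT z|lborel. \<phi> (max 0 z) * (indicator {0<..} z * exp (-(g * z))))"
proof -
  have k: "kac g 1 (\<lambda>_. 1) (\<lambda>_. 0) n 0 = 1 / g^Suc n" for n
    by (induction n) (auto simp: green_def field_simps)
  have mom: "(LINT w|N. Z 0 w ^ n * 1) = fact n / g^Suc n" for n
    using single_moment(2)[of 0 n] k[of n] by simp
  have nn: "(NN z. ennreal (max 0 z ^ n * (indicator {0<..} z * exp (-(r * z))))) = ennreal (fact n / r^Suc n)" if "0 < r" for n and r :: real
  proof -
    have "(NN z. ennreal (max 0 z ^ n * (indicator {0<..} z * exp (-(r * z))))) = (NN z. ennreal (z^n * exp (-(r * z))) * indicator {0<..} z)"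
      by (intro nn_integral_cong) (auto simp: indicator_def)
    then show ?thesis using nn_integral_power_exp[OF that] by simp
  qed
  have L: "integrable lborel (\<lambda>z. max 0 z ^ n * (indicator {0<..} z * exp (-(r * z))))"
    "(LINT z|lborel. max 0 z ^ n * (indicator {0<..} z * exp (-(r * z)))) = fact n / r^Suc n" if "0 < r" for n and r :: real
    by (rule nn_integral_to_lebesgue[OF _ _ nn[OF that]]; use that in \<open>auto intro!: divide_nonneg_nonneg\<close>)+
  obtain c0 where c0: "0 < c0" "integrable N (\<lambda>w. exp (c0 * lin 1 (\<lambda>_. 1) (\<lambda>_. 0) w) * 1)"
    using exp_lin_integrable[of 1 "\<lambda>_. 1" "\<lambda>_. 0"] by auto
  define c where "c = min c0 (g/2)"
  have c: "0 < c" "c \<le> c0" "c < g" using c0 g by (auto simp: c_def)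
  have i1: "integrable N (\<lambda>w. exp (c * Z 0 w) * 1)"
  proof (rule Bochner_Integration.integrable_bound[OF c0(2)])
    show "AE w in N. norm (exp (c * Z 0 w) * 1) \<le> norm (exp (c0 * lin 1 (\<lambda>_. 1) (\<lambda>_. 0) w) * 1 :: real)"
      using c Z_nonneg by (auto intro!: AE_I2 mult_right_mono simp: lin_def)
  qed measurable
  have i2: "integrable lborel (\<lambda>z. exp (c * max 0 z) * (indicator {0<..} z * exp (-(g * z))))"
  proof -
    have eq: "exp (c * max 0 z) * (indicator {0<..} z * exp (-(g * z))) = max 0 z ^ 0 * (indicator {0<..} z * exp (-((g - c) * z)))" for z
      by (auto simp: indicator_def exp_add[symmetric] algebra_simps)
    show ?thesis unfolding eq by (rule L(1)) (use c in simp)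
  qed
  have lap: "(LINT w|N. exp (-(r * Z 0 w)) * 1) = (LINT z|lborel. exp (-(r * max 0 z)) * (indicator {0<..} z * exp (-(g * z))))" if "0 \<le> r" for r
    by (rule moments_determine_laplace[OF c(1) i1 _ _ _ i2 _ _ _ _ that]) (use Z_nonneg mom L(2)[OF g] in auto)
  have "(LINT w|N. \<phi> (Z 0 w) * 1) = (LINT z|lborel. \<phi> (max 0 z) * (indicator {0<..} z * exp (-(g * z))))"
  proof (rule laplace_determines[OF _ _ _ _ _ _ _ assms])
    show "integrable lborel (\<lambda>z. indicator {0<..} z * exp (-(g * z)))" using L(1)[OF g, of 0] by simp
  qed (use Z_nonneg lap in \<open>auto simp: integrable_const\<close>)
  then show ?thesis by simp
qed

definition cubic_integral :: "'a \<Rightarrow> real" where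
  "cubic_integral w = (LINT x|lborel. Z x w ^ 3)"

lemma potential_0: "w \<in> space N \<Longrightarrow> potential 0 (Z x w) = Z x w ^ 3 / 8"
  using Z_nonneg[of w x] by (simp add: potential_def power2_eq_square power3_eq_cube)

text \<open>The right half is eliminated first, with the left half as part of the past; this leaves
  \<open>wbar (Z 0)\<close>. For the reflected field \<open>wbar (Z 0)\<close> is in turn part of
  the past, so the left half is eliminated in the same way and \<open>wbar (Z 0)^2\<close>
  remains.\<close>

lemma cubic_expectation:
  "ennreal (LINT w|N. exp (- (cubic_integral w / 8))) =
    (NN t. ennreal (exp (-(g^2 * t / 2)) / sqrt (2 * pi * t) * (t / sinh t) powr (3/2)) * indicator {0<..} t)"
proof -
  interpret R: kac_field g N "\<lambda>x. Z (- x)" by (rule reflected)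
  note mh[measurable] = future_eliminate(2)[OF past_one] R.future_eliminate(2)[OF R.past_one]
  have e0: "exp (- half_integral 0 w) \<le> 1" "exp (- R.half_integral 0 w) \<le> 1" for w
    using half_integral_nonneg R.half_integral_nonneg by auto
  define I where "I X w = integral {0..X} (\<lambda>x. potential 0 (Z (- x) w))" for X w
  have I0: "0 \<le> I X w" if "w \<in> space N" for X w
    unfolding I_def using R.Z_integrable_on[OF that potential_cont] potential_nonneg
    by (intro Henstock_Kurzweil_Integration.integral_nonneg integrable_continuous_real) auto
  have fixed: "(LINT w|N. exp (- I X w) * exp (- half_integral 0 w)) = (LINT w|N. exp (- I X w) * wbar (Z 0 w))"
    and mI: "I X \<in> borel_measurable N" if X: "0 \<le> X" for X
  proof -
    \<comment> \<open>The exponential of the left integral is not a finite product. It is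
      approximated by path weights of the reflected field, which lie in \<open>past 0\<close> of the
      original one.\<close>
    define H where "H n = R.path_weight 0 (X / real (Suc n)) (\<lambda>_. 1) (Suc n)" for n
    have Hp: "R.path_weight 0 h (\<lambda>_. 1) k \<in> past 0" if h: "0 \<le> h" for h k
    proof (induction k)
      case 0
      have "R.path_weight 0 h (\<lambda>_. 1) 0 = (\<lambda>_. 1)" by (rule ext) simp
      then show ?case using past_one by simp
    next
      case (Suc k)
      have "R.path_weight 0 h (\<lambda>_. 1) (Suc k) = (\<lambda>w. R.path_weight 0 h (\<lambda>_. 1) k w * exp (- (h * potential 0 (Z (- (real k * h)) w))))"
        by (rule ext) simp
      moreover have "\<dots> \<in> past 0"
      proof (rule past_mult[OF Suc])
        show "continuous_on UNIV (\<lambda>z. exp (- (h * potential 0 z)))" using potential_cont by (intro continuous_intros) auto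
        show "\<bar>exp (- (h * potential 0 z))\<bar> \<le> 1" for z using h potential_nonneg by simp
      qed (use h in auto)
      ultimately show ?case by simp
    qed
    have hn: "0 \<le> X / real (Suc n)" for n using X by simp
    have H1: "\<bar>H n w\<bar> \<le> 1" for n w unfolding H_def by (rule R.path_weight_bound[OF hn]) auto
    have Hl: "(\<lambda>n. H n w) \<longlonglongrightarrow> exp (- I X w)" if w: "w \<in> space N" for w
    proof -
      have "(\<lambda>n. X / real (Suc n) * (\<Sum>i<Suc n. potential 0 (Z (- (real i * (X / real (Suc n)))) w))) \<longlonglongrightarrow> I X w"
        unfolding I_def using X R.Z_integrable_on[OF w potential_cont] by (rule riemann_sum_tendsto)
      then have "(\<lambda>n. exp (- (X / real (Suc n) * (\<Sum>i<Suc n. potential 0 (Z (- (real i * (X / real (Suc n)))) w))))) \<longlonglongrightarrow> exp (- I X w)"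
        by (intro tendsto_exp tendsto_minus)
      then show ?thesis unfolding H_def R.path_weight_eq by simp
    qed
    have mH[measurable]: "H n \<in> borel_measurable N" for n unfolding H_def by (rule past_measurable[OF Hp[OF hn]])
    have mE: "(\<lambda>w. exp (- I X w)) \<in> borel_measurable N" by (rule borel_measurable_LIMSEQ_real[OF Hl mH])
    \<comment> \<open>Measurability of \<open>I X\<close> is recovered from its exponential, for
      which it came with the limit.\<close>
    then have "(\<lambda>w. - ln (exp (- I X w))) \<in> borel_measurable N" by measurable
    then show mI[measurable]: "I X \<in> borel_measurable N" by simp
    have dct: "(\<lambda>n. LINT w|N. H n w * f w) \<longlonglongrightarrow> (LINT w|N. exp (- I X w) * f w)"
      if [measurable]: "f \<in> borel_measurable N" and f: "\<And>w. \<bar>f w\<bar> \<le> 1" for f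
    proof (rule integral_dominated_convergence[where w="\<lambda>_. 1"])
      show "AE w in N. (\<lambda>n. H n w * f w) \<longlonglongrightarrow> exp (- I X w) * f w"
        by (intro AE_I2 tendsto_intros Hl)
      show "AE w in N. norm (H n w * f w) \<le> 1" for n
        unfolding norm_mult using H1 f by (intro AE_I2 mult_le_one) auto
    qed (auto simp: integrable_const)
    have "(\<lambda>n. LINT w|N. H n w * exp (- half_integral 0 w)) \<longlonglongrightarrow> (LINT w|N. exp (- I X w) * exp (- half_integral 0 w))"
      by (rule dct) (use e0 in auto)
    moreover have "(\<lambda>n. LINT w|N. H n w * wbar (Z 0 w)) \<longlonglongrightarrow> (LINT w|N. exp (- I X w) * wbar (Z 0 w))"
      by (rule dct) (use wbar_bound in auto)
    moreover have "(LINT w|N. H n w * exp (- half_integral 0 w)) = (LINT w|N. H n w * wbar (Z 0 w))" for n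
      by (rule future_eliminate(1)[OF _ H1]) (unfold H_def, rule Hp[OF hn])
    ultimately show "(LINT w|N. exp (- I X w) * exp (- half_integral 0 w)) = (LINT w|N. exp (- I X w) * wbar (Z 0 w))"
      by (simp add: LIMSEQ_unique)
  qed
  have dct: "(\<lambda>n. LINT w|N. exp (- I (real n) w) * f w) \<longlonglongrightarrow> (LINT w|N. exp (- R.half_integral 0 w) * f w)"
    if [measurable]: "f \<in> borel_measurable N" and f: "\<And>w. \<bar>f w\<bar> \<le> 1" for f
  proof (rule integral_dominated_convergence[where w="\<lambda>_. 1"])
    show "AE w in N. (\<lambda>n. exp (- I (real n) w) * f w) \<longlonglongrightarrow> exp (- R.half_integral 0 w) * f w"
    proof (rule AE_I2, rule tendsto_eventually)
      fix w assume w: "w \<in> space N"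
      obtain r where r: "\<And>X. r \<le> X \<Longrightarrow> R.half_integral 0 w = I X w"
        using R.half_integral_eq[OF w] unfolding I_def by metis
      have "\<forall>\<^sub>F n in sequentially. r \<le> real n" using filterlim_real_sequentially unfolding filterlim_at_top by auto
      then show "\<forall>\<^sub>F n in sequentially. exp (- I (real n) w) * f w = exp (- R.half_integral 0 w) * f w"
        by eventually_elim (simp add: r)
    qed
    show "AE w in N. norm (exp (- I (real n) w) * f w) \<le> 1" for n
      unfolding norm_mult using I0 f by (intro AE_I2 mult_le_one) auto
    show "(\<lambda>w. exp (- I (real n) w) * f w) \<in> borel_measurable N" for n
      using mI[of "real n"] by measurable
  qed (auto simp: integrable_const)
  have "(\<lambda>n. LINT w|N. exp (- I (real n) w) * exp (- half_integral 0 w)) \<longlonglongrightarrow> (LINT w|N. exp (- R.half_integral 0 w) * exp (- half_integral 0 w))"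
    by (rule dct) (use e0 in auto)
  moreover have "(\<lambda>n. LINT w|N. exp (- I (real n) w) * wbar (Z 0 w)) \<longlonglongrightarrow> (LINT w|N. exp (- R.half_integral 0 w) * wbar (Z 0 w))"
    by (rule dct) (use wbar_bound in auto)
  ultimately have "(LINT w|N. exp (- R.half_integral 0 w) * exp (- half_integral 0 w)) = (LINT w|N. exp (- R.half_integral 0 w) * wbar (Z 0 w))"
    by (simp add: fixed LIMSEQ_unique)
  also have "\<dots> = (LINT w|N. wbar (Z 0 w) * exp (- R.half_integral 0 w))" by (simp only: mult.commute)
  also have "\<dots> = (LINT w|N. wbar (Z 0 w) * R.wbar (Z (- 0) w))"
  proof (rule R.future_eliminate(1))
    have "(\<lambda>w. 1 * wbar (Z (- 0) w)) \<in> R.past 0"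
      by (rule R.past_mult[OF R.past_one order.refl wbar_cont wbar_bound(3)])
    then show "(\<lambda>w. wbar (Z 0 w)) \<in> R.past 0" by simp
  qed (use wbar_bound in auto)
  also have "\<dots> = (LINT w|N. (wbar (Z 0 w))^2)" by (simp add: power2_eq_square R.wbar_def wbar_def)
  also have "\<dots> = (LINT z|lborel. (wbar (max 0 z))^2 * (indicator {0<..} z * exp (-(g * z))))"
    by (rule Z0_law[of "\<lambda>z. (wbar z)^2" 1]) (use wbar_bound wbar_cont in \<open>auto intro!: continuous_intros simp: power_le_one\<close>)
  finally have "(LINT w|N. exp (- R.half_integral 0 w) * exp (- half_integral 0 w)) = (LINT z|lborel. (wbar (max 0 z))^2 * (indicator {0<..} z * exp (-(g * z))))" .
  moreover have "(LINT w|N. exp (- R.half_integral 0 w) * exp (- half_integral 0 w)) = (LINT w|N. exp (- (cubic_integral w / 8)))"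
  proof (rule Bochner_Integration.integral_cong[OF refl])
    fix w assume w: "w \<in> space N"
    obtain r where r: "0 \<le> r" "\<And>x. r \<le> \<bar>x\<bar> \<Longrightarrow> Z x w = 0" using half_integral_eq[OF w] by metis
    have cZ: "continuous_on {a..b} (\<lambda>x. potential 0 (Z x w))" for a b by (rule Z_integrable_on[OF w potential_cont])
    have ip: "integrable lborel (\<lambda>x. indicator {a..b} x * potential 0 (Z x w))" for a b
      using borel_integrable_atLeastAtMost'[OF cZ, of a b] by (simp add: set_integrable_def)
    have h1: "half_integral 0 w = (LINT x|lborel. indicator {0..r} x * potential 0 (Z x w))"
      unfolding half_integral_def by (intro Bochner_Integration.integral_cong) (use r in \<open>auto simp: indicator_def potential_def\<close>)
    have "R.half_integral 0 w = (LINT x|lborel. indicator {0..} x * potential 0 (Z (- x) w))"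
      by (simp add: R.half_integral_def)
    also have "\<dots> = (LINT x|lborel. indicator {0..} (- x) * potential 0 (Z x w))"
      using lborel_integral_real_affine[of "-1" "\<lambda>x. indicator {0..} x * potential 0 (Z (- x) w)" 0] by simp
    also have "\<dots> = (LINT x|lborel. indicator {-r..0} x * potential 0 (Z x w))"
      by (intro Bochner_Integration.integral_cong) (use r in \<open>auto simp: indicator_def potential_def\<close>)
    finally have h2: "R.half_integral 0 w = (LINT x|lborel. indicator {-r..0} x * potential 0 (Z x w))" .
    have "cubic_integral w / 8 = (LINT x|lborel. Z x w ^ 3 / 8)" by (simp add: cubic_integral_def)
    also have "\<dots> = (LINT x|lborel. indicator {-r..0} x * potential 0 (Z x w) + indicator {0..r} x * potential 0 (Z x w))"
    proof (rule integral_cong_AE)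
      show "AE x in lborel. Z x w ^ 3 / 8 = indicator {-r..0} x * potential 0 (Z x w) + indicator {0..r} x * potential 0 (Z x w)"
        using AE_lborel_singleton[of 0]
      proof eventually_elim
        case (elim x)
        show ?case using elim r(2)[of x]
          by (cases "r \<le> \<bar>x\<bar>") (auto simp: indicator_def potential_0[OF w] potential_def[of 0 0] abs_if split: if_splits)
      qed
      have "(\<lambda>x. Z x w) \<in> borel_measurable borel" by (rule borel_measurable_continuous_onI[OF Z_cont[OF w]])
      then show "(\<lambda>x. Z x w ^ 3 / 8) \<in> borel_measurable lborel" by measurable
    qed (use ip in auto)
    also have "\<dots> = R.half_integral 0 w + half_integral 0 w" unfolding h1 h2 using ip by simp
    finally have e: "cubic_integral w / 8 = R.half_integral 0 w + half_integral 0 w" .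
    show "exp (- R.half_integral 0 w) * exp (- half_integral 0 w) = exp (- (cubic_integral w / 8))"
      unfolding e by (simp add: exp_add[symmetric])
  qed
  ultimately have "ennreal (LINT w|N. exp (- (cubic_integral w / 8))) = ennreal (LINT z|lborel. (wbar (max 0 z))^2 * (indicator {0<..} z * exp (-(g * z))))"
    by simp
  also have "\<dots> = (NN z. ennreal ((wbar (max 0 z))^2 * (indicator {0<..} z * exp (-(g * z)))))"
  proof (rule nn_integral_eq_integral[symmetric])
    have ie: "integrable lborel (\<lambda>z. indicator {0<..} z * exp (-(g * z)))"
    proof (rule integrableI_nonneg)
      have "(NN z. ennreal (indicator {0<..} z * exp (-(g * z)))) = (NN z. ennreal (z^0 * exp (-(g * z))) * indicator {0<..} z)"
        by (intro nn_integral_cong) (auto simp: indicator_def)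
      then show "(NN z. ennreal (indicator {0<..} z * exp (-(g * z)))) < \<infinity>" unfolding nn_integral_power_exp[OF g] by simp
    qed auto
    show "integrable lborel (\<lambda>z. (wbar (max 0 z))^2 * (indicator {0<..} z * exp (-(g * z))))"
    proof (rule Bochner_Integration.integrable_bound[OF ie])
      show "AE z in lborel. norm ((wbar (max 0 z))^2 * (indicator {0<..} z * exp (-(g * z)))) \<le> norm (indicator {0<..} z * exp (-(g * z)))"
        unfolding norm_mult using wbar_bound by (intro AE_I2 mult_left_le_one_le) (auto simp: power_le_one)
    qed measurable
  qed simp
  also have "\<dots> = (NN z. ennreal (exp (-(g * z)) * (w0 z)^2) * indicator {0<..} z)"
    by (intro nn_integral_cong) (auto simp: indicator_def wbar_def mult.commute)
  also have "\<dots> = (NN t. ennreal (exp (-(g^2 * t / 2)) / sqrt (2 * pi * t) * (t / sinh t) powr (3/2)) * indicator {0<..} t)"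
    by (rule w_square_integral)
  finally show ?thesis .
qed

end

section \<open>Markov property of the Gaussian bridge\<close>

lemma caratheodory_measurable:
  fixes f :: "real \<Rightarrow> 'a \<Rightarrow> real"
  assumes m[measurable]: "\<And>x. f x \<in> borel_measurable M"
    and c: "\<And>w. w \<in> space M \<Longrightarrow> continuous_on UNIV (\<lambda>x. f x w)"
  shows "(\<lambda>(x, w). f x w) \<in> borel_measurable (borel \<Otimes>\<^sub>M M)"
proof (rule borel_measurable_LIMSEQ_real)
  \<comment> \<open>Rounding \<open>x\<close> down to the grid of mesh \<open>1 / Suc n\<close>
    leaves countably many values; continuity in \<open>x\<close> recovers the limit.\<close>
  define d where "d n x = real_of_int \<lfloor>real (Suc n) * x\<rfloor> / real (Suc n)" for n x
  have d: "(\<lambda>n. d n x) \<longlonglongrightarrow> x" for x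
  proof (rule LIM_zero_cancel, rule Lim_null_comparison)
    show "\<forall>\<^sub>F n in sequentially. norm (d n x - x) \<le> 1 / real (Suc n)"
    proof (rule always_eventually, rule allI)
      fix n
      have "\<bar>real_of_int \<lfloor>real (Suc n) * x\<rfloor> - real (Suc n) * x\<bar> \<le> 1" by linarith
      then have "\<bar>real_of_int \<lfloor>real (Suc n) * x\<rfloor> - real (Suc n) * x\<bar> / real (Suc n) \<le> 1 / real (Suc n)" by (intro divide_right_mono) auto
      moreover have "d n x - x = (real_of_int \<lfloor>real (Suc n) * x\<rfloor> - real (Suc n) * x) / real (Suc n)"
        by (simp add: d_def field_simps)
      ultimately show "norm (d n x - x) \<le> 1 / real (Suc n)" by (simp add: abs_divide)
    qed
    show "(\<lambda>n. 1 / real (Suc n)) \<longlonglongrightarrow> 0" by real_asymp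
  qed
  fix p :: "real \<times> 'a" assume "p \<in> space (borel \<Otimes>\<^sub>M M)"
  then have w: "snd p \<in> space M" by (auto simp: space_pair_measure)
  have "(\<lambda>n. f (d n (fst p)) (snd p)) \<longlonglongrightarrow> f (fst p) (snd p)"
    by (rule continuous_on_tendsto_compose[OF c[OF w] d]) auto
  then show "(\<lambda>n. (\<lambda>(x, w). f (real_of_int \<lfloor>real (Suc n) * x\<rfloor> / real (Suc n)) w) p) \<longlonglongrightarrow> (\<lambda>(x, w). f x w) p" by (simp add: split_beta' d_def)
next
  fix n :: nat
  have "(\<lambda>p. f (real_of_int \<lfloor>real (Suc n) * fst p\<rfloor> / real (Suc n)) (snd p)) \<in> borel_measurable (borel \<Otimes>\<^sub>M M)"
    by (rule measurable_compose_countable[where f="\<lambda>i p. f (real_of_int i / real (Suc n)) (snd p)" and g="\<lambda>p. \<lfloor>real (Suc n) * fst p\<rfloor>"]) measurable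
  then show "(\<lambda>(x, w). f (real_of_int \<lfloor>real (Suc n) * x\<rfloor> / real (Suc n)) w) \<in> borel_measurable (borel \<Otimes>\<^sub>M M)"
    by (simp add: split_beta')
qed

definition weighted_distr :: "'a measure \<Rightarrow> ('a \<Rightarrow> real) \<Rightarrow> ('a \<Rightarrow> real) \<Rightarrow> real measure" where
  "weighted_distr M Y X = distr (density M (\<lambda>w. ennreal (Y w))) borel X"

lemma
  fixes X Y :: "'a \<Rightarrow> real"
  assumes i: "integrable M Y" and [measurable]: "X \<in> borel_measurable M" and nn: "\<And>w. 0 \<le> Y w"
  shows real_distribution_weighted_distr: "(LINT w|M. Y w) = 1 \<Longrightarrow> real_distribution (weighted_distr M Y X)"
    and char_weighted_distr: "char (weighted_distr M Y X) k = (CLINT w|M. of_real (Y w) * iexp (k * X w))"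
    and integral_weighted_distr: "f \<in> borel_measurable borel \<Longrightarrow> (LINT x|weighted_distr M Y X. f x) = (LINT w|M. Y w * f (X w))"
proof -
  have [measurable]: "Y \<in> borel_measurable M" using i by auto
  show "real_distribution (weighted_distr M Y X)" if I: "(LINT w|M. Y w) = 1"
  proof -
    have "emeasure (density M (\<lambda>w. ennreal (Y w))) (space M) = (\<integral>\<^sup>+w. ennreal (Y w) \<partial>M)"
      by (subst emeasure_density) (auto intro!: nn_integral_cong simp: indicator_def)
    also have "\<dots> = ennreal (LINT w|M. Y w)"
      by (rule nn_integral_eq_integral[OF i]) (use nn in auto)
    finally have "prob_space (density M (\<lambda>w. ennreal (Y w)))"
      using I by (intro prob_spaceI) simp
    then have "prob_space (weighted_distr M Y X)" unfolding weighted_distr_def by (rule prob_space.prob_space_distr) simp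
    then show ?thesis by (intro real_distribution.intro real_distribution_axioms.intro) (auto simp: weighted_distr_def)
  qed
  show "char (weighted_distr M Y X) k = (CLINT w|M. of_real (Y w) * iexp (k * X w))"
  proof -
    have "char (weighted_distr M Y X) k = (CLINT w|density M (\<lambda>w. ennreal (Y w)). iexp (k * X w))"
      unfolding char_def weighted_distr_def by (subst integral_distr) auto
    also have "\<dots> = (CLINT w|M. Y w *\<^sub>R iexp (k * X w))"
      by (subst integral_density) (use nn in auto)
    finally show ?thesis by (simp add: scaleR_conv_of_real)
  qed
  show "(LINT x|weighted_distr M Y X. f x) = (LINT w|M. Y w * f (X w))" if [measurable]: "f \<in> borel_measurable borel"
  proof -
    have "(LINT x|weighted_distr M Y X. f x) = (LINT w|density M (\<lambda>w. ennreal (Y w)). f (X w))"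
      unfolding weighted_distr_def by (subst integral_distr) auto
    also have "\<dots> = (LINT w|M. Y w *\<^sub>R f (X w))"
      by (subst integral_density) (use nn in auto)
    finally show ?thesis by simp
  qed
qed

text \<open>Both weighted laws have the same mass, by \<open>k = 0\<close>. If it is positive they
  are normalised and uniqueness of characteristic functions applies; if it is zero both weights
  vanish almost everywhere.\<close>

lemma iexp_integral_determines_nonneg:
  fixes Y1 X1 :: "'a \<Rightarrow> real" and Y2 X2 :: "'b \<Rightarrow> real" and f :: "real \<Rightarrow> real"
  assumes i: "integrable M1 Y1" "integrable M2 Y2" and nn: "\<And>w. 0 \<le> Y1 w" "\<And>w. 0 \<le> Y2 w"
    and m[measurable]: "X1 \<in> borel_measurable M1" "X2 \<in> borel_measurable M2" "f \<in> borel_measurable borel"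
    and eq: "\<And>k. (CLINT w|M1. of_real (Y1 w) * iexp (k * X1 w)) = (CLINT w|M2. of_real (Y2 w) * iexp (k * X2 w))"
  shows "(LINT w|M1. Y1 w * f (X1 w)) = (LINT w|M2. Y2 w * f (X2 w))"
proof -
  define c where "c = (LINT w|M1. Y1 w)"
  have mY[measurable]: "Y1 \<in> borel_measurable M1" "Y2 \<in> borel_measurable M2" using i by auto
  have c2: "(LINT w|M2. Y2 w) = c"
  proof -
    have "complex_of_real (LINT w|M1. Y1 w) = complex_of_real (LINT w|M2. Y2 w)"
      using eq[of 0] by simp
    then show ?thesis by (simp add: c_def)
  qed
  have c0: "0 \<le> c" unfolding c_def using nn by simp
  show ?thesis
  proof (cases "c = 0")
    case True
    have "AE w in M1. Y1 w = 0" "AE w in M2. Y2 w = 0"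
      using integral_nonneg_eq_0_iff_AE[OF i(1)] integral_nonneg_eq_0_iff_AE[OF i(2)] nn True c2 by (auto simp: c_def)
    then have "AE w in M1. Y1 w * f (X1 w) = 0" "AE w in M2. Y2 w * f (X2 w) = 0"
      by (auto elim: eventually_mono)
    then have "(LINT w|M1. Y1 w * f (X1 w)) = 0" "(LINT w|M2. Y2 w * f (X2 w)) = 0"
      by (simp_all add: integral_eq_zero_AE)
    then show ?thesis by simp
  next
    case False
    with c0 have c: "0 < c" by simp
    define V1 where "V1 w = Y1 w / c" for w
    define V2 where "V2 w = Y2 w / c" for w
    have iV: "integrable M1 V1" "integrable M2 V2" unfolding V1_def V2_def using i by auto
    have nV: "0 \<le> V1 w" "0 \<le> V2 w'" for w w' using nn c by (auto simp: V1_def V2_def)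
    have one: "(LINT w|M1. V1 w) = 1" "(LINT w|M2. V2 w) = 1"
      using c c2 by (auto simp: V1_def V2_def c_def)
    have "weighted_distr M1 V1 X1 = weighted_distr M2 V2 X2"
    proof (rule Levy_uniqueness)
      show "real_distribution (weighted_distr M1 V1 X1)"
        by (rule real_distribution_weighted_distr[OF iV(1) m(1) nV(1) one(1)])
      show "real_distribution (weighted_distr M2 V2 X2)"
        by (rule real_distribution_weighted_distr[OF iV(2) m(2) nV(2) one(2)])
      have "(CLINT w|M1. of_real (V1 w) * iexp (k * X1 w)) = (CLINT w|M2. of_real (V2 w) * iexp (k * X2 w))" for k
        using eq[of k] by (simp add: V1_def V2_def)
      then show "char (weighted_distr M1 V1 X1) = char (weighted_distr M2 V2 X2)"
        by (intro ext) (simp only: char_weighted_distr[OF iV(1) m(1) nV(1)] char_weighted_distr[OF iV(2) m(2) nV(2)])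
    qed
    then have "(LINT w|M1. V1 w * f (X1 w)) = (LINT w|M2. V2 w * f (X2 w))"
      using integral_weighted_distr[OF iV(1) m(1) nV(1) m(3)] integral_weighted_distr[OF iV(2) m(2) nV(2) m(3)] by simp
    then show ?thesis using c by (simp add: V1_def V2_def)
  qed
qed

text \<open>Passing to real and imaginary parts of \<open>Y\<close>, and to their positive and
  negative parts, leads to nonnegative weights. The real and imaginary parts can be separated
  because conjugation, with \<open>-k\<close> in place of \<open>k\<close>, gives the hypothesis for
  \<open>cnj (Y w)\<close> too.\<close>

lemma iexp_integral_zero:
  fixes Y :: "'a \<Rightarrow> complex" and X :: "'a \<Rightarrow> real" and f :: "real \<Rightarrow> real"
  assumes i: "integrable M Y" and m[measurable]: "X \<in> borel_measurable M" "f \<in> borel_measurable borel" and f: "\<And>x. \<bar>f x\<bar> \<le> B"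
    and z: "\<And>k. (CLINT w|M. Y w * iexp (k * X w)) = 0"
  shows "(CLINT w|M. Y w * of_real (f (X w))) = 0"
proof -
  have [measurable]: "Y \<in> borel_measurable M" using i by auto
  have ie: "integrable M (\<lambda>w. Y w * iexp (k * X w))" for k
    by (rule Bochner_Integration.integrable_bound[OF i]) (auto simp: norm_mult)
  have ib: "integrable M (\<lambda>w. V w * f (X w))" if V: "integrable M V" for V :: "'a \<Rightarrow> real"
  proof (rule Bochner_Integration.integrable_bound[of M "\<lambda>w. B * V w"])
    show "AE w in M. norm (V w * f (X w)) \<le> norm (B * V w)"
    proof (rule AE_I2)
      fix w
      have "\<bar>f (X w)\<bar> \<le> \<bar>B\<bar>" using f[of "X w"] by linarith
      then have "\<bar>V w\<bar> * \<bar>f (X w)\<bar> \<le> \<bar>V w\<bar> * \<bar>B\<bar>" by (intro mult_left_mono) auto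
      then show "norm (V w * f (X w)) \<le> norm (B * V w)" by (simp add: abs_mult mult.commute)
    qed
    show "(\<lambda>w. V w * f (X w)) \<in> borel_measurable M" using V by measurable
  qed (use V in auto)
  have real_case: "(LINT w|M. V w * f (X w)) = 0"
    if V: "integrable M V" and zV: "\<And>k. (CLINT w|M. of_real (V w) * iexp (k * X w)) = 0" for V :: "'a \<Rightarrow> real"
  proof -
    define P where "P w = max 0 (V w)" for w
    define Q where "Q w = max 0 (- V w)" for w
    have iP: "integrable M P" "integrable M Q" unfolding P_def Q_def using V by auto
    have V_eq: "V w = P w - Q w" for w by (auto simp: P_def Q_def)
    have [measurable]: "P \<in> borel_measurable M" "Q \<in> borel_measurable M" using iP by auto
    have iPe: "integrable M (\<lambda>w. of_real (P w) * iexp (k * X w))" "integrable M (\<lambda>w. of_real (Q w) * iexp (k * X w))" for k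
      by (rule Bochner_Integration.integrable_bound[OF iP(1)] Bochner_Integration.integrable_bound[OF iP(2)]; auto simp: norm_mult)+
    have "(LINT w|M. P w * f (X w)) = (LINT w|M. Q w * f (X w))"
    proof (rule iexp_integral_determines_nonneg[where f=f and ?X1.0=X and ?X2.0=X, OF iP])
      fix k :: real
      have "(CLINT w|M. of_real (P w) * iexp (k * X w)) - (CLINT w|M. of_real (Q w) * iexp (k * X w)) = (CLINT w|M. of_real (V w) * iexp (k * X w))"
        by (subst Bochner_Integration.integral_diff[symmetric], rule iPe, rule iPe) (simp add: V_eq left_diff_distrib)
      then show "(CLINT w|M. of_real (P w) * iexp (k * X w)) = (CLINT w|M. of_real (Q w) * iexp (k * X w))" using zV[of k] by simp
    qed (auto simp: P_def Q_def)
    then show ?thesis using ib[OF iP(1)] ib[OF iP(2)] by (simp add: V_eq left_diff_distrib)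
  qed
  have cn: "cnj (Y w) * iexp (k * X w) = cnj (Y w * iexp ((-k) * X w))" for k w
    by (simp add: exp_cnj)
  have cz: "(CLINT w|M. cnj (Y w) * iexp (k * X w)) = 0" for k
    unfolding cn Bochner_Integration.integral_cnj z by simp
  have ic: "integrable M (\<lambda>w. cnj (Y w) * iexp (k * X w))" for k
    unfolding cn by (rule integrable_cnj[OF ie])
  have re: "(LINT w|M. Re (Y w) * f (X w)) = 0"
  proof (rule real_case)
    show "integrable M (\<lambda>w. Re (Y w))" using i by auto
    fix k :: real
    have "of_real (Re (Y w)) * iexp (k * X w) = (Y w * iexp (k * X w) + cnj (Y w) * iexp (k * X w)) / 2" for w
    proof -
      have e: "of_real (Re (Y w)) = (Y w + cnj (Y w)) / 2" by (simp add: complex_add_cnj)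
      show ?thesis unfolding e by (simp only: distrib_right times_divide_eq_left)
    qed
    note * = this
    show "(CLINT w|M. of_real (Re (Y w)) * iexp (k * X w)) = 0"
      unfolding * by (subst integral_divide_zero, subst Bochner_Integration.integral_add, rule ie, rule ic) (simp only: z cz, simp)
  qed
  have im: "(LINT w|M. Im (Y w) * f (X w)) = 0"
  proof (rule real_case)
    show "integrable M (\<lambda>w. Im (Y w))" using i by auto
    fix k :: real
    have "of_real (Im (Y w)) * iexp (k * X w) = (Y w * iexp (k * X w) - cnj (Y w) * iexp (k * X w)) / (2 * \<i>)" for w
    proof -
      have e: "of_real (Im (Y w)) = (Y w - cnj (Y w)) / (2 * \<i>)" by (simp add: complex_eq_iff)
      show ?thesis unfolding e by (simp only: left_diff_distrib times_divide_eq_left)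
    qed
    note * = this
    show "(CLINT w|M. of_real (Im (Y w)) * iexp (k * X w)) = 0"
      unfolding * by (subst integral_divide_zero, subst Bochner_Integration.integral_diff, rule ie, rule ic) (simp only: z cz, simp)
  qed
  have iYf: "integrable M (\<lambda>w. Y w * of_real (f (X w)))"
  proof (rule Bochner_Integration.integrable_bound[of M "\<lambda>w. of_real B * Y w"])
    show "AE w in M. norm (Y w * of_real (f (X w))) \<le> norm (of_real B * Y w)"
    proof (rule AE_I2)
      fix w
      have "\<bar>f (X w)\<bar> \<le> \<bar>B\<bar>" using f[of "X w"] by linarith
      then have "cmod (Y w) * \<bar>f (X w)\<bar> \<le> cmod (Y w) * \<bar>B\<bar>" by (intro mult_left_mono) auto
      then show "norm (Y w * of_real (f (X w))) \<le> norm (of_real B * Y w)" by (simp add: norm_mult mult.commute)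
    qed
  qed (use i in auto)
  have "Re (CLINT w|M. Y w * of_real (f (X w))) = 0" "Im (CLINT w|M. Y w * of_real (f (X w))) = 0"
    using re im by (simp_all add: integral_Re[OF iYf, symmetric] integral_Im[OF iYf, symmetric])
  then show ?thesis by (simp add: complex_eq_iff)
qed

section \<open>Heat kernel and transitions of the bridge\<close>

definition heat :: "real \<Rightarrow> real \<Rightarrow> real" where
  "heat t x = exp (-(x^2/(2*t))) / sqrt (2*pi*t)"

lemma heat_measurable[measurable]: "(\<lambda>(t, x). heat t x) \<in> borel_measurable (borel \<Otimes>\<^sub>M borel)"
  unfolding heat_def by measurable

lemma heat_pos: "0 < t \<Longrightarrow> 0 < heat t x" by (simp add: heat_def)
lemma heat_nonneg: "0 \<le> t \<Longrightarrow> 0 \<le> heat t x" by (simp add: heat_def)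

text \<open>The transition from \<open>(s, y)\<close> to \<open>(r, z)\<close> is that of Brownian
  motion conditioned to be at 0 at time \<open>T\<close>, with density
  \<open>heat (r - s) (z - y) * heat (T - r) z / heat (T - s) y\<close>. The exponents agree after
  clearing denominators.\<close>

lemma bridge_density:
  assumes "0 \<le> s" "s < r" "r < T"
  shows "normal_density ((T - r)/(T - s) * y) (sqrt ((r - s) * (T - r)/(T - s))) z * heat (T - s) y = heat (r - s) (z - y) * heat (T - r) z"
proof -
  define a where "a = r - s"
  define b where "b = T - r"
  have ab: "0 < a" "0 < b" using assms by (auto simp: a_def b_def)
  have Ts: "T - s = a + b" by (simp add: a_def b_def)
  define v where "v = a * b / (a + b)"
  have v: "0 < v" using ab by (simp add: v_def)
  have ne: "a + b \<noteq> 0" "a \<noteq> 0" "b \<noteq> 0" using ab by auto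
  have e: "-((z - b/(a+b) * y)^2 / (2 * v)) + -(y^2 / (2 * (a+b))) = -((z - y)^2/(2*a)) + -(z^2/(2*b))"
  proof -
    define c where "c = a + b"
    define w where "w = c * z - b * y"
    have c: "c \<noteq> 0" using ne by (simp add: c_def)
    have "z - b/c * y = w / c" using c by (simp add: w_def diff_divide_distrib)
    then have 1: "(z - b/c * y)^2 / (2 * v) = w^2 / (2 * a * b * c)"
      using c ne by (simp add: v_def c_def[symmetric] power2_eq_square)
    have 2: "y^2 / (2 * c) = a * b * y^2 / (2 * a * b * c)" using c ne by simp
    have 3: "(z - y)^2/(2*a) = b * c * (z - y)^2 / (2 * a * b * c)" using c ne by simp
    have 4: "z^2/(2*b) = a * c * z^2 / (2 * a * b * c)" using c ne by simp
    have "w^2 + a * b * y^2 = b * c * (z - y)^2 + a * c * z^2"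
      by (simp add: w_def c_def power2_eq_square algebra_simps)
    then have "w^2 / (2 * a * b * c) + a * b * y^2 / (2 * a * b * c) = b * c * (z - y)^2 / (2 * a * b * c) + a * c * z^2 / (2 * a * b * c)"
      by (simp only: add_divide_distrib[symmetric])
    then show ?thesis unfolding c_def[symmetric] 1 2 3 4 by linarith
  qed
  have s: "sqrt (2 * pi * v) * sqrt (2 * pi * (a+b)) = sqrt (2 * pi * a) * sqrt (2 * pi * b)"
  proof -
    have "(2 * pi * v) * (2 * pi * (a+b)) = (2 * pi * a) * (2 * pi * b)" using ab by (simp add: v_def)
    then show ?thesis by (simp only: real_sqrt_mult[symmetric])
  qed
  have "normal_density (b/(a+b) * y) (sqrt v) z * heat (a+b) y = exp (-((z - b/(a+b) * y)^2 / (2 * v)) + -(y^2 / (2 * (a+b)))) / (sqrt (2 * pi * v) * sqrt (2 * pi * (a+b)))"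
    using v unfolding normal_density_def heat_def exp_add by simp
  also have "\<dots> = heat a (z - y) * heat b z"
    unfolding e s exp_add heat_def by simp
  finally show ?thesis unfolding Ts unfolding a_def[symmetric] b_def[symmetric] v_def[symmetric] .
qed

lemma normal_density_iexp:
  assumes \<sigma>: "0 < \<sigma>"
  shows "(CLINT z|lborel. of_real (normal_density \<mu> \<sigma> z) * iexp (k * z)) = iexp (k * \<mu>) * of_real (exp (-(k^2 * \<sigma>^2 / 2)))"
proof -
  have "(CLINT z|lborel. of_real (normal_density \<mu> \<sigma> z) * iexp (k * z)) = (CLINT z|lborel. \<bar>\<sigma>\<bar> *\<^sub>R (of_real (normal_density \<mu> \<sigma> (\<mu> + \<sigma> * z)) * iexp (k * (\<mu> + \<sigma> * z))))"
    by (subst lborel_integral_real_affine[of \<sigma> _ \<mu>]) (use \<sigma> in auto)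
  also have "\<dots> = (CLINT z|lborel. iexp (k * \<mu>) * (std_normal_density z *\<^sub>R iexp ((k * \<sigma>) * z)))"
  proof (intro Bochner_Integration.integral_cong refl)
    fix z :: real
    have "\<bar>\<sigma>\<bar> * normal_density \<mu> \<sigma> (\<mu> + \<sigma> * z) = std_normal_density z"
      using \<sigma> by (simp add: normal_density_def std_normal_density_def power_mult_distrib real_sqrt_mult)
    then have n: "of_real \<bar>\<sigma>\<bar> * of_real (normal_density \<mu> \<sigma> (\<mu> + \<sigma> * z)) = complex_of_real (std_normal_density z)"
      by (simp only: of_real_mult[symmetric])
    have "iexp (k * (\<mu> + \<sigma> * z)) = iexp (k * \<mu>) * iexp ((k * \<sigma>) * z)"
      by (simp add: exp_add[symmetric] algebra_simps)
    then show "\<bar>\<sigma>\<bar> *\<^sub>R (of_real (normal_density \<mu> \<sigma> (\<mu> + \<sigma> * z)) * iexp (k * (\<mu> + \<sigma> * z))) = iexp (k * \<mu>) * (std_normal_density z *\<^sub>R iexp ((k * \<sigma>) * z))"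
      unfolding scaleR_conv_of_real n[symmetric] by (simp only: mult_ac)
  qed
  also have "\<dots> = iexp (k * \<mu>) * (CLINT z|lborel. std_normal_density z *\<^sub>R iexp ((k * \<sigma>) * z))" by (rule integral_mult_right_zero)
  also have "(CLINT z|lborel. std_normal_density z *\<^sub>R iexp ((k * \<sigma>) * z)) = char std_normal_distribution (k * \<sigma>)"
    unfolding char_def by (subst integral_density) auto
  also have "\<dots> = of_real (exp (-(k^2 * \<sigma>^2 / 2)))"
    unfolding char_std_normal_distribution by (simp add: power_mult_distrib)
  finally show ?thesis .
qed

text \<open>Linear combinations grow by one term at a time, with repeated indices allowed, to match
  the induction over the factors of a cylinder function.\<close>

inductive_set gspan :: "('i \<Rightarrow> 'a \<Rightarrow> real) \<Rightarrow> 'i set \<Rightarrow> ('a \<Rightarrow> real) set" for X S where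
  gspan_zero: "(\<lambda>_. 0) \<in> gspan X S"
| gspan_add: "V \<in> gspan X S \<Longrightarrow> s \<in> S \<Longrightarrow> (\<lambda>w. V w + k * X s w) \<in> gspan X S"

lemma gspan_mono: "V \<in> gspan X S \<Longrightarrow> S \<subseteq> S' \<Longrightarrow> V \<in> gspan X S'"
  by (induction rule: gspan.induct) (auto intro: gspan.intros)

text \<open>Centred Gaussianity is stated through characteristic functions, which puts degenerate
  combinations on the same footing; the bridge vanishes at both ends.\<close>

locale gauss_bridge = prob_space M for M :: "'a measure" +
  fixes T :: real and X :: "real \<Rightarrow> 'a \<Rightarrow> real"
  assumes T: "0 < T"
    and X_measurable[measurable]: "\<And>s. X s \<in> borel_measurable M"
    and X_cont: "\<And>w. w \<in> space M \<Longrightarrow> continuous_on UNIV (\<lambda>s. X s w)"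
    and X_square: "\<And>s. s \<in> {0..T} \<Longrightarrow> integrable M (\<lambda>w. X s w ^ 2)"
    and X_cov: "\<And>s t. s \<in> {0..T} \<Longrightarrow> t \<in> {0..T} \<Longrightarrow> (LINT w|M. X s w * X t w) = min s t - s * t / T"
    and X_char: "\<And>V. V \<in> gspan X {0..T} \<Longrightarrow> (CLINT w|M. iexp (V w)) = of_real (exp (- (LINT w|M. V w ^ 2) / 2))"
begin

lemma square_mult_integrable:
  fixes V W :: "'a \<Rightarrow> real"
  assumes [measurable]: "V \<in> borel_measurable M" "W \<in> borel_measurable M" and i: "integrable M (\<lambda>w. V w ^ 2)" "integrable M (\<lambda>w. W w ^ 2)"
  shows "integrable M (\<lambda>w. V w * W w)"
proof (rule Bochner_Integration.integrable_bound[OF Bochner_Integration.integrable_add[OF i]])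
  show "AE w in M. norm (V w * W w) \<le> norm (V w ^ 2 + W w ^ 2)"
  proof (rule AE_I2)
    fix w
    have "0 \<le> (\<bar>V w\<bar> - \<bar>W w\<bar>)^2" by simp
    then have "2 * (\<bar>V w\<bar> * \<bar>W w\<bar>) \<le> V w ^ 2 + W w ^ 2" by (simp add: power2_diff)
    moreover have "0 \<le> \<bar>V w\<bar> * \<bar>W w\<bar>" by simp
    ultimately show "norm (V w * W w) \<le> norm (V w ^ 2 + W w ^ 2)" unfolding real_norm_def abs_mult by linarith
  qed
qed measurable

lemma gspan_square:
  assumes "V \<in> gspan X S" "S \<subseteq> {0..T}"
  shows "V \<in> borel_measurable M" "integrable M (\<lambda>w. V w ^ 2)"
  using assms
proof (induction rule: gspan.induct)
  case (gspan_add V s k)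
  {
    case 1
    then show ?case using gspan_add by auto
  next
    case 2
    have s: "s \<in> {0..T}" using gspan_add 2 by auto
    have i: "integrable M (\<lambda>w. V w * X s w)"
      by (rule square_mult_integrable) (use gspan_add 2 X_square[OF s] in auto)
    have "(\<lambda>w. (V w + k * X s w)^2) = (\<lambda>w. V w^2 + (2 * k) * (V w * X s w) + k^2 * X s w^2)"
      by (auto simp: power2_eq_square algebra_simps)
    then show ?case using i gspan_add(4) 2 X_square[OF s] by auto
  }
qed auto

text \<open>\<open>X r - (T - r)/(T - s) * X s\<close> is uncorrelated with all values up to time
  \<open>s\<close>; by linearity this is a statement about the covariance
  \<open>min s t - s * t / T\<close>.\<close>

lemma gspan_cov:
  assumes "V \<in> gspan X {0..s}" "0 \<le> s" "s < r" "r < T"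
  shows "(LINT w|M. V w * X r w) = (T - r)/(T - s) * (LINT w|M. V w * X s w)"
  using assms
proof (induction rule: gspan.induct)
  case (gspan_add V j k)
  have sub: "{0..s} \<subseteq> {0..T}" using gspan_add by auto
  have j: "j \<in> {0..T}" "s \<in> {0..T}" "r \<in> {0..T}" "j \<le> s" using gspan_add by auto
  have i: "integrable M (\<lambda>w. V w * X q w)" "integrable M (\<lambda>w. X j w * X q w)" if "q \<in> {0..T}" for q
    using gspan_square[OF gspan_add(1) sub] X_square j that by (auto intro!: square_mult_integrable)
  have e: "(LINT w|M. (V w + k * X j w) * X q w) = (LINT w|M. V w * X q w) + k * (min j q - j * q / T)" if q: "q \<in> {0..T}" for q
    using i[OF q] X_cov[OF j(1) q] by (simp add: distrib_right mult.assoc)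
  have c: "min j r - j * r / T = (T - r)/(T - s) * (min j s - j * s / T)"
    using j gspan_add T by (simp add: min_def field_simps)
  show ?case unfolding e[OF j(3)] e[OF j(2)] c gspan_add.IH[OF gspan_add.prems] distrib_left by (simp only: mult_ac)
qed simp

text \<open>Conditionally on the past, \<open>X r\<close> is normal with mean \<open>c * X s\<close>
  and variance \<open>v\<close>. On the level of characteristic functions this is the decomposition
  \<open>r - r^2/T = c^2 * (s - s^2/T) + v\<close> of the variance.\<close>

lemma iexp_markov:
  assumes V: "V \<in> gspan X {0..s}" and s: "0 \<le> s" "s < r" "r < T"
  defines "c \<equiv> (T - r)/(T - s)" and "v \<equiv> (r - s) * (T - r)/(T - s)"
  shows "(CLINT w|M. iexp (V w + k * X r w)) = of_real (exp (-(k^2 * v / 2))) * (CLINT w|M. iexp (V w + k * (c * X s w)))"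
proof -
  have sub: "{0..s} \<subseteq> {0..T}" using s by auto
  have sr: "s \<in> {0..T}" "r \<in> {0..T}" using s by auto
  have VT: "V \<in> gspan X {0..T}" by (rule gspan_mono[OF V sub])
  note V2 = gspan_square[OF V sub]
  have i: "integrable M (\<lambda>w. V w * X q w)" if "q \<in> {0..T}" for q
    by (rule square_mult_integrable[OF V2(1) _ V2(2) X_square[OF that]]) simp
  have sq: "(LINT w|M. (V w + a * X q w)^2) = (LINT w|M. V w^2) + 2 * a * (LINT w|M. V w * X q w) + a^2 * (q - q^2 / T)" if q: "q \<in> {0..T}" for q a
  proof -
    have "(LINT w|M. (V w + a * X q w)^2) = (LINT w|M. V w^2 + (2 * a) * (V w * X q w) + a^2 * X q w^2)"
      by (simp add: power2_eq_square algebra_simps)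
    also have "\<dots> = (LINT w|M. V w^2) + 2 * a * (LINT w|M. V w * X q w) + a^2 * (LINT w|M. X q w^2)"
      using i[OF q] V2 X_square[OF q] by simp
    also have "(LINT w|M. X q w^2) = q - q^2 / T" using X_cov[OF q q] by (simp add: power2_eq_square)
    finally show ?thesis .
  qed
  have vv: "r - r^2 / T = c^2 * (s - s^2 / T) + v"
  proof -
    have "T - s \<noteq> 0" "T \<noteq> 0" using s T by auto
    have "c^2 * (s - s^2 / T) = (T - r) * ((T - r) * s) / ((T - s) * T)"
    proof -
      have "s - s^2 / T = s * (T - s) / T" using \<open>T \<noteq> 0\<close> by (simp add: power2_eq_square diff_divide_distrib right_diff_distrib)
      then show ?thesis using \<open>T - s \<noteq> 0\<close> by (simp add: c_def power2_eq_square)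
    qed
    moreover have "v = (T - r) * ((r - s) * T) / ((T - s) * T)" using \<open>T \<noteq> 0\<close> by (simp add: v_def)
    ultimately have "c^2 * (s - s^2 / T) + v = (T - r) * ((T - r) * s + (r - s) * T) / ((T - s) * T)"
      by (simp only: add_divide_distrib[symmetric] distrib_left)
    also have "(T - r) * s + (r - s) * T = r * (T - s)" by (simp add: algebra_simps)
    also have "(T - r) * (r * (T - s)) / ((T - s) * T) = (T - r) * r / T" using \<open>T - s \<noteq> 0\<close> by simp
    also have "\<dots> = r - r^2 / T" using \<open>T \<noteq> 0\<close> by (simp add: power2_eq_square diff_divide_distrib left_diff_distrib)
    finally show ?thesis ..
  qed
  have "(CLINT w|M. iexp (V w + k * X r w)) = of_real (exp (- (LINT w|M. (V w + k * X r w)^2) / 2))"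
    by (rule X_char[OF gspan_add[OF VT sr(2)]])
  also have "- (LINT w|M. (V w + k * X r w)^2) / 2 = -(k^2 * v / 2) + - (LINT w|M. (V w + (k * c) * X s w)^2) / 2"
    unfolding sq[OF sr(1)] sq[OF sr(2)] gspan_cov[OF V s] c_def[symmetric] vv
  proof -
    fix A e D :: real
    show "- (A + 2 * k * (c * e) + k^2 * (c^2 * D + v)) / 2 = -(k^2 * v / 2) + - (A + 2 * (k * c) * e + (k * c)^2 * D) / 2"
      by (simp add: power_mult_distrib field_simps)
  qed
  also have "of_real (exp (-(k^2 * v / 2) + - (LINT w|M. (V w + (k * c) * X s w)^2) / 2)) = of_real (exp (-(k^2 * v / 2))) * complex_of_real (exp (- (LINT w|M. (V w + (k * c) * X s w)^2) / 2))"
    unfolding exp_add of_real_mult ..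
  also have "complex_of_real (exp (- (LINT w|M. (V w + (k * c) * X s w)^2) / 2)) = (CLINT w|M. iexp (V w + (k * c) * X s w))"
    by (rule X_char[OF gspan_add[OF VT sr(1)], symmetric])
  finally show ?thesis by (simp only: mult.assoc)
qed

text \<open>In contrast to \<open>past\<close>, the factors are nonnegative and merely measurable:
  they become weights of \<open>ennreal\<close> integrals, and discontinuous \<open>F\<close> have
  to be absorbed.\<close>

inductive_set cylinder :: "real \<Rightarrow> ('a \<Rightarrow> real) set" for s :: real where
  cylinder_one: "(\<lambda>_. 1) \<in> cylinder s"
| cylinder_mult: "H \<in> cylinder s \<Longrightarrow> j \<in> {0..s} \<Longrightarrow> F \<in> borel_measurable borel \<Longrightarrow> (\<And>z. 0 \<le> F z) \<Longrightarrow> (\<And>z. F z \<le> B) \<Longrightarrow>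
    (\<lambda>w. H w * F (X j w)) \<in> cylinder s"

lemma cylinder_props:
  assumes "H \<in> cylinder s"
  shows "H \<in> borel_measurable M" "\<exists>B. \<forall>w. 0 \<le> H w \<and> H w \<le> B"
  using assms
proof (induction rule: cylinder.induct)
  case (cylinder_mult H j F B)
  {
    case 1
    show ?case using cylinder_mult by measurable
  next
    case 2
    obtain B' where B': "\<And>w. 0 \<le> H w" "\<And>w. H w \<le> B'" using cylinder_mult by auto
    have "H w * F (X j w) \<le> B' * B" for w
      using B' cylinder_mult(4,5) by (intro mult_mono order.trans[OF B'(1) B'(2)]) auto
    then show ?case using B' cylinder_mult(4) by (intro exI[of _ "B' * B"]) auto
  }
qed auto

text \<open>The factors of \<open>H\<close> are inserted one at a time: for fixed remaining factors, an identity for all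
  exponentials of \<open>X j\<close> extends to all bounded functions of \<open>X j\<close>.\<close>

lemma cylinder_iexp:
  assumes H: "H \<in> cylinder s" and s: "0 \<le> s" "s < r" "r < T" and V: "V \<in> gspan X {0..s}"
  defines "c \<equiv> (T - r)/(T - s)" and "v \<equiv> (r - s) * (T - r)/(T - s)"
  shows "(CLINT w|M. of_real (H w) * (iexp (V w + k * X r w) - of_real (exp (-(k^2 * v / 2))) * iexp (V w + k * (c * X s w)))) = 0"
  using H V
proof (induction arbitrary: V rule: cylinder.induct)
  case cylinder_one
  have mV[measurable]: "V \<in> borel_measurable M" using gspan_square(1)[OF cylinder_one] s by auto
  have i: "integrable M (\<lambda>w. iexp (V w + a * X q w))" for a q
    by (rule integrable_const_bound[where B=1]) auto
  have i2: "integrable M (\<lambda>w. iexp (V w + k * (c * X s w)))"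
    by (rule integrable_const_bound[where B=1]) auto
  show ?case
    using iexp_markov[OF cylinder_one s, of k] i[of k r] i2 unfolding c_def[symmetric] v_def[symmetric]
    by (simp add: Bochner_Integration.integral_diff)
next
  case (cylinder_mult H j F B)
  note mH[measurable] = cylinder_props(1)[OF cylinder_mult(1)]
  obtain BH where BH: "\<And>w. 0 \<le> H w" "\<And>w. H w \<le> BH" using cylinder_props(2)[OF cylinder_mult(1)] by auto
  have mV[measurable]: "V \<in> borel_measurable M" using gspan_square(1)[OF cylinder_mult.prems] s by auto
  define W where "W V w = iexp (V w + k * X r w) - of_real (exp (-(k^2 * v / 2))) * iexp (V w + k * (c * X s w))" for V w
  have "(CLINT w|M. (of_real (H w) * W V w) * of_real (F (X j w))) = 0"
  proof (rule iexp_integral_zero[where X="X j" and f=F and B=B and Y="\<lambda>w. of_real (H w) * W V w"])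
    show "integrable M (\<lambda>w. of_real (H w) * W V w)"
    proof (rule integrable_const_bound[where B="BH * (1 + \<bar>exp (-(k^2 * v / 2))\<bar>)"])
      show "AE w in M. norm (of_real (H w) * W V w) \<le> BH * (1 + \<bar>exp (-(k^2 * v / 2))\<bar>)"
      proof (rule AE_I2)
        fix w
        have "norm (W V w) \<le> norm (iexp (V w + k * X r w)) + norm (of_real (exp (-(k^2 * v / 2))) * iexp (V w + k * (c * X s w)))"
          unfolding W_def by (rule norm_triangle_ineq4)
        also have "\<dots> = 1 + \<bar>exp (-(k^2 * v / 2))\<bar>" unfolding norm_mult norm_exp_i_times norm_of_real by simp
        finally show "norm (of_real (H w) * W V w) \<le> BH * (1 + \<bar>exp (-(k^2 * v / 2))\<bar>)"
          unfolding norm_mult norm_of_real using BH by (intro mult_mono) (auto intro: order.trans[OF BH(1) BH(2)])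
      qed
    qed (simp add: W_def)
    show "\<bar>F z\<bar> \<le> B" for z using cylinder_mult(4,5)[of z] by simp
    fix k' :: real
    have "(of_real (H w) * W V w) * iexp (k' * X j w) = of_real (H w) * W (\<lambda>w. V w + k' * X j w) w" for w
    proof -
      have "iexp (V w + a) * iexp (k' * X j w) = iexp ((V w + k' * X j w) + a)" for a
        by (simp add: exp_add[symmetric] algebra_simps)
      then have "W V w * iexp (k' * X j w) = W (\<lambda>w. V w + k' * X j w) w"
        unfolding W_def left_diff_distrib mult.assoc by (simp only:)
      then show ?thesis by (simp only: mult.assoc)
    qed
    note e = this
    show "(CLINT w|M. (of_real (H w) * W V w) * iexp (k' * X j w)) = 0"
      unfolding e unfolding W_def by (rule cylinder_mult.IH[OF gspan_add[OF cylinder_mult.prems cylinder_mult(2)]])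
  qed (use cylinder_mult in auto)
  then show ?case unfolding W_def[symmetric] by (simp add: mult_ac)
qed

definition bridge_trans :: "real \<Rightarrow> real \<Rightarrow> (real \<Rightarrow> real) \<Rightarrow> real \<Rightarrow> real" where
  "bridge_trans s r f y = (LINT z|lborel. normal_density ((T - r)/(T - s) * y) (sqrt ((r - s) * (T - r)/(T - s))) z * f z)"

lemma bridge_trans_measurable[measurable]:
  assumes [measurable]: "f \<in> borel_measurable borel"
  shows "bridge_trans s r f \<in> borel_measurable borel"
  unfolding bridge_trans_def[abs_def] normal_density_def by measurable

lemma bridge_trans_bounds:
  assumes s: "s < r" "r < T" and [measurable]: "f \<in> borel_measurable borel" and f: "\<And>z. \<bar>f z\<bar> \<le> B"
  shows "\<bar>bridge_trans s r f y\<bar> \<le> B" "(\<And>z. 0 \<le> f z) \<Longrightarrow> 0 \<le> bridge_trans s r f y"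
proof -
  let ?n = "normal_density ((T - r)/(T - s) * y) (sqrt ((r - s) * (T - r)/(T - s)))"
  have v: "0 < sqrt ((r - s) * (T - r)/(T - s))" using s by simp
  have i: "integrable lborel ?n" "(LINT z|lborel. ?n z) = 1" using v by auto
  have ib: "integrable lborel (\<lambda>z. ?n z * f z)"
  proof (rule Bochner_Integration.integrable_bound[of _ "\<lambda>z. B * ?n z"])
    show "AE z in lborel. norm (?n z * f z) \<le> norm (B * ?n z)"
    proof (rule AE_I2)
      fix z
      have "?n z * \<bar>f z\<bar> \<le> ?n z * \<bar>B\<bar>" using f[of z] by (intro mult_left_mono) auto
      then show "norm (?n z * f z) \<le> norm (B * ?n z)" by (simp add: abs_mult mult.commute)
    qed
  qed (use i in auto)
  have "\<bar>bridge_trans s r f y\<bar> \<le> (LINT z|lborel. \<bar>?n z * f z\<bar>)" unfolding bridge_trans_def by (rule integral_abs_bound)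
  also have "\<dots> \<le> (LINT z|lborel. B * ?n z)"
  proof (rule integral_mono)
    fix z
    show "\<bar>?n z * f z\<bar> \<le> B * ?n z" using f[of z] by (simp add: abs_mult mult.commute mult_right_mono)
  qed (use i ib in auto)
  also have "\<dots> = B" using i by simp
  finally show "\<bar>bridge_trans s r f y\<bar> \<le> B" .
  show "0 \<le> bridge_trans s r f y" if "\<And>z. 0 \<le> f z"
    unfolding bridge_trans_def using that by (intro Bochner_Integration.integral_nonneg) auto
qed

text \<open>The law of \<open>X r\<close> weighted by \<open>H\<close> is compared with the second
  marginal of \<open>H\<close> times the normal density on a product space. Their characteristic
  functions agree by \<open>cylinder_iexp\<close>.\<close>

lemma cylinder_markov:
  assumes H: "H \<in> cylinder s" and s: "0 \<le> s" "s < r" "r < T" and [measurable]: "f \<in> borel_measurable borel" and f: "\<And>z. \<bar>f z\<bar> \<le> B"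
  shows "(LINT w|M. H w * f (X r w)) = (LINT w|M. H w * bridge_trans s r f (X s w))"
proof -
  define c where "c = (T - r)/(T - s)"
  define v where "v = (r - s) * (T - r)/(T - s)"
  have v: "0 < v" "0 < sqrt v" using s by (auto simp: v_def)
  note mH[measurable] = cylinder_props(1)[OF H]
  obtain BH where BH: "\<And>w. 0 \<le> H w" "\<And>w. H w \<le> BH" using cylinder_props(2)[OF H] by auto
  interpret L: pair_sigma_finite M lborel by unfold_locales
  let ?n = "\<lambda>w z. normal_density (c * X s w) (sqrt v) z"
  define Y2 where "Y2 = (\<lambda>p::'a \<times> real. H (fst p) * normal_density (c * X s (fst p)) (sqrt v) (snd p))"
  have [measurable]: "X s \<in> borel_measurable M" using X_measurable s by auto
  have mY2[measurable]: "Y2 \<in> borel_measurable (M \<Otimes>\<^sub>M lborel)" unfolding Y2_def normal_density_def by measurable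
  have iH: "integrable M H" by (rule integrable_const_bound[where B=BH]) (use BH in auto)
  have iY2: "integrable (M \<Otimes>\<^sub>M lborel) Y2"
  proof (rule L.Fubini_integrable)
    have "(LINT z|lborel. norm (Y2 (w, z))) = H w" for w
      using v BH by (simp add: Y2_def abs_mult)
    then show "integrable M (\<lambda>w. LINT z|lborel. norm (Y2 (w, z)))" using iH by simp
    show "AE w in M. integrable lborel (\<lambda>z. Y2 (w, z))" using v by (simp add: Y2_def)
  qed measurable
  have key: "(LINT w|M. H w * f (X r w)) = (LINT p|(M \<Otimes>\<^sub>M lborel). Y2 p * f (snd p))"
  proof (rule iexp_integral_determines_nonneg[where f=f and ?X1.0="X r" and ?X2.0=snd, OF iH iY2 BH(1)])
    show "0 \<le> Y2 p" for p using BH v by (simp add: Y2_def)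
    fix k :: real
    have iW: "integrable M (\<lambda>w. of_real (H w) * iexp (U w))" if [measurable]: "U \<in> borel_measurable M" for U :: "'a \<Rightarrow> real"
      by (rule Bochner_Integration.integrable_bound[OF iH]) (auto simp: norm_mult)
    have "(CLINT w|M. of_real (H w) * iexp (k * X r w)) = of_real (exp (-(k^2 * v / 2))) * (CLINT w|M. of_real (H w) * iexp (k * (c * X s w)))"
    proof -
      have "0 = (CLINT w|M. of_real (H w) * (iexp (0 + k * X r w) - of_real (exp (-(k^2 * v / 2))) * iexp (0 + k * (c * X s w))))"
        using cylinder_iexp[OF H s gspan_zero, of k] unfolding c_def v_def by simp
      also have "\<dots> = (CLINT w|M. of_real (H w) * iexp (k * X r w) - of_real (exp (-(k^2 * v / 2))) * (of_real (H w) * iexp (k * (c * X s w))))"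
        by (intro Bochner_Integration.integral_cong refl) (simp only: add_0_left right_diff_distrib mult.left_commute)
      also have "\<dots> = (CLINT w|M. of_real (H w) * iexp (k * X r w)) - of_real (exp (-(k^2 * v / 2))) * (CLINT w|M. of_real (H w) * iexp (k * (c * X s w)))"
        by (subst Bochner_Integration.integral_diff, rule iW, simp, rule integrable_mult_right, rule iW, simp, simp only: integral_mult_right_zero)
      finally show ?thesis by simp
    qed
    also have "\<dots> = (CLINT p|(M \<Otimes>\<^sub>M lborel). of_real (Y2 p) * iexp (k * snd p))"
    proof -
      have i2: "integrable (M \<Otimes>\<^sub>M lborel) (\<lambda>p. of_real (Y2 p) * iexp (k * snd p))"
        by (rule Bochner_Integration.integrable_bound[OF iY2]) (auto simp: norm_mult)
      have "(CLINT p|(M \<Otimes>\<^sub>M lborel). of_real (Y2 p) * iexp (k * snd p)) = (CLINT w|M. CLINT z|lborel. of_real (Y2 (w, z)) * iexp (k * z))"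
        using L.integral_fst'[OF i2] by simp
      also have "\<dots> = (CLINT w|M. of_real (exp (-(k^2 * v / 2))) * (of_real (H w) * iexp (k * (c * X s w))))"
      proof (intro Bochner_Integration.integral_cong refl)
        fix w
        have "(CLINT z|lborel. of_real (Y2 (w, z)) * iexp (k * z)) = (CLINT z|lborel. of_real (H w) * (of_real (?n w z) * iexp (k * z)))"
          by (intro Bochner_Integration.integral_cong refl) (simp add: Y2_def)
        also have "\<dots> = of_real (H w) * (iexp (k * (c * X s w)) * of_real (exp (-(k^2 * v / 2))))"
          using normal_density_iexp[OF v(2), of "c * X s w" k] v by (simp only: integral_mult_right_zero real_sqrt_pow2 less_imp_le)
        finally show "(CLINT z|lborel. of_real (Y2 (w, z)) * iexp (k * z)) = of_real (exp (-(k^2 * v / 2))) * (of_real (H w) * iexp (k * (c * X s w)))"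
          by (simp only: mult_ac)
      qed
      finally show ?thesis by (simp only: integral_mult_right_zero)
    qed
    finally show "(CLINT w|M. of_real (H w) * iexp (k * X r w)) = (CLINT p|(M \<Otimes>\<^sub>M lborel). of_real (Y2 p) * iexp (k * snd p))" .
  qed auto
  have i3: "integrable (M \<Otimes>\<^sub>M lborel) (\<lambda>p. Y2 p * f (snd p))"
  proof (rule Bochner_Integration.integrable_bound[of _ "\<lambda>p. B * Y2 p"])
    show "AE p in M \<Otimes>\<^sub>M lborel. norm (Y2 p * f (snd p)) \<le> norm (B * Y2 p)"
    proof (rule AE_I2)
      fix p :: "'a \<times> real"
      have "\<bar>f (snd p)\<bar> \<le> \<bar>B\<bar>" using f[of "snd p"] by simp
      then have "\<bar>Y2 p\<bar> * \<bar>f (snd p)\<bar> \<le> \<bar>Y2 p\<bar> * \<bar>B\<bar>" by (intro mult_left_mono) auto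
      then show "norm (Y2 p * f (snd p)) \<le> norm (B * Y2 p)" by (simp add: abs_mult mult.commute)
    qed
  qed (use iY2 in auto)
  have "(LINT p|(M \<Otimes>\<^sub>M lborel). Y2 p * f (snd p)) = (LINT w|M. LINT z|lborel. Y2 (w, z) * f z)"
    using L.integral_fst'[OF i3] by simp
  also have "\<dots> = (LINT w|M. H w * bridge_trans s r f (X s w))"
    by (simp add: Y2_def bridge_trans_def c_def v_def mult.assoc)
  finally show ?thesis using key by simp
qed

end

section \<open>Moments of occupation times\<close>

text \<open>Integral over the simplex of ordered times below \<open>s\<close>. The outermost
  variable is the latest time, so that the times can be peeled off backwards with the Markov
  property.\<close>

primrec iterated_integral :: "(real \<Rightarrow> ennreal) \<Rightarrow> nat \<Rightarrow> real \<Rightarrow> ennreal" where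
  "iterated_integral h 0 s = 1"
| "iterated_integral h (Suc n) s = (NN u. (if 0 < u \<and> u < s then h u * iterated_integral h n u else 0))"

lemma iterated_integral_measurable:
  assumes [measurable]: "(\<lambda>(u, w). h w u) \<in> borel_measurable (borel \<Otimes>\<^sub>M M)"
  shows "(\<lambda>(s, w). iterated_integral (h w) n s) \<in> borel_measurable (borel \<Otimes>\<^sub>M M)"
proof (induction n)
  case (Suc n)
  note [measurable] = Suc
  show ?case by simp measurable
qed simp

text \<open>The square of integration is cut along its diagonal, a null set.\<close>

lemma nn_integral_triangle:
  fixes h k :: "real \<Rightarrow> ennreal"
  assumes [measurable]: "h \<in> borel_measurable borel" "k \<in> borel_measurable borel"
  defines "J \<equiv> \<lambda>f s. NN u. f u * indicator {0<..<s} u"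
  shows "J h s * J k s = J (\<lambda>u. J h u * k u) s + J (\<lambda>u. h u * J k u) s"
proof -
  define P where "P u v = (h v * k u * indicator {0<..<s} u) * indicator {0<..<u} v" for u v :: real
  define Q where "Q u v = (h v * k u * indicator {0<..<s} v) * indicator {0<..<v} u" for u v :: real
  have i: "indicator {0<..<t} u = (if 0 < u \<and> u < t then 1 else 0 :: ennreal)" for t u :: real
    by (simp add: indicator_def)
  have [measurable]: "(\<lambda>(u, v). P u v) \<in> borel_measurable (borel \<Otimes>\<^sub>M borel)" "(\<lambda>(u, v). Q u v) \<in> borel_measurable (borel \<Otimes>\<^sub>M borel)"
    unfolding P_def Q_def i by measurable
  have "J h s * J k s = (NN u. J h s * (k u * indicator {0<..<s} u))"
    unfolding J_def by (rule nn_integral_cmult[symmetric]) simp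
  also have "\<dots> = (NN u. NN v. P u v + Q u v)"
  proof (rule nn_integral_cong)
    fix u :: real
    have "J h s * (k u * indicator {0<..<s} u) = (NN v. h v * indicator {0<..<s} v * (k u * indicator {0<..<s} u))"
      unfolding J_def by (rule nn_integral_multc[symmetric]) simp
    also have "\<dots> = (NN v. P u v + Q u v)"
    proof (rule nn_integral_cong_AE)
      show "AE v in lborel. h v * indicator {0<..<s} v * (k u * indicator {0<..<s} u) = P u v + Q u v"
        using AE_lborel_singleton[of u] by eventually_elim (auto simp: P_def Q_def i)
    qed
    finally show "J h s * (k u * indicator {0<..<s} u) = (NN v. P u v + Q u v)" .
  qed
  also have "\<dots> = (NN u. (NN v. P u v) + (NN v. Q u v))"
    by (rule nn_integral_cong, rule nn_integral_add) simp_all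
  also have "\<dots> = (NN u. NN v. P u v) + (NN u. NN v. Q u v)"
    by (rule nn_integral_add) simp_all
  finally have *: "J h s * J k s = (NN u. NN v. P u v) + (NN u. NN v. Q u v)" .
  have Pu: "(NN v. P u v) = J h u * k u * indicator {0<..<s} u" for u
  proof -
    have "P u v = (h v * indicator {0<..<u} v) * (k u * indicator {0<..<s} u)" for v
      unfolding P_def by (simp only: mult_ac)
    then have "(NN v. P u v) = (NN v. (h v * indicator {0<..<u} v) * (k u * indicator {0<..<s} u))" by simp
    also have "\<dots> = J h u * (k u * indicator {0<..<s} u)" unfolding J_def by (rule nn_integral_multc) simp
    finally show ?thesis by (simp only: mult.assoc)
  qed
  have Qv: "(NN u. Q u v) = h v * J k v * indicator {0<..<s} v" for v
  proof -
    have "Q u v = (k u * indicator {0<..<v} u) * (h v * indicator {0<..<s} v)" for u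
      unfolding Q_def by (simp only: mult_ac)
    then have "(NN u. Q u v) = (NN u. (k u * indicator {0<..<v} u) * (h v * indicator {0<..<s} v))" by simp
    also have "\<dots> = J k v * (h v * indicator {0<..<s} v)" unfolding J_def by (rule nn_integral_multc) simp
    finally show ?thesis by (simp only: mult_ac)
  qed
  have "(NN u. NN v. Q u v) = (NN v. NN u. Q u v)"
    by (rule lborel_pair.Fubini') simp
  then show ?thesis unfolding * Pu Qv unfolding J_def by simp
qed

text \<open>A cube consists of \<open>n!\<close> simplices. Formally, \<open>J h s\<close> times the
  \<open>n\<close>-th iterated integral is \<open>Suc n\<close> times the next one, by induction
  with \<open>nn_integral_triangle\<close>.\<close>

lemma iterated_integral_power:
  assumes [measurable]: "h \<in> borel_measurable borel"
  shows "of_nat (fact n) * iterated_integral h n s = (NN u. (if 0 < u \<and> u < s then h u else 0)) ^ n"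
proof -
  let ?I = "iterated_integral h"
  define J where "J f s = (NN u. f u * indicator {0<..<s} u)" for f :: "real \<Rightarrow> ennreal" and s :: real
  have J: "(NN u. (if 0 < u \<and> u < s then f u else 0)) = J f s" for f s
    unfolding J_def by (rule nn_integral_cong) simp
  have I_Suc: "?I (Suc n) s = J (\<lambda>u. h u * ?I n u) s" for n s
    unfolding iterated_integral.simps by (rule J)
  have mI[measurable]: "?I n \<in> borel_measurable borel" for n
  proof (induction n)
    case (Suc n)
    note [measurable] = Suc
    have "(\<lambda>s. NN u. (if 0 < u \<and> u < s then h u * ?I n u else 0)) \<in> borel_measurable borel" by measurable
    moreover have "?I (Suc n) = (\<lambda>s. NN u. (if 0 < u \<and> u < s then h u * ?I n u else 0))" by (rule ext) (rule iterated_integral.simps)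
    ultimately show ?case by (simp only:)
  next
    case 0
    have "?I 0 = (\<lambda>s. 1)" by (rule ext) (rule iterated_integral.simps)
    then show ?case by (simp only: borel_measurable_const)
  qed
  have step: "J h s * ?I n s = of_nat (Suc n) * ?I (Suc n) s" for n s
  proof (induction n arbitrary: s)
    case 0
    show ?case by (simp only: I_Suc) simp
  next
    case (Suc n)
    have "(\<lambda>u. J h u * (h u * ?I n u)) = (\<lambda>u. of_nat (Suc n) * (h u * ?I (Suc n) u))"
    proof
      fix u
      have "J h u * (h u * ?I n u) = h u * (J h u * ?I n u)" by (simp only: mult_ac)
      then show "J h u * (h u * ?I n u) = of_nat (Suc n) * (h u * ?I (Suc n) u)"
        unfolding Suc.IH[of u] by (simp only: mult_ac)
    qed
    moreover have "J (\<lambda>u. of_nat (Suc n) * (h u * ?I (Suc n) u)) s = of_nat (Suc n) * ?I (Suc (Suc n)) s"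
    proof -
      have "(\<lambda>u. h u * ?I (Suc n) u * indicator {0<..<s} u) \<in> borel_measurable lborel" by (simp del: iterated_integral.simps)
      then show ?thesis unfolding J_def I_Suc[of "Suc n"] mult.assoc[of "of_nat (Suc n)"] by (rule nn_integral_cmult)
    qed
    moreover have "J h s * ?I (Suc n) s = J (\<lambda>u. J h u * (h u * ?I n u)) s + J (\<lambda>u. h u * J (\<lambda>u. h u * ?I n u) u) s"
      unfolding I_Suc J_def by (rule nn_integral_triangle) simp_all
    ultimately have "J h s * ?I (Suc n) s = of_nat (Suc n) * ?I (Suc (Suc n)) s + ?I (Suc (Suc n)) s"
      by (simp only: I_Suc)
    then show ?case by (simp only: of_nat_Suc[of "Suc n"] distrib_right mult_1 add.commute)
  qed
  have "of_nat (fact n) * ?I n s = J h s ^ n"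
  proof (induction n)
    case (Suc n)
    have "of_nat (fact (Suc n)) * ?I (Suc n) s = of_nat (fact n) * (of_nat (Suc n) * ?I (Suc n) s)"
      by (simp only: fact_Suc of_nat_mult of_nat_id mult_ac)
    also have "\<dots> = J h s * (of_nat (fact n) * ?I n s)" unfolding step[symmetric] by (simp only: mult_ac)
    also have "\<dots> = J h s ^ Suc n" unfolding Suc by simp
    finally show ?case .
  qed simp
  then show ?thesis unfolding J .
qed

text \<open>Density at \<open>z\<close> of Brownian motion from 0 at time \<open>s\<close>, weighted
  by the \<open>n\<close>-fold simplex integral of \<open>F\<close> along the path.\<close>

primrec heat_iter :: "(real \<Rightarrow> real) \<Rightarrow> nat \<Rightarrow> real \<Rightarrow> real \<Rightarrow> ennreal" where
  "heat_iter F 0 s z = ennreal (heat s z)"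
| "heat_iter F (Suc n) s z = (NN u. (if 0 < u \<and> u < s then (NN y. heat_iter F n u y * ennreal (F y * heat (s - u) (z - y))) else 0))"

lemma heat_iter_measurable[measurable]:
  assumes [measurable]: "F \<in> borel_measurable borel"
  shows "(\<lambda>(s, z). heat_iter F n s z) \<in> borel_measurable (borel \<Otimes>\<^sub>M borel)"
proof (induction n)
  case 0
  show ?case by simp measurable
next
  case (Suc n)
  note [measurable] = Suc
  show ?case by simp measurable
qed

section \<open>Occupation functionals of the bridge\<close>

context gauss_bridge
begin

lemma X_pair_measurable[measurable]: "(\<lambda>(s, w). X s w) \<in> borel_measurable (borel \<Otimes>\<^sub>M M)"
  by (rule caratheodory_measurable[OF X_measurable X_cont])

abbreviation occupation :: "(real \<Rightarrow> real) \<Rightarrow> nat \<Rightarrow> real \<Rightarrow> 'a \<Rightarrow> ennreal" where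
  "occupation F n s w \<equiv> iterated_integral (\<lambda>u. ennreal (F (X u w))) n s"

lemma occupation_measurable[measurable]:
  assumes [measurable]: "F \<in> borel_measurable borel"
  shows "(\<lambda>(s, w). occupation F n s w) \<in> borel_measurable (borel \<Otimes>\<^sub>M M)"
  by (rule iterated_integral_measurable) measurable

lemma occupation_Suc:
  assumes [measurable]: "F \<in> borel_measurable borel" "D \<in> borel_measurable M" and F: "\<And>z. 0 \<le> F z"
  shows "(\<integral>\<^sup>+w. occupation F (Suc n) s w * ennreal (D w) \<partial>M) = (NN u. (if 0 < u \<and> u < s then (\<integral>\<^sup>+w. occupation F n u w * ennreal (F (X u w) * D w) \<partial>M) else 0))"
proof -
  interpret L: pair_sigma_finite M lborel by unfold_locales
  have "(\<integral>\<^sup>+w. occupation F (Suc n) s w * ennreal (D w) \<partial>M) = (\<integral>\<^sup>+w. (NN u. if 0 < u \<and> u < s then occupation F n u w * ennreal (F (X u w) * D w) else 0) \<partial>M)"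
  proof (intro nn_integral_cong)
    fix w assume [measurable]: "w \<in> space M"
    have "occupation F (Suc n) s w * ennreal (D w) = (NN u. (if 0 < u \<and> u < s then ennreal (F (X u w)) * occupation F n u w else 0) * ennreal (D w))"
      by (subst nn_integral_multc) auto
    also have "\<dots> = (NN u. (if 0 < u \<and> u < s then occupation F n u w * ennreal (F (X u w) * D w) else 0))"
      unfolding ennreal_mult'[OF F] by (intro nn_integral_cong) (auto simp: mult_ac)
    finally show "occupation F (Suc n) s w * ennreal (D w) = (NN u. (if 0 < u \<and> u < s then occupation F n u w * ennreal (F (X u w) * D w) else 0))" .
  qed
  also have "\<dots> = (NN u. \<integral>\<^sup>+w. (if 0 < u \<and> u < s then occupation F n u w * ennreal (F (X u w) * D w) else 0) \<partial>M)"
    by (rule L.Fubini'[symmetric]) measurable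
  also have "\<dots> = (NN u. (if 0 < u \<and> u < s then (\<integral>\<^sup>+w. occupation F n u w * ennreal (F (X u w) * D w) \<partial>M) else 0))"
    by (intro nn_integral_cong) auto
  finally show ?thesis .
qed

text \<open>Induction peels off the latest occupation time, which lies before
  \<open>s \<le> q\<close>, and moves \<open>F (X u)\<close> into the cylinder function
  \<open>C\<close> until \<open>cylinder_markov\<close> applies.\<close>

lemma occupation_markov:
  assumes C: "C \<in> cylinder q" and s: "s \<le> q" "0 \<le> q" "q < r" "r < T"
    and [measurable]: "F \<in> borel_measurable borel" "f \<in> borel_measurable borel"
    and F: "\<And>z. 0 \<le> F z" "\<And>z. F z \<le> BF" and f: "\<And>z. 0 \<le> f z" "\<And>z. f z \<le> B"
  shows "(\<integral>\<^sup>+w. occupation F n s w * ennreal (C w * f (X r w)) \<partial>M) = (\<integral>\<^sup>+w. occupation F n s w * ennreal (C w * bridge_trans q r f (X q w)) \<partial>M)"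
  using C s(1)
proof (induction n arbitrary: C s)
  case 0
  note mC[measurable] = cylinder_props(1)[OF 0(1)]
  obtain BC where BC: "\<And>w. 0 \<le> C w" "\<And>w. C w \<le> BC" using cylinder_props(2)[OF 0(1)] by auto
  have fB: "\<bar>f z\<bar> \<le> B" for z using f[of z] by simp
  note tb = bridge_trans_bounds[OF s(3,4) \<open>f \<in> borel_measurable borel\<close> fB]
  have t: "0 \<le> bridge_trans q r f y" "bridge_trans q r f y \<le> B" for y using tb(1)[of y] tb(2)[OF f(1), of y] by auto
  have nn: "(\<integral>\<^sup>+w. ennreal (C w * k w) \<partial>M) = ennreal (LINT w|M. C w * k w)"
    if [measurable]: "k \<in> borel_measurable M" and k: "\<And>w. 0 \<le> k w" "\<And>w. k w \<le> B" for k
  proof (rule nn_integral_eq_integral)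
    show "integrable M (\<lambda>w. C w * k w)"
      by (rule integrable_const_bound[where B="BC * B"])
        (auto simp: abs_mult BC k intro!: AE_I2 mult_mono order.trans[OF BC(1) BC(2)])
  qed (simp add: BC k)
  show ?case
    using nn[of "\<lambda>w. f (X r w)"] nn[of "\<lambda>w. bridge_trans q r f (X q w)"] f t
      cylinder_markov[OF 0(1) s(2,3,4) \<open>f \<in> borel_measurable borel\<close> fB] by simp
next
  case (Suc n)
  note mC[measurable] = cylinder_props(1)[OF Suc(2)]
  show ?case
    unfolding occupation_Suc[OF \<open>F \<in> borel_measurable borel\<close> borel_measurable_times[OF mC measurable_compose[OF X_measurable \<open>f \<in> borel_measurable borel\<close>]] F(1)]
      occupation_Suc[OF \<open>F \<in> borel_measurable borel\<close> borel_measurable_times[OF mC measurable_compose[OF X_measurable bridge_trans_measurable[OF \<open>f \<in> borel_measurable borel\<close>]]] F(1)]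
  proof (rule nn_integral_cong, rule if_cong[OF refl _ refl])
    fix u assume u: "0 < u \<and> u < s"
    have "(\<lambda>w. C w * F (X u w)) \<in> cylinder q"
      by (rule cylinder_mult[OF Suc(2) _ \<open>F \<in> borel_measurable borel\<close> F]) (use u Suc(3) in auto)
    from Suc.IH[OF this, of u] u Suc(3)
    show "(\<integral>\<^sup>+w. occupation F n u w * ennreal (F (X u w) * (C w * f (X r w))) \<partial>M) = (\<integral>\<^sup>+w. occupation F n u w * ennreal (F (X u w) * (C w * bridge_trans q r f (X q w))) \<partial>M)"
      by (simp add: mult_ac)
  qed
qed

text \<open>By \<open>bridge_density\<close>, multiplication by \<open>heat (T - s) y\<close> turns
  the bridge transition into the plain heat kernel. This cancellation makes the moments of the
  bridge heat convolutions.\<close>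

lemma bridge_trans_heat:
  assumes s: "0 \<le> s" "s < r" "r < T" and [measurable]: "f \<in> borel_measurable borel" and f: "\<And>z. 0 \<le> f z" "\<And>z. f z \<le> B"
  shows "ennreal (bridge_trans s r f y * heat (T - s) y) = (NN z. ennreal (heat (r - s) (z - y) * (f z * heat (T - r) z)))"
proof -
  let ?n = "normal_density ((T - r)/(T - s) * y) (sqrt ((r - s) * (T - r)/(T - s)))"
  have v: "0 < sqrt ((r - s) * (T - r)/(T - s))" using s by simp
  have i: "integrable lborel ?n" using v by auto
  have ib: "integrable lborel (\<lambda>z. ?n z * f z)"
  proof (rule Bochner_Integration.integrable_bound[of _ "\<lambda>z. B * ?n z"])
    show "AE z in lborel. norm (?n z * f z) \<le> norm (B * ?n z)"
    proof (rule AE_I2)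
      fix z
      have "?n z * f z \<le> ?n z * \<bar>B\<bar>" using f[of z] by (intro mult_left_mono) auto
      then show "norm (?n z * f z) \<le> norm (B * ?n z)" using f[of z] by (simp add: abs_mult mult.commute)
    qed
  qed (use i in auto)
  have "ennreal (bridge_trans s r f y * heat (T - s) y) = (NN z. ennreal (?n z * f z * heat (T - s) y))"
    unfolding bridge_trans_def using s f ib
    by (subst integral_mult_left_zero[symmetric], subst nn_integral_eq_integral) (auto simp: heat_nonneg)
  also have "\<dots> = (NN z. ennreal (heat (r - s) (z - y) * (f z * heat (T - r) z)))"
  proof (intro nn_integral_cong arg_cong[where f=ennreal])
    fix z
    show "?n z * f z * heat (T - s) y = heat (r - s) (z - y) * (f z * heat (T - r) z)"
      using bridge_density[OF s, of y z] by (metis mult.commute mult.assoc)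
  qed
  finally show ?thesis .
qed

lemma X_zero: "AE w in M. X 0 w = 0"
proof -
  have "(LINT w|M. X 0 w ^ 2) = 0" using X_cov[of 0 0] T by (simp add: power2_eq_square)
  then have "AE w in M. X 0 w ^ 2 = 0"
    using X_square[of 0] T by (subst (asm) integral_nonneg_eq_0_iff_AE) auto
  then show ?thesis by simp
qed

text \<open>\<open>heat T 0\<close> and \<open>heat (T - r) z\<close> are the normalisations of the
  conditioning at times 0 and \<open>r\<close>. In the induction step
  \<open>bridge_trans_heat\<close> converts the transition from the latest occupation time
  \<open>u\<close> to \<open>r\<close>.\<close>

lemma occupation_law:
  assumes r: "0 < r" "r < T" and [measurable]: "F \<in> borel_measurable borel" "f \<in> borel_measurable borel"
    and F: "\<And>z. 0 \<le> F z" "\<And>z. F z \<le> BF" and f: "\<And>z. 0 \<le> f z" "\<And>z. f z \<le> B"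
  shows "ennreal (heat T 0) * (\<integral>\<^sup>+w. occupation F n r w * ennreal (f (X r w)) \<partial>M) = (NN z. heat_iter F n r z * ennreal (f z * heat (T - r) z))"
  using r f \<open>f \<in> borel_measurable borel\<close>
proof (induction n arbitrary: r f B)
  case 0
  note [measurable] = 0(5)
  have "(\<integral>\<^sup>+w. ennreal (f (X r w)) \<partial>M) = (\<integral>\<^sup>+w. ennreal (bridge_trans 0 r f (X 0 w)) \<partial>M)"
    using occupation_markov[OF cylinder_one order.refl order.refl 0(1,2) \<open>F \<in> _\<close> \<open>f \<in> _\<close> F 0(3,4), of 0] by simp
  also have "\<dots> = (\<integral>\<^sup>+w. ennreal (bridge_trans 0 r f 0) \<partial>M)"
    using X_zero by (intro nn_integral_cong_AE) (auto elim!: eventually_mono)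
  also have "\<dots> = ennreal (bridge_trans 0 r f 0)" by (simp add: emeasure_space_1)
  finally have "ennreal (heat T 0) * (\<integral>\<^sup>+w. ennreal (f (X r w)) \<partial>M) = ennreal (bridge_trans 0 r f 0 * heat (T - 0) 0)"
    using T by (simp add: ennreal_mult' heat_nonneg mult.commute[of _ "heat T 0"])
  also have "\<dots> = (NN z. ennreal (heat r z) * ennreal (f z * heat (T - r) z))"
    using bridge_trans_heat[OF order.refl 0(1,2) \<open>f \<in> _\<close> 0(3,4), of 0] 0 by (simp add: ennreal_mult' heat_nonneg)
  finally show ?case by simp
next
  case (Suc n)
  note [measurable] = Suc(6)
  have "ennreal (heat T 0) * (\<integral>\<^sup>+w. occupation F (Suc n) r w * ennreal (f (X r w)) \<partial>M) = (NN u. ennreal (heat T 0) * (if 0 < u \<and> u < r then (\<integral>\<^sup>+w. occupation F n u w * ennreal (F (X u w) * f (X r w)) \<partial>M) else 0))"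
    unfolding occupation_Suc[OF \<open>F \<in> _\<close> measurable_compose[OF X_measurable \<open>f \<in> _\<close>] F(1)] by (rule nn_integral_cmult[symmetric]) measurable
  also have "\<dots> = (NN u. NN y. (if 0 < u \<and> u < r then (NN z. heat_iter F n u z * ennreal (F z * heat (r - u) (y - z))) else 0) * ennreal (f y * heat (T - r) y))"
  proof (intro nn_integral_cong)
    fix u
    show "ennreal (heat T 0) * (if 0 < u \<and> u < r then (\<integral>\<^sup>+w. occupation F n u w * ennreal (F (X u w) * f (X r w)) \<partial>M) else 0) =
      (NN y. (if 0 < u \<and> u < r then (NN z. heat_iter F n u z * ennreal (F z * heat (r - u) (y - z))) else 0) * ennreal (f y * heat (T - r) y))"
    proof (cases "0 < u \<and> u < r")
      case True
      then have u: "0 \<le> u" "0 < u" "u < r" "u < T" using Suc(3) by auto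
      have "(\<lambda>w. 1 * F (X u w)) \<in> cylinder u"
        by (rule cylinder_mult[OF cylinder_one _ \<open>F \<in> _\<close> F]) (use u in auto)
      then have c: "(\<lambda>w. F (X u w)) \<in> cylinder u" by simp
      have fB: "\<bar>f z\<bar> \<le> B" for z using Suc(4,5)[of z] by simp
      note tb = bridge_trans_bounds[OF u(3) Suc(3) \<open>f \<in> borel_measurable borel\<close> fB]
      have t: "0 \<le> bridge_trans u r f y" "bridge_trans u r f y \<le> B" for y using tb(1)[of y] tb(2)[OF Suc(4), of y] by auto
      have g: "0 \<le> F y * bridge_trans u r f y" "F y * bridge_trans u r f y \<le> BF * B" for y
        using t[of y] F[of y] by (auto intro!: mult_mono order.trans[OF F(1) F(2)])
      have "ennreal (heat T 0) * (\<integral>\<^sup>+w. occupation F n u w * ennreal (F (X u w) * f (X r w)) \<partial>M) = ennreal (heat T 0) * (\<integral>\<^sup>+w. occupation F n u w * ennreal (F (X u w) * bridge_trans u r f (X u w)) \<partial>M)"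
        by (subst occupation_markov[OF c order.refl u(1,3) Suc(3) \<open>F \<in> _\<close> \<open>f \<in> _\<close> F Suc(4,5)]) simp
      also have "\<dots> = (NN z. heat_iter F n u z * ennreal (F z * bridge_trans u r f z * heat (T - u) z))"
        by (rule Suc.IH[OF u(2,4) g]) measurable
      also have "\<dots> = (NN z. NN y. heat_iter F n u z * ennreal (F z * heat (r - u) (y - z)) * ennreal (f y * heat (T - r) y))"
      proof (intro nn_integral_cong)
        fix z
        have "heat_iter F n u z * ennreal (F z * bridge_trans u r f z * heat (T - u) z) = heat_iter F n u z * ennreal (F z) * (NN y. ennreal (heat (r - u) (y - z) * (f y * heat (T - r) y)))"
          using bridge_trans_heat[OF u(1,3) Suc(3) \<open>f \<in> _\<close> Suc(4,5), of z] F(1)[of z] by (simp add: ennreal_mult' mult.assoc)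
        also have "\<dots> = (NN y. heat_iter F n u z * ennreal (F z) * ennreal (heat (r - u) (y - z) * (f y * heat (T - r) y)))"
          by (rule nn_integral_cmult[symmetric]) measurable
        also have "\<dots> = (NN y. heat_iter F n u z * ennreal (F z * heat (r - u) (y - z)) * ennreal (f y * heat (T - r) y))"
          using u F(1) by (intro nn_integral_cong) (simp add: ennreal_mult' heat_nonneg mult.assoc)
        finally show "heat_iter F n u z * ennreal (F z * bridge_trans u r f z * heat (T - u) z) = (NN y. heat_iter F n u z * ennreal (F z * heat (r - u) (y - z)) * ennreal (f y * heat (T - r) y))" .
      qed
      also have "\<dots> = (NN y. NN z. heat_iter F n u z * ennreal (F z * heat (r - u) (y - z)) * ennreal (f y * heat (T - r) y))"
        by (rule lborel_pair.Fubini') measurable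
      also have "\<dots> = (NN y. (NN z. heat_iter F n u z * ennreal (F z * heat (r - u) (y - z))) * ennreal (f y * heat (T - r) y))"
        by (intro nn_integral_cong nn_integral_multc) measurable
      finally show ?thesis using True by simp
    qed auto
  qed
  also have "\<dots> = (NN y. NN u. (if 0 < u \<and> u < r then (NN z. heat_iter F n u z * ennreal (F z * heat (r - u) (y - z))) else 0) * ennreal (f y * heat (T - r) y))"
    by (rule lborel_pair.Fubini') measurable
  also have "\<dots> = (NN y. heat_iter F (Suc n) r y * ennreal (f y * heat (T - r) y))"
    by (intro nn_integral_cong, simp, rule nn_integral_multc) measurable
  finally show ?case .
qed

text \<open>\<open>occupation_law\<close> stops before \<open>T\<close>, where the bridge transition
  degenerates. The latest occupation time is therefore split off once more, and its end value
  supplies the last kernel \<open>heat (T - u)\<close>.\<close>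

lemma occupation_total:
  assumes [measurable]: "F \<in> borel_measurable borel" and F: "\<And>z. 0 \<le> F z" "\<And>z. F z \<le> BF"
  shows "ennreal (heat T 0) * (\<integral>\<^sup>+w. occupation F n T w \<partial>M) = heat_iter F n T 0"
proof (cases n)
  case 0
  then show ?thesis by (simp add: emeasure_space_1)
next
  case (Suc m)
  have "ennreal (heat T 0) * (\<integral>\<^sup>+w. occupation F (Suc m) T w \<partial>M) = ennreal (heat T 0) * (NN u. (if 0 < u \<and> u < T then (\<integral>\<^sup>+w. occupation F m u w * ennreal (F (X u w)) \<partial>M) else 0))"
    using occupation_Suc[OF \<open>F \<in> _\<close> borel_measurable_const[of 1] F(1), of m T] by (simp cong: if_cong)
  also have "\<dots> = (NN u. ennreal (heat T 0) * (if 0 < u \<and> u < T then (\<integral>\<^sup>+w. occupation F m u w * ennreal (F (X u w)) \<partial>M) else 0))"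
    by (rule nn_integral_cmult[symmetric]) measurable
  also have "\<dots> = (NN u. (if 0 < u \<and> u < T then (NN y. heat_iter F m u y * ennreal (F y * heat (T - u) (0 - y))) else 0))"
  proof (intro nn_integral_cong)
    fix u
    show "ennreal (heat T 0) * (if 0 < u \<and> u < T then (\<integral>\<^sup>+w. occupation F m u w * ennreal (F (X u w)) \<partial>M) else 0) = (if 0 < u \<and> u < T then (NN y. heat_iter F m u y * ennreal (F y * heat (T - u) (0 - y))) else 0)"
      using occupation_law[OF _ _ \<open>F \<in> _\<close> \<open>F \<in> _\<close> F F, of u m] by (auto simp: heat_def)
  qed
  finally show ?thesis by (simp add: Suc)
qed

end

section \<open>Green functions and smeared point masses\<close>

primrec green_iter :: "real \<Rightarrow> (real \<Rightarrow> real) \<Rightarrow> nat \<Rightarrow> real \<Rightarrow> ennreal" where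
  "green_iter g F 0 z = ennreal (green g z)"
| "green_iter g F (Suc n) z = (NN y. green_iter g F n y * ennreal (F y * green g (z - y)))"

lemma green_measurable[measurable]: "green g \<in> borel_measurable borel"
  unfolding green_def[abs_def] by measurable

lemma laplace_heat:
  assumes g: "0 < g"
  shows "(NN t. (if 0 < t then ennreal (exp (-(g^2 * t / 2)) * heat t x) else 0)) = ennreal (green g x)"
  unfolding green_def nn_integral_green[OF g, symmetric]
  by (intro nn_integral_cong) (simp add: heat_def)

text \<open>The Laplace transform turns the time convolution into a product: after exchanging the
  integrals, the substitution \<open>s = u + v\<close> separates the two times.\<close>

lemma laplace_heat_iter:
  assumes g: "0 < g" and [measurable]: "F \<in> borel_measurable borel" and F: "\<And>y. 0 \<le> F y"
  shows "(NN s. (if 0 < s then ennreal (exp (-(g^2 * s / 2))) * heat_iter F n s z else 0)) = green_iter g F n z"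
proof (induction n arbitrary: z)
  case 0
  show ?case unfolding heat_iter.simps green_iter.simps laplace_heat[OF g, symmetric]
    by (intro nn_integral_cong) (simp add: ennreal_mult')
next
  case (Suc n)
  define e where "e s = ennreal (exp (-(g^2 * s / 2)))" for s
  have [measurable]: "e \<in> borel_measurable borel" unfolding e_def[abs_def] by measurable
  have e_add: "e (u + v) = e u * e v" for u v
    by (simp add: e_def ennreal_mult'[symmetric] exp_add[symmetric] algebra_simps add_divide_distrib)
  define a where "a u y = (if 0 < u then e u * heat_iter F n u y else 0)" for u y
  define b where "b v y = (if 0 < v then e v * ennreal (heat v (z - y)) else 0)" for v y
  have [measurable]: "(\<lambda>(u, y). a u y) \<in> borel_measurable (borel \<Otimes>\<^sub>M borel)" "(\<lambda>(u, y). b u y) \<in> borel_measurable (borel \<Otimes>\<^sub>M borel)"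
    unfolding a_def b_def by measurable
  have b: "(NN v. b v y) = ennreal (green g (z - y))" for y
    unfolding laplace_heat[OF g, symmetric] b_def e_def by (intro nn_integral_cong) (simp add: ennreal_mult')
  define Q where "Q u s = (if 0 < u \<and> u < s then e s * (NN y. heat_iter F n u y * ennreal (F y * heat (s - u) (z - y))) else 0)" for u s
  have [measurable]: "(\<lambda>(u, s). Q u s) \<in> borel_measurable (borel \<Otimes>\<^sub>M borel)" unfolding Q_def by measurable
  have "(NN s. (if 0 < s then e s * heat_iter F (Suc n) s z else 0)) = (NN s. NN u. Q u s)"
  proof (rule nn_integral_cong)
    fix s :: real
    have "(NN u. Q u s) = (NN u. e s * (if 0 < u \<and> u < s then (NN y. heat_iter F n u y * ennreal (F y * heat (s - u) (z - y))) else 0))"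
      unfolding Q_def by (rule nn_integral_cong) simp
    also have "\<dots> = e s * heat_iter F (Suc n) s z"
      unfolding heat_iter.simps by (rule nn_integral_cmult) measurable
    finally have *: "(NN u. Q u s) = e s * heat_iter F (Suc n) s z" .
    show "(if 0 < s then e s * heat_iter F (Suc n) s z else 0) = (NN u. Q u s)"
    proof (cases "0 < s")
      case True
      then show ?thesis by (simp only: * if_True)
    next
      case False
      then have "Q u s = 0" for u by (auto simp: Q_def)
      then show ?thesis using False by simp
    qed
  qed
  also have "\<dots> = (NN u. NN s. Q u s)"
    by (rule lborel_pair.Fubini') measurable
  also have "\<dots> = (NN u. NN y. a u y * ennreal (F y * green g (z - y)))"
  proof (rule nn_integral_cong)
    fix u :: real
    have "(NN s. Q u s) = (NN v. Q u (u + v))"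
      using nn_integral_real_affine[of "Q u" 1 u] by simp
    also have "\<dots> = (NN v. NN y. (a u y * ennreal (F y)) * b v y)"
    proof (rule nn_integral_cong)
      fix v :: real
      show "Q u (u + v) = (NN y. (a u y * ennreal (F y)) * b v y)"
      proof (cases "0 < u \<and> 0 < v")
        case True
        then have "Q u (u + v) = (NN y. e (u + v) * (heat_iter F n u y * ennreal (F y * heat v (z - y))))"
          unfolding Q_def by (simp add: nn_integral_cmult)
        also have "\<dots> = (NN y. (a u y * ennreal (F y)) * b v y)"
          unfolding ennreal_mult'[OF F] e_add a_def b_def using True by (intro nn_integral_cong) (simp add: mult_ac)
        finally show ?thesis .
      next
        case False
        then have z: "(a u y * ennreal (F y)) * b v y = 0" for y by (auto simp: a_def b_def)
        have "Q u (u + v) = 0" using False by (auto simp: Q_def)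
        then show ?thesis unfolding z by simp
      qed
    qed
    also have "\<dots> = (NN y. NN v. (a u y * ennreal (F y)) * b v y)"
      by (rule lborel_pair.Fubini') measurable
    also have "\<dots> = (NN y. a u y * ennreal (F y * green g (z - y)))"
      unfolding ennreal_mult'[OF F] b[symmetric] mult.assoc[symmetric] by (intro nn_integral_cong nn_integral_cmult) measurable
    finally show "(NN s. Q u s) = (NN y. a u y * ennreal (F y * green g (z - y)))" .
  qed
  also have "\<dots> = (NN y. NN u. a u y * ennreal (F y * green g (z - y)))"
    by (rule lborel_pair.Fubini') measurable
  also have "\<dots> = (NN y. (NN u. a u y) * ennreal (F y * green g (z - y)))"
    by (intro nn_integral_cong nn_integral_multc) measurable
  also have "\<dots> = green_iter g F (Suc n) z"
    unfolding a_def e_def Suc.IH green_iter.simps ..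
  finally show ?case unfolding e_def .
qed

definition bump :: "real \<Rightarrow> real \<Rightarrow> real" where
  "bump d y = (if 0 \<le> y \<and> y \<le> d then 1 / d else 0)"

lemma bump_measurable[measurable]: "bump d \<in> borel_measurable borel"
  unfolding bump_def[abs_def] by measurable

lemma bump_nonneg: "0 < d \<Longrightarrow> 0 \<le> bump d y" by (simp add: bump_def)
lemma bump_le: "0 < d \<Longrightarrow> bump d y \<le> 1 / d" by (simp add: bump_def)

lemma nn_integral_bump:
  assumes d: "0 < d"
  shows "(NN y. ennreal (bump d (y - c))) = 1"
proof -
  have "(NN y. ennreal (bump d (y - c))) = (NN y. ennreal (1 / d) * indicator {c..c + d} y)"
    by (intro nn_integral_cong) (auto simp: bump_def indicator_def)
  also have "\<dots> = ennreal (1 / d) * ennreal d" using d by (simp add: nn_integral_cmult)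
  also have "\<dots> = 1" using d by (simp add: ennreal_mult'[symmetric])
  finally show ?thesis .
qed

lemma nn_integral_bump_sum:
  assumes d: "0 < d" and b: "\<And>i. i < m \<Longrightarrow> 0 \<le> b i"
  shows "(NN y. ennreal (\<Sum>i<m. b i * bump d (y - x i))) = ennreal (\<Sum>i<m. b i)"
proof -
  have "(NN y. ennreal (\<Sum>i<m. b i * bump d (y - x i))) = (NN y. (\<Sum>i<m. ennreal (b i) * ennreal (bump d (y - x i))))"
    by (intro nn_integral_cong) (subst sum_ennreal[symmetric], auto simp: b bump_nonneg d ennreal_mult' intro!: sum.cong)
  also have "\<dots> = (\<Sum>i<m. ennreal (b i) * (NN y. ennreal (bump d (y - x i))))"
    by (subst nn_integral_sum) (auto simp: nn_integral_cmult)
  also have "\<dots> = ennreal (\<Sum>i<m. b i)" unfolding nn_integral_bump[OF d] mult_1_right using b by (intro sum_ennreal) auto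
  finally show ?thesis .
qed

text \<open>The error is multiplicative, so that it can be passed on along a chain of Green
  functions.\<close>

lemma green_shift:
  assumes g: "0 < g" and d: "\<bar>y - x\<bar> \<le> d"
  shows "green g (z - y) \<le> exp (g * d) * green g (z - x)"
proof -
  have "\<bar>z - x\<bar> \<le> \<bar>z - y\<bar> + d" using d by linarith
  then have "g * \<bar>z - x\<bar> \<le> g * (\<bar>z - y\<bar> + d)" using g by (intro mult_left_mono) auto
  then have "exp (-g * \<bar>z - y\<bar>) \<le> exp (g * d) * exp (-g * \<bar>z - x\<bar>)" by (simp add: exp_add[symmetric] distrib_left)
  then show ?thesis using g by (simp add: green_def divide_right_mono)
qed

lemma kac_shift:
  assumes g: "0 < g" and d: "\<bar>y - y'\<bar> \<le> d" and a: "\<And>i. i < m \<Longrightarrow> 0 \<le> a i"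
  shows "kac g m a x n y \<le> exp (g * d) * kac g m a x n y'"
proof (cases n)
  case 0
  then show ?thesis using green_shift[OF g, of "- y" "- y'" d 0] d by simp
next
  case (Suc k)
  have "green g (y - x i) \<le> exp (g * d) * green g (y' - x i)" for i
    using green_shift[OF g, of "- y" "- y'" d "- x i"] d by (simp add: green_def abs_minus_commute)
  then have "a i * green g (y - x i) * kac g m a x k (x i) \<le> exp (g * d) * (a i * green g (y' - x i) * kac g m a x k (x i))" if "i < m" for i
    using mult_left_mono[of "green g (y - x i)" "exp (g * d) * green g (y' - x i)" "a i * kac g m a x k (x i)"] a[OF that] kac_nonneg[OF g, of m a x k "x i"] a
    by (simp add: mult_ac)
  then show ?thesis unfolding Suc kac.simps sum_distrib_left by (intro sum_mono) auto
qed

text \<open>The bumps confine each intermediate point to within \<open>d\<close> of some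
  \<open>x i\<close>. Moving it there changes the link before it and the chain after it by at most a
  factor \<open>exp (g * d)\<close> each, which gives \<open>2 * n\<close> such factors.\<close>

lemma green_iter_kac:
  fixes m :: nat and a x :: "nat \<Rightarrow> real"
  assumes g: "0 < g" and d: "0 < d" and a: "\<And>i. i < m \<Longrightarrow> 0 \<le> a i"
  defines "F \<equiv> \<lambda>y. \<Sum>i<m. a i * bump d (y - x i)"
  shows "green_iter g F n z \<le> ennreal (exp (2 * real n * (g * d)) * kac g m a x n z)" (is ?U)
    and "ennreal (exp (-(2 * real n * (g * d))) * kac g m a x n z) \<le> green_iter g F n z" (is ?L)
proof -
  let ?k = "kac g m a x"
  have k0: "0 \<le> ?k n z" for n z using kac_nonneg[OF g] a by blast
  have F0: "0 \<le> F y" for y unfolding F_def using a d by (auto intro!: sum_nonneg mult_nonneg_nonneg bump_nonneg)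
  have gr0: "0 \<le> green g z" for z by (rule green_nonneg[OF g])
  have near: "bump d (y - c) = 0 \<or> \<bar>y - c\<bar> \<le> d" for y c by (auto simp: bump_def)
  have "?U \<and> ?L"
  proof (induction n arbitrary: z)
    case 0
    show ?case by simp
  next
    case (Suc n)
    define A where "A = exp (2 * real n * (g * d))"
    define q where "q = exp (g * d)"
    have A: "0 < A" "0 < q" "exp (2 * real (Suc n) * (g * d)) = A * q * q"
    proof -
      have "2 * real (Suc n) * (g * d) = 2 * real n * (g * d) + g * d + g * d" by (simp add: algebra_simps)
      then show "exp (2 * real (Suc n) * (g * d)) = A * q * q" by (simp only: exp_add A_def q_def)
    qed (auto simp: A_def q_def)
    have iA: "exp (- (2 * real (Suc n) * (g * d))) = 1 / (A * q * q)" "exp (- (2 * real n * (g * d))) = 1 / A"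
      unfolding A(3)[symmetric] by (simp_all only: A_def exp_minus inverse_eq_divide)
    define b where "b i = a i * green g (z - x i) * ?k n (x i)" for i
    have b0: "0 \<le> b i" if "i < m" for i unfolding b_def using a[OF that] gr0 k0 by simp
    have sumb: "?k (Suc n) z = (\<Sum>i<m. b i)" by (simp add: b_def)
    have gs: "green g (z - y) \<le> q * green g (z - c)" "green g (z - c) \<le> q * green g (z - y)" "?k n y \<le> q * ?k n c" "?k n c \<le> q * ?k n y" if "\<bar>y - c\<bar> \<le> d" for y c
      using that green_shift[OF g, of y c d z] green_shift[OF g, of c y d z] kac_shift[OF g, of y c d m a x n] kac_shift[OF g, of c y d m a x n] a
      by (auto simp: q_def abs_minus_commute)
    have up: "F y * green g (z - y) * (A * ?k n y) \<le> (\<Sum>i<m. (A * q * q * b i) * bump d (y - x i))" for y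
    proof -
      have "a i * bump d (y - x i) * green g (z - y) * (A * ?k n y) \<le> (A * q * q * b i) * bump d (y - x i)" if i: "i < m" for i
      proof (cases "bump d (y - x i) = 0")
        case False
        then have "green g (z - y) * ?k n y \<le> (q * green g (z - x i)) * (q * ?k n (x i))"
          using near[of y "x i"] gr0 k0 A by (intro mult_mono gs) auto
        then have "(a i * bump d (y - x i) * A) * (green g (z - y) * ?k n y) \<le> (a i * bump d (y - x i) * A) * ((q * green g (z - x i)) * (q * ?k n (x i)))"
          using a[OF i] bump_nonneg[OF d] A by (intro mult_left_mono) auto
        then show ?thesis by (simp add: b_def mult_ac)
      qed simp
      then show ?thesis unfolding F_def sum_distrib_right by (intro sum_mono) auto
    qed
    have lo: "(\<Sum>i<m. (1 / (A * q * q) * b i) * bump d (y - x i)) \<le> F y * green g (z - y) * (1 / A * ?k n y)" for y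
    proof -
      have "(1 / (A * q * q) * b i) * bump d (y - x i) \<le> a i * bump d (y - x i) * green g (z - y) * (1 / A * ?k n y)" if i: "i < m" for i
      proof (cases "bump d (y - x i) = 0")
        case False
        then have "green g (z - x i) * ?k n (x i) \<le> (q * green g (z - y)) * (q * ?k n y)"
          using near[of y "x i"] gr0 k0 A by (intro mult_mono gs) auto
        then have "(a i * bump d (y - x i) / (A * q * q)) * (green g (z - x i) * ?k n (x i)) \<le> (a i * bump d (y - x i) / (A * q * q)) * ((q * green g (z - y)) * (q * ?k n y))"
          using a[OF i] bump_nonneg[OF d] A by (intro mult_left_mono) auto
        also have "\<dots> = a i * bump d (y - x i) * green g (z - y) * (1 / A * ?k n y)" using A by simp
        finally show ?thesis by (simp add: b_def mult_ac)
      qed simp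
      then show ?thesis unfolding F_def sum_distrib_right by (intro sum_mono) auto
    qed
    show ?case
    proof
      have "green_iter g F (Suc n) z \<le> (NN y. ennreal (A * ?k n y) * ennreal (F y * green g (z - y)))"
        unfolding green_iter.simps A_def using Suc.IH by (intro nn_integral_mono mult_right_mono) auto
      also have "\<dots> \<le> (NN y. ennreal (\<Sum>i<m. (A * q * q * b i) * bump d (y - x i)))"
      proof (rule nn_integral_mono)
        fix y
        show "ennreal (A * ?k n y) * ennreal (F y * green g (z - y)) \<le> ennreal (\<Sum>i<m. (A * q * q * b i) * bump d (y - x i))"
          using up[of y] A k0[of n y] by (subst ennreal_mult'[symmetric]) (auto intro!: ennreal_leI simp: mult_ac)
      qed
      also have "\<dots> = ennreal (\<Sum>i<m. A * q * q * b i)"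
        by (rule nn_integral_bump_sum[OF d]) (use A b0 in auto)
      finally show "green_iter g F (Suc n) z \<le> ennreal (exp (2 * real (Suc n) * (g * d)) * ?k (Suc n) z)"
        unfolding A(3) sumb sum_distrib_left .
      have "ennreal (\<Sum>i<m. 1 / (A * q * q) * b i) = (NN y. ennreal (\<Sum>i<m. (1 / (A * q * q) * b i) * bump d (y - x i)))"
        by (rule nn_integral_bump_sum[OF d, symmetric]) (use A b0 in auto)
      also have "\<dots> \<le> (NN y. ennreal (1 / A * ?k n y) * ennreal (F y * green g (z - y)))"
      proof (rule nn_integral_mono)
        fix y
        show "ennreal (\<Sum>i<m. (1 / (A * q * q) * b i) * bump d (y - x i)) \<le> ennreal (1 / A * ?k n y) * ennreal (F y * green g (z - y))"
          using lo[of y] A k0[of n y] by (subst ennreal_mult'[symmetric]) (auto intro!: ennreal_leI simp: mult_ac)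
      qed
      also have "\<dots> \<le> green_iter g F (Suc n) z"
        unfolding green_iter.simps using Suc.IH unfolding iA by (intro nn_integral_mono mult_right_mono) auto
      finally show "ennreal (exp (- (2 * real (Suc n) * (g * d))) * ?k (Suc n) z) \<le> green_iter g F (Suc n) z"
        unfolding iA sumb sum_distrib_left .
    qed
  qed
  then show ?U ?L by auto
qed

definition average :: "(real \<Rightarrow> 'a \<Rightarrow> real) \<Rightarrow> real \<Rightarrow> real \<Rightarrow> 'a \<Rightarrow> real" where
  "average Z d c w = (LINT y|lborel. bump d (y - c) * Z y w)"

lemma average_unit:
  assumes d: "0 < d"
  shows "average Z d c w = (LINT v|lborel. indicator {0..1} v * Z (c + d * v) w)"
proof -
  have "average Z d c w = (LINT v|lborel. \<bar>d\<bar> * (bump d (c + d * v - c) * Z (c + d * v) w))"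
    unfolding average_def using d by (subst lborel_integral_real_affine[of d _ c]) auto
  also have "\<dots> = (LINT v|lborel. indicator {0..1} v * Z (c + d * v) w)"
    using d by (intro Bochner_Integration.integral_cong) (auto simp: bump_def indicator_def zero_le_mult_iff)
  finally show ?thesis .
qed

lemma average_nonneg:
  assumes "0 < d" "\<And>y. 0 \<le> Z y w"
  shows "0 \<le> average Z d c w"
  unfolding average_def by (intro Bochner_Integration.integral_nonneg mult_nonneg_nonneg bump_nonneg assms)

lemma average_tendsto:
  assumes c: "continuous_on UNIV (\<lambda>y. Z y w)"
  shows "(\<lambda>k. average Z (1 / real (Suc k)) c w) \<longlonglongrightarrow> Z c w"
proof -
  have "compact ((\<lambda>y. Z y w) ` {c..c + 1})"
    by (rule compact_continuous_image[OF continuous_on_subset[OF c]]) auto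
  from compact_imp_bounded[OF this] obtain C where "\<forall>x\<in>(\<lambda>y. Z y w) ` {c..c + 1}. norm x \<le> C"
    unfolding bounded_iff by (elim exE)
  then have C: "\<And>y. y \<in> {c..c + 1} \<Longrightarrow> \<bar>Z y w\<bar> \<le> C" by simp
  have m[measurable]: "(\<lambda>y. Z y w) \<in> borel_measurable borel"
    by (rule borel_measurable_continuous_onI[OF c])
  have "(\<lambda>k. LINT v|lborel. indicator {0..1} v * Z (c + 1 / real (Suc k) * v) w) \<longlonglongrightarrow> (LINT v|lborel. indicator {0..1} (v::real) * Z c w)"
  proof (rule integral_dominated_convergence[where w="\<lambda>v::real. C * indicator {0..1} v"])
    show "AE v in lborel. (\<lambda>k. indicator {0..1} v * Z (c + 1 / real (Suc k) * v) w) \<longlonglongrightarrow> indicator {0..1} v * Z c w"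
    proof (rule AE_I2, rule tendsto_mult_left)
      fix v :: real
      have "(\<lambda>k. c + 1 / real (Suc k) * v) \<longlonglongrightarrow> c + 0 * v"
        by (intro tendsto_intros LIMSEQ_inverse_real_of_nat[unfolded inverse_eq_divide])
      then show "(\<lambda>k. Z (c + 1 / real (Suc k) * v) w) \<longlonglongrightarrow> Z c w"
        by (intro continuous_on_tendsto_compose[OF c]) auto
    qed
    fix k
    show "AE v in lborel. norm (indicator {0..1} v * Z (c + 1 / real (Suc k) * v) w) \<le> C * indicator {0..1} v"
    proof (rule AE_I2)
      fix v :: real
      have "c + 1 / real (Suc k) * v \<in> {c..c + 1}" if "0 \<le> v" "v \<le> 1"
        using that mult_mono[of "1 / real (Suc k)" 1 v 1] by (auto simp del: times_divide_eq_left)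
      then show "norm (indicator {0..1} v * Z (c + 1 / real (Suc k) * v) w) \<le> C * indicator {0..1} v"
        using C by (auto simp: indicator_def)
    qed
  qed auto
  moreover have "\<And>k. average Z (1 / real (Suc k)) c w = (LINT v|lborel. indicator {0..1} v * Z (c + 1 / real (Suc k) * v) w)"
    by (rule average_unit) simp
  ultimately show ?thesis by simp
qed

text \<open>Fatou's lemma gives the upper bound. For the lower bound, mass could escape to infinity;
  the moment of order \<open>2 * n\<close>, bounded uniformly in \<open>k\<close>, excludes this
  through \<open>s \<le> min s R + s^2 / R\<close>.\<close>

lemma kac_moments_limit:
  fixes Z :: "real \<Rightarrow> 'a \<Rightarrow> real"
  assumes g: "0 < g" and N: "finite_measure N"
    and m[measurable]: "\<And>x. Z x \<in> borel_measurable N" and Z0: "\<And>x w. w \<in> space N \<Longrightarrow> 0 \<le> Z x w"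
    and cont: "\<And>w. w \<in> space N \<Longrightarrow> continuous_on UNIV (\<lambda>x. Z x w)"
    and a: "\<And>i. i < (m::nat) \<Longrightarrow> 0 \<le> a i"
    and mom: "\<And>d n. 0 < d \<Longrightarrow> (\<integral>\<^sup>+w. ennreal ((\<Sum>i<m. a i * average Z d (x i) w)^n) \<partial>N) = of_nat (fact n) * green_iter g (\<lambda>y. \<Sum>i<m. a i * bump d (y - x i)) n 0"
  shows "(\<integral>\<^sup>+w. ennreal ((\<Sum>i<m. a i * Z (x i) w)^n) \<partial>N) = ennreal (fact n * kac g m a x n 0)"
proof -
  interpret N: finite_measure N by (rule N)
  define d where "d k = 1 / real (Suc k)" for k
  have d: "0 < d k" "d k \<le> 1" for k by (auto simp: d_def)
  define S where "S k w = (\<Sum>i<m. a i * average Z (d k) (x i) w)" for k w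
  define S0 where "S0 w = (\<Sum>i<m. a i * Z (x i) w)" for w
  define K where "K = fact n * kac g m a x n 0"
  have k0: "0 \<le> kac g m a x n 0" for n using kac_nonneg[OF g] a by blast
  have K0: "0 \<le> K" using k0 by (simp add: K_def)
  have mZ[measurable]: "(\<lambda>(y, w). Z y w) \<in> borel_measurable (borel \<Otimes>\<^sub>M N)"
    by (rule caratheodory_measurable[OF m cont])
  have [measurable]: "S k \<in> borel_measurable N" for k unfolding S_def average_def by measurable
  have [measurable]: "S0 \<in> borel_measurable N" unfolding S0_def by measurable
  have S_nn: "0 \<le> S k w" "0 \<le> S0 w" if "w \<in> space N" for k w
    unfolding S_def S0_def using a d(1) Z0[OF that] by (auto intro!: sum_nonneg mult_nonneg_nonneg average_nonneg)
  have S_lim: "(\<lambda>k. S k w) \<longlonglongrightarrow> S0 w" if "w \<in> space N" for w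
    unfolding S_def S0_def d_def by (intro tendsto_intros average_tendsto cont that)
  define c where "c n k = exp (2 * real n * (g * d k))" for n k
  have c_up: "(\<integral>\<^sup>+w. ennreal (S k w ^ n) \<partial>N) \<le> ennreal (c n k * (fact n * kac g m a x n 0))" for n k
  proof -
    have "(\<integral>\<^sup>+w. ennreal (S k w ^ n) \<partial>N) \<le> of_nat (fact n) * ennreal (c n k * kac g m a x n 0)"
      unfolding S_def mom[OF d(1)] c_def by (intro mult_left_mono green_iter_kac(1)[OF g d(1)] a) auto
    also have "\<dots> = ennreal (c n k * (fact n * kac g m a x n 0))"
      by (simp add: ennreal_of_nat_eq_real_of_nat ennreal_mult'[symmetric] mult_ac del: ennreal_of_nat_eq_real_of_nat[symmetric])
    finally show ?thesis .
  qed
  have c_lo: "ennreal (1 / c n k * K) \<le> (\<integral>\<^sup>+w. ennreal (S k w ^ n) \<partial>N)" for k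
  proof -
    have "ennreal (1 / c n k * K) = of_nat (fact n) * ennreal (exp (-(2 * real n * (g * d k))) * kac g m a x n 0)"
      by (simp add: ennreal_of_nat_eq_real_of_nat ennreal_mult'[symmetric] mult_ac exp_minus inverse_eq_divide c_def K_def)
    also have "\<dots> \<le> (\<integral>\<^sup>+w. ennreal (S k w ^ n) \<partial>N)"
      unfolding S_def mom[OF d(1)] by (intro mult_left_mono green_iter_kac(2)[OF g d(1)] a) auto
    finally show ?thesis .
  qed
  have c_lim: "(\<lambda>k. c n k) \<longlonglongrightarrow> 1"
  proof -
    have "(\<lambda>k. exp (2 * real n * (g * d k))) \<longlonglongrightarrow> exp (2 * real n * (g * 0))"
      unfolding d_def by (intro tendsto_intros LIMSEQ_inverse_real_of_nat[unfolded inverse_eq_divide])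
    then show ?thesis by (simp add: c_def)
  qed
  have "(\<integral>\<^sup>+w. ennreal (S0 w ^ n) \<partial>N) = (\<integral>\<^sup>+w. liminf (\<lambda>k. ennreal (S k w ^ n)) \<partial>N)"
  proof (rule nn_integral_cong)
    fix w assume "w \<in> space N"
    then have "(\<lambda>k. ennreal (S k w ^ n)) \<longlonglongrightarrow> ennreal (S0 w ^ n)"
      by (intro tendsto_ennrealI tendsto_power S_lim)
    then show "ennreal (S0 w ^ n) = liminf (\<lambda>k. ennreal (S k w ^ n))"
      by (simp add: lim_imp_Liminf)
  qed
  also have "\<dots> \<le> liminf (\<lambda>k. \<integral>\<^sup>+w. ennreal (S k w ^ n) \<partial>N)"
    by (rule nn_integral_liminf) measurable
  also have "\<dots> \<le> liminf (\<lambda>k. ennreal (c n k * K))"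
    by (rule Liminf_mono) (auto intro!: always_eventually c_up simp: K_def)
  also have "\<dots> = ennreal (1 * K)"
    by (intro lim_imp_Liminf tendsto_ennrealI tendsto_intros c_lim) simp
  finally have upper: "(\<integral>\<^sup>+w. ennreal (S0 w ^ n) \<partial>N) \<le> ennreal K" by simp
  have lower: "ennreal K \<le> (\<integral>\<^sup>+w. ennreal (S0 w ^ n) \<partial>N)"
  proof (rule ennreal_le_epsilon)
    fix \<epsilon> :: real assume \<epsilon>: "0 < \<epsilon>"
    define C where "C = exp (2 * real (2 * n) * g) * (fact (2 * n) * kac g m a x (2 * n) 0)"
    have C0: "0 \<le> C" using k0 by (simp add: C_def)
    \<comment> \<open>The summand 1 keeps \<open>R\<close> positive, and
      \<open>C / R \<le> \<epsilon>\<close> bounds the truncation error.\<close>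
    define R where "R = (C + 1) / \<epsilon>"
    have R: "0 < R" "C / R \<le> \<epsilon>" using C0 \<epsilon> by (auto simp: R_def field_simps)
    have C: "(\<integral>\<^sup>+w. ennreal (S k w ^ (2 * n)) \<partial>N) \<le> ennreal C" for k
    proof -
      have "c (2 * n) k \<le> exp (2 * real (2 * n) * g)"
        unfolding c_def using g mult_left_mono[OF d(2)[of k], of "real n * g"] by (simp add: mult.assoc)
      then have "c (2 * n) k * (fact (2 * n) * kac g m a x (2 * n) 0) \<le> C"
        unfolding C_def using k0 by (intro mult_right_mono) auto
      then show ?thesis by (intro order.trans[OF c_up] ennreal_leI)
    qed
    have le: "ennreal (1 / c n k * K) \<le> (\<integral>\<^sup>+w. ennreal (min (S k w ^ n) R) \<partial>N) + ennreal \<epsilon>" for k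
    proof -
      have "ennreal (1 / c n k * K) \<le> (\<integral>\<^sup>+w. ennreal (S k w ^ n) \<partial>N)" by (rule c_lo)
      also have "\<dots> \<le> (\<integral>\<^sup>+w. ennreal (min (S k w ^ n) R) + ennreal (1 / R) * ennreal (S k w ^ (2 * n)) \<partial>N)"
      proof (rule nn_integral_mono)
        fix w assume w: "w \<in> space N"
        define s where "s = S k w ^ n"
        have s: "0 \<le> s" "S k w ^ (2 * n) = s^2" unfolding s_def using S_nn(1)[OF w, of k] by (auto simp: power_mult[symmetric] mult.commute)
        have "s \<le> min s R + 1 / R * s^2"
        proof (cases "s \<le> R")
          case False
          then have "R * s \<le> s^2" using s by (simp add: power2_eq_square mult_right_mono)
          then have "s \<le> 1 / R * s^2" using R by (simp add: field_simps)
          then show ?thesis using False R by (simp add: min_def)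
        qed (use R in \<open>simp add: min_def\<close>)
        then have "ennreal s \<le> ennreal (min s R + 1 / R * s^2)" by (rule ennreal_leI)
        also have "\<dots> = ennreal (min s R) + ennreal (1 / R) * ennreal (s^2)"
          using s R by (simp add: ennreal_plus ennreal_mult'[symmetric])
        finally show "ennreal (S k w ^ n) \<le> ennreal (min (S k w ^ n) R) + ennreal (1 / R) * ennreal (S k w ^ (2 * n))"
          unfolding s(2) s_def[symmetric] .
      qed
      also have "\<dots> = (\<integral>\<^sup>+w. ennreal (min (S k w ^ n) R) \<partial>N) + ennreal (1 / R) * (\<integral>\<^sup>+w. ennreal (S k w ^ (2 * n)) \<partial>N)"
        by (simp add: nn_integral_add nn_integral_cmult)
      also have "\<dots> \<le> (\<integral>\<^sup>+w. ennreal (min (S k w ^ n) R) \<partial>N) + ennreal (1 / R) * ennreal C"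
        by (intro add_left_mono mult_left_mono C) auto
      also have "ennreal (1 / R) * ennreal C = ennreal (C / R)" using R by (simp add: ennreal_mult'[symmetric])
      also have "\<dots> \<le> ennreal \<epsilon>" by (rule ennreal_leI[OF R(2)])
      finally show ?thesis by (simp add: add_left_mono)
    qed
    have "(\<lambda>k. (\<integral>\<^sup>+w. ennreal (min (S k w ^ n) R) \<partial>N) + ennreal \<epsilon>) \<longlonglongrightarrow> (\<integral>\<^sup>+w. ennreal (min (S0 w ^ n) R) \<partial>N) + ennreal \<epsilon>"
    proof (intro tendsto_intros)
      show "(\<lambda>k. \<integral>\<^sup>+w. ennreal (min (S k w ^ n) R) \<partial>N) \<longlonglongrightarrow> (\<integral>\<^sup>+w. ennreal (min (S0 w ^ n) R) \<partial>N)"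
      proof (rule nn_integral_dominated_convergence[where w="\<lambda>_. ennreal R"])
        show "(\<integral>\<^sup>+w. ennreal R \<partial>N) < \<infinity>" by (simp add: ennreal_mult_eq_top_iff N.emeasure_finite less_top[symmetric])
        show "AE w in N. (\<lambda>k. ennreal (min (S k w ^ n) R)) \<longlonglongrightarrow> ennreal (min (S0 w ^ n) R)"
          by (intro AE_I2 tendsto_ennrealI tendsto_min tendsto_power S_lim tendsto_const)
      qed (auto intro!: AE_I2 ennreal_leI)
    qed
    moreover have "(\<lambda>k. ennreal (1 / c n k * K)) \<longlonglongrightarrow> ennreal (1 / 1 * K)"
      by (intro tendsto_ennrealI tendsto_intros c_lim) simp
    ultimately have "ennreal (1 / 1 * K) \<le> (\<integral>\<^sup>+w. ennreal (min (S0 w ^ n) R) \<partial>N) + ennreal \<epsilon>"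
      using le by (intro LIMSEQ_le) auto
    also have "\<dots> \<le> (\<integral>\<^sup>+w. ennreal (S0 w ^ n) \<partial>N) + ennreal \<epsilon>"
      by (intro add_right_mono nn_integral_mono ennreal_leI) simp
    finally show "ennreal K \<le> (\<integral>\<^sup>+w. ennreal (S0 w ^ n) \<partial>N) + ennreal \<epsilon>" by simp
  qed
  show ?thesis using antisym[OF upper lower] by (simp only: S0_def K_def)
qed

section \<open>Local times of the Brownian bridge\<close>

text \<open>The regularised setting: paths are continuous on the whole line and the local time is
  nonnegative with bounded support, for every \<open>w\<close>. A null set remains only in the
  occupation formula. \<open>L\<close> is the local time at the fixed time 1.\<close>

locale bridge_local_time = prob_space M for M :: "'a measure" +
  fixes W L :: "real \<Rightarrow> 'a \<Rightarrow> real"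
  assumes W_measurable[measurable]: "\<And>s. W s \<in> borel_measurable M"
    and W_cont: "\<And>w. w \<in> space M \<Longrightarrow> continuous_on UNIV (\<lambda>s. W s w)"
    and W_square: "\<And>s. s \<in> {0..1} \<Longrightarrow> integrable M (\<lambda>w. W s w ^ 2)"
    and W_cov: "\<And>s t. s \<in> {0..1} \<Longrightarrow> t \<in> {0..1} \<Longrightarrow> (LINT w|M. W s w * W t w) = min s t - s * t"
    and W_char: "\<And>V. V \<in> gspan W {0..1} \<Longrightarrow> (CLINT w|M. iexp (V w)) = of_real (exp (- (LINT w|M. V w ^ 2) / 2))"
    and L_measurable[measurable]: "\<And>x. L x \<in> borel_measurable M"
    and L_cont: "\<And>w. w \<in> space M \<Longrightarrow> continuous_on UNIV (\<lambda>x. L x w)"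
    and L_nonneg: "\<And>x w. w \<in> space M \<Longrightarrow> 0 \<le> L x w"
    and L_support: "\<And>w. w \<in> space M \<Longrightarrow> \<exists>R. \<forall>x. R \<le> \<bar>x\<bar> \<longrightarrow> L x w = 0"
    and L_occupation: "AE w in M. \<forall>f::real \<Rightarrow> real. f \<in> borel_measurable borel \<and> bounded (range f) \<longrightarrow>
        has_bochner_integral lborel (\<lambda>x. f x * L x w) (LINT s:{0..1}|lborel. f (W s w))"
begin

lemma gauss_bridge_scaled:
  assumes T: "0 < T"
  shows "gauss_bridge M T (\<lambda>s w. sqrt T * W (s / T) w)"
proof (unfold_locales)
  show "continuous_on UNIV (\<lambda>s. sqrt T * W (s / T) w)" if "w \<in> space M" for w
    by (intro continuous_intros continuous_on_compose2[OF W_cont[OF that]]) (use T in auto)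
  have d: "s / T \<in> {0..1}" if "s \<in> {0..T}" for s using that T by (auto simp: divide_le_eq)
  show "integrable M (\<lambda>w. (sqrt T * W (s / T) w)\<^sup>2)" if "s \<in> {0..T}" for s
    using W_square[OF d[OF that]] by (simp add: power_mult_distrib)
  show "(LINT w|M. sqrt T * W (s / T) w * (sqrt T * W (t / T) w)) = min s t - s * t / T" if "s \<in> {0..T}" "t \<in> {0..T}" for s t
  proof -
    have "sqrt T * W (s / T) w * (sqrt T * W (t / T) w) = T * (W (s / T) w * W (t / T) w)" for w
      using T by (simp add: mult_ac mult.assoc[symmetric, of "sqrt T" "sqrt T"])
    note e = this
    have "(LINT w|M. sqrt T * W (s / T) w * (sqrt T * W (t / T) w)) = T * (min (s / T) (t / T) - s / T * (t / T))"
      unfolding e integral_mult_right_zero W_cov[OF d[OF that(1)] d[OF that(2)]] ..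
    also have "\<dots> = min s t - s * t / T" using T by (simp add: min_def field_simps)
    finally show ?thesis .
  qed
  show "(CLINT w|M. iexp (V w)) = of_real (exp (- (LINT w|M. V w ^ 2) / 2))"
    if "V \<in> gspan (\<lambda>s w. sqrt T * W (s / T) w) {0..T}" for V
  proof (rule W_char)
    show "V \<in> gspan W {0..1}"
      using that
    proof (induction rule: gspan.induct)
      case (gspan_add V s k)
      have "(\<lambda>w. V w + (k * sqrt T) * W (s / T) w) \<in> gspan W {0..1}"
        by (rule gspan.gspan_add[OF gspan_add(3) d[OF gspan_add(2)]])
      then show ?case by (simp only: mult.assoc)
    qed (rule gspan_zero)
  qed
qed (use T in simp_all)

text \<open>Local time of the bridge of length \<open>T = fst p\<close>: time scales by
  \<open>T\<close> and space by \<open>sqrt T\<close>, which leaves the factor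
  \<open>T / sqrt T\<close>. For \<open>T \<le> 0\<close>, where the mixture puts no mass, the value
  0 is a default.\<close>

definition Z :: "real \<Rightarrow> real \<times> 'a \<Rightarrow> real" where
  "Z x p = (if 0 < fst p then sqrt (fst p) * L (x / sqrt (fst p)) (snd p) else 0)"

lemma L_pair_measurable[measurable]: "(\<lambda>(x, w). L x w) \<in> borel_measurable (borel \<Otimes>\<^sub>M M)"
  by (rule caratheodory_measurable[OF L_measurable L_cont])

lemma Z_measurable[measurable]: "Z x \<in> borel_measurable (borel \<Otimes>\<^sub>M M)"
  unfolding Z_def[abs_def] by measurable

lemma Z_nonneg: "w \<in> space M \<Longrightarrow> 0 \<le> Z x (T, w)"
  by (simp add: Z_def L_nonneg)

lemma Z_cont: "w \<in> space M \<Longrightarrow> continuous_on UNIV (\<lambda>x. Z x (T, w))"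
  unfolding Z_def
  by (cases "0 < T") (auto intro!: continuous_intros continuous_on_compose2[OF L_cont])

lemma Z_support:
  assumes "w \<in> space M"
  shows "\<exists>R. \<forall>x. R \<le> \<bar>x\<bar> \<longrightarrow> Z x (T, w) = 0"
proof (cases "0 < T")
  case True
  obtain R where R: "\<And>x. R \<le> \<bar>x\<bar> \<Longrightarrow> L x w = 0" using L_support[OF assms] by auto
  have "L (x / sqrt T) w = 0" if "sqrt T * R \<le> \<bar>x\<bar>" for x
    using that True by (intro R) (simp add: abs_divide field_simps)
  then show ?thesis by (intro exI[of _ "sqrt T * R"]) (auto simp: Z_def)
qed (auto simp: Z_def)

text \<open>Substitute \<open>u = T * s\<close> and \<open>y = sqrt T * x\<close> in the occupation
  formula. One exceptional set serves all \<open>F\<close>.\<close>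

lemma occupation_scaled:
  assumes T: "0 < T"
  shows "AE w in M. \<forall>F::real \<Rightarrow> real. F \<in> borel_measurable borel \<longrightarrow> (\<forall>y. 0 \<le> F y) \<longrightarrow> bounded (range F) \<longrightarrow>
    integrable lborel (\<lambda>y. F y * Z y (T, w)) \<and>
    (NN u. (if 0 < u \<and> u < T then ennreal (F (sqrt T * W (u / T) w)) else 0)) = ennreal (LINT y|lborel. F y * Z y (T, w))"
  using L_occupation AE_space
proof eventually_elim
  case (elim w)
  show ?case
  proof (intro allI impI)
    fix F :: "real \<Rightarrow> real" assume F[measurable]: "F \<in> borel_measurable borel" and F0: "\<forall>y. 0 \<le> F y" and bF: "bounded (range F)"
    define f where "f x = F (sqrt T * x)" for x
    define I where "I = (LINT s:{0..1}|lborel. f (W s w))"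
    have fm[measurable]: "f \<in> borel_measurable borel" unfolding f_def by measurable
    have "bounded (range f)" by (rule bounded_subset[OF bF]) (auto simp: f_def)
    with elim(1) fm have h: "integrable lborel (\<lambda>x. f x * L x w)" "(LINT x|lborel. f x * L x w) = I"
      unfolding I_def by (auto simp: has_bochner_integral_iff)
    have s: "sqrt T * sqrt T = T" "0 < sqrt T" using T by auto
    have e: "F (0 + sqrt T * x) * Z (0 + sqrt T * x) (T, w) = sqrt T * (f x * L x w)" for x
      using s T by (simp add: f_def Z_def)
    have int: "integrable lborel (\<lambda>y. F y * Z y (T, w))"
    proof (rule lborel_integrable_real_affine_iff[of "sqrt T" _ 0, THEN iffD1])
      show "integrable lborel (\<lambda>x. F (0 + sqrt T * x) * Z (0 + sqrt T * x) (T, w))"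
        unfolding e using h(1) by simp
    qed (use s in auto)
    have val: "(LINT y|lborel. F y * Z y (T, w)) = T * I"
    proof -
      have "(LINT y|lborel. F y * Z y (T, w)) = \<bar>sqrt T\<bar> *\<^sub>R (LINT x|lborel. F (0 + sqrt T * x) * Z (0 + sqrt T * x) (T, w))"
        by (rule lborel_integral_real_affine) (use s in simp)
      also have "\<dots> = (sqrt T * sqrt T) * I"
        unfolding e integral_mult_right_zero h(2) using s by simp
      finally show ?thesis unfolding s(1) .
    qed
    obtain C where C: "\<And>y. F y \<le> C" using bF F0 unfolding bounded_iff by (auto simp: abs_of_nonneg)
    have mW[measurable]: "(\<lambda>s. W s w) \<in> borel_measurable borel"
      by (rule borel_measurable_continuous_onI[OF W_cont[OF elim(2)]])
    have si: "set_integrable lborel {0..1} (\<lambda>s. f (W s w))"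
      unfolding set_integrable_def
    proof (rule Bochner_Integration.integrable_bound[of _ "\<lambda>s. C * indicator {0..1::real} s"])
      show "AE s in lborel. norm (indicator {0..1} s *\<^sub>R f (W s w)) \<le> norm (C * indicator {0..1} s)"
        using F0 by (intro AE_I2) (auto simp: f_def indicator_def intro: order.trans[OF C abs_ge_self])
    qed auto
    have "(NN u. (if 0 < u \<and> u < T then ennreal (F (sqrt T * W (u / T) w)) else 0))
      = ennreal \<bar>T\<bar> * (NN s. (if 0 < 0 + T * s \<and> 0 + T * s < T then ennreal (F (sqrt T * W ((0 + T * s) / T) w)) else 0))"
      by (rule nn_integral_real_affine) (use T in auto)
    also have "(NN s. (if 0 < 0 + T * s \<and> 0 + T * s < T then ennreal (F (sqrt T * W ((0 + T * s) / T) w)) else 0))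
      = (NN s. ennreal (indicator {0..1} s *\<^sub>R f (W s w)))"
    proof (rule nn_integral_cong_AE)
      show "AE s in lborel. (if 0 < 0 + T * s \<and> 0 + T * s < T then ennreal (F (sqrt T * W ((0 + T * s) / T) w)) else 0) = ennreal (indicator {0..1} s *\<^sub>R f (W s w))"
        using AE_lborel_singleton[of 0] AE_lborel_singleton[of 1]
        by eventually_elim (use T in \<open>auto simp: f_def indicator_def zero_less_mult_iff\<close>)
    qed
    also have "\<dots> = ennreal I"
      unfolding I_def set_lebesgue_integral_def
      by (rule nn_integral_eq_integral[OF si[unfolded set_integrable_def]]) (use F0 in \<open>auto simp: f_def\<close>)
    also have "ennreal \<bar>T\<bar> * ennreal I = ennreal (LINT y|lborel. F y * Z y (T, w))"
      unfolding val using T by (simp add: ennreal_mult')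
    finally show "integrable lborel (\<lambda>y. F y * Z y (T, w)) \<and>
      (NN u. (if 0 < u \<and> u < T then ennreal (F (sqrt T * W (u / T) w)) else 0)) = ennreal (LINT y|lborel. F y * Z y (T, w))"
      using int by simp
  qed
qed

text \<open>\<open>fact n\<close> times a simplex integral is a power of the occupation integral of
  \<open>F\<close>, which is the weighted sum of averages of the local time;
  \<open>occupation_total\<close> evaluates its mean.\<close>

lemma smoothed_moment:
  fixes m :: nat and a x :: "nat \<Rightarrow> real"
  assumes T: "0 < T" and d: "0 < d" and a: "\<And>i. i < m \<Longrightarrow> 0 \<le> a i"
  defines "F \<equiv> \<lambda>y. \<Sum>i<m. a i * bump d (y - x i)"
  shows "ennreal (heat T 0) * (\<integral>\<^sup>+w. ennreal ((\<Sum>i<m. a i * average Z d (x i) (T, w)) ^ n) \<partial>M) = of_nat (fact n) * heat_iter F n T 0"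
proof -
  interpret G: gauss_bridge M T "\<lambda>s w. sqrt T * W (s / T) w" by (rule gauss_bridge_scaled[OF T])
  have Fm[measurable]: "F \<in> borel_measurable borel" unfolding F_def by measurable
  have F0: "0 \<le> F y" for y unfolding F_def using a d by (auto intro!: sum_nonneg mult_nonneg_nonneg bump_nonneg)
  have FB: "F y \<le> (\<Sum>i<m. a i * (1 / d))" for y unfolding F_def by (intro sum_mono mult_left_mono bump_le) (use a d in auto)
  have bF: "bounded (range F)"
    unfolding bounded_iff using F0 FB by (intro exI[of _ "\<Sum>i<m. a i * (1 / d)"]) auto
  have b: "bounded (range (\<lambda>y. bump d (y - c)))" for c
    unfolding bounded_iff using bump_nonneg[OF d] bump_le[OF d] by (intro exI[of _ "1 / d"]) auto
  have "(\<integral>\<^sup>+w. ennreal ((\<Sum>i<m. a i * average Z d (x i) (T, w)) ^ n) \<partial>M) = (\<integral>\<^sup>+w. of_nat (fact n) * G.occupation F n T w \<partial>M)"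
  proof (rule nn_integral_cong_AE)
    show "AE w in M. ennreal ((\<Sum>i<m. a i * average Z d (x i) (T, w)) ^ n) = of_nat (fact n) * G.occupation F n T w"
      using occupation_scaled[OF T] AE_space
    proof eventually_elim
      case (elim w)
      have [measurable]: "(\<lambda>s. W s w) \<in> borel_measurable borel"
        by (rule borel_measurable_continuous_onI[OF W_cont[OF elim(2)]])
      have i: "integrable lborel (\<lambda>y. bump d (y - x i) * Z y (T, w))" for i
        using elim(1)[rule_format, of "\<lambda>y. bump d (y - x i)"] b bump_nonneg[OF d] by auto
      have "(LINT y|lborel. F y * Z y (T, w)) = (LINT y|lborel. (\<Sum>i<m. a i * (bump d (y - x i) * Z y (T, w))))"
        by (simp add: F_def sum_distrib_right mult.assoc)
      also have "\<dots> = (\<Sum>i<m. a i * average Z d (x i) (T, w))"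
        unfolding average_def using i by (subst Bochner_Integration.integral_sum) auto
      finally have e: "(LINT y|lborel. F y * Z y (T, w)) = (\<Sum>i<m. a i * average Z d (x i) (T, w))" .
      have nn: "0 \<le> (\<Sum>i<m. a i * average Z d (x i) (T, w))"
        using a Z_nonneg[OF elim(2)] d by (auto intro!: sum_nonneg mult_nonneg_nonneg average_nonneg)
      have "of_nat (fact n) * G.occupation F n T w = (NN u. (if 0 < u \<and> u < T then ennreal (F (sqrt T * W (u / T) w)) else 0)) ^ n"
        by (rule iterated_integral_power) measurable
      also have "\<dots> = ennreal (\<Sum>i<m. a i * average Z d (x i) (T, w)) ^ n"
        using elim(1)[rule_format, OF Fm F0 bF] e by simp
      finally show ?case using nn by (simp add: ennreal_power)
    qed
  qed
  also have "\<dots> = of_nat (fact n) * (\<integral>\<^sup>+w. G.occupation F n T w \<partial>M)"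
    by (rule nn_integral_cmult) (use G.occupation_measurable[OF Fm, of n] in measurable)
  finally show ?thesis using G.occupation_total[OF Fm F0 FB, of n] by (simp add: mult.left_commute)
qed

text \<open>\<open>heat T 0\<close> is the factor by which \<open>occupation_total\<close> relates
  moments of the bridge to heat convolutions, so under this weight the normalisation
  disappears.\<close>

definition N :: "real \<Rightarrow> (real \<times> 'a) measure" where
  "N g = density lborel (\<lambda>T. ennreal (indicator {0<..} T * (exp (-(g^2 * T / 2)) * heat T 0))) \<Otimes>\<^sub>M M"

lemma sets_N[measurable_cong]: "sets (N g) = sets (borel \<Otimes>\<^sub>M M)"
  unfolding N_def by (intro sets_pair_measure_cong) auto

lemma nn_integral_N:
  assumes [measurable]: "h \<in> borel_measurable (borel \<Otimes>\<^sub>M M)"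
  shows "(\<integral>\<^sup>+p. h p \<partial>N g) = (NN T. (if 0 < T then ennreal (exp (-(g^2 * T / 2))) * (ennreal (heat T 0) * (\<integral>\<^sup>+w. h (T, w) \<partial>M)) else 0))"
proof -
  let ?w = "\<lambda>T. ennreal (indicator {0<..} T * (exp (-(g^2 * T / 2)) * heat T 0))"
  have "(\<integral>\<^sup>+p. h p \<partial>N g) = (\<integral>\<^sup>+T. \<integral>\<^sup>+w. h (T, w) \<partial>M \<partial>density lborel ?w)"
    unfolding N_def by (rule nn_integral_fst[symmetric]) measurable
  also have "\<dots> = (NN T. ?w T * (\<integral>\<^sup>+w. h (T, w) \<partial>M))"
    by (rule nn_integral_density) measurable
  also have "\<dots> = (NN T. (if 0 < T then ennreal (exp (-(g^2 * T / 2))) * (ennreal (heat T 0) * (\<integral>\<^sup>+w. h (T, w) \<partial>M)) else 0))"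
    by (intro nn_integral_cong) (auto simp: ennreal_mult' mult.assoc)
  finally show ?thesis .
qed

lemma kac_field_N:
  assumes g: "0 < g"
  shows "kac_field g (N g) Z"
proof -
  have sp: "snd p \<in> space M" if "p \<in> space (N g)" for p
    using that by (auto simp: N_def space_pair_measure)
  have Zm: "Z x \<in> borel_measurable (N g)" for x by measurable
  have fin: "emeasure (N g) (space (N g)) \<noteq> \<infinity>"
  proof -
    have "emeasure (N g) (space (N g)) = (\<integral>\<^sup>+p. 1 \<partial>N g)" by simp
    also have "\<dots> = (NN T. (if 0 < T then ennreal (exp (-(g^2 * T / 2)) * heat T 0) else 0))"
      by (subst nn_integral_N, simp, intro nn_integral_cong) (simp add: emeasure_space_1 ennreal_mult')
    also have "\<dots> = ennreal (green g 0)" by (rule laplace_heat[OF g])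
    finally show ?thesis by simp
  qed
  have Z0: "0 \<le> Z x p" and Zc: "continuous_on UNIV (\<lambda>x. Z x p)" and Zs: "\<exists>R. \<forall>x. R \<le> \<bar>x\<bar> \<longrightarrow> Z x p = 0" if "p \<in> space (N g)" for x p
    using Z_nonneg[OF sp[OF that], of x "fst p"] Z_cont[OF sp[OF that], of "fst p"] Z_support[OF sp[OF that], of "fst p"] by auto
  have f: "finite_measure (N g)" by (rule finite_measureI[OF fin])
  have mom: "(\<integral>\<^sup>+w. ennreal ((\<Sum>i<m. a i * Z (x i) w) ^ n) \<partial>N g) = ennreal (fact n * kac g m a x n 0)"
    if a: "\<And>i. i < m \<Longrightarrow> 0 \<le> a i" for m a x n
  proof (rule kac_moments_limit[OF g f Zm Z0 Zc a])
    fix d :: real and n assume d: "0 < d"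
    let ?F = "\<lambda>y. \<Sum>i<m. a i * bump d (y - x i)"
    have F0: "0 \<le> ?F y" for y using a d by (auto intro!: sum_nonneg mult_nonneg_nonneg bump_nonneg)
    have [measurable]: "(\<lambda>(y, p). Z y p) \<in> borel_measurable (borel \<Otimes>\<^sub>M (borel \<Otimes>\<^sub>M M))"
      unfolding Z_def[abs_def] by measurable
    have "(\<integral>\<^sup>+p. ennreal ((\<Sum>i<m. a i * average Z d (x i) p) ^ n) \<partial>N g)
      = (NN T. (if 0 < T then ennreal (exp (-(g^2 * T / 2))) * (ennreal (heat T 0) * (\<integral>\<^sup>+w. ennreal ((\<Sum>i<m. a i * average Z d (x i) (T, w)) ^ n) \<partial>M)) else 0))"
      by (rule nn_integral_N) (unfold average_def, measurable)
    also have "\<dots> = (NN T. of_nat (fact n) * (if 0 < T then ennreal (exp (-(g^2 * T / 2))) * heat_iter ?F n T 0 else 0))"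
      by (intro nn_integral_cong) (auto simp: smoothed_moment[OF _ d a] mult.left_commute)
    also have "\<dots> = of_nat (fact n) * (NN T. (if 0 < T then ennreal (exp (-(g^2 * T / 2))) * heat_iter ?F n T 0 else 0))"
      by (rule nn_integral_cmult) measurable
    also have "\<dots> = of_nat (fact n) * green_iter g ?F n 0"
      by (subst laplace_heat_iter[OF g _ F0]) auto
    finally show "(\<integral>\<^sup>+p. ennreal ((\<Sum>i<m. a i * average Z d (x i) p) ^ n) \<partial>N g) = of_nat (fact n) * green_iter g ?F n 0" .
  qed auto
  show ?thesis
    by (intro kac_field.intro kac_field_axioms.intro f killing_rate.intro g Zm Z0 Zc Zs mom)
qed

definition cube :: "'a \<Rightarrow> real" where
  "cube w = (LINT x|lborel. L x w ^ 3)"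

lemma cube_measurable[measurable]: "cube \<in> borel_measurable M"
  unfolding cube_def[abs_def] by measurable

lemma cube_nonneg: "w \<in> space M \<Longrightarrow> 0 \<le> cube w"
  unfolding cube_def by (intro Bochner_Integration.integral_nonneg zero_le_power L_nonneg)

text \<open>The cube contributes \<open>T powr (3/2)\<close> and the space variable
  \<open>sqrt T\<close>. This is why the Laplace transform appears at the parameter
  \<open>t^2/8\<close>.\<close>

lemma cube_scaled:
  assumes T: "0 < T"
  shows "(LINT x|lborel. Z x (T, w) ^ 3) = T^2 * cube w"
proof -
  have "(LINT x|lborel. Z x (T, w) ^ 3) = (LINT x|lborel. sqrt T * Z (0 + sqrt T * x) (T, w) ^ 3)"
    by (subst lborel_integral_real_affine[of "sqrt T" _ 0]) (use T in auto)
  also have "\<dots> = (LINT x|lborel. T^2 * L x w ^ 3)"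
  proof (intro Bochner_Integration.integral_cong refl)
    fix x
    have "sqrt T * sqrt T ^ 3 = (sqrt T ^ 2) ^ 2" by (simp only: power_mult[symmetric] power_Suc[symmetric]) simp
    also have "\<dots> = T^2" using T by simp
    finally show "sqrt T * Z (0 + sqrt T * x) (T, w) ^ 3 = T^2 * L x w ^ 3"
      using T by (simp add: Z_def power_mult_distrib mult.assoc[symmetric])
  qed
  finally show ?thesis by (simp add: cube_def)
qed

lemma laplace_cube:
  assumes g: "0 < g"
  shows "(NN T. (if 0 < T then ennreal (exp (-(g^2 * T / 2)) * (heat T 0 * expectation (\<lambda>w. exp (-(T^2/8 * cube w))))) else 0))
    = (NN T. (if 0 < T then ennreal (exp (-(g^2 * T / 2)) * (heat T 0 * (T / sinh T) powr (3/2))) else 0))"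
proof -
  interpret K: kac_field g "N g" Z by (rule kac_field_N[OF g])
  have [measurable]: "(\<lambda>(y, p). Z y p) \<in> borel_measurable (borel \<Otimes>\<^sub>M (borel \<Otimes>\<^sub>M M))"
    unfolding Z_def[abs_def] by measurable
  have [measurable]: "K.cubic_integral \<in> borel_measurable (borel \<Otimes>\<^sub>M M)"
    unfolding K.cubic_integral_def[abs_def] by measurable
  have c0: "0 \<le> K.cubic_integral p" if "p \<in> space (N g)" for p
    unfolding K.cubic_integral_def using K.Z_nonneg[OF that] by (intro Bochner_Integration.integral_nonneg zero_le_power) auto
  have iN: "integrable (N g) (\<lambda>p. exp (-(K.cubic_integral p / 8)))"
    by (rule K.integrable_const_bound[where B=1]) (auto intro!: AE_I2 c0)
  have e: "ennreal (heat T 0) * (\<integral>\<^sup>+w. ennreal (exp (-(K.cubic_integral (T, w) / 8))) \<partial>M) = ennreal (heat T 0 * expectation (\<lambda>w. exp (-(T^2/8 * cube w))))"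
    if T: "0 < T" for T
  proof -
    have "(\<integral>\<^sup>+w. ennreal (exp (-(K.cubic_integral (T, w) / 8))) \<partial>M) = (\<integral>\<^sup>+w. ennreal (exp (-(T^2/8 * cube w))) \<partial>M)"
      unfolding K.cubic_integral_def cube_scaled[OF T] by simp
    also have "\<dots> = ennreal (expectation (\<lambda>w. exp (-(T^2/8 * cube w))))"
    proof (rule nn_integral_eq_integral)
      show "integrable M (\<lambda>w. exp (-(T^2/8 * cube w)))"
        by (rule integrable_const_bound[where B=1]) (auto intro!: AE_I2 mult_nonneg_nonneg cube_nonneg)
    qed simp
    finally show ?thesis using T by (simp add: ennreal_mult' heat_nonneg)
  qed
  have "(NN T. (if 0 < T then ennreal (exp (-(g^2 * T / 2)) * (heat T 0 * expectation (\<lambda>w. exp (-(T^2/8 * cube w))))) else 0))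
    = (\<integral>\<^sup>+p. ennreal (exp (-(K.cubic_integral p / 8))) \<partial>N g)"
    by (subst nn_integral_N, measurable, intro nn_integral_cong) (auto simp: e ennreal_mult')
  also have "\<dots> = ennreal (LINT p|N g. exp (-(K.cubic_integral p / 8)))"
    by (rule nn_integral_eq_integral[OF iN]) simp
  also have "\<dots> = (NN T. (if 0 < T then ennreal (exp (-(g^2 * T / 2)) * (heat T 0 * (T / sinh T) powr (3/2))) else 0))"
    unfolding K.cubic_expectation by (intro nn_integral_cong) (simp add: heat_def)
  finally show ?thesis .
qed

end

text \<open>Uniqueness of Laplace transforms, improved from almost every point to every point by
  continuity. A factor \<open>exp (-T)\<close> makes both weights integrable, so the rates compared
  are \<open>g^2/2 = n + 1\<close>.\<close>

lemma laplace_identity: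
  fixes a b :: "real \<Rightarrow> real"
  assumes ca: "continuous_on {0<..} a" and cb: "continuous_on {0<..} b"
    and m[measurable]: "a \<in> borel_measurable borel" "b \<in> borel_measurable borel"
    and a: "\<And>t. 0 < t \<Longrightarrow> 0 \<le> a t \<and> a t \<le> 1" and b: "\<And>t. 0 < t \<Longrightarrow> 0 \<le> b t \<and> b t \<le> 1"
    and eq: "\<And>g. 0 < g \<Longrightarrow> (NN T. (if 0 < T then ennreal (exp (-(g^2 * T / 2)) * (heat T 0 * a T)) else 0))
      = (NN T. (if 0 < T then ennreal (exp (-(g^2 * T / 2)) * (heat T 0 * b T)) else 0))"
    and t: "0 < t"
  shows "a t = b t"
proof -
  define Y where "Y f T = (if 0 < T then exp (-T) * (heat T 0 * f T) else 0)" for f :: "real \<Rightarrow> real" and T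
  have [measurable]: "Y f \<in> borel_measurable borel" if [measurable]: "f \<in> borel_measurable borel" for f
    unfolding Y_def[abs_def] by measurable
  have Y0: "0 \<le> Y f T" if "\<And>t. 0 < t \<Longrightarrow> 0 \<le> f t \<and> f t \<le> 1" for f T
    using that by (auto simp: Y_def heat_nonneg)
  have iY: "integrable lborel (Y f)" if [measurable]: "f \<in> borel_measurable borel" and f: "\<And>t. 0 < t \<Longrightarrow> 0 \<le> f t \<and> f t \<le> 1" for f
  proof (rule integrableI_nonneg)
    have "(NN T. ennreal (Y f T)) \<le> (NN T. (if 0 < T then ennreal (exp (-((sqrt 2)^2 * T / 2)) * heat T 0) else 0))"
    proof (rule nn_integral_mono)
      fix T :: real
      show "ennreal (Y f T) \<le> (if 0 < T then ennreal (exp (-((sqrt 2)^2 * T / 2)) * heat T 0) else 0)"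
      proof (cases "0 < T")
        case True
        then have "heat T 0 * f T \<le> heat T 0" using f heat_pos[OF True, of 0] by (simp add: mult_left_le)
        then show ?thesis using True by (auto simp: Y_def intro!: ennreal_leI)
      qed (simp add: Y_def)
    qed
    also have "\<dots> = ennreal (green (sqrt 2) 0)" by (rule laplace_heat) simp
    finally show "(NN T. ennreal (Y f T)) < \<infinity>" by (simp add: le_less_trans)
  qed (auto simp: Y0[OF f])
  define S where "S T = max 0 T" for T :: real
  have [measurable]: "S \<in> borel_measurable borel" unfolding S_def[abs_def] by measurable
  have L: "(LINT T|lborel. exp (-(real n * S T)) * Y f T) = enn2real (NN T. (if 0 < T then ennreal (exp (-(sqrt (2 * (real n + 1))^2 * T / 2)) * (heat T 0 * f T)) else 0))"
    if [measurable]: "f \<in> borel_measurable borel" and f: "\<And>t. 0 < t \<Longrightarrow> 0 \<le> f t \<and> f t \<le> 1" for f n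
  proof -
    have "(LINT T|lborel. exp (-(real n * S T)) * Y f T) = enn2real (NN T. ennreal (exp (-(real n * S T)) * Y f T))"
      by (rule integral_eq_nn_integral) (auto simp: S_def[abs_def] Y0[OF f])
    also have "(NN T. ennreal (exp (-(real n * S T)) * Y f T)) = (NN T. (if 0 < T then ennreal (exp (-(sqrt (2 * (real n + 1))^2 * T / 2)) * (heat T 0 * f T)) else 0))"
    proof (rule nn_integral_cong)
      fix T :: real
      have "exp (-(real n * T)) * exp (-T) = exp (-(sqrt (2 * (real n + 1))^2 * T / 2))"
        by (simp add: exp_add[symmetric] algebra_simps)
      then show "ennreal (exp (-(real n * S T)) * Y f T) = (if 0 < T then ennreal (exp (-(sqrt (2 * (real n + 1))^2 * T / 2)) * (heat T 0 * f T)) else 0)"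
        by (auto simp: S_def Y_def mult.assoc[symmetric])
    qed
    finally show ?thesis .
  qed
  define c where "c = t / 2"
  have c: "0 < c" "c < t" using t by (auto simp: c_def)
  \<comment> \<open>Testing with a cut-off of \<open>a - b\<close> itself turns equality of the
    integrals into a vanishing integral of \<open>(a T - b T)^2\<close>. The arguments
    \<open>max c T\<close> stay away from 0, so that continuity on \<open>{0<..}\<close> is
    enough.\<close>
  define \<theta> where "\<theta> T = max 0 (min 1 (T - c)) * (a (max c T) - b (max c T))" for T
  have c\<theta>: "continuous_on UNIV \<theta>"
    unfolding \<theta>_def by (intro continuous_intros continuous_on_compose2[OF ca] continuous_on_compose2[OF cb]) (use c in auto)
  have B\<theta>: "\<bar>\<theta> T\<bar> \<le> 1" for T
  proof -
    have "0 < max c T" using c by simp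
    from a[OF this] b[OF this] have "\<bar>max 0 (min 1 (T - c))\<bar> \<le> 1" "\<bar>a (max c T) - b (max c T)\<bar> \<le> 1"
      by auto
    from mult_mono[OF this] show ?thesis by (simp add: \<theta>_def abs_mult)
  qed
  have [measurable]: "\<theta> \<in> borel_measurable borel" by (rule borel_measurable_continuous_onI[OF c\<theta>])
  have main: "(LINT T|lborel. \<theta> (S T) * Y a T) = (LINT T|lborel. \<theta> (S T) * Y b T)"
  proof (rule laplace_determines[OF iY[OF m(1) a] _ _ iY[OF m(2) b] _ _ _ c\<theta> B\<theta>])
    show "(LINT T|lborel. exp (-(real n * S T)) * Y a T) = (LINT T|lborel. exp (-(real n * S T)) * Y b T)" for n
      using L[OF m(1) a, where n=n] L[OF m(2) b, where n=n] eq[of "sqrt (2 * (real n + 1))"] by simp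
  qed (auto simp: S_def[abs_def])
  have i\<theta>: "integrable lborel (\<lambda>T. \<theta> (S T) * Y f T)" if [measurable]: "f \<in> borel_measurable borel" and f: "\<And>t. 0 < t \<Longrightarrow> 0 \<le> f t \<and> f t \<le> 1" for f
  proof (rule Bochner_Integration.integrable_bound[OF iY[OF that]])
    show "AE T in lborel. norm (\<theta> (S T) * Y f T) \<le> norm (Y f T)"
      using B\<theta> by (intro AE_I2) (auto simp: abs_mult intro: mult_left_le_one_le)
  qed measurable
  from main have "(LINT T|lborel. \<theta> (S T) * Y a T - \<theta> (S T) * Y b T) = 0"
    by (subst Bochner_Integration.integral_diff[OF i\<theta>[OF m(1) a] i\<theta>[OF m(2) b]]) auto
  moreover have e: "\<theta> (S T) * Y a T - \<theta> (S T) * Y b T = (if c < T then (min 1 (T - c) * exp (-T) * heat T 0) * (a T - b T)^2 else 0)" for T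
    using c by (auto simp: S_def Y_def \<theta>_def power2_eq_square algebra_simps max_def min_def)
  moreover have "0 \<le> (if c < T then (min 1 (T - c) * exp (-T) * heat T 0) * (a T - b T)^2 else 0)" for T
    using c by (auto simp: heat_nonneg)
  moreover have "integrable lborel (\<lambda>T. \<theta> (S T) * Y a T - \<theta> (S T) * Y b T)"
    by (intro Bochner_Integration.integrable_diff i\<theta> m a b)
  ultimately have "AE T in lborel. (if c < T then (min 1 (T - c) * exp (-T) * heat T 0) * (a T - b T)^2 else 0) = 0"
    by (subst (asm) integral_nonneg_eq_0_iff_AE) auto
  then have ae: "AE T in lborel. c < T \<longrightarrow> a T - b T = 0"
  proof eventually_elim
    case (elim T)
    then show ?case using heat_pos[of T 0] c by (auto split: if_splits)
  qed
  define D where "D = {c<..} \<inter> (\<lambda>T. a T - b T) -` (- {0})"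
  have "open D" unfolding D_def
    by (rule continuous_open_preimage) (use c in \<open>auto intro!: continuous_intros continuous_on_subset[OF ca] continuous_on_subset[OF cb]\<close>)
  have "negligible D"
  proof -
    have "D \<in> null_sets lborel"
      using ae \<open>open D\<close> by (subst AE_iff_null_sets) (auto simp: D_def elim: eventually_mono)
    then show ?thesis by (simp add: negligible_iff_null_sets null_sets_completionI)
  qed
  with \<open>open D\<close> have "D = {}" using open_not_negligible by blast
  then show ?thesis using c by (auto simp: D_def)
qed

context bridge_local_time
begin

text \<open>Both sides are continuous in the parameter with values in the unit interval, and by
  \<open>laplace_cube\<close> their mixtures agree for every \<open>g\<close>.\<close>

lemma laplace_transform_cube:
  assumes t: "0 < t"
  shows "expectation (\<lambda>w. exp (-(t^2/8 * cube w))) = (t / sinh t) powr (3/2)"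
proof (rule laplace_identity[where t=t])
  define a where "a T = expectation (\<lambda>w. exp (-(T^2/8 * cube w)))" for T
  have i: "integrable M (\<lambda>w. exp (-(T^2/8 * cube w)))" for T
    by (rule integrable_const_bound[where B=1]) (auto intro!: AE_I2 mult_nonneg_nonneg cube_nonneg)
  have ca: "continuous_on UNIV a"
    unfolding continuous_on_sequentially
  proof (intro allI ballI impI, elim conjE)
    fix x and y :: real assume x: "x \<longlonglongrightarrow> y"
    have "(\<lambda>n. a (x n)) \<longlonglongrightarrow> a y"
      unfolding a_def
    proof (rule integral_dominated_convergence[where w="\<lambda>_. 1"])
      show "AE w in M. (\<lambda>n. exp (-((x n)^2/8 * cube w))) \<longlonglongrightarrow> exp (-(y^2/8 * cube w))"
        by (intro AE_I2 tendsto_intros x) simp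
      show "AE w in M. norm (exp (-((x n)^2/8 * cube w))) \<le> 1" for n
        by (auto intro!: AE_I2 mult_nonneg_nonneg cube_nonneg)
    qed auto
    then show "(a \<circ> x) \<longlonglongrightarrow> a y" by (simp add: comp_def)
  qed
  show "continuous_on {0<..} (\<lambda>T. expectation (\<lambda>w. exp (-(T^2/8 * cube w))))"
    using continuous_on_subset[OF ca, of "{0<..}"] by (simp add: a_def[abs_def])
  show "(\<lambda>T. expectation (\<lambda>w. exp (-(T^2/8 * cube w)))) \<in> borel_measurable borel"
    using borel_measurable_continuous_onI[OF ca] by (simp add: a_def[abs_def])
  show "continuous_on {0<..} (\<lambda>T::real. (T / sinh T) powr (3/2))"
    by (intro continuous_intros) auto
  show "(\<lambda>T::real. (T / sinh T) powr (3/2)) \<in> borel_measurable borel"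
    unfolding sinh_field_def by measurable
  show "0 \<le> expectation (\<lambda>w. exp (-(T^2/8 * cube w))) \<and> expectation (\<lambda>w. exp (-(T^2/8 * cube w))) \<le> 1" for T
  proof
    have "expectation (\<lambda>w. exp (-(T^2/8 * cube w))) \<le> expectation (\<lambda>w. 1)"
      by (intro integral_mono_AE i) (auto intro!: AE_I2 mult_nonneg_nonneg cube_nonneg)
    then show "expectation (\<lambda>w. exp (-(T^2/8 * cube w))) \<le> 1" by (simp add: prob_space)
  qed simp
  show "0 \<le> (T / sinh T) powr (3/2) \<and> (T / sinh T) powr (3/2) \<le> 1" if T: "0 < T" for T :: real
  proof -
    have "0 \<le> T / sinh T" "T / sinh T \<le> 1" using T sinh_ge_self[of T] by (auto simp: divide_le_eq)
    then show ?thesis using powr_mono2[of "3/2" "T / sinh T" 1] by simp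
  qed
  show "(NN T. (if 0 < T then ennreal (exp (-(g^2 * T / 2)) * (heat T 0 * expectation (\<lambda>w. exp (-(T^2/8 * cube w))))) else 0))
    = (NN T. (if 0 < T then ennreal (exp (-(g^2 * T / 2)) * (heat T 0 * (T / sinh T) powr (3/2))) else 0))" if "0 < g" for g
    by (rule laplace_cube[OF that])
qed (rule t)

end

section \<open>Passing from the given processes to a regular version\<close>

lemma gaussian_rv_centred:
  assumes M: "prob_space M" and V: "gaussian_rv M V" and mean: "(LINT w|M. V w) = 0"
  shows "integrable M (\<lambda>w. V w ^ 2)" (is ?i)
    and "(CLINT w|M. iexp (V w)) = of_real (exp (- (LINT w|M. V w ^ 2) / 2))" (is ?c)
proof -
  interpret prob_space M by (rule M)
  have [measurable]: "V \<in> borel_measurable M" using V by (simp add: gaussian_rv_def)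
  from V obtain \<mu> \<sigma> where "(AE w in M. V w = \<mu>) \<or> 0 < \<sigma> \<and> distributed M lborel V (normal_density \<mu> \<sigma>)"
    unfolding gaussian_rv_def by blast
  then have "?i \<and> ?c"
  proof
    assume c: "AE w in M. V w = \<mu>"
    have "(LINT w|M. V w) = (LINT w|M. \<mu>)" by (rule integral_cong_AE) (use c in auto)
    then have \<mu>: "\<mu> = 0" using mean by (simp add: prob_space)
    have 2: "(LINT w|M. V w ^ 2) = (LINT w|M. 0)" by (rule integral_cong_AE) (use c \<mu> in auto)
    have 3: "(CLINT w|M. iexp (V w)) = (CLINT w|M. 1)"
      by (rule integral_cong_AE) (use c \<mu> in \<open>auto elim: eventually_mono\<close>)
    have "integrable M (\<lambda>w. V w ^ 2)"
      by (rule integrable_cong_AE[THEN iffD2, of _ _ "\<lambda>_. 0"]) (use c \<mu> in auto)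
    then show ?thesis using 2 3 by (simp add: prob_space)
  next
    assume n: "0 < \<sigma> \<and> distributed M lborel V (normal_density \<mu> \<sigma>)"
    then have \<sigma>: "0 < \<sigma>" and d: "distributed M lborel V (normal_density \<mu> \<sigma>)" by auto
    have \<mu>: "\<mu> = 0" using normal_distributed_expectation[OF \<sigma> d] mean by simp
    have v: "(LINT w|M. V w ^ 2) = \<sigma>^2" using normal_distributed_variance[OF \<sigma> d] mean by simp
    have "integrable lborel (\<lambda>x. normal_density \<mu> \<sigma> x * x^2)"
      using integrable_normal_moment[OF \<sigma>, of \<mu> 2] \<mu> by simp
    then have i: ?i by (subst (asm) distributed_integrable[OF d]) auto
    have "(CLINT w|M. iexp (V w)) = (CLINT z|distr M lborel V. iexp z)"
      by (subst integral_distr) auto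
    also have "\<dots> = (CLINT z|lborel. normal_density \<mu> \<sigma> z *\<^sub>R iexp z)"
      unfolding distributed_distr_eq_density[OF d] by (subst integral_density) auto
    also have "\<dots> = of_real (exp (- (\<sigma>^2) / 2))"
      using normal_density_iexp[OF \<sigma>, of \<mu> 1] \<mu> by (simp add: scaleR_conv_of_real)
    finally show ?thesis using i v by simp
  qed
  then show ?i ?c by auto
qed

lemma local_time_continuous:
  assumes "local_time M B L" "w \<in> space M"
  shows "continuous_on UNIV (\<lambda>x. L 1 x w)"
proof -
  have c: "continuous_on ({0..1} \<times> UNIV) (\<lambda>(t, x). L t x w)" using assms unfolding local_time_def by blast
  have p: "continuous_on UNIV (\<lambda>x::real. (1::real, x))" by (intro continuous_intros)
  have "(\<lambda>x::real. (1::real, x)) ` UNIV \<subseteq> {0..1} \<times> UNIV" by auto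
  from continuous_on_compose2[OF c p this] show ?thesis by simp
qed

text \<open>Paths and local time are set to zero on a null set, and the paths are frozen outside
  \<open>{0..1}\<close>. Nonnegativity and bounded support of the local time are consequences of the
  occupation formula for narrow bumps, whose averages converge to the local time by
  continuity.\<close>

lemma bridge_local_time_version:
  assumes M: "prob_space M" and B: "brownian_bridge M B" and L: "local_time M B L"
  shows "\<exists>W K. bridge_local_time M W K \<and> (AE w in M. \<forall>x. K x w = L 1 x w)"
proof -
  interpret prob_space M by (rule M)
  have gauss: "gaussian_rv M (\<lambda>w. \<Sum>t\<in>J. c t * B t w)" if "finite J" "J \<subseteq> {0..1}" for J c
    using B that unfolding brownian_bridge_def gaussian_process_def by blast
  have B_mean: "(LINT w|M. B t w) = 0" if "t \<in> {0..1}" for t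
    using B that unfolding brownian_bridge_def by blast
  have B_cov: "(LINT w|M. B s w * B t w) = min s t - s * t" if "s \<in> {0..1}" "t \<in> {0..1}" for s t
    using B that unfolding brownian_bridge_def by blast
  have B_gauss: "gaussian_rv M (B t)" if "t \<in> {0..1}" for t
    using gauss[of "{t}" "\<lambda>_. 1"] that by simp
  have B_meas: "B t \<in> borel_measurable M" if "t \<in> {0..1}" for t
    using B_gauss[OF that] by (simp add: gaussian_rv_def)
  have B_sq: "integrable M (\<lambda>w. B t w ^ 2)" if "t \<in> {0..1}" for t
    by (rule gaussian_rv_centred(1)[OF M B_gauss[OF that] B_mean[OF that]])
  have B_int: "integrable M (B t)" if "t \<in> {0..1}" for t
    by (rule square_integrable_imp_integrable[OF B_meas[OF that] B_sq[OF that]])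
  have L_meas: "L 1 x \<in> borel_measurable M" for x
    using L unfolding local_time_def by auto
  note L_cont = local_time_continuous[OF L]
  define good where "good w \<longleftrightarrow> continuous_on {0..1} (\<lambda>t. B t w) \<and> (\<forall>f::real \<Rightarrow> real. f \<in> borel_measurable borel \<and> bounded (range f) \<longrightarrow>
        has_bochner_integral lborel (\<lambda>x. f x * L 1 x w) (LINT s:{0..1}|lborel. f (B s w)))" for w
  have "AE w in M. continuous_on {0..1} (\<lambda>t. B t w)"
    using B unfolding brownian_bridge_def by blast
  moreover have "AE w in M. \<forall>f::real \<Rightarrow> real. f \<in> borel_measurable borel \<and> bounded (range f) \<longrightarrow>
        has_bochner_integral lborel (\<lambda>x. f x * L 1 x w) (LINT s:{0..1}|lborel. f (B s w))"
  proof -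
    have "AE w in M. \<forall>t\<in>{0..1}. \<forall>f::real \<Rightarrow> real. f \<in> borel_measurable borel \<and> bounded (range f) \<longrightarrow>
        has_bochner_integral lborel (\<lambda>x. f x * L t x w) (LINT s:{0..t}|lborel. f (B s w))"
      using L unfolding local_time_def by blast
    then show ?thesis by eventually_elim (drule bspec[of _ _ 1], auto)
  qed
  ultimately have "AE w in M. good w" unfolding good_def by eventually_elim auto
  \<comment> \<open>\<open>good\<close> may fail to be measurable, so a measurable null set that
    covers its failures is chosen.\<close>
  from AE_E[OF this] obtain E where E: "{w \<in> space M. \<not> good w} \<subseteq> E" "emeasure M E = 0" "E \<in> sets M" .
  have Enull: "E \<in> null_sets M" using E by auto
  have nE: "AE w in M. w \<notin> E" by (rule AE_not_in[OF Enull])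
  have good: "good w" if "w \<in> space M" "w \<notin> E" for w using E(1) that by auto
  define clamp where "clamp s = max 0 (min 1 s)" for s :: real
  have clamp: "clamp s \<in> {0..1}" "s \<in> {0..1} \<Longrightarrow> clamp s = s" for s by (auto simp: clamp_def)
  define W where "W s w = (if w \<in> E then 0 else B (clamp s) w)" for s w
  define K where "K x w = (if w \<in> E then 0 else L 1 x w)" for x w
  have W_meas[measurable]: "W s \<in> borel_measurable M" for s
    unfolding W_def[abs_def] by (rule measurable_If_set) (use B_meas[OF clamp(1)] E(3) in auto)
  have WB: "AE w in M. \<forall>s\<in>{0..1}. W s w = B s w"
    using nE by eventually_elim (auto simp: W_def clamp(2))
  have occ: "has_bochner_integral lborel (\<lambda>x. f x * K x w) (LINT s:{0..1}|lborel. f (W s w))"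
    if w: "w \<in> space M" "w \<notin> E" and f: "f \<in> borel_measurable borel" "bounded (range f)" for w and f :: "real \<Rightarrow> real"
  proof -
    have "(LINT s:{0..1}|lborel. f (W s w)) = (LINT s:{0..1}|lborel. f (B s w))"
      by (rule set_lebesgue_integral_cong) (use w in \<open>auto simp: W_def clamp(2)\<close>)
    then show ?thesis using good[OF w] f w unfolding good_def K_def by auto
  qed
  have W_cont: "continuous_on UNIV (\<lambda>s. W s w)" if "w \<in> space M" for w
  proof (cases "w \<in> E")
    case False
    have "continuous_on {0..1} (\<lambda>t. B t w)" using good[OF that False] by (simp add: good_def)
    then have "continuous_on UNIV (\<lambda>s. B (clamp s) w)"
      by (rule continuous_on_compose2) (use clamp in \<open>auto simp: clamp_def intro!: continuous_intros\<close>)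
    then show ?thesis using False by (simp add: W_def)
  qed (simp add: W_def)
  have K_cont: "continuous_on UNIV (\<lambda>x. K x w)" if "w \<in> space M" for w
    using L_cont[OF that] by (cases "w \<in> E") (auto simp: K_def)
  have K_avg: "average K d c w = (LINT s:{0..1}|lborel. bump d (W s w - c))" if "w \<in> space M" "w \<notin> E" "0 < d" for w d c
  proof -
    have "bounded (range (\<lambda>y. bump d (y - c)))"
      unfolding bounded_iff using bump_nonneg[OF that(3)] bump_le[OF that(3)] by (intro exI[of _ "1 / d"]) auto
    with occ[OF that(1,2), of "\<lambda>y. bump d (y - c)"] show ?thesis
      by (auto simp: average_def has_bochner_integral_iff)
  qed
  have K_lim: "(\<lambda>k. average K (1 / real (Suc k)) c w) \<longlonglongrightarrow> K c w" if "w \<in> space M" for w c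
    by (rule average_tendsto[where Z=K and w=w, OF K_cont[OF that]])
  have K_nonneg: "0 \<le> K x w" if w: "w \<in> space M" for x w
  proof (cases "w \<in> E")
    case False
    show ?thesis
    proof (rule LIMSEQ_le_const[OF K_lim[OF w]], intro exI allI impI)
      fix k :: nat
      have k: "0 < 1 / real (Suc k)" by simp
      show "0 \<le> average K (1 / real (Suc k)) x w"
        unfolding K_avg[OF w False k] set_lebesgue_integral_def
        by (intro Bochner_Integration.integral_nonneg scaleR_nonneg_nonneg bump_nonneg[OF k]) auto
    qed
  qed (simp add: K_def)
  have K_support: "\<exists>R. \<forall>x. R \<le> \<bar>x\<bar> \<longrightarrow> K x w = 0" if w: "w \<in> space M" for w
  proof (cases "w \<in> E")
    case False
    have "compact ((\<lambda>s. W s w) ` {0..1})"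
      by (rule compact_continuous_image[OF continuous_on_subset[OF W_cont[OF w]]]) auto
    from compact_imp_bounded[OF this] obtain C where "\<forall>x\<in>(\<lambda>s. W s w) ` {0..1}. norm x \<le> C"
      unfolding bounded_iff by (elim exE)
    then have C: "\<bar>W s w\<bar> \<le> C" if "s \<in> {0..1}" for s using that by simp
    \<comment> \<open>Path values are bounded by \<open>C\<close> and the bumps have width at most
      1, so all averages vanish at distance \<open>C + 2\<close> from 0.\<close>
    have "K x w = 0" if x: "C + 2 \<le> \<bar>x\<bar>" for x
    proof -
      have "average K (1 / real (Suc k)) x w = 0" for k
      proof -
        have k: "0 < 1 / real (Suc k)" "1 / real (Suc k) \<le> 1" by auto
        have "(LINT s:{0..1}|lborel. bump (1 / real (Suc k)) (W s w - x)) = (LINT s:{0..1::real}|lborel. 0)"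
        proof (rule set_lebesgue_integral_cong)
          show "\<forall>s. s \<in> {0..1} \<longrightarrow> bump (1 / real (Suc k)) (W s w - x) = 0"
          proof (intro allI impI)
            fix s :: real assume "s \<in> {0..1}"
            from C[OF this] x k(2) show "bump (1 / real (Suc k)) (W s w - x) = 0"
              unfolding bump_def by (smt (verit))
          qed
        qed simp
        then show ?thesis unfolding K_avg[OF w False k(1)] by (simp add: set_lebesgue_integral_def)
      qed
      then have "(\<lambda>k. 0) \<longlonglongrightarrow> K x w" using K_lim[OF w, of x] by simp
      then show ?thesis using LIMSEQ_unique[OF tendsto_const] by metis
    qed
    then show ?thesis by blast
  qed (auto simp: K_def)
  have span: "\<exists>J c. finite J \<and> J \<subseteq> {0..1} \<and> (AE w in M. V w = (\<Sum>t\<in>J. c t * B t w))" if "V \<in> gspan W {0..1}" for V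
    using that
  proof (induction rule: gspan.induct)
    case gspan_zero
    show ?case by (intro exI[of _ "{}"]) auto
  next
    case (gspan_add V s k)
    then obtain J c where J: "finite J" "J \<subseteq> {0..1}" and V: "AE w in M. V w = (\<Sum>t\<in>J. c t * B t w)" by blast
    \<comment> \<open>The index \<open>s\<close> may already occur in \<open>J\<close>, in which
      case the two coefficients are added.\<close>
    define c' where "c' t = (if t \<in> J then c t else 0) + (if t = s then k else 0)" for t
    have "(\<Sum>t\<in>insert s J. c' t * B t w) = (\<Sum>t\<in>J. c t * B t w) + k * B s w" for w
    proof -
      have "(\<Sum>t\<in>insert s J. c' t * B t w) = (\<Sum>t\<in>insert s J. (if t \<in> J then c t else 0) * B t w) + (\<Sum>t\<in>insert s J. (if t = s then k * B s w else 0))"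
        unfolding sum.distrib[symmetric] by (intro sum.cong) (auto simp: c'_def distrib_right)
      also have "(\<Sum>t\<in>insert s J. (if t \<in> J then c t else 0) * B t w) = (\<Sum>t\<in>J. c t * B t w)"
        using J by (intro sum.mono_neutral_cong_right) auto
      also have "(\<Sum>t\<in>insert s J. (if t = s then k * B s w else 0)) = k * B s w"
        using J by (subst sum.delta) auto
      finally show ?thesis .
    qed
    note sum_eq = this
    have "AE w in M. V w + k * W s w = (\<Sum>t\<in>insert s J. c' t * B t w)"
      using V WB by eventually_elim (use gspan_add(2) in \<open>simp only: sum_eq\<close>)
    then show ?case using J gspan_add(2) by (intro exI[of _ "insert s J"] exI[of _ c']) auto
  qed
  have gspan_meas: "V \<in> borel_measurable M" if "V \<in> gspan W {0..1}" for V
    using that by (induction rule: gspan.induct) auto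
  have "bridge_local_time M W K"
  proof (unfold_locales)
    show "W s \<in> borel_measurable M" for s by measurable
    show "K x \<in> borel_measurable M" for x
      unfolding K_def[abs_def] by (rule measurable_If_set) (use L_meas E(3) in auto)
    show "integrable M (\<lambda>w. W s w ^ 2)" if s: "s \<in> {0..1}" for s
      by (rule integrable_cong_AE[THEN iffD2, OF _ _ _ B_sq[OF s]]) (use WB s B_meas[OF s] in auto)
    show "(LINT w|M. W s w * W t w) = min s t - s * t" if st: "s \<in> {0..1}" "t \<in> {0..1}" for s t
    proof -
      have "(LINT w|M. W s w * W t w) = (LINT w|M. B s w * B t w)"
        by (rule integral_cong_AE) (use WB st B_meas[OF st(1)] B_meas[OF st(2)] in auto)
      then show ?thesis using B_cov[OF st] by simp
    qed
    show "(CLINT w|M. iexp (V w)) = of_real (exp (- (LINT w|M. V w ^ 2) / 2))" if V: "V \<in> gspan W {0..1}" for V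
    proof -
      note mV[measurable] = gspan_meas[OF V]
      obtain J c where J: "finite J" "J \<subseteq> {0..1}" and e: "AE w in M. V w = (\<Sum>t\<in>J. c t * B t w)"
        using span[OF V] by blast
      define V' where "V' w = (\<Sum>t\<in>J. c t * B t w)" for w
      have g: "gaussian_rv M V'" unfolding V'_def[abs_def] by (rule gauss[OF J])
      note e = e[folded V'_def]
      from g have [measurable]: "V' \<in> borel_measurable M" by (simp add: gaussian_rv_def)
      have "(LINT w|M. V' w) = (\<Sum>t\<in>J. c t * (LINT w|M. B t w))"
        unfolding V'_def using J B_int by (subst Bochner_Integration.integral_sum) auto
      also have "\<dots> = 0" using J B_mean by (auto intro!: sum.neutral)
      finally have mean: "(LINT w|M. V' w) = 0" .
      have "(CLINT w|M. iexp (V w)) = (CLINT w|M. iexp (V' w))"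
        by (rule integral_cong_AE) (use e in \<open>auto elim: eventually_mono\<close>)
      moreover have "(LINT w|M. V w ^ 2) = (LINT w|M. V' w ^ 2)"
        by (rule integral_cong_AE) (use e in \<open>auto elim: eventually_mono\<close>)
      ultimately show ?thesis using gaussian_rv_centred(2)[OF M g mean] by simp
    qed
    show "AE w in M. \<forall>f::real \<Rightarrow> real. f \<in> borel_measurable borel \<and> bounded (range f) \<longrightarrow>
        has_bochner_integral lborel (\<lambda>x. f x * K x w) (LINT s:{0..1}|lborel. f (W s w))"
      using nE AE_space by eventually_elim (use occ in auto)
  qed (use W_cont K_cont K_nonneg K_support in auto)
  moreover have "AE w in M. \<forall>x. K x w = L 1 x w"
    using nE by eventually_elim (auto simp: K_def)
  ultimately show ?thesis by blast
qed

theorem proposition5: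
  fixes M :: "'a measure"
    and B :: "real \<Rightarrow> 'a \<Rightarrow> real"
    and L :: "real \<Rightarrow> real \<Rightarrow> 'a \<Rightarrow> real"
  assumes "prob_space M"
    and "brownian_bridge M B"
    and "local_time M B L"
  shows "(\<lambda>\<epsilon>::real. measure M {\<omega> \<in> space M. (LINT x|lborel. (L 1 x \<omega>) ^ 3) \<le> \<epsilon>})
           \<sim>[at_right 0]
         (\<lambda>\<epsilon>. 8 * sqrt 6 / sqrt pi * inverse \<epsilon> * exp (- (9 / 2) * inverse \<epsilon>))"
proof -
  obtain W K where "bridge_local_time M W K" and KL: "AE w in M. \<forall>x. K x w = L 1 x w"
    using bridge_local_time_version[OF assms] by blast
  then interpret bridge_local_time M W K by simp
  have Lm[measurable]: "L 1 x \<in> borel_measurable M" for x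
    using assms(3) unfolding local_time_def by auto
  \<comment> \<open>Joint measurability makes the event of the statement measurable, as the
    comparison of probabilities of almost surely equal events requires.\<close>
  have [measurable]: "(\<lambda>(x, w). L 1 x w) \<in> borel_measurable (borel \<Otimes>\<^sub>M M)"
    by (rule caratheodory_measurable[OF Lm local_time_continuous[OF assms(3)]])
  have "prob {w \<in> space M. cube w \<le> \<epsilon>} = prob {w \<in> space M. (LINT x|lborel. (L 1 x w) ^ 3) \<le> \<epsilon>}" for \<epsilon>
  proof (rule measure_eq_AE)
    show "AE w in M. w \<in> {w \<in> space M. cube w \<le> \<epsilon>} \<longleftrightarrow> w \<in> {w \<in> space M. (LINT x|lborel. (L 1 x w) ^ 3) \<le> \<epsilon>}"
      using KL by eventually_elim (simp add: cube_def)
  qed measurable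
  then show ?thesis
    using small_deviation_from_laplace[OF cube_measurable cube_nonneg laplace_transform_cube] by simp
qed

end
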